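(* Let $F$ and $G$ be rectangular lattices and let $\varphi \colon \mathrm{Con}\,F \to \mathrm{Con}\,G$ be a bounded lattice homomorphism. Then there is a rectangular lattice $L$ containing $F$ and $G$ as convex sublattices, where $L$ can be chosen so that $G$ is a filter of $L$, satisfying the following two conditions: (i) the lattice $L$ is a congruence-preserving extension of $F$; (ii) for every $\alpha \in \mathrm{Con}\,L$, $\varphi(\alpha|_F) = \alpha|_G$ (that is, the map $\varphi$ is $\alpha|_F \mapsto \alpha|_G$).
   Context: A rectangular lattice is a finite planar semimodular lattice $L$ (with a planar diagram) whose left boundary chain contains exactly one doubly irreducible element other than $0,1$, denoted $\mathrm{lc}(L)$, whose right boundary chain contains exactly one doubly irreducible element other than $0,1$, denoted $\mathrm{rc}(L)$, and these two elements are complementary: $\mathrm{lc}(L)\vee \mathrm{rc}(L)=1$, $\mathrm{lc}(L)\wedge \mathrm{rc}(L)=0$. (Doubly irreducible means having exactly one upper cover and exactly one lower cover.) $\mathrm{Con}\,L$ is the congruence lattice of $L$. For a sublattice $K$ of $L$ and $\alpha\in\mathrm{Con}\,L$, $\alpha|_K$ is the restriction of $\alpha$ to $K$. A bounded lattice homomorphism preserves $0$ and $1$. $L$ is a congruence-preserving extension of a sublattice $F$ if every congruence of $F$ is the restriction of exactly one congruence of $L$. "Containing $F$ and $G$ as (convex) sublattices" is understood in the usual sense of identifying $F$ and $G$ with isomorphic copies inside $L$. *)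

theory Defs
  imports "HOL-Algebra.Lattice" "HOL-Analysis.Line_Segment"
begin

definition covers :: "('a, 'm) gorder_scheme \<Rightarrow> 'a \<Rightarrow> 'a \<Rightarrow> bool" where
  "covers L a b \<longleftrightarrow> a \<in> carrier L \<and> b \<in> carrier L \<and> a \<sqsubset>\<^bsub>L\<^esub> b
     \<and> \<not> (\<exists>z\<in>carrier L. a \<sqsubset>\<^bsub>L\<^esub> z \<and> z \<sqsubset>\<^bsub>L\<^esub> b)"
  \<comment> \<open>the upper element is the second argument\<close>

definition semimodular :: "('a, 'm) gorder_scheme \<Rightarrow> bool" where
  "semimodular L \<longleftrightarrow>
     (\<forall>a\<in>carrier L. \<forall>b\<in>carrier L. \<forall>c\<in>carrier L. covers L a b \<longrightarrow>
        a \<squnion>\<^bsub>L\<^esub> c = b \<squnion>\<^bsub>L\<^esub> c \<or> covers L (a \<squnion>\<^bsub>L\<^esub> c) (b \<squnion>\<^bsub>L\<^esub> c))"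

definition doubly_irreducible :: "('a, 'm) gorder_scheme \<Rightarrow> 'a \<Rightarrow> bool" where
  "doubly_irreducible L x \<longleftrightarrow> x \<in> carrier L \<and> (\<exists>!y. covers L x y) \<and> (\<exists>!y. covers L y x)"

text \<open>A planar diagram places each element at a point of the plane, larger elements higher, and
  draws each covering pair as a straight line segment; distinct segments meet only in common
  endpoints. In a lattice with more than one element every element is an endpoint of some segment,
  so the last clause also prevents a segment from passing through a third element.\<close>

definition planar_diagram :: "('a, 'm) gorder_scheme \<Rightarrow> ('a \<Rightarrow> real \<times> real) \<Rightarrow> bool" where
  "planar_diagram L p \<longleftrightarrow>
     inj_on p (carrier L) \<and>
     (\<forall>x\<in>carrier L. \<forall>y\<in>carrier L. x \<sqsubset>\<^bsub>L\<^esub> y \<longrightarrow> snd (p x) < snd (p y)) \<and>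
     (\<forall>a b c d. covers L a b \<and> covers L c d \<and> (a, b) \<noteq> (c, d) \<longrightarrow>
        closed_segment (p a) (p b) \<inter> closed_segment (p c) (p d) \<subseteq> p ` ({a, b} \<inter> {c, d}))"

text \<open>The left (right) boundary consists of the elements having no point of the drawing, edges
  included, at the same height strictly to their left (right). In a planar diagram of a finite
  lattice the leftmost points at the various heights form one ascending path of edges from
  \<open>\<bottom>\<close> to \<open>\<top>\<close>, so this set is the left boundary chain, a maximal chain.\<close>

definition left_boundary :: "('a, 'm) gorder_scheme \<Rightarrow> ('a \<Rightarrow> real \<times> real) \<Rightarrow> 'a set" where
  "left_boundary L p = {x \<in> carrier L.
     \<forall>a b q. covers L a b \<and> q \<in> closed_segment (p a) (p b) \<and> snd q = snd (p x)
       \<longrightarrow> fst (p x) \<le> fst q}"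

definition right_boundary :: "('a, 'm) gorder_scheme \<Rightarrow> ('a \<Rightarrow> real \<times> real) \<Rightarrow> 'a set" where
  "right_boundary L p = {x \<in> carrier L.
     \<forall>a b q. covers L a b \<and> q \<in> closed_segment (p a) (p b) \<and> snd q = snd (p x)
       \<longrightarrow> fst q \<le> fst (p x)}"

definition rectangular_lattice :: "('a, 'm) gorder_scheme \<Rightarrow> bool" where
  "rectangular_lattice L \<longleftrightarrow>
     bounded_lattice L \<and> finite (carrier L) \<and> semimodular L \<and>
     (\<exists>p lc rc. planar_diagram L p \<and>
        {x \<in> left_boundary L p. doubly_irreducible L x \<and> x \<noteq> \<bottom>\<^bsub>L\<^esub> \<and> x \<noteq> \<top>\<^bsub>L\<^esub>} = {lc} \<and>
        {x \<in> right_boundary L p. doubly_irreducible L x \<and> x \<noteq> \<bottom>\<^bsub>L\<^esub> \<and> x \<noteq> \<top>\<^bsub>L\<^esub>} = {rc} \<and>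
        lc \<squnion>\<^bsub>L\<^esub> rc = \<top>\<^bsub>L\<^esub> \<and> lc \<sqinter>\<^bsub>L\<^esub> rc = \<bottom>\<^bsub>L\<^esub>)"

definition lattice_congruence :: "('a, 'm) gorder_scheme \<Rightarrow> ('a \<times> 'a) set \<Rightarrow> bool" where
  "lattice_congruence L \<theta> \<longleftrightarrow> equiv (carrier L) \<theta> \<and>
     (\<forall>x y u v. (x, y) \<in> \<theta> \<and> (u, v) \<in> \<theta> \<longrightarrow>
        (x \<squnion>\<^bsub>L\<^esub> u, y \<squnion>\<^bsub>L\<^esub> v) \<in> \<theta> \<and> (x \<sqinter>\<^bsub>L\<^esub> u, y \<sqinter>\<^bsub>L\<^esub> v) \<in> \<theta>)"

definition Con :: "('a, 'm) gorder_scheme \<Rightarrow> ('a \<times> 'a) set gorder" where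
  "Con L = \<lparr>carrier = {\<theta>. lattice_congruence L \<theta>}, eq = (=), le = (\<subseteq>)\<rparr>"

definition bounded_lattice_hom ::
    "('a, 'm) gorder_scheme \<Rightarrow> ('b, 'n) gorder_scheme \<Rightarrow> ('a \<Rightarrow> 'b) \<Rightarrow> bool" where
  "bounded_lattice_hom X Y f \<longleftrightarrow> f \<in> carrier X \<rightarrow> carrier Y \<and>
     join_pres X Y f \<and> meet_pres X Y f \<and> f \<bottom>\<^bsub>X\<^esub> = \<bottom>\<^bsub>Y\<^esub> \<and> f \<top>\<^bsub>X\<^esub> = \<top>\<^bsub>Y\<^esub>"

definition lattice_embedding ::
    "('a, 'm) gorder_scheme \<Rightarrow> ('b, 'n) gorder_scheme \<Rightarrow> ('a \<Rightarrow> 'b) \<Rightarrow> bool" where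
  "lattice_embedding X Y f \<longleftrightarrow> f \<in> carrier X \<rightarrow> carrier Y \<and> inj_on f (carrier X) \<and>
     join_pres X Y f \<and> meet_pres X Y f"

definition sublattice :: "'a set \<Rightarrow> ('a, 'm) gorder_scheme \<Rightarrow> bool" where
  "sublattice K L \<longleftrightarrow> K \<noteq> {} \<and> K \<subseteq> carrier L \<and>
     (\<forall>x\<in>K. \<forall>y\<in>K. x \<squnion>\<^bsub>L\<^esub> y \<in> K \<and> x \<sqinter>\<^bsub>L\<^esub> y \<in> K)"

definition convex_sublattice :: "'a set \<Rightarrow> ('a, 'm) gorder_scheme \<Rightarrow> bool" where
  "convex_sublattice K L \<longleftrightarrow> sublattice K L \<and>
     (\<forall>x\<in>K. \<forall>y\<in>K. \<forall>z\<in>carrier L. x \<sqsubseteq>\<^bsub>L\<^esub> z \<and> z \<sqsubseteq>\<^bsub>L\<^esub> y \<longrightarrow> z \<in> K)"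

definition lattice_filter :: "'a set \<Rightarrow> ('a, 'm) gorder_scheme \<Rightarrow> bool" where
  "lattice_filter K L \<longleftrightarrow> sublattice K L \<and>
     (\<forall>x\<in>K. \<forall>z\<in>carrier L. x \<sqsubseteq>\<^bsub>L\<^esub> z \<longrightarrow> z \<in> K)"

text \<open>For an embedding \<open>f\<close> of \<open>F\<close> into a lattice with congruence \<open>\<alpha>\<close>: the restriction of \<open>\<alpha>\<close> to
  the image of \<open>F\<close>, transported back to \<open>F\<close> along the identification of \<open>F\<close> with its image.\<close>

definition restrict_con ::
    "('a, 'm) gorder_scheme \<Rightarrow> ('a \<Rightarrow> 'b) \<Rightarrow> ('b \<times> 'b) set \<Rightarrow> ('a \<times> 'a) set" where
  "restrict_con F f \<alpha> = {(x, y) \<in> carrier F \<times> carrier F. (f x, f y) \<in> \<alpha>}"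

definition congruence_preserving_extension ::
    "('a, 'm) gorder_scheme \<Rightarrow> ('b, 'n) gorder_scheme \<Rightarrow> ('a \<Rightarrow> 'b) \<Rightarrow> bool" where
  "congruence_preserving_extension F L f \<longleftrightarrow> lattice_embedding F L f \<and>
     (\<forall>\<theta>\<in>carrier (Con F). \<exists>!\<alpha>. \<alpha> \<in> carrier (Con L) \<and> restrict_con F f \<alpha> = \<theta>)"

end

theory Submission imports Defs "HOL-Library.Product_Order" begin

text \<open>A planar lattice is isomorphic to a finite set of points of the plane under the componentwise
  order. Represent \<open>F\<close> and \<open>G\<close> in this way with the top of \<open>F\<close> equal to the bottom of \<open>G\<close>. Their glued
  sum has congruence lattice \<open>Con F \<times> Con G\<close>; filling in the corners between the upper boundary of \<open>F\<close>
  and the lower boundary of \<open>G\<close> with new elements yields a rectangular lattice with the same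
  congruences. Every prime interval of a rectangular lattice is projective to an edge of its lower
  boundary. Adding below the lattice a strip along one side of that boundary, and inserting
  a further atom into the cells of the strip at chosen edges, makes these edges generate the same
  congruence without affecting the other congruences. For a prime interval \<open>p\<close> of \<open>G\<close>, the \<open>\<alpha>\<close> for which
  \<open>\<phi> \<alpha>\<close> collapses \<open>p\<close> form a prime filter of \<open>Con F\<close>, so its least element is generated by a prime
  interval of \<open>F\<close>, which is identified with \<open>p\<close>. The congruences that remain are the pairs
  \<open>(\<alpha>, \<phi> \<alpha>)\<close>.\<close>

section \<open>Sets of elements of an order as lattices\<close>

text \<open>The obstacle is that planarity, semimodularity, the shape of the boundary and the
  congruences must all be under control at once. So every enlargement after the glued sum is
  composed of two moves only: a new least element, and a new element \<open>w\<close> in an interval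
  \<open>[x, z]\<close> of length two cut off by two consecutive boundary edges. If
  \<open>[x, z]\<close> has one inner element, \<open>w\<close> completes a four-element cell:
  opposite edges are perspective and no congruence is gained or lost. If it has two, the result is a
  diamond \<open>M3\<close>, whose edges all generate the same congruence; this is the only source
  of identifications. Labels on the boundary edges tell where such moves are possible: an upper edge
  followed by a lower edge is a corner, and in a rectangular boundary all lower edges precede all
  upper ones, so filling in corners amounts to sorting labels. Strips are added at the bottom only,
  so \<open>G\<close> stays a filter, and \<open>F\<close> stays convex because the filled glued sum
  remains an up-set in which \<open>F\<close> is a down-set.\<close>

definition olat :: "'a::order set \<Rightarrow> 'a gorder" where
  "olat K = \<lparr>carrier = K, eq = (=), le = (\<le>)\<rparr>"

abbreviation lat :: "'a::order set \<Rightarrow> bool" where "lat K \<equiv> lattice (olat K)"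
abbreviation jn :: "'a::order set \<Rightarrow> 'a \<Rightarrow> 'a \<Rightarrow> 'a" where "jn K \<equiv> join (olat K)"
abbreviation mt :: "'a::order set \<Rightarrow> 'a \<Rightarrow> 'a \<Rightarrow> 'a" where "mt K \<equiv> meet (olat K)"
abbreviation cov :: "'a::order set \<Rightarrow> 'a \<Rightarrow> 'a \<Rightarrow> bool" where "cov K \<equiv> covers (olat K)"
abbreviation con :: "'a::order set \<Rightarrow> ('a \<times> 'a) set \<Rightarrow> bool" where "con K \<equiv> lattice_congruence (olat K)"
abbreviation smod :: "'a::order set \<Rightarrow> bool" where "smod K \<equiv> semimodular (olat K)"

text \<open>Joins and meets as relations on an arbitrary set of elements: they can be exhibited in
  an enlarged set before that set is known to be a lattice.\<close>

definition isjn :: "'a::order set \<Rightarrow> 'a \<Rightarrow> 'a \<Rightarrow> 'a \<Rightarrow> bool" where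
  "isjn K a b c \<longleftrightarrow> c \<in> K \<and> a \<le> c \<and> b \<le> c \<and> (\<forall>d\<in>K. a \<le> d \<and> b \<le> d \<longrightarrow> c \<le> d)"
definition ismt :: "'a::order set \<Rightarrow> 'a \<Rightarrow> 'a \<Rightarrow> 'a \<Rightarrow> bool" where
  "ismt K a b c \<longleftrightarrow> c \<in> K \<and> c \<le> a \<and> c \<le> b \<and> (\<forall>d\<in>K. d \<le> a \<and> d \<le> b \<longrightarrow> d \<le> c)"

lemma olat_simps [simp]: "carrier (olat K) = K" "le (olat K) = (\<le>)" "eq (olat K) = (=)"
  by (auto simp: olat_def)

lemma lless_olat [simp]: "lless (olat K) a b \<longleftrightarrow> a < b"
  by (auto simp: lless_def)

lemma partial_order_olat: "partial_order (olat K)"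
  by unfold_locales auto

lemma cov_iff: "cov K a b \<longleftrightarrow> a \<in> K \<and> b \<in> K \<and> a < b \<and> \<not> (\<exists>z\<in>K. a < z \<and> z < b)"
  by (simp add: covers_def)

lemma isjn_iff_least: "a \<in> K \<Longrightarrow> b \<in> K \<Longrightarrow> isjn K a b c \<longleftrightarrow> least (olat K) c (Upper (olat K) {a, b})"
  by (auto simp: isjn_def least_def Upper_def)

lemma ismt_iff_greatest: "a \<in> K \<Longrightarrow> b \<in> K \<Longrightarrow> ismt K a b c \<longleftrightarrow> greatest (olat K) c (Lower (olat K) {a, b})"
  by (auto simp: ismt_def greatest_def Lower_def)

lemma latI:
  assumes "\<And>a b. a \<in> K \<Longrightarrow> b \<in> K \<Longrightarrow> \<exists>c. isjn K a b c" "\<And>a b. a \<in> K \<Longrightarrow> b \<in> K \<Longrightarrow> \<exists>c. ismt K a b c"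
  shows "lat K"
proof -
  interpret partial_order "olat K" by (rule partial_order_olat)
  show ?thesis
  proof unfold_locales
    fix x y assume xy: "x \<in> carrier (olat K)" "y \<in> carrier (olat K)"
    show "\<exists>s. least (olat K) s (Upper (olat K) {x, y})"
      using assms(1)[of x y] xy isjn_iff_least[of x K y] by auto
    show "\<exists>s. greatest (olat K) s (Lower (olat K) {x, y})"
      using assms(2)[of x y] xy ismt_iff_greatest[of x K y] by auto
  qed
qed

lemma isjn_unique: "isjn K a b c \<Longrightarrow> isjn K a b d \<Longrightarrow> c = d"
  by (simp add: isjn_def order_antisym)
lemma ismt_unique: "ismt K a b c \<Longrightarrow> ismt K a b d \<Longrightarrow> c = d"
  by (simp add: ismt_def order_antisym)

lemma isjn_jn: "lat K \<Longrightarrow> a \<in> K \<Longrightarrow> b \<in> K \<Longrightarrow> isjn K a b (jn K a b)"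
proof -
  assume "lat K" and ab: "a \<in> K" "b \<in> K"
  then interpret lattice "olat K" by simp
  show ?thesis
    using join_closed[of a b] join_left[of a b] join_right[of a b] join_le[of a _ b] ab
    by (simp add: isjn_def)
qed

lemma ismt_mt: "lat K \<Longrightarrow> a \<in> K \<Longrightarrow> b \<in> K \<Longrightarrow> ismt K a b (mt K a b)"
proof -
  assume "lat K" and ab: "a \<in> K" "b \<in> K"
  then interpret lattice "olat K" by simp
  show ?thesis
    using meet_closed[of a b] meet_left[of a b] meet_right[of a b] meet_le[of _ a b] ab
    by (simp add: ismt_def)
qed

lemma jn_eqI: "lat K \<Longrightarrow> a \<in> K \<Longrightarrow> b \<in> K \<Longrightarrow> isjn K a b c \<Longrightarrow> jn K a b = c"
  using isjn_jn isjn_unique by blast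
lemma mt_eqI: "lat K \<Longrightarrow> a \<in> K \<Longrightarrow> b \<in> K \<Longrightarrow> ismt K a b c \<Longrightarrow> mt K a b = c"
  using ismt_mt ismt_unique by blast

lemma jn_in [simp, intro]: "lat K \<Longrightarrow> a \<in> K \<Longrightarrow> b \<in> K \<Longrightarrow> jn K a b \<in> K"
  and jn_ge1 [simp, intro]: "lat K \<Longrightarrow> a \<in> K \<Longrightarrow> b \<in> K \<Longrightarrow> a \<le> jn K a b"
  and jn_ge2 [simp, intro]: "lat K \<Longrightarrow> a \<in> K \<Longrightarrow> b \<in> K \<Longrightarrow> b \<le> jn K a b"
  and jn_least: "lat K \<Longrightarrow> a \<in> K \<Longrightarrow> b \<in> K \<Longrightarrow> d \<in> K \<Longrightarrow> a \<le> d \<Longrightarrow> b \<le> d \<Longrightarrow> jn K a b \<le> d"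
  using isjn_jn[of K a b] by (auto simp: isjn_def)

lemma mt_in [simp, intro]: "lat K \<Longrightarrow> a \<in> K \<Longrightarrow> b \<in> K \<Longrightarrow> mt K a b \<in> K"
  and mt_le1 [simp, intro]: "lat K \<Longrightarrow> a \<in> K \<Longrightarrow> b \<in> K \<Longrightarrow> mt K a b \<le> a"
  and mt_le2 [simp, intro]: "lat K \<Longrightarrow> a \<in> K \<Longrightarrow> b \<in> K \<Longrightarrow> mt K a b \<le> b"
  and mt_greatest: "lat K \<Longrightarrow> a \<in> K \<Longrightarrow> b \<in> K \<Longrightarrow> d \<in> K \<Longrightarrow> d \<le> a \<Longrightarrow> d \<le> b \<Longrightarrow> d \<le> mt K a b"
  using ismt_mt[of K a b] by (auto simp: ismt_def)

lemma jn_comm: "jn K a b = jn K b a" by (rule join_comm)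
lemma mt_comm: "mt K a b = mt K b a" by (rule meet_comm)

lemma jn_le_iff: "lat K \<Longrightarrow> a \<in> K \<Longrightarrow> b \<in> K \<Longrightarrow> d \<in> K \<Longrightarrow> jn K a b \<le> d \<longleftrightarrow> a \<le> d \<and> b \<le> d"
  by (meson jn_ge1 jn_ge2 jn_least order_trans)
lemma le_mt_iff: "lat K \<Longrightarrow> a \<in> K \<Longrightarrow> b \<in> K \<Longrightarrow> d \<in> K \<Longrightarrow> d \<le> mt K a b \<longleftrightarrow> d \<le> a \<and> d \<le> b"
  by (meson mt_le1 mt_le2 mt_greatest order_trans)

lemma jn_absorb: "lat K \<Longrightarrow> a \<in> K \<Longrightarrow> b \<in> K \<Longrightarrow> a \<le> b \<Longrightarrow> jn K a b = b"
  by (rule jn_eqI) (auto simp: isjn_def)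
lemma jn_absorb2: "lat K \<Longrightarrow> a \<in> K \<Longrightarrow> b \<in> K \<Longrightarrow> b \<le> a \<Longrightarrow> jn K a b = a"
  by (rule jn_eqI) (auto simp: isjn_def)
lemma mt_absorb: "lat K \<Longrightarrow> a \<in> K \<Longrightarrow> b \<in> K \<Longrightarrow> a \<le> b \<Longrightarrow> mt K a b = a"
  by (rule mt_eqI) (auto simp: ismt_def)
lemma mt_absorb2: "lat K \<Longrightarrow> a \<in> K \<Longrightarrow> b \<in> K \<Longrightarrow> b \<le> a \<Longrightarrow> mt K a b = b"
  by (rule mt_eqI) (auto simp: ismt_def)

lemma le_jnI1: "lat K \<Longrightarrow> a \<in> K \<Longrightarrow> b \<in> K \<Longrightarrow> d \<le> a \<Longrightarrow> d \<le> jn K a b"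
  and le_jnI2: "lat K \<Longrightarrow> a \<in> K \<Longrightarrow> b \<in> K \<Longrightarrow> d \<le> b \<Longrightarrow> d \<le> jn K a b"
  by (meson jn_ge1 jn_ge2 order_trans)+
lemma mt_leI1: "lat K \<Longrightarrow> a \<in> K \<Longrightarrow> b \<in> K \<Longrightarrow> a \<le> d \<Longrightarrow> mt K a b \<le> d"
  and mt_leI2: "lat K \<Longrightarrow> a \<in> K \<Longrightarrow> b \<in> K \<Longrightarrow> b \<le> d \<Longrightarrow> mt K a b \<le> d"
  by (meson mt_le1 mt_le2 order_trans)+

lemma jn_assoc:
  assumes "lat K" "a \<in> K" "b \<in> K" "c \<in> K" shows "jn K (jn K a b) c = jn K a (jn K b c)"
  by (rule order_antisym) (use assms in \<open>simp_all add: jn_le_iff le_jnI1 le_jnI2\<close>)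

lemma mt_assoc:
  assumes "lat K" "a \<in> K" "b \<in> K" "c \<in> K" shows "mt K (mt K a b) c = mt K a (mt K b c)"
  by (rule order_antisym) (use assms in \<open>simp_all add: le_mt_iff mt_leI1 mt_leI2\<close>)

lemma smodD:
  "smod K \<Longrightarrow> cov K a b \<Longrightarrow> c \<in> K \<Longrightarrow> jn K a c = jn K b c \<or> cov K (jn K a c) (jn K b c)"
  by (auto simp: semimodular_def cov_iff)

lemma smodI:
  "(\<And>a b c. cov K a b \<Longrightarrow> c \<in> K \<Longrightarrow> jn K a c = jn K b c \<or> cov K (jn K a c) (jn K b c)) \<Longrightarrow> smod K"
  by (auto simp: semimodular_def)

lemma cov_in: "cov K a b \<Longrightarrow> a \<in> K" "cov K a b \<Longrightarrow> b \<in> K" "cov K a b \<Longrightarrow> a < b"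
  by (auto simp: cov_iff)

lemma cov_between: "cov K a b \<Longrightarrow> t \<in> K \<Longrightarrow> a \<le> t \<Longrightarrow> t \<le> b \<Longrightarrow> t = a \<or> t = b"
  by (auto simp: cov_iff order_le_less)

lemma finite_cov_above:
  assumes "finite K" "a \<in> K" "b \<in> K" "a < b" shows "\<exists>c. cov K a c \<and> c \<le> b"
proof -
  let ?S = "{t \<in> K. a < t \<and> t \<le> b}"
  have "finite ?S" "?S \<noteq> {}" using assms by auto
  then obtain c where c: "c \<in> ?S" "\<And>t. t \<in> ?S \<Longrightarrow> t \<le> c \<Longrightarrow> c = t"
    using finite_has_minimal[of ?S] by blast
  have "cov K a c" unfolding cov_iff
  proof (intro conjI notI)
    assume "\<exists>z\<in>K. a < z \<and> z < c"
    then obtain z where z: "z \<in> K" "a < z" "z < c" by blast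
    then have "z \<in> ?S" using c(1) by auto
    from c(2)[OF this] z show False by (simp add: less_imp_le)
  qed (use assms c(1) in auto)
  then show ?thesis using c(1) by blast
qed

text \<open>Since \<open>a \<le> c\<close>, the join of \<open>a\<close> and \<open>c\<close> is
  \<open>c\<close>. Equality of the two joins would put \<open>b\<close> below \<open>c\<close>,
  which leaves only the covering alternative of semimodularity.\<close>

lemma smod_cov_jn:
  assumes "lat K" "smod K" "cov K a b" "c \<in> K" "a \<le> c" "\<not> b \<le> c" shows "cov K c (jn K b c)"
  using assms smodD[of K a b c] jn_absorb[of K a c] jn_ge1[of K b c] cov_in[of K a b] by metis

section \<open>Congruences\<close>

lemma conD:
  assumes "con K \<theta>"
  shows con_sub: "\<theta> \<subseteq> K \<times> K" and con_refl: "a \<in> K \<Longrightarrow> (a, a) \<in> \<theta>"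
    and con_sym: "(a, b) \<in> \<theta> \<Longrightarrow> (b, a) \<in> \<theta>"
    and con_trans: "(a, b) \<in> \<theta> \<Longrightarrow> (b, c) \<in> \<theta> \<Longrightarrow> (a, c) \<in> \<theta>"
  using assms unfolding lattice_congruence_def equiv_def refl_on_def sym_def trans_def olat_simps
  by blast+

lemma con_in: "con K \<theta> \<Longrightarrow> (a, b) \<in> \<theta> \<Longrightarrow> a \<in> K" "con K \<theta> \<Longrightarrow> (a, b) \<in> \<theta> \<Longrightarrow> b \<in> K"
  using con_sub by blast+

lemma con_jn: "con K \<theta> \<Longrightarrow> (a, b) \<in> \<theta> \<Longrightarrow> (c, d) \<in> \<theta> \<Longrightarrow> (jn K a c, jn K b d) \<in> \<theta>"
  and con_mt: "con K \<theta> \<Longrightarrow> (a, b) \<in> \<theta> \<Longrightarrow> (c, d) \<in> \<theta> \<Longrightarrow> (mt K a c, mt K b d) \<in> \<theta>"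
  unfolding lattice_congruence_def by auto

lemma con_jn1: "con K \<theta> \<Longrightarrow> (a, b) \<in> \<theta> \<Longrightarrow> c \<in> K \<Longrightarrow> (jn K a c, jn K b c) \<in> \<theta>"
  and con_mt1: "con K \<theta> \<Longrightarrow> (a, b) \<in> \<theta> \<Longrightarrow> c \<in> K \<Longrightarrow> (mt K a c, mt K b c) \<in> \<theta>"
  by (auto intro: con_jn con_mt con_refl)

text \<open>One-sided compatibility suffices: two steps through the middle elements
  \<open>jn K y u\<close> and \<open>mt K y u\<close> are combined by transitivity.\<close>

lemma conI:
  assumes sub: "\<theta> \<subseteq> K \<times> K" and rf: "\<And>a. a \<in> K \<Longrightarrow> (a, a) \<in> \<theta>"
    and sy: "\<And>a b. (a, b) \<in> \<theta> \<Longrightarrow> (b, a) \<in> \<theta>"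
    and tr: "\<And>a b c. (a, b) \<in> \<theta> \<Longrightarrow> (b, c) \<in> \<theta> \<Longrightarrow> (a, c) \<in> \<theta>"
    and J: "\<And>a b c. (a, b) \<in> \<theta> \<Longrightarrow> c \<in> K \<Longrightarrow> (jn K a c, jn K b c) \<in> \<theta>"
    and M: "\<And>a b c. (a, b) \<in> \<theta> \<Longrightarrow> c \<in> K \<Longrightarrow> (mt K a c, mt K b c) \<in> \<theta>"
  shows "con K \<theta>"
proof -
  have eqv: "equiv K \<theta>"
    unfolding equiv_def refl_on_def sym_def trans_def using sub rf sy tr by blast
  have in1: "a \<in> K" "b \<in> K" if "(a, b) \<in> \<theta>" for a b using that sub by blast+
  have "(jn K x u, jn K y v) \<in> \<theta> \<and> (mt K x u, mt K y v) \<in> \<theta>"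
    if "(x, y) \<in> \<theta>" "(u, v) \<in> \<theta>" for x y u v
  proof -
    have "(jn K x u, jn K y u) \<in> \<theta>" "(jn K y u, jn K y v) \<in> \<theta>"
      "(mt K x u, mt K y u) \<in> \<theta>" "(mt K y u, mt K y v) \<in> \<theta>"
      using J[OF that(1)] M[OF that(1)] J[OF that(2), of y] M[OF that(2), of y] in1 that
      by (simp_all add: jn_comm[of K y] mt_comm[of K y])
    then show ?thesis using tr by blast
  qed
  then show ?thesis using eqv by (auto simp: lattice_congruence_def)
qed

text \<open>The map \<open>h\<close> has to respect joins and meets only modulo \<theta>. This
  admits retractions of an extended lattice onto the old one that are not homomorphisms.\<close>

lemma con_pullback:
  assumes K: "lat K" and K': "lat K'" and th: "con K \<theta>" and h: "\<And>a. a \<in> K' \<Longrightarrow> h a \<in> K"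
    and J: "\<And>a b. a \<in> K' \<Longrightarrow> b \<in> K' \<Longrightarrow> (h (jn K' a b), jn K (h a) (h b)) \<in> \<theta>"
    and M: "\<And>a b. a \<in> K' \<Longrightarrow> b \<in> K' \<Longrightarrow> (h (mt K' a b), mt K (h a) (h b)) \<in> \<theta>"
  shows "con K' {(a, b). a \<in> K' \<and> b \<in> K' \<and> (h a, h b) \<in> \<theta>}"
proof (rule conI)
  fix a b c
  assume ab: "(a, b) \<in> {(a, b). a \<in> K' \<and> b \<in> K' \<and> (h a, h b) \<in> \<theta>}" and c: "c \<in> K'"
  have "(jn K (h a) (h c), jn K (h b) (h c)) \<in> \<theta>" using con_jn1[OF th] ab c h by auto
  then show "(jn K' a c, jn K' b c) \<in> {(a, b). a \<in> K' \<and> b \<in> K' \<and> (h a, h b) \<in> \<theta>}"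
    using J[of a c] J[of b c] ab c K' con_sym[OF th] con_trans[OF th] by blast
  have "(mt K (h a) (h c), mt K (h b) (h c)) \<in> \<theta>" using con_mt1[OF th] ab c h by auto
  then show "(mt K' a c, mt K' b c) \<in> {(a, b). a \<in> K' \<and> b \<in> K' \<and> (h a, h b) \<in> \<theta>}"
    using M[of a c] M[of b c] ab c K' con_sym[OF th] con_trans[OF th] by blast
qed (use h con_refl[OF th] con_sym[OF th] con_trans[OF th] in blast)+

lemma con_between:
  assumes "lat K" "con K \<theta>" "(a, b) \<in> \<theta>" "a \<le> c" "c \<le> b" "c \<in> K" shows "(a, c) \<in> \<theta>" "(c, b) \<in> \<theta>"
proof -
  have ab: "a \<in> K" "b \<in> K" using con_in assms by blast+
  show "(a, c) \<in> \<theta>" using con_mt1[OF assms(2,3,6)] mt_absorb[of K a c] mt_absorb2[of K b c] assms ab by simp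
  show "(c, b) \<in> \<theta>" using con_jn1[OF assms(2,3,6)] jn_absorb[of K a c] jn_absorb2[of K b c] assms ab by simp
qed

lemma con_mt_jn:
  assumes "lat K" "con K \<theta>" "a \<in> K" "b \<in> K" shows "(a, b) \<in> \<theta> \<longleftrightarrow> (mt K a b, jn K a b) \<in> \<theta>"
proof
  assume ab: "(a, b) \<in> \<theta>"
  have "(mt K a b, b) \<in> \<theta>" using con_mt1[OF assms(2) ab assms(4)] mt_absorb[of K b b] assms by simp
  moreover have "(jn K a b, b) \<in> \<theta>" using con_jn1[OF assms(2) ab assms(4)] jn_absorb[of K b b] assms by simp
  ultimately show "(mt K a b, jn K a b) \<in> \<theta>" using con_sym[OF assms(2)] con_trans[OF assms(2)] by blast
next
  assume "(mt K a b, jn K a b) \<in> \<theta>"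
  then have "(mt K a b, a) \<in> \<theta>" "(mt K a b, b) \<in> \<theta>"
    using con_between[OF assms(1,2)] assms by (meson jn_ge1 jn_ge2 mt_le1 mt_le2)+
  then show "(a, b) \<in> \<theta>" using con_sym[OF assms(2)] con_trans[OF assms(2)] by blast
qed

text \<open>The intervals \<open>[mt K a b, a]\<close> and \<open>[b, jn K a b]\<close> are
  transposed: joining with \<open>b\<close> carries the first to the second, meeting with
  \<open>a\<close> carries it back.\<close>

lemma con_persp:
  assumes "lat K" "con K \<theta>" "a \<in> K" "b \<in> K"
  shows "(mt K a b, a) \<in> \<theta> \<longleftrightarrow> (b, jn K a b) \<in> \<theta>"
proof
  assume "(mt K a b, a) \<in> \<theta>"
  from con_jn1[OF assms(2) this assms(4)] show "(b, jn K a b) \<in> \<theta>"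
    using jn_absorb[of K "mt K a b" b] assms by simp
next
  assume "(b, jn K a b) \<in> \<theta>"
  from con_mt1[OF assms(2) this assms(3)] show "(mt K a b, a) \<in> \<theta>"
    using mt_absorb2[of K "jn K a b" a] assms by (simp add: mt_comm)
qed

text \<open>A collapsed interval splits into the collapsed covers of a chain, and a collapsed pair
  is equivalent to the interval from its meet to its join; so congruences of a finite lattice can be
  compared on prime intervals.\<close>

lemma con_covers_le:
  assumes K: "lat K" "finite K" and a: "con K \<alpha>" and b: "con K \<beta>"
    and cv: "\<And>s t. cov K s t \<Longrightarrow> (s, t) \<in> \<alpha> \<Longrightarrow> (s, t) \<in> \<beta>"
  shows "\<alpha> \<subseteq> \<beta>"
proof -
  have main: "(s, t) \<in> \<beta>" if "(s, t) \<in> \<alpha>" "s \<le> t" for s t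
    using that
  proof (induction "card {r \<in> K. s < r \<and> r \<le> t}" arbitrary: s rule: less_induct)
    case less
    have st: "s \<in> K" "t \<in> K" using con_in[OF a] less by blast+
    show ?case
    proof (cases "s = t")
      case True then show ?thesis using con_refl[OF b] st by simp
    next
      case False
      then obtain c where c: "cov K s c" "c \<le> t" using finite_cov_above[OF K(2) st] less(3) by (auto simp: order_less_le)
      then have "c \<in> K" "s < c" by (auto simp: cov_iff)
      moreover have "(s, c) \<in> \<alpha>" "(c, t) \<in> \<alpha>"
        using con_between[OF K(1) a less(2), of c] c calculation by auto
      moreover have "card {r \<in> K. c < r \<and> r \<le> t} < card {r \<in> K. s < r \<and> r \<le> t}"
        using K(2) calculation c(2) by (intro psubset_card_mono) (auto intro: order_less_trans)
      ultimately show ?thesis using less(1)[of c] cv[OF c(1)] c(2) con_trans[OF b] by blast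
    qed
  qed
  show ?thesis
  proof clarify
    fix s t assume st: "(s, t) \<in> \<alpha>"
    then have i: "s \<in> K" "t \<in> K" using con_in[OF a] by blast+
    then have "(mt K s t, jn K s t) \<in> \<alpha>" using con_mt_jn[OF K(1) a] st by blast
    then have "(mt K s t, jn K s t) \<in> \<beta>" using main i K(1) by (meson jn_ge1 mt_le1 order_trans)
    then show "(s, t) \<in> \<beta>" using con_mt_jn[OF K(1) b] i by blast
  qed
qed

section \<open>Extensions of lattices and congruences\<close>

definition subl :: "'a::order set \<Rightarrow> 'a set \<Rightarrow> bool" where
  "subl K K' \<longleftrightarrow> lat K \<and> lat K' \<and> K \<subseteq> K' \<and>
     (\<forall>a\<in>K. \<forall>b\<in>K. jn K' a b = jn K a b \<and> mt K' a b = mt K a b)"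

lemma sublI:
  assumes "lat K" "lat K'" "K \<subseteq> K'"
    and "\<And>a b. a \<in> K \<Longrightarrow> b \<in> K \<Longrightarrow> isjn K' a b (jn K a b)"
    and "\<And>a b. a \<in> K \<Longrightarrow> b \<in> K \<Longrightarrow> ismt K' a b (mt K a b)"
  shows "subl K K'"
proof -
  have "jn K' a b = jn K a b \<and> mt K' a b = mt K a b" if "a \<in> K" "b \<in> K" for a b
    using jn_eqI[OF assms(2) _ _ assms(4)[OF that]] mt_eqI[OF assms(2) _ _ assms(5)[OF that]]
      that assms(3) by auto
  then show ?thesis using assms by (simp add: subl_def)
qed

lemma subl_jn: "subl K K' \<Longrightarrow> a \<in> K \<Longrightarrow> b \<in> K \<Longrightarrow> jn K' a b = jn K a b"
  and subl_mt: "subl K K' \<Longrightarrow> a \<in> K \<Longrightarrow> b \<in> K \<Longrightarrow> mt K' a b = mt K a b"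
  and subl_sub: "subl K K' \<Longrightarrow> K \<subseteq> K'" and subl_lat: "subl K K' \<Longrightarrow> lat K" "subl K K' \<Longrightarrow> lat K'"
  by (auto simp: subl_def)

lemma subl_trans: "subl K K' \<Longrightarrow> subl K' K'' \<Longrightarrow> subl K K''"
  unfolding subl_def by (simp add: subset_eq)

lemma subl_refl: "lat K \<Longrightarrow> subl K K" by (simp add: subl_def)

lemma con_restrict:
  assumes s: "subl K K'" and th: "con K' \<theta>" shows "con K (\<theta> \<inter> K \<times> K)"
proof (rule conI)
  note K = subl_lat[OF s] subl_sub[OF s]
  fix a b c assume ab: "(a, b) \<in> \<theta> \<inter> K \<times> K" and c: "c \<in> K"
  then have i: "a \<in> K" "b \<in> K" "c \<in> K'" "(a, b) \<in> \<theta>" using K by auto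
  show "(jn K a c, jn K b c) \<in> \<theta> \<inter> K \<times> K"
    using con_jn1[OF th i(4,3)] i c K by (simp add: subl_jn[OF s])
  show "(mt K a c, mt K b c) \<in> \<theta> \<inter> K \<times> K"
    using con_mt1[OF th i(4,3)] i c K by (simp add: subl_mt[OF s])
next
  show "(a, c) \<in> \<theta> \<inter> K \<times> K" if "(a, b) \<in> \<theta> \<inter> K \<times> K" "(b, c) \<in> \<theta> \<inter> K \<times> K" for a b c
    using that con_trans[OF th, of a b c] by auto
  show "(a, a) \<in> \<theta> \<inter> K \<times> K" if "a \<in> K" for a using that con_refl[OF th] subl_sub[OF s] by auto
qed (auto intro: con_sym[OF th])

text \<open>Restriction is a bijection from the congruences of \<open>K'\<close> onto those
  congruences of \<open>K\<close> that satisfy \<open>C\<close>. With \<open>C\<close> constantly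
  true this is a congruence-preserving extension; in general \<open>C\<close> records the relations
  between prime intervals that the enlargement forces.\<close>

definition cext :: "'a::order set \<Rightarrow> 'a set \<Rightarrow> (('a \<times> 'a) set \<Rightarrow> bool) \<Rightarrow> bool" where
  "cext K K' C \<longleftrightarrow> subl K K' \<and> (\<forall>\<theta>. con K' \<theta> \<longrightarrow> C (\<theta> \<inter> K \<times> K)) \<and>
     (\<forall>\<theta>. con K \<theta> \<and> C \<theta> \<longrightarrow> (\<exists>\<theta>'. con K' \<theta>' \<and> \<theta>' \<inter> K \<times> K = \<theta>)) \<and>
     (\<forall>\<theta> \<theta>'. con K' \<theta> \<and> con K' \<theta>' \<and> \<theta> \<inter> K \<times> K = \<theta>' \<inter> K \<times> K \<longrightarrow> \<theta> = \<theta>')"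

lemma cext_subl: "cext K K' C \<Longrightarrow> subl K K'" by (simp add: cext_def)

lemma cextD:
  assumes "cext K K' C"
  shows cext_C: "con K' \<theta> \<Longrightarrow> C (\<theta> \<inter> K \<times> K)"
    and cext_ex: "con K \<theta> \<Longrightarrow> C \<theta> \<Longrightarrow> \<exists>\<theta>'. con K' \<theta>' \<and> \<theta>' \<inter> K \<times> K = \<theta>"
    and cext_inj: "con K' \<theta> \<Longrightarrow> con K' \<theta>' \<Longrightarrow> \<theta> \<inter> K \<times> K = \<theta>' \<inter> K \<times> K \<Longrightarrow> \<theta> = \<theta>'"
proof -
  note c = assms[unfolded cext_def, THEN conjunct2]
  show "con K' \<theta> \<Longrightarrow> C (\<theta> \<inter> K \<times> K)" using c by simp
  show "con K \<theta> \<Longrightarrow> C \<theta> \<Longrightarrow> \<exists>\<theta>'. con K' \<theta>' \<and> \<theta>' \<inter> K \<times> K = \<theta>" using c by simp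
  show "con K' \<theta> \<Longrightarrow> con K' \<theta>' \<Longrightarrow> \<theta> \<inter> K \<times> K = \<theta>' \<inter> K \<times> K \<Longrightarrow> \<theta> = \<theta>'"
    using c[THEN conjunct2, THEN conjunct2, rule_format, of \<theta> \<theta>'] by blast
qed

lemma cextI:
  assumes "subl K K'" "\<And>\<theta>. con K' \<theta> \<Longrightarrow> C (\<theta> \<inter> K \<times> K)"
    and "\<And>\<theta>. con K \<theta> \<Longrightarrow> C \<theta> \<Longrightarrow> \<exists>\<theta>'. con K' \<theta>' \<and> \<theta>' \<inter> K \<times> K = \<theta>"
    and "\<And>\<theta> \<theta>'. con K' \<theta> \<Longrightarrow> con K' \<theta>' \<Longrightarrow> \<theta> \<inter> K \<times> K = \<theta>' \<inter> K \<times> K \<Longrightarrow> \<theta> = \<theta>'"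
  shows "cext K K' C"
  unfolding cext_def by (intro conjI allI impI) (use assms in simp_all)

text \<open>The condition \<open>C'\<close> lives on the middle lattice. It can be pulled down to
  \<open>K\<close> when it depends on the trace in \<open>K\<close> only, so the constraints of
  successive extensions accumulate as a conjunction.\<close>

lemma cext_trans:
  assumes 1: "cext K K' C" and 2: "cext K' K'' C'"
    and c: "\<And>\<theta>. con K' \<theta> \<Longrightarrow> C' \<theta> \<longleftrightarrow> C'' (\<theta> \<inter> K \<times> K)"
  shows "cext K K'' (\<lambda>\<theta>. C \<theta> \<and> C'' \<theta>)"
proof (rule cextI)
  note s1 = cext_subl[OF 1] and s2 = cext_subl[OF 2]
  have K: "K \<subseteq> K'" using subl_sub[OF s1] .
  have I: "(\<theta> \<inter> K' \<times> K') \<inter> K \<times> K = \<theta> \<inter> K \<times> K" for \<theta> using K by blast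
  show "subl K K''" using subl_trans s1 s2 by blast
  show "C (\<theta> \<inter> K \<times> K) \<and> C'' (\<theta> \<inter> K \<times> K)" if "con K'' \<theta>" for \<theta>
    using cext_C[OF 1 con_restrict[OF s2 that]] cext_C[OF 2 that] c[OF con_restrict[OF s2 that]]
    by (simp add: I)
  show "\<exists>\<theta>'. con K'' \<theta>' \<and> \<theta>' \<inter> K \<times> K = \<theta>" if th: "con K \<theta>" "C \<theta> \<and> C'' \<theta>" for \<theta>
  proof -
    obtain \<theta>' where t: "con K' \<theta>'" "\<theta>' \<inter> K \<times> K = \<theta>" using cext_ex[OF 1] th by blast
    then obtain \<theta>'' where t2: "con K'' \<theta>''" "\<theta>'' \<inter> K' \<times> K' = \<theta>'"
      using cext_ex[OF 2 t(1)] c[OF t(1)] th by blast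
    then have "\<theta>'' \<inter> K \<times> K = \<theta>" using I[of \<theta>''] t by simp
    then show ?thesis using t2 by blast
  qed
  show "\<theta> = \<theta>'" if "con K'' \<theta>" "con K'' \<theta>'" "\<theta> \<inter> K \<times> K = \<theta>' \<inter> K \<times> K" for \<theta> \<theta>'
  proof (rule cext_inj[OF 2 that(1,2)])
    show "\<theta> \<inter> K' \<times> K' = \<theta>' \<inter> K' \<times> K'"
      using cext_inj[OF 1 con_restrict[OF s2 that(1)] con_restrict[OF s2 that(2)]] that(3) I by simp
  qed
qed

lemma cext_cong:
  assumes "cext K K' C" "\<And>\<theta>. con K \<theta> \<Longrightarrow> C \<theta> \<longleftrightarrow> C' \<theta>" shows "cext K K' C'"
proof (rule cextI)
  show "subl K K'" using assms(1) cext_subl by blast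
  show "C' (\<theta> \<inter> K \<times> K)" if "con K' \<theta>" for \<theta>
    using cext_C[OF assms(1) that] assms(2) con_restrict[OF cext_subl[OF assms(1)] that] by blast
  show "\<exists>\<theta>'. con K' \<theta>' \<and> \<theta>' \<inter> K \<times> K = \<theta>" if "con K \<theta>" "C' \<theta>" for \<theta>
    using cext_ex[OF assms(1) that(1)] assms(2)[OF that(1)] that(2) by simp
qed (rule cext_inj[OF assms(1)])

lemma con_Int: "con K \<theta> \<Longrightarrow> \<theta> \<inter> K \<times> K = \<theta>"
  by (rule Int_absorb2[OF con_sub])

lemma cext_refl: "lat K \<Longrightarrow> cext K K (\<lambda>_. True)"
proof (rule cextI)
  assume "lat K" then show "subl K K" by (rule subl_refl)
  show "\<exists>\<theta>'. con K \<theta>' \<and> \<theta>' \<inter> K \<times> K = \<theta>" if "con K \<theta>" for \<theta>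
    using that con_Int[OF that] by blast
qed (auto simp: con_Int)

text \<open>The new element \<open>w\<close> becomes a further atom of the interval \<open>[x, z]\<close>, which has length two.\<close>

locale insertion =
  fixes K :: "'a::order set" and x z w :: 'a
  assumes K: "lat K" and x: "x \<in> K" and z: "z \<in> K" and w: "w \<notin> K"
    and le_w: "\<And>t. t \<in> K \<Longrightarrow> t \<le> w \<longleftrightarrow> t \<le> x" and w_le: "\<And>t. t \<in> K \<Longrightarrow> w \<le> t \<longleftrightarrow> z \<le> t"
    and mid: "\<exists>m\<in>K. x < m \<and> m < z"
    and above: "\<And>t. t \<in> K \<Longrightarrow> x < t \<Longrightarrow> \<exists>m\<in>K. x < m \<and> m < z \<and> m \<le> t"
    and below: "\<And>t. t \<in> K \<Longrightarrow> t < z \<Longrightarrow> \<exists>m\<in>K. x < m \<and> m < z \<and> t \<le> m"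
    and anti: "\<And>m m'. m \<in> K \<Longrightarrow> m' \<in> K \<Longrightarrow> x < m \<Longrightarrow> m < z \<Longrightarrow> x < m' \<Longrightarrow> m' < z \<Longrightarrow>
      m \<le> m' \<Longrightarrow> m = m'"
begin

lemma xz: "x < z" using mid order_less_trans by blast

lemma x_less_w: "x < w" using le_w[OF x] w x by (auto simp: order_less_le)
lemma w_less_z: "w < z" using w_le[OF z] w z by (auto simp: order_less_le)

lemma isjn_old: "a \<in> K \<Longrightarrow> b \<in> K \<Longrightarrow> isjn (insert w K) a b (jn K a b)"
  using K x by (auto simp: isjn_def jn_le_iff le_w)

lemma ismt_old: "a \<in> K \<Longrightarrow> b \<in> K \<Longrightarrow> ismt (insert w K) a b (mt K a b)"
  using K z by (auto simp: ismt_def le_mt_iff w_le)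

text \<open>Above \<open>w\<close> there are, besides \<open>w\<close>, only elements above
  \<open>z\<close>. Hence joining with \<open>w\<close> is joining with \<open>z\<close> unless
  \<open>t\<close> already lies below \<open>x\<close>.\<close>

lemma isjn_w: "t \<in> K \<Longrightarrow> isjn (insert w K) w t (if t \<le> x then w else jn K z t)"
  using K z by (auto simp: isjn_def jn_le_iff le_w w_le)

lemma ismt_w: "t \<in> K \<Longrightarrow> ismt (insert w K) w t (if z \<le> t then w else mt K x t)"
  using K x by (auto simp: ismt_def le_mt_iff le_w w_le)

lemma lat': "lat (insert w K)"
proof (rule latI)
  fix a b assume ab: "a \<in> insert w K" "b \<in> insert w K"
  have sy: "isjn (insert w K) a b c = isjn (insert w K) b a c"
    "ismt (insert w K) a b c = ismt (insert w K) b a c" for c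
    by (auto simp: isjn_def ismt_def)
  consider "a \<in> K" "b \<in> K" | "a = w" "b \<in> K" | "a \<in> K" "b = w" | "a = w" "b = w" using ab by blast
  then have "(\<exists>c. isjn (insert w K) a b c) \<and> (\<exists>c. ismt (insert w K) a b c)"
  proof cases
    case 4 then show ?thesis by (auto simp: isjn_def ismt_def)
  qed (use isjn_old ismt_old isjn_w ismt_w sy in blast)+
  then show "\<exists>c. isjn (insert w K) a b c" "\<exists>c. ismt (insert w K) a b c" by auto
qed

lemma subl': "subl K (insert w K)"
  by (rule sublI[OF K lat' subset_insertI]) (auto intro: isjn_old ismt_old)

lemma jn_w: "t \<in> K \<Longrightarrow> jn (insert w K) w t = (if t \<le> x then w else jn K z t)"
  by (rule jn_eqI[OF lat' _ _ isjn_w]) auto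
lemma mt_w: "t \<in> K \<Longrightarrow> mt (insert w K) w t = (if z \<le> t then w else mt K x t)"
  by (rule mt_eqI[OF lat' _ _ ismt_w]) auto
lemma jn_ww: "jn (insert w K) w w = w" by (rule jn_absorb[OF lat']) auto
lemma mt_ww: "mt (insert w K) w w = w" by (rule mt_absorb[OF lat']) auto
lemma jn_old: "a \<in> K \<Longrightarrow> b \<in> K \<Longrightarrow> jn (insert w K) a b = jn K a b" using subl_jn[OF subl'] .
lemma mt_old: "a \<in> K \<Longrightarrow> b \<in> K \<Longrightarrow> mt (insert w K) a b = mt K a b" using subl_mt[OF subl'] .

lemma cov_x_mid: "m \<in> K \<Longrightarrow> x < m \<Longrightarrow> m < z \<Longrightarrow> cov K x m"
proof -
  assume m: "m \<in> K" "x < m" "m < z"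
  have False if "t \<in> K" "x < t" "t < m" for t
    using anti[of t m] that m order_less_trans[of t m z] by (auto simp: order_less_le)
  then show ?thesis using m x unfolding cov_iff by blast
qed

lemma cov_mid_z: "m \<in> K \<Longrightarrow> x < m \<Longrightarrow> m < z \<Longrightarrow> cov K m z"
proof -
  assume m: "m \<in> K" "x < m" "m < z"
  have False if "t \<in> K" "m < t" "t < z" for t
    using anti[of m t] that m order_less_trans[of x m t] by (auto simp: order_less_le)
  then show ?thesis using m z unfolding cov_iff by blast
qed

lemma cov_xw: "cov (insert w K) x w"
proof -
  have False if "t \<in> K" "x < t" "t < w" for t
    using le_w[OF that(1)] that by (auto simp: order_less_le)
  then show ?thesis using x x_less_w unfolding cov_iff by blast
qed

lemma cov_wz: "cov (insert w K) w z"
proof -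
  have False if "t \<in> K" "w < t" "t < z" for t
    using w_le[OF that(1)] that by (auto simp: order_less_le)
  then show ?thesis using z w_less_z unfolding cov_iff by blast
qed

text \<open>If \<open>w\<close> split the pair, its ends would enclose the whole of
  \<open>[x, z]\<close>, and an inner element would already split it in \<open>K\<close>.\<close>

lemma cov_old: assumes "cov K a b" shows "cov (insert w K) a b"
proof -
  have False if "a < w" "w < b"
  proof -
    have "a \<le> x" "z \<le> b" using that le_w[of a] w_le[of b] cov_in[OF assms] by (auto simp: order_less_le)
    moreover obtain m where "m \<in> K" "x < m" "m < z" using mid by blast
    ultimately show False using assms unfolding cov_iff
      by (meson order_le_less_trans order_less_le_trans)
  qed
  then show ?thesis using assms unfolding cov_iff by blast
qed

lemma cov_cases:
  assumes "cov (insert w K) a b"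
  obtains "cov K a b" | "a = x" "b = w" | "a = w" "b = z"
proof -
  consider "a \<in> K" "b \<in> K" | "a = w" "b \<in> K" | "a \<in> K" "b = w" using assms by (auto simp: cov_iff)
  then show thesis
  proof cases
    case 1 then show thesis using assms that(1) unfolding cov_iff by blast
  next
    case 2
    then have "z \<le> b" using w_le[of b] cov_in[OF assms] by (auto simp: order_less_le)
    then have "b = z" using cov_between[OF assms, of z] z w_less_z 2 w by (auto simp: order_less_le)
    then show thesis using that 2 by blast
  next
    case 3
    then have "a \<le> x" using le_w[of a] cov_in[OF assms] by (auto simp: order_less_le)
    then have "a = x" using cov_between[OF assms, of x] x x_less_w 3 w by (auto simp: order_less_le)
    then show thesis using that 3 by blast
  qed
qed

lemma smod': assumes S: "smod K" shows "smod (insert w K)"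
proof (rule smodI)
  let ?K = "insert w K"
  fix a b c assume ab: "cov ?K a b" and c: "c \<in> ?K"
  show "jn ?K a c = jn ?K b c \<or> cov ?K (jn ?K a c) (jn ?K b c)"
  proof (cases "c = w")
    case cw: True
    from ab show ?thesis
    proof (cases rule: cov_cases)
      case 1
      then have i: "a \<in> K" "b \<in> K" "a < b" by (auto simp: cov_iff)
      have e: "jn ?K a w = jn ?K w a" "jn ?K b w = jn ?K w b" by (rule jn_comm)+
      consider "b \<le> x" | "a \<le> x" "\<not> b \<le> x" | "\<not> a \<le> x" "\<not> b \<le> x"
        using i by (meson less_imp_le order_trans)
      then show ?thesis
      proof cases
        case 1 then have "a \<le> x" using i by (meson less_imp_le order_trans)
        then show ?thesis using 1 i by (simp add: cw e jn_w)
      next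
        case 2
        \<comment> \<open>Semimodularity makes \<open>jn K b x\<close> a cover of \<open>x\<close>.
          By \<open>above\<close> an inner element lies below it, hence equals it, so
          \<open>b \<le> z\<close> and the join with \<open>w\<close> rises exactly from
          \<open>w\<close> to \<open>z\<close>.\<close>
        then have cv: "cov K x (jn K b x)" using smod_cov_jn[OF K S 1 x] by blast
        then obtain m where m: "m \<in> K" "x < m" "m < z" "m \<le> jn K b x"
          using above[of "jn K b x"] by (auto simp: cov_iff)
        then have "m = jn K b x" using cov_between[OF cv, of m] by (auto simp: order_less_le)
        then have "b \<le> z" using m i x K by (metis jn_ge1 less_imp_le order_trans)
        then have "jn K z b = z" using jn_absorb2 K z i by blast
        then show ?thesis using 2 i cov_wz by (simp add: cw e jn_w)
      next
        case 3
        then show ?thesis using smodD[OF S 1 z] i cov_old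
          by (auto simp: cw e jn_w jn_comm[of K z a] jn_comm[of K z b])
      qed
    next
      case 2 then show ?thesis using cw x by (simp add: jn_ww jn_comm[of _ x w] jn_w)
    next
      case 3 then show ?thesis using cw z xz cov_wz K jn_absorb[OF K z z]
        by (simp add: jn_ww jn_comm[of _ z w] jn_w)
    qed
  next
    case False
    then have cK: "c \<in> K" using c by simp
    from ab show ?thesis
    proof (cases rule: cov_cases)
      case 1
      then have i: "a \<in> K" "b \<in> K" by (auto simp: cov_iff)
      then show ?thesis using smodD[OF S 1 cK] cov_old cK by (auto simp: jn_old)
    next
      case 2
      show ?thesis
      proof (cases "c \<le> x")
        case True
        then show ?thesis using 2 cK x cov_xw jn_absorb2[OF K x cK] by (simp add: jn_old jn_w)
      next
        case False
        \<comment> \<open>By \<open>above\<close> some inner \<open>m\<close> lies below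
          \<open>jn K x c\<close>. Since \<open>z\<close> covers \<open>m\<close>, joining with this
          element shows that the step from \<open>jn K x c\<close> to \<open>jn K z c\<close> is at
          most a cover.\<close>
        let ?d = "jn K x c"
        have d: "?d \<in> K" "x < ?d" using False K x cK
          by (auto simp: order_less_le) (metis jn_ge2)
        then obtain m where m: "m \<in> K" "x < m" "m < z" "m \<le> ?d" using above by blast
        have "jn K m ?d = ?d" using jn_absorb K m d by blast
        moreover have "jn K z ?d = jn K z c"
          using jn_assoc[OF K z x cK] jn_absorb2[OF K z x] xz by (simp add: less_imp_le)
        ultimately have "?d = jn K z c \<or> cov K ?d (jn K z c)"
          using smodD[OF S cov_mid_z[OF m(1,2,3)] d(1)] by simp
        then show ?thesis using 2 cK x False cov_old by (auto simp: jn_old jn_w)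
      qed
    next
      case 3
      then show ?thesis
      proof (cases "c \<le> x")
        case True
        then have "jn K z c = z" using jn_absorb2[OF K z cK] xz by (meson less_imp_le order_trans)
        then show ?thesis using 3 True cK z cov_wz by (simp add: jn_old jn_w)
      next
        case False then show ?thesis using 3 cK z by (simp add: jn_old jn_w)
      qed
    qed
  qed
qed

text \<open>The inner elements are treated alike by \<theta>. The condition is void for a single
  inner element; for two of them it is what the diamond that they form with \<open>w\<close>
  imposes.\<close>

definition mixed :: "('a \<times> 'a) set \<Rightarrow> bool" where
  "mixed \<theta> \<longleftrightarrow> (\<forall>m\<in>K. \<forall>m'\<in>K. x < m \<and> m < z \<and> x < m' \<and> m' < z \<longrightarrow>
     ((m, z) \<in> \<theta> \<longrightarrow> (m', z) \<in> \<theta>) \<and> ((x, m) \<in> \<theta> \<longrightarrow> (x, m') \<in> \<theta>))"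

lemma mid_w:
  assumes "m \<in> K" "x < m" "m < z"
  shows "jn (insert w K) w m = z" "mt (insert w K) w m = x"
proof -
  have "\<not> m \<le> x" "\<not> z \<le> m" using assms by auto
  then show "jn (insert w K) w m = z" "mt (insert w K) w m = x"
    using assms jn_absorb2[OF K z assms(1)] mt_absorb[OF K x assms(1)] by (auto simp: jn_w mt_w)
qed

text \<open>The edges \<open>[x, w]\<close> and \<open>[m, z]\<close>, and likewise
  \<open>[w, z]\<close> and \<open>[x, m]\<close>, are opposite edges of the cell with corners
  \<open>x\<close>, \<open>m\<close>, \<open>w\<close>, \<open>z\<close>, for every inner
  \<open>m\<close>.\<close>

lemma con_xw: assumes th: "con (insert w K) \<theta>" and m: "m \<in> K" "x < m" "m < z"
  shows "(x, w) \<in> \<theta> \<longleftrightarrow> (m, z) \<in> \<theta>" "(w, z) \<in> \<theta> \<longleftrightarrow> (x, m) \<in> \<theta>"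
  using con_persp[OF lat' th, of w m] con_persp[OF lat' th, of m w] mid_w[OF m] m
  by (auto simp: jn_comm[of _ m w] mt_comm[of _ m w])

text \<open>A class containing \<open>w\<close> and \<open>t\<close> passes through \<open>z\<close>
  if \<open>z \<le> t\<close> and through \<open>x\<close> otherwise. Together with
  \<open>con_xw\<close> this lets the trace on \<open>K\<close> determine the congruence.\<close>

lemma con_w_iff:
  assumes th: "con (insert w K) \<theta>" and t: "t \<in> K"
  shows "(w, t) \<in> \<theta> \<longleftrightarrow> (x, w) \<in> \<theta> \<and> (x, t) \<in> \<theta> \<or> (w, z) \<in> \<theta> \<and> (z, t) \<in> \<theta>"
proof
  assume wt: "(w, t) \<in> \<theta>"
  show "(x, w) \<in> \<theta> \<and> (x, t) \<in> \<theta> \<or> (w, z) \<in> \<theta> \<and> (z, t) \<in> \<theta>"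
  proof (cases "z \<le> t")
    case True
    then have "(w, z) \<in> \<theta> \<and> (z, t) \<in> \<theta>"
      using con_between[OF lat' th wt, of z] z w_less_z by (auto simp: less_imp_le)
    then show ?thesis by simp
  next
    case False
    then have "(mt K x t, w) \<in> \<theta>"
      using con_mt_jn[OF lat' th, of w t] wt t mt_w[OF t]
        con_between[OF lat' th, of "mt K x t" "jn (insert w K) w t" w] K x lat'
        x_less_w mt_le1[OF K x t] by (auto simp: less_imp_le intro: order_trans)
    then have "(x, w) \<in> \<theta>"
      using con_between[OF lat' th _ mt_le1[OF K x t]] x x_less_w by (auto simp: less_imp_le)
    then show ?thesis using wt con_trans[OF th] by blast
  qed
next
  assume "(x, w) \<in> \<theta> \<and> (x, t) \<in> \<theta> \<or> (w, z) \<in> \<theta> \<and> (z, t) \<in> \<theta>"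
  then show "(w, t) \<in> \<theta>" using con_trans[OF th] con_sym[OF th] by blast
qed

text \<open>If an edge \<open>[m, z]\<close> is collapsed, \<open>[x, w]\<close> has to be collapsed
  too, and sending \<open>w\<close> to \<open>x\<close> is compatible modulo \<theta>; if an edge
  \<open>[x, m]\<close> is collapsed, \<open>w\<close> is sent to \<open>z\<close> instead. If
  neither happens, \<open>w\<close> can form a class of its own.\<close>

lemma con_extend:
  assumes th: "con K \<theta>" and mx: "mixed \<theta>"
  shows "\<exists>\<theta>'. con (insert w K) \<theta>' \<and> \<theta>' \<inter> K \<times> K = \<theta>"
proof -
  let ?K = "insert w K"
  \<comment> \<open>Pullback along the map that fixes \<open>K\<close> and sends \<open>w\<close> to
    \<open>y\<close>. The assumptions compare, modulo \<theta>, the joins and meets with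
    \<open>w\<close> in the new lattice to those with \<open>y\<close> in \<open>K\<close>.\<close>
  have pb: "\<exists>\<theta>'. con ?K \<theta>' \<and> \<theta>' \<inter> K \<times> K = \<theta>"
    if y: "y \<in> K" and J: "\<And>t. t \<in> K \<Longrightarrow> t \<le> x \<Longrightarrow> (y, jn K y t) \<in> \<theta>"
       "\<And>t. t \<in> K \<Longrightarrow> \<not> t \<le> x \<Longrightarrow> (jn K z t, jn K y t) \<in> \<theta>"
      and M: "\<And>t. t \<in> K \<Longrightarrow> z \<le> t \<Longrightarrow> (y, mt K y t) \<in> \<theta>"
       "\<And>t. t \<in> K \<Longrightarrow> \<not> z \<le> t \<Longrightarrow> (mt K x t, mt K y t) \<in> \<theta>" for y
  proof -
    define h where "h = (\<lambda>t. if t = w then y else t)"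
    have hK: "h t = t" if "t \<in> K" for t using that w by (auto simp: h_def)
    have hw: "h w = y" by (simp add: h_def)
    have jw: "(h (jn ?K w t), jn K y t) \<in> \<theta>" and mw: "(h (mt ?K w t), mt K y t) \<in> \<theta>" if "t \<in> K" for t
      using J[OF that] M[OF that] that K x z by (auto simp: jn_w mt_w hw hK)
    have "con ?K {(a, b). a \<in> ?K \<and> b \<in> ?K \<and> (h a, h b) \<in> \<theta>}"
    proof (rule con_pullback[OF K lat' th])
      fix a b assume ab: "a \<in> ?K" "b \<in> ?K"
      consider "a \<in> K" "b \<in> K" | "a = w" "b \<in> K" | "a \<in> K" "b = w" | "a = w" "b = w" using ab by blast
      then have "(h (jn ?K a b), jn K (h a) (h b)) \<in> \<theta> \<and> (h (mt ?K a b), mt K (h a) (h b)) \<in> \<theta>"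
      proof cases
        case 1 then show ?thesis using K con_refl[OF th] by (simp add: hK jn_old mt_old)
      next
        case 2 then show ?thesis using jw mw by (simp add: hK hw)
      next
        case 3 then show ?thesis using jw mw by (simp add: hK hw jn_comm[of _ a w] mt_comm[of _ a w] jn_comm[of K a y] mt_comm[of K a y])
      next
        case 4 then show ?thesis using con_refl[OF th y] jn_absorb[OF K y y] mt_absorb[OF K y y]
          by (simp add: jn_ww mt_ww hw)
      qed
      then show "(h (jn ?K a b), jn K (h a) (h b)) \<in> \<theta>" "(h (mt ?K a b), mt K (h a) (h b)) \<in> \<theta>" by auto
    qed (use y in \<open>auto simp: h_def\<close>)
    moreover have "{(a, b). a \<in> ?K \<and> b \<in> ?K \<and> (h a, h b) \<in> \<theta>} \<inter> K \<times> K = \<theta>"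
      using con_sub[OF th] hK by auto
    ultimately show ?thesis by blast
  qed
  have up: "\<exists>m\<in>K. x < m \<and> m < z \<and> m \<le> jn K x t" if "t \<in> K" "\<not> t \<le> x" for t
    by (rule above) (use that K x in \<open>auto simp: order_less_le, metis jn_ge2\<close>)
  have dn: "\<exists>m\<in>K. x < m \<and> m < z \<and> mt K z t \<le> m" if "t \<in> K" "\<not> z \<le> t" for t
    by (rule below) (use that K z in \<open>auto simp: order_less_le, metis mt_le2\<close>)
  have jz: "jn K (jn K x t) z = jn K z t" if "t \<in> K" for t
    using jn_assoc[OF K z x that] jn_absorb2[OF K z x] xz by (simp add: less_imp_le jn_comm)
  have mx': "mt K (mt K z t) x = mt K x t" if "t \<in> K" for t
    using mt_assoc[OF K x z that] mt_absorb[OF K x z] xz by (simp add: less_imp_le mt_comm)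
  consider (a) "\<exists>m\<in>K. x < m \<and> m < z \<and> (m, z) \<in> \<theta>" | (b) "\<exists>m\<in>K. x < m \<and> m < z \<and> (x, m) \<in> \<theta>"
    | (c) "\<forall>m\<in>K. x < m \<and> m < z \<longrightarrow> (m, z) \<notin> \<theta> \<and> (x, m) \<notin> \<theta>" by blast
  then show ?thesis
  proof cases
    case a
    then have all: "(m, z) \<in> \<theta>" if "m \<in> K" "x < m" "m < z" for m using mx that unfolding mixed_def by blast
    show ?thesis
    proof (rule pb[OF x])
      fix t assume t: "t \<in> K"
      show "(x, jn K x t) \<in> \<theta>" if "t \<le> x" using jn_absorb2[OF K x t that] con_refl[OF th x] by simp
      show "(x, mt K x t) \<in> \<theta>" if "z \<le> t"
        using mt_absorb[OF K x t] xz that con_refl[OF th x] by (metis less_imp_le order_trans)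
      show "(mt K x t, mt K x t) \<in> \<theta>" using con_refl[OF th] K x t by simp
      assume "\<not> t \<le> x"
      then obtain m where m: "m \<in> K" "x < m" "m < z" "m \<le> jn K x t" using up[OF t] by blast
      have "(jn K m (jn K x t), jn K z (jn K x t)) \<in> \<theta>" using con_jn1[OF th all[OF m(1,2,3)]] K x t by simp
      then have "(jn K x t, jn K z t) \<in> \<theta>"
        using jn_absorb[OF K m(1) _ m(4)] K x t jz[OF t] by (simp add: jn_comm[of K z "jn K x t"])
      then show "(jn K z t, jn K x t) \<in> \<theta>" by (rule con_sym[OF th])
    qed
  next
    case b
    then have all: "(x, m) \<in> \<theta>" if "m \<in> K" "x < m" "m < z" for m using mx that unfolding mixed_def by blast
    show ?thesis
    proof (rule pb[OF z])
      fix t assume t: "t \<in> K"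
      show "(z, mt K z t) \<in> \<theta>" if "z \<le> t" using mt_absorb[OF K z t that] con_refl[OF th z] by simp
      show "(z, jn K z t) \<in> \<theta>" if "t \<le> x"
        using jn_absorb2[OF K z t] xz that con_refl[OF th z] by (metis less_imp_le order_trans)
      show "(jn K z t, jn K z t) \<in> \<theta>" using con_refl[OF th] K z t by simp
      assume "\<not> z \<le> t"
      then obtain m where m: "m \<in> K" "x < m" "m < z" "mt K z t \<le> m" using dn[OF t] by blast
      have "(mt K x (mt K z t), mt K m (mt K z t)) \<in> \<theta>" using con_mt1[OF th all[OF m(1,2,3)]] K z t by simp
      then show "(mt K x t, mt K z t) \<in> \<theta>"
        using mt_absorb2[OF K m(1) _ m(4)] K z t mx'[OF t] by (simp add: mt_comm[of K x "mt K z t"])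
    qed
  next
    case c
    \<comment> \<open>With no edge of \<open>[x, z]\<close> collapsed, related elements are alike in
      lying below \<open>x\<close> and in lying above \<open>z\<close>. So their joins and meets
      with \<open>w\<close> come out of the same branch of \<open>jn_w\<close> and
      \<open>mt_w\<close>.\<close>
    have A: "(s \<le> x) = (t \<le> x)" if st: "(s, t) \<in> \<theta>" for s t
    proof -
      have "t \<le> x" if st: "(s, t) \<in> \<theta>" and s: "s \<le> x" for s t
      proof (rule ccontr)
        have i: "s \<in> K" "t \<in> K" using con_in[OF th st] by auto
        assume "\<not> t \<le> x"
        then obtain m where m: "m \<in> K" "x < m" "m < z" "m \<le> jn K x t" using up i by blast
        have "(jn K s x, jn K t x) \<in> \<theta>" using con_jn1[OF th st x] .
        then have "(x, jn K x t) \<in> \<theta>" using jn_absorb[OF K i(1) x s] by (simp add: jn_comm[of K t x])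
        from con_between(1)[OF K th this _ m(4,1)] m have "(x, m) \<in> \<theta>" by (simp add: less_imp_le)
        then show False using c m by blast
      qed
      from this[OF st] this[OF con_sym[OF th st]] show ?thesis by blast
    qed
    have B: "(z \<le> s) = (z \<le> t)" if st: "(s, t) \<in> \<theta>" for s t
    proof -
      have "z \<le> t" if st: "(s, t) \<in> \<theta>" and s: "z \<le> s" for s t
      proof (rule ccontr)
        have i: "s \<in> K" "t \<in> K" using con_in[OF th st] by auto
        assume "\<not> z \<le> t"
        then obtain m where m: "m \<in> K" "x < m" "m < z" "mt K z t \<le> m" using dn i by blast
        have "(mt K s z, mt K t z) \<in> \<theta>" using con_mt1[OF th st z] .
        then have "(mt K z t, z) \<in> \<theta>" using mt_absorb2[OF K i(1) z s] con_sym[OF th]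
          by (simp add: mt_comm[of K t z])
        from con_between(2)[OF K th this m(4) _ m(1)] m have "(m, z) \<in> \<theta>" by (simp add: less_imp_le)
        then show False using c m by blast
      qed
      from this[OF st] this[OF con_sym[OF th st]] show ?thesis by blast
    qed
    let ?T = "insert (w, w) \<theta>"
    have i: "a \<in> K" "b \<in> K" if "(a, b) \<in> \<theta>" for a b using con_in[OF th that] by auto
    have "con ?K ?T"
    proof (rule conI)
      show "?T \<subseteq> ?K \<times> ?K" using con_sub[OF th] by blast
      show "(a, a) \<in> ?T" if "a \<in> ?K" for a using that con_refl[OF th] by blast
      show "(b, a) \<in> ?T" if "(a, b) \<in> ?T" for a b using that con_sym[OF th] by blast
      show "(a, d) \<in> ?T" if "(a, b) \<in> ?T" "(b, d) \<in> ?T" for a b d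
        using that con_trans[OF th] i w by blast
      fix a b d assume ab: "(a, b) \<in> ?T" and d: "d \<in> ?K"
      have "(jn ?K a d, jn ?K b d) \<in> ?T \<and> (mt ?K a d, mt ?K b d) \<in> ?T"
      proof (cases "(a, b) = (w, w)")
        case True
        have "(e, e) \<in> ?T" if "e \<in> ?K" for e using that con_refl[OF th] by blast
        moreover have "jn ?K w d \<in> ?K" "mt ?K w d \<in> ?K"
          using jn_in[OF lat' _ d, of w] mt_in[OF lat' _ d, of w] by blast+
        ultimately show ?thesis using True by simp
      next
        case False
        then have ab': "(a, b) \<in> \<theta>" using ab by blast
        show ?thesis
        proof (cases "d = w")
          case True
          have e: "jn ?K a w = jn ?K w a" "jn ?K b w = jn ?K w b" "mt ?K a w = mt ?K w a" "mt ?K b w = mt ?K w b"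
            by (rule jn_comm mt_comm)+
          show ?thesis using True i[OF ab'] A[OF ab'] B[OF ab'] con_jn1[OF th ab' z] con_mt1[OF th ab' x]
            by (simp add: e jn_w mt_w jn_comm[of K z a] jn_comm[of K z b] mt_comm[of K x a] mt_comm[of K x b])
        next
          case False
          then show ?thesis using i[OF ab'] d con_jn1[OF th ab'] con_mt1[OF th ab'] by (simp add: jn_old mt_old)
        qed
      qed
      then show "(jn ?K a d, jn ?K b d) \<in> ?T" "(mt ?K a d, mt ?K b d) \<in> ?T" by auto
    qed
    moreover have "?T \<inter> K \<times> K = \<theta>" using con_sub[OF th] w by blast
    ultimately show ?thesis by blast
  qed
qed

lemma cext': "cext K (insert w K) mixed"
proof (rule cextI[OF subl'])
  show "mixed (\<theta> \<inter> K \<times> K)" if "con (insert w K) \<theta>" for \<theta>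
    using con_xw[OF that] x z unfolding mixed_def by blast
  show "\<exists>\<theta>'. con (insert w K) \<theta>' \<and> \<theta>' \<inter> K \<times> K = \<theta>" if "con K \<theta>" "mixed \<theta>" for \<theta>
    using con_extend that .
  fix \<theta> \<theta>' assume c: "con (insert w K) \<theta>" "con (insert w K) \<theta>'" and e: "\<theta> \<inter> K \<times> K = \<theta>' \<inter> K \<times> K"
  obtain m where m: "m \<in> K" "x < m" "m < z" using mid by blast
  have old: "(a, b) \<in> \<theta> \<longleftrightarrow> (a, b) \<in> \<theta>'" if "a \<in> K" "b \<in> K" for a b using e that by blast
  have wt: "(w, t) \<in> \<theta> \<longleftrightarrow> (w, t) \<in> \<theta>'" if "t \<in> K" for t
    using con_w_iff[OF c(1) that] con_w_iff[OF c(2) that] con_xw[OF c(1) m] con_xw[OF c(2) m]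
      old x z m that by simp
  have "(a, b) \<in> \<theta> \<longleftrightarrow> (a, b) \<in> \<theta>'" if "a \<in> insert w K" "b \<in> insert w K" for a b
  proof (cases "a = w")
    case True then show ?thesis using that wt con_refl[OF c(1)] con_refl[OF c(2)] by blast
  next
    case False
    then show ?thesis using that wt[of a] old[of a b] con_sym[OF c(1)] con_sym[OF c(2)] by blast
  qed
  then show "\<theta> = \<theta>'" using con_sub[OF c(1)] con_sub[OF c(2)] by blast
qed

end

section \<open>New bottom elements and glued sums\<close>

locale new_bottom =
  fixes K :: "'a::order set" and b o1 :: 'a
  assumes K: "lat K" and b: "b \<notin> K" and o1: "o1 \<in> K" and o1_le: "\<And>t. t \<in> K \<Longrightarrow> o1 \<le> t" and b_less: "b < o1"
begin

lemma b_le: "t \<in> K \<Longrightarrow> b \<le> t" using o1_le[of t] b_less by (auto intro: less_imp_le order_less_le_trans)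
lemma not_le_b: "t \<in> K \<Longrightarrow> \<not> t \<le> b" using b b_le[of t] order_antisym[of t b] by blast

lemma isjn_old: "s \<in> K \<Longrightarrow> t \<in> K \<Longrightarrow> isjn (insert b K) s t (jn K s t)"
  using K not_le_b by (auto simp: isjn_def jn_le_iff)
lemma ismt_old: "s \<in> K \<Longrightarrow> t \<in> K \<Longrightarrow> ismt (insert b K) s t (mt K s t)"
  using K b_le by (auto simp: ismt_def le_mt_iff)
lemma isjn_b: "t \<in> insert b K \<Longrightarrow> isjn (insert b K) b t t"
  using b_le by (auto simp: isjn_def)
lemma ismt_b: "t \<in> insert b K \<Longrightarrow> ismt (insert b K) b t b"
  using b_le by (auto simp: ismt_def)

lemma lat': "lat (insert b K)"
proof (rule latI)
  fix s t assume st: "s \<in> insert b K" "t \<in> insert b K"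
  have sy: "isjn (insert b K) s t c = isjn (insert b K) t s c"
    "ismt (insert b K) s t c = ismt (insert b K) t s c" for c
    by (auto simp: isjn_def ismt_def)
  show "\<exists>c. isjn (insert b K) s t c" using st isjn_old isjn_b sy by blast
  show "\<exists>c. ismt (insert b K) s t c" using st ismt_old ismt_b sy by blast
qed

lemma subl': "subl K (insert b K)"
  by (rule sublI[OF K lat' subset_insertI]) (auto intro: isjn_old ismt_old)

lemma jn_b: "t \<in> insert b K \<Longrightarrow> jn (insert b K) b t = t"
  by (rule jn_eqI[OF lat' _ _ isjn_b]) auto
lemma mt_b: "t \<in> insert b K \<Longrightarrow> mt (insert b K) b t = b"
  by (rule mt_eqI[OF lat' _ _ ismt_b]) auto

lemma cov_b: "cov (insert b K) b o1"
proof -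
  have False if "t \<in> K" "t < o1" for t using o1_le[OF that(1)] that(2) by auto
  then show ?thesis using o1 b_less unfolding cov_iff by blast
qed

lemma cov_old: "cov K s t \<Longrightarrow> cov (insert b K) s t"
  using not_le_b unfolding cov_iff by (blast intro: less_imp_le)

lemma cov_cases: assumes "cov (insert b K) s t" obtains "cov K s t" | "s = b" "t = o1"
proof (cases "s = b")
  case True
  then have "t \<in> K" using assms by (auto simp: cov_iff)
  then have "t = o1" using cov_between[OF assms, of o1] o1 o1_le b_less True b by (auto simp: less_imp_le)
  then show thesis using that True by blast
next
  case False
  then have "s \<in> K" using assms by (auto simp: cov_iff)
  moreover have "t \<in> K" using cov_in[OF assms] b_le[OF \<open>s \<in> K\<close>] by (auto simp: order_less_le)
  ultimately show thesis using assms that(1) unfolding cov_iff by blast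
qed

lemma smod': assumes S: "smod K" shows "smod (insert b K)"
proof (rule smodI)
  let ?K = "insert b K"
  fix s t c assume st: "cov ?K s t" and c: "c \<in> ?K"
  show "jn ?K s c = jn ?K t c \<or> cov ?K (jn ?K s c) (jn ?K t c)"
  proof (cases "c = b")
    case True
    then show ?thesis using jn_b[of s] jn_b[of t] st cov_in[OF st] jn_comm[of ?K s b] jn_comm[of ?K t b] by simp
  next
    case False
    then have cK: "c \<in> K" using c by simp
    from st show ?thesis
    proof (cases rule: cov_cases)
      case 1 then show ?thesis
        using smodD[OF S 1 cK] cov_in[OF 1] cK cov_old by (auto simp: subl_jn[OF subl'])
    next
      case 2
      then show ?thesis using cK o1 o1_le K jn_absorb[OF K o1 cK] by (simp add: jn_b subl_jn[OF subl'])
    qed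
  qed
qed

lemma con_b_iff:
  assumes "con (insert b K) \<theta>" "t \<in> K" shows "(b, t) \<in> \<theta> \<longleftrightarrow> (b, o1) \<in> \<theta> \<and> (o1, t) \<in> \<theta>"
proof
  assume t: "(b, t) \<in> \<theta>"
  show "(b, o1) \<in> \<theta> \<and> (o1, t) \<in> \<theta>"
    using con_between[OF lat' assms(1) t, of o1] o1 o1_le assms(2) b_less by (simp add: less_imp_le)
qed (use con_trans[OF assms(1)] in blast)

lemma con_inj:
  assumes c: "con (insert b K) \<theta>" "con (insert b K) \<theta>'"
    and e: "\<theta> \<inter> K \<times> K = \<theta>' \<inter> K \<times> K" "(b, o1) \<in> \<theta> \<longleftrightarrow> (b, o1) \<in> \<theta>'"
  shows "\<theta> = \<theta>'"
proof -
  have old: "(s, t) \<in> \<theta> \<longleftrightarrow> (s, t) \<in> \<theta>'" if "s \<in> K" "t \<in> K" for s t using e(1) that by blast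
  have bt: "(b, t) \<in> \<theta> \<longleftrightarrow> (b, t) \<in> \<theta>'" if "t \<in> K" for t
    using con_b_iff[OF c(1) that] con_b_iff[OF c(2) that] old[OF o1 that] e(2) by simp
  have "(s, t) \<in> \<theta> \<longleftrightarrow> (s, t) \<in> \<theta>'" if st: "s \<in> insert b K" "t \<in> insert b K" for s t
  proof (cases "s = b")
    case True then show ?thesis using st bt con_refl[OF c(1)] con_refl[OF c(2)] by blast
  next
    case False
    then show ?thesis using st bt[of s] old[of s t] con_sym[OF c(1)] con_sym[OF c(2)] by blast
  qed
  then show ?thesis using con_sub[OF c(1)] con_sub[OF c(2)] by blast
qed

text \<open>The new edge is an independent choice: mapping \<open>b\<close> to \<open>o1\<close>
  collapses it, and leaving \<open>b\<close> a class of its own keeps it.\<close>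

lemma con_extend:
  assumes th: "con K \<theta>"
  shows "\<exists>\<theta>'. con (insert b K) \<theta>' \<and> \<theta>' \<inter> K \<times> K = \<theta> \<and> ((b, o1) \<in> \<theta>' \<longleftrightarrow> P)"
proof (cases P)
  case True
  let ?K = "insert b K"
  define h where "h = (\<lambda>t. if t = b then o1 else t)"
  have hK: "h t = t" if "t \<in> K" for t using that b by (auto simp: h_def)
  have hb: "h b = o1" by (simp add: h_def)
  have hin: "h t \<in> K" if "t \<in> ?K" for t using that o1 by (auto simp: h_def)
  have J: "h (jn ?K s t) = jn K (h s) (h t) \<and> h (mt ?K s t) = mt K (h s) (h t)"
    if st: "s \<in> ?K" "t \<in> ?K" for s t
  proof -
    have ab: "jn K o1 r = r" "mt K o1 r = o1" if "r \<in> K" for r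
      using jn_absorb[OF K o1 that o1_le[OF that]] mt_absorb[OF K o1 that o1_le[OF that]] by auto
    consider "s \<in> K" "t \<in> K" | "s = b" | "t = b" using st by blast
    then show ?thesis
    proof cases
      case 1 then show ?thesis using K by (simp add: hK subl_jn[OF subl'] subl_mt[OF subl'])
    next
      case 2 then show ?thesis using st hin[of t] ab[of "h t"] by (simp add: jn_b mt_b hb)
    next
      case 3 then show ?thesis using st hin[of s] ab[of "h s"] jn_b[of s] mt_b[of s]
        by (simp add: hb jn_comm[of _ s b] mt_comm[of _ s b] jn_comm[of K "h s" o1] mt_comm[of K "h s" o1])
    qed
  qed
  have "con ?K {(s, t). s \<in> ?K \<and> t \<in> ?K \<and> (h s, h t) \<in> \<theta>}"
    by (rule con_pullback[OF K lat' th]) (use hin J K con_refl[OF th] in auto)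
  moreover have "{(s, t). s \<in> ?K \<and> t \<in> ?K \<and> (h s, h t) \<in> \<theta>} \<inter> K \<times> K = \<theta>"
    using con_sub[OF th] hK by auto
  moreover have "(b, o1) \<in> {(s, t). s \<in> ?K \<and> t \<in> ?K \<and> (h s, h t) \<in> \<theta>}"
    using hb hK[OF o1] con_refl[OF th o1] o1 by simp
  ultimately show ?thesis using True by blast
next
  case False
  let ?K = "insert b K" and ?T = "insert (b, b) \<theta>"
  have i: "s \<in> K" "t \<in> K" if "(s, t) \<in> \<theta>" for s t using con_in[OF th that] by auto
  have "con ?K ?T"
  proof (rule conI)
    show "?T \<subseteq> ?K \<times> ?K" using con_sub[OF th] by blast
    show rf: "(s, s) \<in> ?T" if "s \<in> ?K" for s using that con_refl[OF th] by blast
    show "(t, s) \<in> ?T" if "(s, t) \<in> ?T" for s t using that con_sym[OF th] by blast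
    show "(s, r) \<in> ?T" if st: "(s, t) \<in> ?T" "(t, r) \<in> ?T" for s t r
      using st con_trans[OF th, of s t r] i b by blast
    fix s t d assume st: "(s, t) \<in> ?T" and d: "d \<in> ?K"
    have "(jn ?K s d, jn ?K t d) \<in> ?T \<and> (mt ?K s d, mt ?K t d) \<in> ?T"
    proof (cases "(s, t) = (b, b)")
      case True
      then show ?thesis using d rf[of d] rf[of b] by (simp add: jn_b mt_b)
    next
      case False
      then have st': "(s, t) \<in> \<theta>" using st by blast
      show ?thesis
      proof (cases "d = b")
        case True
        then show ?thesis using st i[OF st'] jn_b[of s] jn_b[of t] mt_b[of s] mt_b[of t]
          by (simp add: jn_comm[of _ s b] mt_comm[of _ s b] jn_comm[of _ t b] mt_comm[of _ t b])
      next
        case False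
        then show ?thesis using i[OF st'] d con_jn1[OF th st'] con_mt1[OF th st']
          by (simp add: subl_jn[OF subl'] subl_mt[OF subl'])
      qed
    qed
    then show "(jn ?K s d, jn ?K t d) \<in> ?T" "(mt ?K s d, mt ?K t d) \<in> ?T" by auto
  qed
  moreover have "?T \<inter> K \<times> K = \<theta>" "(b, o1) \<notin> ?T" using con_sub[OF th] b b_less by auto
  ultimately show ?thesis using False by blast
qed

end

locale glued_sum =
  fixes F G :: "'a::order set" and e :: 'a
  assumes F: "lat F" and G: "lat G" and eF: "e \<in> F" and eG: "e \<in> G"
    and Fe: "\<And>s. s \<in> F \<Longrightarrow> s \<le> e" and Ge: "\<And>t. t \<in> G \<Longrightarrow> e \<le> t"
begin

lemma both: "s \<in> F \<Longrightarrow> s \<in> G \<Longrightarrow> s = e" using Fe Ge order_antisym by blast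
lemma FG_le: "s \<in> F \<Longrightarrow> t \<in> G \<Longrightarrow> s \<le> t" using Fe Ge order_trans by blast
lemma GF_le: "t \<in> G \<Longrightarrow> s \<in> F \<Longrightarrow> t \<le> s \<longleftrightarrow> t = e \<and> s = e"
  using Fe Ge order_antisym order_trans by blast

lemma isjn_F: "a \<in> F \<Longrightarrow> b \<in> F \<Longrightarrow> isjn (F \<union> G) a b (jn F a b)"
  using F FG_le by (auto simp: isjn_def jn_le_iff)
lemma ismt_G: "a \<in> G \<Longrightarrow> b \<in> G \<Longrightarrow> ismt (F \<union> G) a b (mt G a b)"
  using G FG_le by (auto simp: ismt_def le_mt_iff)
lemma isjn_G: assumes ab: "a \<in> G" "b \<in> G" shows "isjn (F \<union> G) a b (jn G a b)"
proof -
  have "jn G a b \<le> d" if d: "d \<in> F" "a \<le> d" "b \<le> d" for d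
    using GF_le[OF ab(1) d(1)] GF_le[OF ab(2) d(1)] d eG ab G by (simp add: jn_le_iff)
  then show ?thesis using G ab by (auto simp: isjn_def jn_le_iff)
qed
lemma ismt_F: assumes ab: "a \<in> F" "b \<in> F" shows "ismt (F \<union> G) a b (mt F a b)"
proof -
  have "d \<le> mt F a b" if d: "d \<in> G" "d \<le> a" "d \<le> b" for d
    using GF_le[OF d(1) ab(1)] GF_le[OF d(1) ab(2)] d eF ab F by (simp add: le_mt_iff)
  then show ?thesis using F ab by (auto simp: ismt_def le_mt_iff)
qed
lemma isjn_FG: "a \<in> F \<Longrightarrow> b \<in> G \<Longrightarrow> isjn (F \<union> G) a b b"
  using FG_le by (auto simp: isjn_def)
lemma ismt_FG: "a \<in> F \<Longrightarrow> b \<in> G \<Longrightarrow> ismt (F \<union> G) a b a"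
  using FG_le by (auto simp: ismt_def)

lemma lat': "lat (F \<union> G)"
proof (rule latI)
  fix s t assume st: "s \<in> F \<union> G" "t \<in> F \<union> G"
  have sy: "isjn (F \<union> G) s t c = isjn (F \<union> G) t s c"
    "ismt (F \<union> G) s t c = ismt (F \<union> G) t s c" for c
    by (auto simp: isjn_def ismt_def)
  show "\<exists>c. isjn (F \<union> G) s t c" using st isjn_F isjn_G isjn_FG sy by blast
  show "\<exists>c. ismt (F \<union> G) s t c" using st ismt_F ismt_G ismt_FG sy by blast
qed

lemma sublF: "subl F (F \<union> G)"
  by (rule sublI[OF F lat']) (auto intro: isjn_F ismt_F)
lemma sublG: "subl G (F \<union> G)"
  by (rule sublI[OF G lat']) (auto intro: isjn_G ismt_G)
lemma jn_FG: "a \<in> F \<Longrightarrow> b \<in> G \<Longrightarrow> jn (F \<union> G) a b = b"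
  by (rule jn_eqI[OF lat' _ _ isjn_FG]) auto
lemma mt_FG: "a \<in> F \<Longrightarrow> b \<in> G \<Longrightarrow> mt (F \<union> G) a b = a"
  by (rule mt_eqI[OF lat' _ _ ismt_FG]) auto

lemma cov_F: assumes "cov F a b" shows "cov (F \<union> G) a b"
proof -
  note i = cov_in[OF assms]
  have "c \<in> F" if "c \<in> G" "c < b" for c
    using Ge[OF that(1)] Fe[OF i(2)] that by (meson leD order_trans)
  then show ?thesis using assms unfolding cov_iff by blast
qed

lemma cov_G: assumes "cov G a b" shows "cov (F \<union> G) a b"
proof -
  note i = cov_in[OF assms]
  have "c \<in> G" if "c \<in> F" "a < c" for c
    using Fe[OF that(1)] Ge[OF i(1)] that by (meson leD order_trans)
  then show ?thesis using assms unfolding cov_iff by blast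
qed

lemma cov_cases: assumes "cov (F \<union> G) a b" obtains "cov F a b" | "cov G a b"
proof -
  have i: "a \<in> F \<union> G" "b \<in> F \<union> G" "a < b" using cov_in[OF assms] by auto
  have "(a \<in> F \<and> b \<in> F) \<or> (a \<in> G \<and> b \<in> G)"
  proof (rule ccontr)
    assume n: "\<not> ?thesis"
    have "a \<notin> G \<or> b \<notin> F" using i GF_le[of a b] by (auto simp: order_less_le)
    then have ab: "a \<in> F" "b \<in> G" using i n by auto
    then have "e = a \<or> e = b" using cov_between[OF assms, of e] eF Fe Ge by auto
    then show False using n ab eF eG by auto
  qed
  then show thesis using assms that unfolding cov_iff by blast
qed

lemma smod': assumes "smod F" "smod G" shows "smod (F \<union> G)"
proof (rule smodI)
  let ?K = "F \<union> G"
  fix a b c assume ab: "cov ?K a b" and c: "c \<in> ?K"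
  from ab show "jn ?K a c = jn ?K b c \<or> cov ?K (jn ?K a c) (jn ?K b c)"
  proof (cases rule: cov_cases)
    case 1
    note i = cov_in[OF 1]
    show ?thesis
    proof (cases "c \<in> F")
      case True then show ?thesis using smodD[OF assms(1) 1 True] i cov_F by (auto simp: subl_jn[OF sublF])
    next
      case False then show ?thesis using c i by (simp add: jn_FG)
    qed
  next
    case 2
    note i = cov_in[OF 2]
    show ?thesis
    proof (cases "c \<in> G")
      case True then show ?thesis using smodD[OF assms(2) 2 True] i cov_G by (auto simp: subl_jn[OF sublG])
    next
      case False then show ?thesis using c i ab by (simp add: jn_comm[of _ _ c] jn_FG)
    qed
  qed
qed

lemma con_FG_iff:
  assumes "con (F \<union> G) \<theta>" "s \<in> F" "t \<in> G" shows "(s, t) \<in> \<theta> \<longleftrightarrow> (s, e) \<in> \<theta> \<and> (e, t) \<in> \<theta>"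
proof
  assume t: "(s, t) \<in> \<theta>"
  show "(s, e) \<in> \<theta> \<and> (e, t) \<in> \<theta>"
    using con_between[OF lat' assms(1) t, of e] eF Fe Ge assms by simp
qed (use con_trans[OF assms(1)] in blast)

lemma con_inj:
  assumes c: "con (F \<union> G) \<theta>" "con (F \<union> G) \<theta>'"
    and e: "\<theta> \<inter> F \<times> F = \<theta>' \<inter> F \<times> F" "\<theta> \<inter> G \<times> G = \<theta>' \<inter> G \<times> G"
  shows "\<theta> = \<theta>'"
proof -
  have 1: "(s, t) \<in> \<theta> \<longleftrightarrow> (s, t) \<in> \<theta>'" if "s \<in> F" "t \<in> F" for s t using e that by blast
  have 2: "(s, t) \<in> \<theta> \<longleftrightarrow> (s, t) \<in> \<theta>'" if "s \<in> G" "t \<in> G" for s t using e that by blast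
  have 3: "(s, t) \<in> \<theta> \<longleftrightarrow> (s, t) \<in> \<theta>'" if "s \<in> F" "t \<in> G" for s t
    using con_FG_iff[OF c(1) that] con_FG_iff[OF c(2) that] 1[OF that(1) eF] 2[OF eG that(2)] by simp
  have "(s, t) \<in> \<theta> \<longleftrightarrow> (s, t) \<in> \<theta>'" if st: "s \<in> F \<union> G" "t \<in> F \<union> G" for s t
  proof -
    consider "s \<in> F" "t \<in> F" | "s \<in> G" "t \<in> G" | "s \<in> F" "t \<in> G" | "t \<in> F" "s \<in> G" using st by blast
    then show ?thesis
    proof cases
      case 4 then show ?thesis using 3[OF 4] con_sym[OF c(1)] con_sym[OF c(2)] by blast
    qed (use 1 2 3 in auto)
  qed
  then show ?thesis using con_sub[OF c(1)] con_sub[OF c(2)] by blast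
qed

text \<open>Sending all of \<open>G\<close> to \<open>e\<close>, or all of \<open>F\<close> to
  \<open>e\<close>, is a homomorphism onto \<open>F\<close>, respectively \<open>G\<close>. The
  intersection of the two pullbacks has the prescribed traces.\<close>

lemma con_extend:
  assumes a: "con F \<alpha>" and b: "con G \<beta>"
  shows "\<exists>\<theta>. con (F \<union> G) \<theta> \<and> \<theta> \<inter> F \<times> F = \<alpha> \<and> \<theta> \<inter> G \<times> G = \<beta>"
proof -
  let ?K = "F \<union> G"
  define f where "f = (\<lambda>t. if t \<in> F then t else e)"
  define g where "g = (\<lambda>t. if t \<in> G then t else e)"
  have fF: "f t = t" if "t \<in> F" for t using that by (simp add: f_def)
  have fG: "f t = e" if "t \<in> G" for t using that both by (auto simp: f_def)
  have gG: "g t = t" if "t \<in> G" for t using that by (simp add: g_def)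
  have gF: "g t = e" if "t \<in> F" for t using that both by (auto simp: g_def)
  have top: "jn F s e = e" "jn F e s = e" "mt F s e = s" "mt F e s = s" if "s \<in> F" for s
    using jn_absorb[OF F that eF] jn_absorb2[OF F eF that] mt_absorb[OF F that eF] mt_absorb2[OF F eF that] Fe[OF that] by auto
  have bot: "jn G s e = s" "jn G e s = s" "mt G s e = e" "mt G e s = e" if "s \<in> G" for s
    using jn_absorb2[OF G that eG] jn_absorb[OF G eG that] mt_absorb2[OF G that eG] mt_absorb[OF G eG that] Ge[OF that] by auto
  have hom: "f (jn ?K s t) = jn F (f s) (f t) \<and> f (mt ?K s t) = mt F (f s) (f t) \<and>
      g (jn ?K s t) = jn G (g s) (g t) \<and> g (mt ?K s t) = mt G (g s) (g t)"
    if st: "s \<in> ?K" "t \<in> ?K" for s t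
  proof -
    consider "s \<in> F" "t \<in> F" | "s \<in> G" "t \<in> G" | "s \<in> F" "t \<in> G" | "t \<in> F" "s \<in> G" using st by blast
    then show ?thesis
    proof cases
      case 1 then show ?thesis using F top[OF eF] bot[OF eG]
        by (simp add: subl_jn[OF sublF] subl_mt[OF sublF] fF gF)
    next
      case 2 then show ?thesis using G top[OF eF] bot[OF eG]
        by (simp add: subl_jn[OF sublG] subl_mt[OF sublG] fG gG)
    next
      case 3 then show ?thesis using top[OF 3(1)] bot[OF 3(2)] by (simp add: jn_FG mt_FG fF fG gF gG)
    next
      case 4 then show ?thesis using top[OF 4(1)] bot[OF 4(2)]
        by (simp add: jn_comm[of ?K s t] mt_comm[of ?K s t] jn_FG mt_FG fF fG gF gG)
    qed
  qed
  have fin: "f t \<in> F" "g t \<in> G" for t using eF eG by (auto simp: f_def g_def)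
  let ?A = "{(s, t). s \<in> ?K \<and> t \<in> ?K \<and> (f s, f t) \<in> \<alpha>}"
  let ?B = "{(s, t). s \<in> ?K \<and> t \<in> ?K \<and> (g s, g t) \<in> \<beta>}"
  have cA: "con ?K ?A"
    by (rule con_pullback[OF F lat' a]) (use fin hom F con_refl[OF a] in auto)
  have cB: "con ?K ?B"
    by (rule con_pullback[OF G lat' b]) (use fin hom G con_refl[OF b] in auto)
  have "con ?K (?A \<inter> ?B)"
  proof (rule conI)
    show "?A \<inter> ?B \<subseteq> ?K \<times> ?K" by blast
    show "(s, s) \<in> ?A \<inter> ?B" if "s \<in> ?K" for s using con_refl[OF cA that] con_refl[OF cB that] by (rule IntI)
    show "(t, s) \<in> ?A \<inter> ?B" if "(s, t) \<in> ?A \<inter> ?B" for s t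
      using con_sym[OF cA] con_sym[OF cB] that by (meson IntE IntI)
    show "(s, r) \<in> ?A \<inter> ?B" if "(s, t) \<in> ?A \<inter> ?B" "(t, r) \<in> ?A \<inter> ?B" for s t r
      using con_trans[OF cA, of s t r] con_trans[OF cB, of s t r] that by (meson IntE IntI)
    fix s t d assume st: "(s, t) \<in> ?A \<inter> ?B" and d: "d \<in> ?K"
    show "(jn ?K s d, jn ?K t d) \<in> ?A \<inter> ?B"
      using con_jn1[OF cA _ d] con_jn1[OF cB _ d] st by (meson IntE IntI)
    show "(mt ?K s d, mt ?K t d) \<in> ?A \<inter> ?B"
      using con_mt1[OF cA _ d] con_mt1[OF cB _ d] st by (meson IntE IntI)
  qed
  moreover have "(?A \<inter> ?B) \<inter> F \<times> F = \<alpha>"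
    using con_sub[OF a] con_refl[OF b eG] fF gF by auto
  moreover have "(?A \<inter> ?B) \<inter> G \<times> G = \<beta>"
    using con_sub[OF b] con_refl[OF a eF] fG gG by auto
  ultimately show ?thesis by blast
qed

end

declare split_paired_All [simp del] split_paired_Ex [simp del]

section \<open>Finite lattices in the plane\<close>

text \<open>After rotating the plane by 45 degrees the componentwise order points upwards, and \<open>lam True p q\<close>
  says that \<open>p\<close> lies to the left of \<open>q\<close>; the Boolean argument interchanges left and right.\<close>

definition co :: "bool \<Rightarrow> real \<times> real \<Rightarrow> real" where "co d p = (if d then fst p else snd p)"
definition lam :: "bool \<Rightarrow> real \<times> real \<Rightarrow> real \<times> real \<Rightarrow> bool" where
  "lam d p q \<longleftrightarrow> co d p < co d q \<and> co (\<not> d) q < co (\<not> d) p"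
definition lbd :: "bool \<Rightarrow> (real \<times> real) set \<Rightarrow> (real \<times> real) set" where
  "lbd d K = {x \<in> K. \<forall>y\<in>K. \<not> lam d y x}"
text \<open>Distinct coordinates put the points in general position: distinct comparable points
  differ strictly in both coordinates, and two incomparable points are always in the relation
  \<open>lam\<close> one way or the other.\<close>

definition plat :: "(real \<times> real) set \<Rightarrow> bool" where
  "plat K \<longleftrightarrow> lat K \<and> smod K \<and> finite K \<and> K \<noteq> {} \<and> inj_on fst K \<and> inj_on snd K"

lemma le_co: "p \<le> q \<longleftrightarrow> co d p \<le> co d q \<and> co (\<not> d) p \<le> co (\<not> d) q"
  by (auto simp: co_def less_eq_prod_def)

lemma co_inj: "plat K \<Longrightarrow> p \<in> K \<Longrightarrow> q \<in> K \<Longrightarrow> co d p = co d q \<Longrightarrow> p = q"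
  by (auto simp: plat_def co_def inj_on_def split: if_splits)

lemma less_co: "plat K \<Longrightarrow> p \<in> K \<Longrightarrow> q \<in> K \<Longrightarrow> p < q \<longleftrightarrow> co d p < co d q \<and> co (\<not> d) p < co (\<not> d) q"
  using co_inj[of K p q d] co_inj[of K p q "\<not> d"] le_co[of p q d] unfolding order_less_le
  by fastforce

lemma lam_mirror: "lam (\<not> d) p q \<longleftrightarrow> lam d q p" by (auto simp: lam_def)

lemma lam_cases:
  assumes "plat K" "p \<in> K" "q \<in> K" obtains "p \<le> q" | "q \<le> p" | "lam d p q" | "lam d q p"
  using le_co[of p q d] le_co[of q p d] unfolding lam_def by fastforce

lemma lam_not_le: "lam d p q \<Longrightarrow> \<not> p \<le> q" "lam d p q \<Longrightarrow> \<not> q \<le> p"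
  by (auto simp: lam_def le_co[of _ _ d])
lemma lam_trans: "lam d p q \<Longrightarrow> lam d q r \<Longrightarrow> lam d p r" by (auto simp: lam_def)
lemma lam_irrefl: "\<not> lam d p p" by (auto simp: lam_def)
lemma lam_le_right: "lam d p q \<Longrightarrow> q \<le> r \<Longrightarrow> \<not> p \<le> r \<Longrightarrow> lam d p r"
  by (auto simp: lam_def le_co[of _ _ d])
lemma lam_ge_right: "lam d p q \<Longrightarrow> r \<le> q \<Longrightarrow> \<not> r \<le> p \<Longrightarrow> lam d p r"
  by (auto simp: lam_def le_co[of _ _ d])
lemma lam_le_left: "lam d p q \<Longrightarrow> p \<le> r \<Longrightarrow> \<not> q \<le> r \<Longrightarrow> lam d r q"
  by (auto simp: lam_def le_co[of _ _ d])
text \<open>An element horizontally between two others has one coordinate below that of the left one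
  and the other below that of the right one. Planarity enters the later computations of joins in
  this form.\<close>

lemma lam_between_le: "lam d p q \<Longrightarrow> lam d q r \<Longrightarrow> p \<le> j \<Longrightarrow> r \<le> j \<Longrightarrow> q \<le> j"
  by (auto simp: lam_def le_co[of _ _ d])

lemma lbd_in: "x \<in> lbd d K \<Longrightarrow> x \<in> K" by (simp add: lbd_def)
lemma lbdD: "x \<in> lbd d K \<Longrightarrow> y \<in> K \<Longrightarrow> \<not> lam d y x" by (simp add: lbd_def)
lemma lbd_chain: "plat K \<Longrightarrow> x \<in> lbd d K \<Longrightarrow> y \<in> lbd d K \<Longrightarrow> x \<le> y \<or> y \<le> x"
proof -
  assume K: "plat K" and x: "x \<in> lbd d K" and y: "y \<in> lbd d K"
  show ?thesis
    by (rule lam_cases[OF K lbd_in[OF x] lbd_in[OF y]])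
      (use lbdD[OF x lbd_in[OF y]] lbdD[OF y lbd_in[OF x]] in auto)
qed

lemma real_gap_above: "finite S \<Longrightarrow> \<exists>s>a. \<forall>t\<in>S. a < t \<longrightarrow> s < (t::real)"
proof (induction S rule: finite_induct)
  case empty show ?case using gt_ex by auto
next
  case (insert u S)
  then obtain s where s: "s > a" "\<forall>t\<in>S. a < t \<longrightarrow> s < t" by blast
  show ?case
  proof (cases "a < u")
    case True
    then obtain r where "a < r" "r < min s u" using s(1) dense[of a "min s u"] by auto
    then show ?thesis using s by (intro exI[of _ r]) auto
  next
    case False then show ?thesis using s by auto
  qed
qed

lemma real_gap_below: "finite S \<Longrightarrow> \<exists>s<a. \<forall>t\<in>S. t < a \<longrightarrow> t < (s::real)"
proof -
  assume "finite S"
  then obtain s where "s > - a" "\<forall>t\<in>uminus ` S. - a < t \<longrightarrow> s < t"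
    using real_gap_above[of "uminus ` S" "- a"] by blast
  then show ?thesis by (intro exI[of _ "- s"]) force
qed

text \<open>In the orientation \<open>d\<close> the first coordinate of \<open>w\<close> is put just
  above that of \<open>x\<close> and the second just below that of \<open>z\<close>. As nothing lies
  beside \<open>x\<close> and \<open>z\<close> on the side \<open>d\<close>, only the elements below
  \<open>x\<close> get under \<open>w\<close>, and only those above \<open>z\<close> get over
  it.\<close>

lemma plane_gap:
  assumes K: "plat K" and x: "x \<in> lbd d K" and z: "z \<in> lbd d K" and xz: "x < z"
  obtains w where "w \<notin> K" "inj_on fst (insert w K)" "inj_on snd (insert w K)"
    "\<And>t. t \<in> K \<Longrightarrow> t \<le> w \<longleftrightarrow> t \<le> x" "\<And>t. t \<in> K \<Longrightarrow> w \<le> t \<longleftrightarrow> z \<le> t"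
    "lbd d (insert w K) = insert w (lbd d K - {t. x < t \<and> t < z})"
    "(\<exists>m\<in>K. x < m \<and> m < z) \<Longrightarrow> lbd (\<not> d) (insert w K) = lbd (\<not> d) K"
proof -
  have fin: "finite (co d ` K)" "finite (co (\<not> d) ` K)" using K by (auto simp: plat_def)
  note xK = lbd_in[OF x] and zK = lbd_in[OF z]
  obtain s where s: "s > co d x" "\<And>t. t \<in> K \<Longrightarrow> co d x < co d t \<Longrightarrow> s < co d t"
    using real_gap_above[OF fin(1), of "co d x"] by auto
  obtain r where r: "r < co (\<not> d) z" "\<And>t. t \<in> K \<Longrightarrow> co (\<not> d) t < co (\<not> d) z \<Longrightarrow> co (\<not> d) t < r"
    using real_gap_below[OF fin(2), of "co (\<not> d) z"] by auto
  define w where "w = (if d then (s, r) else (r, s))"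
  have w: "co d w = s" "co (\<not> d) w = r" by (auto simp: w_def co_def)
  have ne: "co d t \<noteq> s" "co (\<not> d) t \<noteq> r" if "t \<in> K" for t
    using s(1) s(2)[OF that] r(1) r(2)[OF that] by fastforce+
  have c1: "s \<le> co d t \<longleftrightarrow> co d x < co d t" "s < co d t \<longleftrightarrow> co d x < co d t"
    "co (\<not> d) t \<le> r \<longleftrightarrow> co (\<not> d) t < co (\<not> d) z" "co (\<not> d) t < r \<longleftrightarrow> co (\<not> d) t < co (\<not> d) z" if "t \<in> K" for t
    using s(1) s(2)[OF that] r(1) r(2)[OF that] by fastforce+
  have c2: "co d t \<le> s \<longleftrightarrow> co d t \<le> co d x" "co d t < s \<longleftrightarrow> co d t \<le> co d x"
    "r \<le> co (\<not> d) t \<longleftrightarrow> co (\<not> d) z \<le> co (\<not> d) t" "r < co (\<not> d) t \<longleftrightarrow> co (\<not> d) z \<le> co (\<not> d) t" if "t \<in> K" for t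
    using c1[OF that] by auto
  have xz': "co d x < co d z" "co (\<not> d) x < co (\<not> d) z" using less_co[OF K xK zK] xz by blast+
  have wK: "w \<notin> K" using ne w by blast
  have A: "t \<le> w \<longleftrightarrow> t \<le> x" if t: "t \<in> K" for t
  proof
    assume "t \<le> w"
    then have h: "co d t \<le> co d x" "co (\<not> d) t < co (\<not> d) z" using c1[OF t] c2[OF t] w le_co[of t w d] by auto
    show "t \<le> x"
    proof (rule ccontr)
      assume "\<not> t \<le> x"
      then have g: "co (\<not> d) x < co (\<not> d) t" using h le_co[of t x d] by auto
      then have "co d t \<noteq> co d x" using co_inj[OF K t xK] by blast
      then show False using lbdD[OF x t] g h by (auto simp: lam_def)
    qed
  next
    assume "t \<le> x" then show "t \<le> w" using c1[OF t] c2[OF t] w le_co[of t w d] le_co[of t x d] xz' by auto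
  qed
  have B: "w \<le> t \<longleftrightarrow> z \<le> t" if t: "t \<in> K" for t
  proof
    assume "w \<le> t"
    then have h: "co d x < co d t" "co (\<not> d) z \<le> co (\<not> d) t" using c1[OF t] c2[OF t] w le_co[of w t d] by auto
    show "z \<le> t"
    proof (rule ccontr)
      assume "\<not> z \<le> t"
      then have g: "co d t < co d z" using h le_co[of z t d] by auto
      then have "co (\<not> d) t \<noteq> co (\<not> d) z" using co_inj[OF K t zK] by blast
      then show False using lbdD[OF z t] g h by (auto simp: lam_def)
    qed
  next
    assume "z \<le> t" then show "w \<le> t" using c1[OF t] c2[OF t] w le_co[of w t d] le_co[of z t d] xz' by auto
  qed
  have tw: "\<not> lam d t w" if t: "t \<in> K" for t
  proof
    assume "lam d t w"
    then have h: "co d t \<le> co d x" "co (\<not> d) z \<le> co (\<not> d) t" using c2[OF t] w by (auto simp: lam_def)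
    then have "co d t \<noteq> co d x" using co_inj[OF K t xK, of d] xz' by auto
    then show False using h lbdD[OF x t] xz' by (auto simp: lam_def)
  qed
  have wt: "lam d w t \<longleftrightarrow> x < t \<and> t < z" if t: "t \<in> lbd d K" for t
  proof
    note tK = lbd_in[OF t]
    assume "lam d w t"
    then have h: "co d x < co d t" "co (\<not> d) t < co (\<not> d) z" using c1[OF tK] w by (auto simp: lam_def)
    have "co (\<not> d) x \<noteq> co (\<not> d) t" "co d z \<noteq> co d t"
      using co_inj[OF K xK tK, of "\<not> d"] co_inj[OF K zK tK, of d] h by auto
    then show "x < t \<and> t < z"
      using h lbdD[OF t xK] lbdD[OF t zK] less_co[OF K xK tK, of d] less_co[OF K tK zK, of d] by (auto simp: lam_def)
  next
    note tK = lbd_in[OF t]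
    assume "x < t \<and> t < z"
    then show "lam d w t" using less_co[OF K xK tK, of d] less_co[OF K tK zK, of d] c1[OF tK] w by (auto simp: lam_def)
  qed
  have mw: "lam d w m" if "m \<in> K" "x < m" "m < z" for m
    using less_co[OF K xK that(1), of d] less_co[OF K that(1) zK, of d] that c1[OF that(1)] w by (auto simp: lam_def)
  have inj: "inj_on fst (insert w K)" "inj_on snd (insert w K)"
  proof -
    have "fst w \<noteq> fst t \<and> snd w \<noteq> snd t" if "t \<in> K" for t
      using ne[OF that] w by (cases d) (auto simp: co_def)
    then show "inj_on fst (insert w K)" "inj_on snd (insert w K)" using K wK by (auto simp: plat_def)
  qed
  have l1: "lbd d (insert w K) = insert w (lbd d K - {t. x < t \<and> t < z})"
  proof (intro equalityI subsetI)
    fix t assume "t \<in> lbd d (insert w K)"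
    then show "t \<in> insert w (lbd d K - {t. x < t \<and> t < z})"
      using wt[of t] unfolding lbd_def by blast
  next
    fix t assume "t \<in> insert w (lbd d K - {t. x < t \<and> t < z})"
    then show "t \<in> lbd d (insert w K)" using wt[of t] tw lam_irrefl unfolding lbd_def by blast
  qed
  have l2: "lbd (\<not> d) (insert w K) = lbd (\<not> d) K" if "\<exists>m\<in>K. x < m \<and> m < z"
    using that mw tw unfolding lbd_def lam_mirror by blast
  show thesis by (rule that[OF wK inj A B l1 l2])
qed

type_synonym edge = "(real \<times> real) \<times> bool \<times> (real \<times> real)"

fun walk :: "edge list \<Rightarrow> real \<times> real \<Rightarrow> real \<times> real \<Rightarrow> bool" where
  "walk [] a b \<longleftrightarrow> a = b"
| "walk ((x, l, y) # es) a b \<longleftrightarrow> x = a \<and> walk es y b"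

definition verts :: "edge list \<Rightarrow> (real \<times> real) set" where
  "verts es = {v. (\<exists>l y. (v, l, y) \<in> set es) \<or> (\<exists>x l. (x, l, v) \<in> set es)}"

lemma verts_Nil [simp]: "verts [] = {}"
  and verts_Cons [simp]: "verts ((x, l, y) # es) = {x, y} \<union> verts es"
  and verts_append [simp]: "verts (es @ fs) = verts es \<union> verts fs"
  by (auto simp: verts_def)

lemma walk_append: "walk (es @ fs) a b \<longleftrightarrow> (\<exists>c. walk es a c \<and> walk fs c b)"
  by (induction es a b rule: walk.induct) auto

text \<open>The edges of a boundary chain carry labels: an edge labelled \<open>True\<close> (a lower edge) ends in an
  element with a unique lower cover, an edge labelled \<open>False\<close> (an upper edge) starts in an element
  with a unique upper cover.\<close>

definition side :: "bool \<Rightarrow> (real \<times> real) set \<Rightarrow> edge list \<Rightarrow> bool" where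
  "side d K es \<longleftrightarrow> es \<noteq> [] \<and> (\<exists>b t. b \<in> K \<and> t \<in> K \<and> (\<forall>s\<in>K. b \<le> s \<and> s \<le> t) \<and> walk es b t) \<and>
     lbd d K = verts es \<and> (\<forall>x l y. (x, l, y) \<in> set es \<longrightarrow> cov K x y) \<and>
     (\<forall>x y. (x, True, y) \<in> set es \<longrightarrow> (\<forall>t\<in>K. t < y \<longrightarrow> t \<le> x)) \<and>
     (\<forall>x y. (x, False, y) \<in> set es \<longrightarrow> (\<forall>t\<in>K. x < t \<longrightarrow> y \<le> t)) \<and>
     (\<forall>x y z. (x, True, y) \<in> set es \<and> (y, True, z) \<in> set es \<longrightarrow> (\<exists>t. t \<noteq> z \<and> cov K y t)) \<and>
     (\<forall>x y z. (x, False, y) \<in> set es \<and> (y, False, z) \<in> set es \<longrightarrow> (\<exists>t. t \<noteq> x \<and> cov K t y))"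

lemma sideD:
  assumes "side d K es"
  shows side_ne: "es \<noteq> []"
    and side_walk: "\<exists>b t. b \<in> K \<and> t \<in> K \<and> (\<forall>s\<in>K. b \<le> s \<and> s \<le> t) \<and> walk es b t"
    and side_lbd: "lbd d K = verts es"
    and side_cov: "(x, l, y) \<in> set es \<Longrightarrow> cov K x y"
    and side_lower: "(x, True, y) \<in> set es \<Longrightarrow> t \<in> K \<Longrightarrow> t < y \<Longrightarrow> t \<le> x"
    and side_upper: "(x, False, y) \<in> set es \<Longrightarrow> t \<in> K \<Longrightarrow> x < t \<Longrightarrow> y \<le> t"
    and side_TT: "(x, True, y) \<in> set es \<Longrightarrow> (y, True, z) \<in> set es \<Longrightarrow> \<exists>t. t \<noteq> z \<and> cov K y t"
    and side_FF: "(x, False, y) \<in> set es \<Longrightarrow> (y, False, z) \<in> set es \<Longrightarrow> \<exists>t. t \<noteq> x \<and> cov K t y"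
proof -
  note S = assms[unfolded side_def]
  show "es \<noteq> []" using S by (elim conjE)
  show "\<exists>b t. b \<in> K \<and> t \<in> K \<and> (\<forall>s\<in>K. b \<le> s \<and> s \<le> t) \<and> walk es b t" using S by (elim conjE)
  show "lbd d K = verts es" using S by (elim conjE)
  show "(x, l, y) \<in> set es \<Longrightarrow> cov K x y" using S by (elim conjE) simp
  show "(x, True, y) \<in> set es \<Longrightarrow> t \<in> K \<Longrightarrow> t < y \<Longrightarrow> t \<le> x" using S by (elim conjE) simp
  show "(x, False, y) \<in> set es \<Longrightarrow> t \<in> K \<Longrightarrow> x < t \<Longrightarrow> y \<le> t" using S by (elim conjE) simp
  have "\<forall>x y z. (x, True, y) \<in> set es \<and> (y, True, z) \<in> set es \<longrightarrow> (\<exists>t. t \<noteq> z \<and> cov K y t)"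
    using S by (elim conjE)
  then show "(x, True, y) \<in> set es \<Longrightarrow> (y, True, z) \<in> set es \<Longrightarrow> \<exists>t. t \<noteq> z \<and> cov K y t"
    by simp
  have "\<forall>x y z. (x, False, y) \<in> set es \<and> (y, False, z) \<in> set es \<longrightarrow> (\<exists>t. t \<noteq> x \<and> cov K t y)"
    using S by (elim conjE)
  then show "(x, False, y) \<in> set es \<Longrightarrow> (y, False, z) \<in> set es \<Longrightarrow> \<exists>t. t \<noteq> x \<and> cov K t y"
    by blast
qed

lemma sideI:
  assumes "es \<noteq> []" "\<exists>b t. b \<in> K \<and> t \<in> K \<and> (\<forall>s\<in>K. b \<le> s \<and> s \<le> t) \<and> walk es b t"
    and "lbd d K = verts es" and "\<And>x l y. (x, l, y) \<in> set es \<Longrightarrow> cov K x y"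
    and "\<And>x y t. (x, True, y) \<in> set es \<Longrightarrow> t \<in> K \<Longrightarrow> t < y \<Longrightarrow> t \<le> x"
    and "\<And>x y t. (x, False, y) \<in> set es \<Longrightarrow> t \<in> K \<Longrightarrow> x < t \<Longrightarrow> y \<le> t"
    and "\<And>x y z. (x, True, y) \<in> set es \<Longrightarrow> (y, True, z) \<in> set es \<Longrightarrow> \<exists>t. t \<noteq> z \<and> cov K y t"
    and "\<And>x y z. (x, False, y) \<in> set es \<Longrightarrow> (y, False, z) \<in> set es \<Longrightarrow> \<exists>t. t \<noteq> x \<and> cov K t y"
  shows "side d K es"
  unfolding side_def by (intro conjI allI impI ballI; (elim conjE)?) (fact assms | rule assms; assumption)+

lemma side_verts:
  assumes "side d K es" "(x, l, y) \<in> set es" shows "x \<in> lbd d K" "y \<in> lbd d K"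
  using assms(2) unfolding side_lbd[OF assms(1)] verts_def by blast+

lemma walk_bounds:
  assumes "walk es a b" "\<And>x l y. (x, l, y) \<in> set es \<Longrightarrow> x < y"
  shows "a \<le> b \<and> (\<forall>x l y. (x, l, y) \<in> set es \<longrightarrow> a \<le> x \<and> y \<le> b)"
  using assms
proof (induction es a b rule: walk.induct)
  case (2 x l y es a b)
  have h: "x = a" "walk es y b" "x < y" using 2(2) 2(3)[of x l y] by auto
  have IH: "y \<le> b \<and> (\<forall>x l y'. (x, l, y') \<in> set es \<longrightarrow> y \<le> x \<and> y' \<le> b)"
    using 2(1)[OF h(2)] 2(3) by (meson list.set_intros(2))
  have ay: "a \<le> y" using h by (simp add: less_imp_le)
  show ?case using IH ay h order_trans[OF ay] by fastforce
qed auto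

lemma side_split:
  assumes s: "side d K (es @ (x, l, y) # fs)" and ab: "(a, m, b) \<in> set es"
  shows "b \<le> x"
proof -
  obtain c t where "walk (es @ (x, l, y) # fs) c t" using side_walk[OF s] by blast
  then have "walk es c x" by (auto simp: walk_append)
  moreover have "a < b" if "(a, l, b) \<in> set es" for a l b using side_cov[OF s, of a l b] that by (auto simp: cov_iff)
  ultimately show ?thesis using walk_bounds ab by blast
qed

lemma side_split2:
  assumes s: "side d K (es @ (x, l, y) # fs)" and ab: "(a, m, b) \<in> set fs"
  shows "y \<le> a"
proof -
  obtain c t where "walk (es @ (x, l, y) # fs) c t" using side_walk[OF s] by blast
  then have "walk fs y t" by (auto simp: walk_append)
  moreover have "a < b" if "(a, l, b) \<in> set fs" for a l b using side_cov[OF s, of a l b] that by (auto simp: cov_iff)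
  ultimately show ?thesis using walk_bounds ab by blast
qed

text \<open>The new element has \<open>x\<close> as unique lower cover and \<open>z\<close> as
  unique upper cover, so its two edges are labelled lower and upper whatever the old labels were.
  The displaced \<open>y\<close> supplies the branches required at \<open>x\<close> and at
  \<open>z\<close>.\<close>

lemma side_ins:
  assumes ins: "insertion K x z w" and s: "side d K (es @ (x, l, y) # (y, l', z) # fs)"
    and lb: "lbd d (insert w K) = insert w (lbd d K - {t. x < t \<and> t < z})"
  shows "side d (insert w K) (es @ (x, True, w) # (w, False, z) # fs)"
proof -
  interpret insertion K x z w by (rule ins)
  let ?K = "insert w K" and ?P = "es @ (x, l, y) # (y, l', z) # fs" and ?P' = "es @ (x, True, w) # (w, False, z) # fs"
  have xy: "x < y" "y < z" "y \<in> K" using side_cov[OF s, of x l y] side_cov[OF s, of y l' z] by (auto simp: cov_iff)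
  have bel: "b \<le> x" if "(a, m, b) \<in> set es" for a m b using side_split[OF s that] .
  have abv: "z \<le> a" if "(a, m, b) \<in> set fs" for a m b
    using side_split2[of d K "es @ [(x, l, y)]" y l' z fs a m b] s that by simp
  have inc: "a < b" if "(a, m, b) \<in> set ?P" for a m b using side_cov[OF s that] by (auto simp: cov_iff)
  have mem: "e \<in> set ?P' \<longleftrightarrow> e \<in> set es \<or> e \<in> set fs \<or> e = (x, True, w) \<or> e = (w, False, z)" for e by auto
  have memP: "e \<in> set ?P" if "e \<in> set es \<or> e \<in> set fs" for e using that by auto
  have inK: "a \<in> K" "b \<in> K" if "(a, m, b) \<in> set ?P" for a m b using side_cov[OF s that] by (auto simp: cov_iff)
  have 1: "?P' \<noteq> []" by simp
  obtain b t where bt: "b \<in> K" "t \<in> K" "\<forall>s\<in>K. b \<le> s \<and> s \<le> t" "walk ?P b t" using side_walk[OF s] by blast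
  have "walk ?P' b t" using bt(4) by (auto simp: walk_append)
  moreover have "b \<le> w" "w \<le> t" using bt le_w[OF bt(1)] w_le[OF bt(2)] x z by auto
  ultimately have 2: "\<exists>b t. b \<in> ?K \<and> t \<in> ?K \<and> (\<forall>s\<in>?K. b \<le> s \<and> s \<le> t) \<and> walk ?P' b t" using bt by blast
  have 3: "lbd d ?K = verts ?P'"
  proof -
    \<comment> \<open>The edges before the pair end below \<open>x\<close> and those after it start
      above \<open>z\<close>, so \<open>y\<close> is the only boundary vertex that \<open>w\<close>
      displaces.\<close>
    have "verts ?P - {t. x < t \<and> t < z} = verts ?P - {y}"
    proof -
      have "v = y" if vP: "v \<in> verts ?P" and vx: "x < v" "v < z" for v
      proof -
        consider a m where "(v, m, a) \<in> set ?P" | a m where "(a, m, v) \<in> set ?P"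
          using vP unfolding verts_def by blast
        then show ?thesis
        proof cases
          case 1
          then have "(v, m, a) \<in> set es \<or> (v, m, a) \<in> set fs \<or> v = x \<or> v = y" by auto
          then show ?thesis using bel[of v m a] abv[of v m a] inc[OF 1] vx by (auto dest: order_less_le_trans)
        next
          case 2
          then have "(a, m, v) \<in> set es \<or> (a, m, v) \<in> set fs \<or> v = y \<or> v = z" by auto
          then show ?thesis using bel[of a m v] abv[of a m v] inc[OF 2] vx by (auto dest: order_less_le_trans)
        qed
      qed
      then show ?thesis using xy by blast
    qed
    moreover have "insert w (verts ?P - {y}) = verts ?P'"
    proof -
      have "(a, m, b) \<in> set es \<Longrightarrow> a \<noteq> y \<and> b \<noteq> y" "(a, m, b) \<in> set fs \<Longrightarrow> a \<noteq> y \<and> b \<noteq> y" for a m b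
        using bel[of a m b] abv[of a m b] inc[OF memP, of a m b] xy
        by (auto dest: order_less_le_trans order_le_less_trans)
      then have "y \<notin> verts es" "y \<notin> verts fs" unfolding verts_def by blast+
      then show ?thesis using xy by auto
    qed
    ultimately show ?thesis using lb side_lbd[OF s] by simp
  qed
  have 4: "cov ?K a b" if "(a, m, b) \<in> set ?P'" for a m b
    using that mem[of "(a, m, b)"] side_cov[OF s, of a m b] memP[of "(a, m, b)"] cov_old cov_xw cov_wz by blast
  have 5: "t \<le> a" if e: "(a, True, b) \<in> set ?P'" and t: "t \<in> ?K" "t < b" for a b t
  proof -
    consider "(a, True, b) \<in> set es" | "(a, True, b) \<in> set fs" | "a = x" "b = w" using e mem by blast
    then show ?thesis
    proof cases
      case 1
      have "t \<noteq> w" using bel[OF 1] t(2) x_less_w by (auto dest: order_less_le_trans)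
      then show ?thesis using side_lower[OF s memP, of a b t] 1 t by blast
    next
      case 2
      show ?thesis
      proof (cases "t = w")
        case True then show ?thesis using abv[OF 2] w_less_z by (meson less_imp_le order_trans)
      next
        case False then show ?thesis using side_lower[OF s memP, of a b t] 2 t by blast
      qed
    next
      case 3 then show ?thesis using t le_w[of t] by (auto simp: order_less_le)
    qed
  qed
  have 6: "b \<le> t" if e: "(a, False, b) \<in> set ?P'" and t: "t \<in> ?K" "a < t" for a b t
  proof -
    consider "(a, False, b) \<in> set es" | "(a, False, b) \<in> set fs" | "a = w" "b = z" using e mem by blast
    then show ?thesis
    proof cases
      case 2
      have "t \<noteq> w" using abv[OF 2] t(2) w_less_z by (auto dest: order_less_le_trans)
      then show ?thesis using side_upper[OF s memP, of a b t] 2 t by blast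
    next
      case 1
      show ?thesis
      proof (cases "t = w")
        case True then show ?thesis using bel[OF 1] x_less_w by (meson less_imp_le order_trans)
      next
        case False then show ?thesis using side_upper[OF s memP, of a b t] 1 t by blast
      qed
    next
      case 3 then show ?thesis using t w_le[of t] by (auto simp: order_less_le)
    qed
  qed
  have old: "a \<noteq> w" "b \<noteq> w" if "(a, m, b) \<in> set es \<or> (a, m, b) \<in> set fs" for a m b
    using inK[OF memP[OF that]] w by auto
  have 7: "\<exists>t. t \<noteq> c \<and> cov ?K b t" if e: "(a, True, b) \<in> set ?P'" "(b, True, c) \<in> set ?P'" for a b c
  proof (cases "(b, True, c) = (x, True, w)")
    case True then show ?thesis using cov_old[OF cov_x_mid[OF xy(3,1,2)]] xy w by auto
  next
    case False
    then have bc: "(b, True, c) \<in> set es \<or> (b, True, c) \<in> set fs" using e(2) mem by blast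
    then have "(a, True, b) \<in> set es \<or> (a, True, b) \<in> set fs" using e(1) mem old[OF bc] by blast
    then show ?thesis using side_TT[OF s memP memP[OF bc]] cov_old by blast
  qed
  have 8: "\<exists>t. t \<noteq> a \<and> cov ?K t b" if e: "(a, False, b) \<in> set ?P'" "(b, False, c) \<in> set ?P'" for a b c
  proof (cases "(a, False, b) = (w, False, z)")
    case True then show ?thesis using cov_old[OF cov_mid_z[OF xy(3,1,2)]] xy w by auto
  next
    case False
    then have ab: "(a, False, b) \<in> set es \<or> (a, False, b) \<in> set fs" using e(1) mem by blast
    then have "(b, False, c) \<in> set es \<or> (b, False, c) \<in> set fs" using e(2) mem old[OF ab] by blast
    then show ?thesis using side_FF[OF s memP[OF ab] memP] cov_old by blast
  qed
  show ?thesis by (rule sideI) (fact 1 2 3 4 5 6 7 8)+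
qed

text \<open>For the other side, \<open>w\<close> is only a further upper cover of \<open>x\<close>
  and a further lower cover of \<open>z\<close>. An upper edge starting at \<open>x\<close> or a
  lower edge ending at \<open>z\<close> would lose its label, which \<open>nx\<close> and
  \<open>nz\<close> exclude.\<close>

lemma side_other:
  assumes ins: "insertion K x z w" and s: "side d K Q" and lb: "lbd d (insert w K) = lbd d K"
    and nx: "\<And>b. (x, False, b) \<notin> set Q" and nz: "\<And>a. (a, True, z) \<notin> set Q"
  shows "side d (insert w K) Q"
proof -
  interpret insertion K x z w by (rule ins)
  let ?K = "insert w K"
  obtain b t where bt: "b \<in> K" "t \<in> K" "\<forall>s\<in>K. b \<le> s \<and> s \<le> t" "walk Q b t" using side_walk[OF s] by blast
  moreover have "b \<le> w" "w \<le> t" using bt le_w[OF bt(1)] w_le[OF bt(2)] x z by auto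
  ultimately have 2: "\<exists>b t. b \<in> ?K \<and> t \<in> ?K \<and> (\<forall>s\<in>?K. b \<le> s \<and> s \<le> t) \<and> walk Q b t" using bt by blast
  have 3: "lbd d ?K = verts Q" using lb side_lbd[OF s] by simp
  have 4: "cov ?K a b" if "(a, m, b) \<in> set Q" for a m b using cov_old side_cov[OF s that] by blast
  have inK: "a \<in> K" "b \<in> K" if "(a, m, b) \<in> set Q" for a m b using side_cov[OF s that] by (auto simp: cov_iff)
  have 5: "t \<le> a" if e: "(a, True, b) \<in> set Q" and t: "t \<in> ?K" "t < b" for a b t
  proof (cases "t = w")
    case True
    then have "z < b" using t(2) w_le[of b] inK[OF e] nz[of a] e by (auto simp: order_less_le)
    then show ?thesis using side_lower[OF s e z] True w_less_z by (meson less_imp_le order_trans)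
  next
    case False then show ?thesis using side_lower[OF s e] t by blast
  qed
  have 6: "b \<le> t" if e: "(a, False, b) \<in> set Q" and t: "t \<in> ?K" "a < t" for a b t
  proof (cases "t = w")
    case True
    then have "a < x" using t(2) le_w[of a] inK[OF e] nx[of b] e by (auto simp: order_less_le)
    then show ?thesis using side_upper[OF s e x] True x_less_w by (meson less_imp_le order_trans)
  next
    case False then show ?thesis using side_upper[OF s e] t by blast
  qed
  have 7: "\<exists>t. t \<noteq> c \<and> cov ?K b t" if e: "(a, True, b) \<in> set Q" "(b, True, c) \<in> set Q" for a b c
    using side_TT[OF s e] cov_old by blast
  have 8: "\<exists>t. t \<noteq> a \<and> cov ?K t b" if e: "(a, False, b) \<in> set Q" "(b, False, c) \<in> set Q" for a b c
    using side_FF[OF s e] cov_old by blast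
  show ?thesis by (rule sideI) (fact side_ne[OF s] 2 3 4 5 6 7 8)+
qed

section \<open>Filling in corners\<close>

text \<open>Prevents an insertion at one side from spoiling a label at the other. At the end it also
  makes the corners complementary: a join other than the top would start an upper edge on both
  sides, and a meet other than the bottom would end a lower edge on both.\<close>

definition compat :: "edge list \<Rightarrow> edge list \<Rightarrow> bool" where
  "compat P Q \<longleftrightarrow> (\<forall>x y y'. (x, False, y) \<in> set P \<longrightarrow> (x, False, y') \<notin> set Q) \<and>
     (\<forall>x x' y. (x, True, y) \<in> set P \<longrightarrow> (x', True, y) \<notin> set Q)"

text \<open>The argument \<open>d\<close> tells on which side of the plane \<open>P\<close> runs, so
  that statements about one side serve for both by \<open>state_sym\<close>.\<close>

definition state :: "bool \<Rightarrow> (real \<times> real) set \<Rightarrow> edge list \<Rightarrow> edge list \<Rightarrow> bool" where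
  "state d K P Q \<longleftrightarrow> plat K \<and> side d K P \<and> side (\<not> d) K Q \<and> compat P Q"

lemma stateD:
  assumes "state d K P Q"
  shows state_plat: "plat K" and state_side: "side d K P" and state_side2: "side (\<not> d) K Q"
    and state_compat: "compat P Q"
  using assms by (auto simp: state_def)

lemma state_lat: "state d K P Q \<Longrightarrow> lat K" by (simp add: state_def plat_def)

lemma compat_sym: "compat P Q \<Longrightarrow> compat Q P" unfolding compat_def by blast

lemma state_sym: "state d K P Q \<Longrightarrow> state (\<not> d) K Q P"
  by (simp add: state_def compat_sym)

lemma compatF: "compat P Q \<Longrightarrow> (x, False, y) \<in> set P \<Longrightarrow> (x, False, y') \<notin> set Q"
  and compatT: "compat P Q \<Longrightarrow> (x, True, y) \<in> set P \<Longrightarrow> (x', True, y) \<notin> set Q"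
  unfolding compat_def by blast+

text \<open>Up-sets compose along successive extensions, and their covering pairs remain covering
  pairs in the larger set. The first keeps \<open>G\<close> a filter, the second lets prime
  intervals be followed through the construction.\<close>

definition up :: "'a::order set \<Rightarrow> 'a set \<Rightarrow> bool" where
  "up D K \<longleftrightarrow> D \<subseteq> K \<and> (\<forall>s\<in>D. \<forall>t\<in>K. s \<le> t \<longrightarrow> t \<in> D)"
definition dn :: "'a::order set \<Rightarrow> 'a set \<Rightarrow> bool" where
  "dn D K \<longleftrightarrow> D \<subseteq> K \<and> (\<forall>s\<in>D. \<forall>t\<in>K. t \<le> s \<longrightarrow> t \<in> D)"

lemma upI: "D \<subseteq> K \<Longrightarrow> (\<And>s t. s \<in> D \<Longrightarrow> t \<in> K \<Longrightarrow> s \<le> t \<Longrightarrow> t \<in> D) \<Longrightarrow> up D K"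
  unfolding up_def by (intro conjI ballI impI) assumption+
lemma dnI: "D \<subseteq> K \<Longrightarrow> (\<And>s t. s \<in> D \<Longrightarrow> t \<in> K \<Longrightarrow> t \<le> s \<Longrightarrow> t \<in> D) \<Longrightarrow> dn D K"
  unfolding dn_def by (intro conjI ballI impI) assumption+

lemma upD: "up D K \<Longrightarrow> s \<in> D \<Longrightarrow> t \<in> K \<Longrightarrow> s \<le> t \<Longrightarrow> t \<in> D"
  unfolding up_def by (elim conjE) (drule (1) bspec, drule (1) bspec, erule (1) mp)
lemma dnD: "dn D K \<Longrightarrow> s \<in> D \<Longrightarrow> t \<in> K \<Longrightarrow> t \<le> s \<Longrightarrow> t \<in> D"
  unfolding dn_def by (elim conjE) (drule (1) bspec, drule (1) bspec, erule (1) mp)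
lemma up_sub: "up D K \<Longrightarrow> D \<subseteq> K" and dn_sub: "dn D K \<Longrightarrow> D \<subseteq> K"
  by (simp_all only: up_def dn_def)

lemma up_refl: "up K K" by (rule upI) auto
lemma up_trans: assumes "up D K" "up K K'" shows "up D K'"
proof (rule upI)
  show "D \<subseteq> K'" using up_sub[OF assms(1)] up_sub[OF assms(2)] by (rule subset_trans)
  fix s t assume st: "s \<in> D" "t \<in> K'" "s \<le> t"
  have "s \<in> K" using up_sub[OF assms(1)] st(1) ..
  then have "t \<in> K" using upD[OF assms(2) _ st(2,3)] by simp
  then show "t \<in> D" using upD[OF assms(1) st(1) _ st(3)] by simp
qed

lemma cov_up: assumes "up K K'" "cov K a b" shows "cov K' a b"
proof -
  have "t \<in> K" if "t \<in> K'" "a < t" for t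
    using upD[OF assms(1) cov_in(1)[OF assms(2)] that(1) less_imp_le[OF that(2)]] .
  then show ?thesis using assms(2) up_sub[OF assms(1)] unfolding cov_iff by blast
qed

text \<open>The coordinates of \<open>w\<close> come from \<open>plane_gap\<close>; the rest follows
  from the position of \<open>w\<close> in the order. No edge of \<open>Q\<close> touches
  \<open>w\<close>, so \<open>compat\<close> survives.\<close>

lemma insert_step:
  assumes st: "state d K (es @ (x, l, y) # (y, l', z) # fs) Q"
    and above: "\<And>t. t \<in> K \<Longrightarrow> x < t \<Longrightarrow> \<exists>m\<in>K. x < m \<and> m < z \<and> m \<le> t"
    and below: "\<And>t. t \<in> K \<Longrightarrow> t < z \<Longrightarrow> \<exists>m\<in>K. x < m \<and> m < z \<and> t \<le> m"
    and anti: "\<And>m m'. m \<in> K \<Longrightarrow> m' \<in> K \<Longrightarrow> x < m \<Longrightarrow> m < z \<Longrightarrow> x < m' \<Longrightarrow> m' < z \<Longrightarrow>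
      m \<le> m' \<Longrightarrow> m = m'"
    and nx: "\<And>b. (x, False, b) \<notin> set Q" and nz: "\<And>a. (a, True, z) \<notin> set Q"
  shows "\<exists>w. insertion K x z w \<and> state d (insert w K) (es @ (x, True, w) # (w, False, z) # fs) Q"
proof -
  note K = state_plat[OF st] and s = state_side[OF st] and s2 = state_side2[OF st] and cp = state_compat[OF st]
  let ?P = "es @ (x, l, y) # (y, l', z) # fs"
  have e: "(x, l, y) \<in> set ?P" "(y, l', z) \<in> set ?P" by auto
  have xy: "x < y" "y < z" "y \<in> K" "x \<in> K" "z \<in> K" using side_cov[OF s e(1)] side_cov[OF s e(2)] by (auto simp: cov_iff)
  have xz: "x < z" using xy(1,2) by (rule order_less_trans)
  obtain w where w: "w \<notin> K" "inj_on fst (insert w K)" "inj_on snd (insert w K)"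
    "\<And>t. t \<in> K \<Longrightarrow> t \<le> w \<longleftrightarrow> t \<le> x" "\<And>t. t \<in> K \<Longrightarrow> w \<le> t \<longleftrightarrow> z \<le> t"
    and lb: "lbd d (insert w K) = insert w (lbd d K - {t. x < t \<and> t < z})"
    "(\<exists>m\<in>K. x < m \<and> m < z) \<Longrightarrow> lbd (\<not> d) (insert w K) = lbd (\<not> d) K"
    using plane_gap[OF K side_verts(1)[OF s e(1)] side_verts(2)[OF s e(2)] xz] by blast
  have mid: "\<exists>m\<in>K. x < m \<and> m < z" using xy by blast
  have ins: "insertion K x z w"
    by (rule insertion.intro) (fact state_lat[OF st] xy w mid above below anti)+
  interpret I: insertion K x z w by (rule ins)
  have "plat (insert w K)" using K w I.lat' I.smod' unfolding plat_def by blast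
  moreover have "side d (insert w K) (es @ (x, True, w) # (w, False, z) # fs)" by (rule side_ins[OF ins s lb(1)])
  moreover have "side (\<not> d) (insert w K) Q" by (rule side_other[OF ins s2 lb(2)[OF mid] nx nz])
  moreover have "compat (es @ (x, True, w) # (w, False, z) # fs) Q"
  proof -
    have "(w, m, b) \<notin> set Q" "(b, m, w) \<notin> set Q" for m b
      using side_cov[OF s2, of w m b] side_cov[OF s2, of b m w] w(1) by (auto simp: cov_iff)
    then show ?thesis using cp unfolding compat_def by auto
  qed
  ultimately show ?thesis using ins unfolding state_def by blast
qed

text \<open>The two labels leave \<open>y\<close> as the only element of \<open>K\<close> strictly
  between \<open>x\<close> and \<open>z\<close>. Hence \<open>mixed\<close> is void, and completing
  the cell preserves all congruences.\<close>

lemma corner: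
  assumes st: "state d K (es @ (x, False, y) # (y, True, z) # fs) Q"
  shows "\<exists>w. insertion K x z w \<and> state d (insert w K) (es @ (x, True, w) # (w, False, z) # fs) Q \<and>
     cext K (insert w K) (\<lambda>_. True) \<and> x < y \<and> y < z \<and> y \<in> K \<and>
     (\<forall>t\<in>K. x < t \<longrightarrow> y \<le> t) \<and> (\<forall>t\<in>K. t < z \<longrightarrow> t \<le> y)"
proof -
  note s = state_side[OF st]
  let ?P = "es @ (x, False, y) # (y, True, z) # fs"
  have e: "(x, False, y) \<in> set ?P" "(y, True, z) \<in> set ?P" by auto
  have xy: "x < y" "y < z" "y \<in> K" using side_cov[OF s e(1)] side_cov[OF s e(2)] by (auto simp: cov_iff)
  have A: "y \<le> t" if "t \<in> K" "x < t" for t using side_upper[OF s e(1) that] .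
  have B: "t \<le> y" if "t \<in> K" "t < z" for t using side_lower[OF s e(2) that] .
  have mid: "m = y" if "m \<in> K" "x < m" "m < z" for m using A[OF that(1,2)] B[OF that(1,3)] by (rule order_antisym[rotated])
  have "\<exists>w. insertion K x z w \<and> state d (insert w K) (es @ (x, True, w) # (w, False, z) # fs) Q"
  proof (rule insert_step[OF st])
    show "\<exists>m\<in>K. x < m \<and> m < z \<and> m \<le> t" if "t \<in> K" "x < t" for t
      using A[OF that] xy by (intro bexI[of _ y] conjI)
    show "\<exists>m\<in>K. x < m \<and> m < z \<and> t \<le> m" if "t \<in> K" "t < z" for t
      using B[OF that] xy by (intro bexI[of _ y] conjI)
    show "m = m'" if "m \<in> K" "m' \<in> K" "x < m" "m < z" "x < m'" "m' < z" "m \<le> m'" for m m'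
      using mid[OF that(1,3,4)] mid[OF that(2,5,6)] by simp
  qed (rule compatF[OF state_compat[OF st] e(1)], rule compatT[OF state_compat[OF st] e(2)])
  then obtain w where w: "insertion K x z w" "state d (insert w K) (es @ (x, True, w) # (w, False, z) # fs) Q"
    by blast
  have "cext K (insert w K) (\<lambda>_. True)"
    using insertion.cext'[OF w(1)] by (rule cext_cong) (simp add: insertion.mixed_def[OF w(1)], use mid in metis)
  then show ?thesis using w A B xy by (intro exI[of _ w] conjI ballI impI)
qed

text \<open>Filling in the corner turns upper-lower into lower-upper, and the upper edge reappears
  as an edge perspective to \<open>(x, y)\<close>. If \<open>e\<close> holds, one more element is
  put into the same interval, and the resulting diamond ties \<open>(x, y)\<close> to
  \<open>(y, z)\<close>.\<close>

lemma swap_edges: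
  assumes st: "state d K (es @ (x, False, y) # (y, True, z) # fs) Q"
  shows "\<exists>K' w. state d K' (es @ (x, True, w) # (w, False, z) # fs) Q \<and> w \<in> K' - K \<and>
     cext K K' (\<lambda>\<theta>. e \<longrightarrow> ((x, y) \<in> \<theta> \<longleftrightarrow> (y, z) \<in> \<theta>)) \<and>
     (\<forall>\<theta>. con K' \<theta> \<longrightarrow> ((w, z) \<in> \<theta> \<longleftrightarrow> (x, y) \<in> \<theta>)) \<and>
     (\<forall>t\<in>K' - K. \<forall>s\<in>K. (s \<le> t \<longleftrightarrow> s \<le> x) \<and> (t \<le> s \<longleftrightarrow> z \<le> s))"
proof -
  obtain w where ins: "insertion K x z w" and st1: "state d (insert w K) (es @ (x, True, w) # (w, False, z) # fs) Q"
    and ce: "cext K (insert w K) (\<lambda>_. True)" and xy: "x < y" "y < z" "y \<in> K"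
    and A: "\<And>t. t \<in> K \<Longrightarrow> x < t \<Longrightarrow> y \<le> t" and B: "\<And>t. t \<in> K \<Longrightarrow> t < z \<Longrightarrow> t \<le> y"
    using corner[OF st] by blast
  interpret insertion K x z w by (rule ins)
  have ord: "(s \<le> w \<longleftrightarrow> s \<le> x) \<and> (w \<le> s \<longleftrightarrow> z \<le> s)" if "s \<in> K" for s using le_w[OF that] w_le[OF that] by blast
  show ?thesis
  proof (cases e)
    case False
    have "cext K (insert w K) (\<lambda>\<theta>. e \<longrightarrow> ((x, y) \<in> \<theta> \<longleftrightarrow> (y, z) \<in> \<theta>))"
      using ce by (rule cext_cong) (simp add: False)
    then show ?thesis using st1 con_xw[OF _ xy(3,1,2)] ord w by (intro exI[of _ "insert w K"] exI[of _ w]) auto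
  next
    case True
    let ?K = "insert w K"
    let ?P = "es @ (x, False, y) # (y, True, z) # fs"
    have e: "(x, False, y) \<in> set ?P" "(y, True, z) \<in> set ?P" by auto
    have yw: "\<not> y \<le> w" "\<not> w \<le> y" using ord[OF xy(3)] xy by auto
    have mids: "t = w \<or> t = y" if "t \<in> ?K" "x < t" "t < z" for t
      using that A[of t] B[of t] order_antisym[of y t] by blast
    have "\<exists>v. insertion ?K x z v \<and> state d (insert v ?K) (es @ (x, True, v) # (v, False, z) # fs) Q"
    proof (rule insert_step[OF st1])
      show "\<exists>m\<in>?K. x < m \<and> m < z \<and> m \<le> t" if "t \<in> ?K" "x < t" for t
        using that A[of t] xy x_less_w w_less_z by (cases "t = w") auto
      show "\<exists>m\<in>?K. x < m \<and> m < z \<and> t \<le> m" if "t \<in> ?K" "t < z" for t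
        using that B[of t] xy x_less_w w_less_z by (cases "t = w") auto
      show "m = m'" if "m \<in> ?K" "m' \<in> ?K" "x < m" "m < z" "x < m'" "m' < z" "m \<le> m'" for m m'
        using mids[OF that(1,3,4)] mids[OF that(2,5,6)] yw that(7) by blast
      show "(x, False, b) \<notin> set Q" for b using compatF[OF state_compat[OF st] e(1)] .
      show "(a, True, z) \<notin> set Q" for a using compatT[OF state_compat[OF st] e(2)] .
    qed
    then obtain v where insv: "insertion ?K x z v" and st2: "state d (insert v ?K) (es @ (x, True, v) # (v, False, z) # fs) Q"
      by blast
    interpret V: insertion ?K x z v by (rule insv)
    \<comment> \<open>In the cell the edges at \<open>w\<close> repeat those at \<open>y\<close>
      crosswise. Treating \<open>w\<close> and \<open>y\<close> alike therefore means collapsing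
      both edges of the corner or neither.\<close>
    have mx: "V.mixed \<theta> \<longleftrightarrow> ((x, y) \<in> \<theta> \<longleftrightarrow> (y, z) \<in> \<theta>)" if "con ?K \<theta>" for \<theta>
    proof -
      have c: "(x, w) \<in> \<theta> \<longleftrightarrow> (y, z) \<in> \<theta>" "(w, z) \<in> \<theta> \<longleftrightarrow> (x, y) \<in> \<theta>" using con_xw[OF that xy(3,1,2)] .
      have "V.mixed \<theta> \<longleftrightarrow> (\<forall>m\<in>{w, y}. \<forall>m'\<in>{w, y}. ((m, z) \<in> \<theta> \<longrightarrow> (m', z) \<in> \<theta>) \<and> ((x, m) \<in> \<theta> \<longrightarrow> (x, m') \<in> \<theta>))"
        unfolding V.mixed_def using mids xy x_less_w w_less_z by blast
      then show ?thesis using c by auto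
    qed
    have "cext ?K (insert v ?K) (\<lambda>\<theta>. (x, y) \<in> \<theta> \<longleftrightarrow> (y, z) \<in> \<theta>)" using V.cext' by (rule cext_cong) (rule mx)
    from cext_trans[OF ce this, of "\<lambda>\<theta>. (x, y) \<in> \<theta> \<longleftrightarrow> (y, z) \<in> \<theta>"]
    have "cext K (insert v ?K) (\<lambda>\<theta>. True \<and> ((x, y) \<in> \<theta> \<longleftrightarrow> (y, z) \<in> \<theta>))" using xy x z by simp
    then have "cext K (insert v ?K) (\<lambda>\<theta>. e \<longrightarrow> ((x, y) \<in> \<theta> \<longleftrightarrow> (y, z) \<in> \<theta>))" by (rule cext_cong) (simp add: True)
    moreover have "\<forall>\<theta>. con (insert v ?K) \<theta> \<longrightarrow> ((v, z) \<in> \<theta> \<longleftrightarrow> (x, y) \<in> \<theta>)"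
      using V.con_xw(2)[of _ y] xy by blast
    moreover have "\<forall>t\<in>insert v ?K - K. \<forall>s\<in>K. (s \<le> t \<longleftrightarrow> s \<le> x) \<and> (t \<le> s \<longleftrightarrow> z \<le> s)"
      using ord V.le_w V.w_le by auto
    moreover have "v \<in> insert v ?K - K" using V.w by blast
    ultimately show ?thesis using st2 by blast
  qed
qed

text \<open>A new element lies above a member of \<open>D\<close> only if \<open>x\<close> does, and
  then \<open>x\<close> would belong to \<open>D\<close>.\<close>

lemma up_extend:
  assumes "up D K" "x \<notin> D" "x \<in> K" "K \<subseteq> K'" "\<forall>t\<in>K' - K. \<forall>s\<in>K. (s \<le> t \<longleftrightarrow> s \<le> x)" shows "up D K'"
proof (rule upI)
  show "D \<subseteq> K'" using up_sub[OF assms(1)] assms(4) by (rule subset_trans)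
  fix s t assume st: "s \<in> D" "t \<in> K'" "s \<le> t"
  show "t \<in> D"
  proof (cases "t \<in> K")
    case True then show ?thesis using upD[OF assms(1) st(1) _ st(3)] by simp
  next
    case False
    then have "s \<le> x" using assms(5) st up_sub[OF assms(1)] by auto
    then show ?thesis using upD[OF assms(1) st(1) assms(3)] assms(2) by simp
  qed
qed

lemma dn_extend:
  assumes "dn D K" "z \<notin> D" "z \<in> K" "K \<subseteq> K'" "\<forall>t\<in>K' - K. \<forall>s\<in>K. (t \<le> s \<longleftrightarrow> z \<le> s)" shows "dn D K'"
proof (rule dnI)
  show "D \<subseteq> K'" using dn_sub[OF assms(1)] assms(4) by (rule subset_trans)
  fix s t assume st: "s \<in> D" "t \<in> K'" "t \<le> s"
  show "t \<in> D"
  proof (cases "t \<in> K")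
    case True then show ?thesis using dnD[OF assms(1) st(1) _ st(3)] by simp
  next
    case False
    then have "z \<le> s" using assms(5) st dn_sub[OF assms(1)] by auto
    then show ?thesis using dnD[OF assms(1) st(1) assms(3)] assms(2) by simp
  qed
qed

text \<open>The upper edge climbs past the lower edges of \<open>as\<close> one swap at a time,
  always remaining perspective to \<open>(x, y)\<close>. So each swap selected by \<open>S\<close>
  ties its edge to \<open>(x, y)\<close> itself, and the conditions combine.\<close>

lemma move_edge:
  assumes "state d K (es @ (x, False, y) # as @ fs) Q" "\<forall>a l b. (a, l, b) \<in> set as \<longrightarrow> l"
  shows "\<exists>K' as' x' y'. state d K' (es @ as' @ (x', False, y') # fs) Q \<and> length as' = length as \<and>
     (\<forall>a l b. (a, l, b) \<in> set as' \<longrightarrow> l \<and> b \<notin> K) \<and>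
     cext K K' (\<lambda>\<theta>. \<forall>a l b. (a, l, b) \<in> set as \<inter> S \<longrightarrow> ((x, y) \<in> \<theta> \<longleftrightarrow> (a, b) \<in> \<theta>)) \<and>
     (\<forall>D. up D K \<and> x \<notin> D \<longrightarrow> up D K') \<and>
     (\<forall>D. dn D K \<and> (\<forall>a l b. (a, l, b) \<in> set as \<longrightarrow> b \<notin> D) \<longrightarrow> dn D K')"
  using assms
proof (induction as arbitrary: K es x y)
  case Nil
  have "cext K K (\<lambda>\<theta>. \<forall>a l b. (a, l, b) \<in> set [] \<inter> S \<longrightarrow> ((x, y) \<in> \<theta> \<longleftrightarrow> (a, b) \<in> \<theta>))"
    by (rule cext_cong[OF cext_refl[OF state_lat[OF Nil(1)]]]) simp
  then show ?case using Nil by (intro exI[of _ K] exI[of _ "[]"] exI[of _ x] exI[of _ y]) auto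
next
  case (Cons e as)
  obtain y0 l z where e: "e = (y0, l, z)" by (cases e)
  have l: "l = True" using Cons(3)[rule_format, of y0 l z] e by simp
  note st = Cons(2)
  obtain c t where "walk (es @ (x, False, y) # (e # as) @ fs) c t" using side_walk[OF state_side[OF st]] by blast
  then have y0: "y0 = y" by (auto simp: walk_append e)
  have ee: "e = (y, True, z)" using e l y0 by simp
  have st': "state d K (es @ (x, False, y) # (y, True, z) # (as @ fs)) Q" using st ee by simp
  have xyK: "x \<in> K" "y \<in> K" "z \<in> K"
    using side_cov[OF state_side[OF st'], of x False y] side_cov[OF state_side[OF st'], of y True z] by (auto simp: cov_iff)
  obtain K1 w where K1: "state d K1 (es @ (x, True, w) # (w, False, z) # (as @ fs)) Q" "w \<in> K1 - K"
    "cext K K1 (\<lambda>\<theta>. (y, True, z) \<in> S \<longrightarrow> ((x, y) \<in> \<theta> \<longleftrightarrow> (y, z) \<in> \<theta>))"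
    "\<forall>\<theta>. con K1 \<theta> \<longrightarrow> ((w, z) \<in> \<theta> \<longleftrightarrow> (x, y) \<in> \<theta>)"
    "\<forall>t\<in>K1 - K. \<forall>s\<in>K. (s \<le> t \<longleftrightarrow> s \<le> x) \<and> (t \<le> s \<longleftrightarrow> z \<le> s)"
    using swap_edges[OF st', of "(y, True, z) \<in> S"] by blast
  have KK1: "K \<subseteq> K1" using subl_sub[OF cext_subl[OF K1(3)]] .
  have st1: "state d K1 ((es @ [(x, True, w)]) @ (w, False, z) # as @ fs) Q" using K1(1) by simp
  have lab: "\<forall>a l b. (a, l, b) \<in> set as \<longrightarrow> l" using Cons(3) by (metis list.set_intros(2))
  from Cons(1)[OF st1 lab] obtain K' as' x' y' where
    IH: "state d K' ((es @ [(x, True, w)]) @ as' @ (x', False, y') # fs) Q" "length as' = length as"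
     "\<forall>a l b. (a, l, b) \<in> set as' \<longrightarrow> l \<and> b \<notin> K1"
     "cext K1 K' (\<lambda>\<theta>. \<forall>a l b. (a, l, b) \<in> set as \<inter> S \<longrightarrow> ((w, z) \<in> \<theta> \<longleftrightarrow> (a, b) \<in> \<theta>))"
     "\<forall>D. up D K1 \<and> w \<notin> D \<longrightarrow> up D K'"
     "\<forall>D. dn D K1 \<and> (\<forall>a l b. (a, l, b) \<in> set as \<longrightarrow> b \<notin> D) \<longrightarrow> dn D K'" by blast
  have asK: "a \<in> K" "b \<in> K" if "(a, m, b) \<in> set as" for a m b
    using side_cov[OF state_side[OF st'], of a m b] that by (auto simp: cov_iff)
  have "cext K K' (\<lambda>\<theta>. ((y, True, z) \<in> S \<longrightarrow> ((x, y) \<in> \<theta> \<longleftrightarrow> (y, z) \<in> \<theta>)) \<and>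
     (\<forall>a l b. (a, l, b) \<in> set as \<inter> S \<longrightarrow> ((x, y) \<in> \<theta> \<longleftrightarrow> (a, b) \<in> \<theta>)))"
  proof (rule cext_trans[OF K1(3) IH(4)])
    fix \<theta> assume th: "con K1 \<theta>"
    have "(w, z) \<in> \<theta> \<longleftrightarrow> (x, y) \<in> \<theta> \<inter> K \<times> K" using K1(4) th xyK by blast
    moreover have "(a, b) \<in> \<theta> \<longleftrightarrow> (a, b) \<in> \<theta> \<inter> K \<times> K" if "(a, l, b) \<in> set as \<inter> S" for a l b using asK that by blast
    ultimately show "(\<forall>a l b. (a, l, b) \<in> set as \<inter> S \<longrightarrow> ((w, z) \<in> \<theta> \<longleftrightarrow> (a, b) \<in> \<theta>)) \<longleftrightarrow>
      (\<forall>a l b. (a, l, b) \<in> set as \<inter> S \<longrightarrow> ((x, y) \<in> \<theta> \<inter> K \<times> K \<longleftrightarrow> (a, b) \<in> \<theta> \<inter> K \<times> K))" by metis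
  qed
  then have "cext K K' (\<lambda>\<theta>. \<forall>a l b. (a, l, b) \<in> set (e # as) \<inter> S \<longrightarrow> ((x, y) \<in> \<theta> \<longleftrightarrow> (a, b) \<in> \<theta>))"
    by (rule cext_cong) (auto simp: ee)
  moreover have "state d K' (es @ ((x, True, w) # as') @ (x', False, y') # fs) Q" using IH(1) by simp
  moreover have "length ((x, True, w) # as') = length (e # as)" using IH(2) by simp
  moreover have "\<forall>a l b. (a, l, b) \<in> set ((x, True, w) # as') \<longrightarrow> l \<and> b \<notin> K" using IH(3) K1(2) KK1 by auto
  moreover have "\<forall>D. up D K \<and> x \<notin> D \<longrightarrow> up D K'"
  proof (intro allI impI)
    fix D assume D: "up D K \<and> x \<notin> D"
    then have "up D K1" using up_extend[OF _ _ xyK(1) KK1] K1(5) by blast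
    moreover have "w \<notin> D" using D K1(2) up_sub[of D K] by blast
    ultimately show "up D K'" using IH(5) by blast
  qed
  moreover have "\<forall>D. dn D K \<and> (\<forall>a l b. (a, l, b) \<in> set (e # as) \<longrightarrow> b \<notin> D) \<longrightarrow> dn D K'"
  proof (intro allI impI)
    fix D assume D: "dn D K \<and> (\<forall>a l b. (a, l, b) \<in> set (e # as) \<longrightarrow> b \<notin> D)"
    then have "z \<notin> D" using ee by auto
    then have "dn D K1" using dn_extend[OF _ _ xyK(3) KK1] K1(5) D by blast
    moreover have "\<forall>a l b. (a, l, b) \<in> set as \<longrightarrow> b \<notin> D" using D by auto
    ultimately show "dn D K'" using IH(6) by blast
  qed
  ultimately show ?case by blast
qed

text \<open>Sorting by swaps: the upper edges of \<open>us\<close> are moved past \<open>bs\<close>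
  one after another, the last first. The set of marked edges is empty, so no congruence is
  lost.\<close>

lemma fill_side:
  assumes "state d K (as @ us @ bs @ fs) Q" "\<forall>a l b. (a, l, b) \<in> set us \<longrightarrow> \<not> l" "\<forall>a l b. (a, l, b) \<in> set bs \<longrightarrow> l"
  shows "\<exists>K' bs' us'. state d K' (as @ bs' @ us' @ fs) Q \<and> (\<forall>a l b. (a, l, b) \<in> set us' \<longrightarrow> \<not> l) \<and>
     (\<forall>a l b. (a, l, b) \<in> set bs' \<longrightarrow> l) \<and> cext K K' (\<lambda>_. True) \<and>
     (\<forall>D. up D K \<and> (\<forall>a l b. (a, l, b) \<in> set us \<longrightarrow> a \<notin> D) \<longrightarrow> up D K') \<and>
     (\<forall>D. dn D K \<and> (\<forall>a l b. (a, l, b) \<in> set bs \<longrightarrow> b \<notin> D) \<longrightarrow> dn D K')"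
  using assms
proof (induction us arbitrary: K bs fs rule: rev_induct)
  case Nil
  then show ?case
    by (intro exI[of _ K] exI[of _ bs] exI[of _ "[]"]) (auto intro: cext_refl state_lat)
next
  case (snoc e us)
  obtain x l y where "e = (x, l, y)" by (cases e)
  then have e: "e = (x, False, y)" using snoc(3)[rule_format, of x l y] by auto
  have st: "state d K ((as @ us) @ (x, False, y) # bs @ fs) Q" using snoc(2) e by simp
  obtain K1 bs1 x' y' where K1: "state d K1 ((as @ us) @ bs1 @ (x', False, y') # fs) Q"
     "\<forall>a l b. (a, l, b) \<in> set bs1 \<longrightarrow> l \<and> b \<notin> K"
     "cext K K1 (\<lambda>\<theta>. \<forall>a l b. (a, l, b) \<in> set bs \<inter> {} \<longrightarrow> ((x, y) \<in> \<theta> \<longleftrightarrow> (a, b) \<in> \<theta>))"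
     "\<forall>D. up D K \<and> x \<notin> D \<longrightarrow> up D K1"
     "\<forall>D. dn D K \<and> (\<forall>a l b. (a, l, b) \<in> set bs \<longrightarrow> b \<notin> D) \<longrightarrow> dn D K1"
    using move_edge[OF st snoc(4), of "{}"] by blast
  have ce: "cext K K1 (\<lambda>_. True)" using K1(3) by (rule cext_cong) simp
  have st1: "state d K1 (as @ us @ bs1 @ ((x', False, y') # fs)) Q" using K1(1) by simp
  have l1: "\<forall>a l b. (a, l, b) \<in> set us \<longrightarrow> \<not> l" using snoc(3) by (metis Un_iff set_append)
  have l2: "\<forall>a l b. (a, l, b) \<in> set bs1 \<longrightarrow> l" using K1(2) by blast
  from snoc(1)[OF st1 l1 l2] obtain K' bs' us' where
    IH: "state d K' (as @ bs' @ us' @ (x', False, y') # fs) Q" "\<forall>a l b. (a, l, b) \<in> set us' \<longrightarrow> \<not> l"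
     "\<forall>a l b. (a, l, b) \<in> set bs' \<longrightarrow> l" "cext K1 K' (\<lambda>_. True)"
     "\<forall>D. up D K1 \<and> (\<forall>a l b. (a, l, b) \<in> set us \<longrightarrow> a \<notin> D) \<longrightarrow> up D K'"
     "\<forall>D. dn D K1 \<and> (\<forall>a l b. (a, l, b) \<in> set bs1 \<longrightarrow> b \<notin> D) \<longrightarrow> dn D K'" by blast
  have "cext K K' (\<lambda>_. True)" using cext_trans[OF ce IH(4), of "\<lambda>_. True"] by simp
  moreover have "state d K' (as @ bs' @ (us' @ [(x', False, y')]) @ fs) Q" using IH(1) by simp
  moreover have "\<forall>a l b. (a, l, b) \<in> set (us' @ [(x', False, y')]) \<longrightarrow> \<not> l" using IH(2) by auto
  moreover have "\<forall>D. up D K \<and> (\<forall>a l b. (a, l, b) \<in> set (us @ [e]) \<longrightarrow> a \<notin> D) \<longrightarrow> up D K'"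
  proof (intro allI impI)
    fix D assume D: "up D K \<and> (\<forall>a l b. (a, l, b) \<in> set (us @ [e]) \<longrightarrow> a \<notin> D)"
    then have "x \<notin> D" using e by auto
    then have "up D K1" using K1(4) D by blast
    moreover have "\<forall>a l b. (a, l, b) \<in> set us \<longrightarrow> a \<notin> D" using D by auto
    ultimately show "up D K'" using IH(5) by blast
  qed
  moreover have "\<forall>D. dn D K \<and> (\<forall>a l b. (a, l, b) \<in> set bs \<longrightarrow> b \<notin> D) \<longrightarrow> dn D K'"
  proof (intro allI impI)
    fix D assume D: "dn D K \<and> (\<forall>a l b. (a, l, b) \<in> set bs \<longrightarrow> b \<notin> D)"
    then have "dn D K1" using K1(5) by blast
    moreover have "D \<subseteq> K" using D dn_sub[of D K] by blast
    ultimately show "dn D K'" using IH(6) K1(2) by blast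
  qed
  ultimately show ?case using IH(3) by blast
qed

section \<open>Identification of prime intervals\<close>

text \<open>The end of the last lower edge of a ladder is the only doubly irreducible element strictly inside
  the boundary chain.\<close>

definition ladder :: "edge list \<Rightarrow> bool" where
  "ladder es \<longleftrightarrow> (\<exists>as us. es = as @ us \<and> as \<noteq> [] \<and> us \<noteq> [] \<and>
     (\<forall>a l b. (a, l, b) \<in> set as \<longrightarrow> l) \<and> (\<forall>a l b. (a, l, b) \<in> set us \<longrightarrow> \<not> l))"

text \<open>The planar counterpart of a rectangular lattice, as \<open>rectangular_frame\<close> and
  \<open>frame_rectangular\<close> show.\<close>

definition frame :: "bool \<Rightarrow> (real \<times> real) set \<Rightarrow> edge list \<Rightarrow> edge list \<Rightarrow> bool" where
  "frame d K P Q \<longleftrightarrow> state d K P Q \<and> ladder P \<and> ladder Q"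

lemma frame_sym: "frame d K P Q \<Longrightarrow> frame (\<not> d) K Q P"
  by (auto simp: frame_def dest: state_sym)

section \<open>Projecting prime intervals to lower boundary edges\<close>

lemma walk_exit: "walk es a b \<Longrightarrow> a \<le> u \<Longrightarrow> \<not> b \<le> u \<Longrightarrow> \<exists>c l c'. (c, l, c') \<in> set es \<and> c \<le> u \<and> \<not> c' \<le> u"
proof (induction es a b rule: walk.induct)
  case (2 x l y es a b)
  show ?case
  proof (cases "y \<le> u")
    case True
    then obtain c m c' where "(c, m, c') \<in> set es" "c \<le> u" "\<not> c' \<le> u" using 2 by auto
    then show ?thesis by (intro exI[of _ c] exI[of _ m] exI[of _ c']) simp
  next
    case False then show ?thesis using 2(2,3) by (intro exI[of _ x] exI[of _ l] exI[of _ y]) simp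
  qed
qed auto

lemma side_exit:
  assumes s: "side d K P" and u: "u \<in> K" and v: "v \<in> K" "u < v"
  shows "\<exists>c l c'. (c, l, c') \<in> set P \<and> c \<le> u \<and> \<not> c' \<le> u"
proof -
  obtain b t where bt: "b \<in> K" "t \<in> K" "\<forall>s\<in>K. b \<le> s \<and> s \<le> t" "walk P b t" using side_walk[OF s] by blast
  have "\<not> t \<le> u" using bt(3) v by (meson leD order_trans)
  then show ?thesis using walk_exit[OF bt(4)] bt(3) u by blast
qed

text \<open>The meet of \<open>c'\<close> and \<open>u\<close> lies between \<open>c\<close> and
  \<open>c'\<close> but differs from \<open>c'\<close>; so it is \<open>c\<close>, and
  \<open>[c, c']\<close> is perspective to \<open>[u, jn K c' u]\<close>.\<close>

lemma persp_cov:
  assumes K: "lat K" and th: "con K \<theta>" and c: "cov K c c'" "u \<in> K" "c \<le> u" "\<not> c' \<le> u"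
  shows "(c, c') \<in> \<theta> \<longleftrightarrow> (u, jn K c' u) \<in> \<theta>"
proof -
  note i = cov_in[OF c(1)]
  have "c \<le> mt K c' u" using K i c by (simp add: le_mt_iff less_imp_le)
  moreover have "mt K c' u \<noteq> c'" using mt_le2[OF K i(2) c(2)] c(4) by metis
  ultimately have "mt K c' u = c" using cov_between[OF c(1), of "mt K c' u"] K i c(2) by auto
  then show ?thesis using con_persp[OF K th i(2) c(2)] by simp
qed

text \<open>Every prime interval \<open>[u, v]\<close> is projective to an edge of a boundary chain: if the joins \<open>l\<close> and
  \<open>r\<close> of \<open>u\<close> with the first elements of the two chains not below \<open>u\<close> both differ from \<open>v\<close>, then
  \<open>v\<close> lies between \<open>l\<close> and \<open>r\<close>, so that \<open>l\<close>, \<open>v\<close>, \<open>r\<close> generate a diamond.\<close>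

lemma boundary_edge:
  assumes st: "state d K P Q" and uv: "cov K u v"
  shows "\<exists>e e' m. (e, m, e') \<in> set P \<union> set Q \<and> (\<forall>\<theta>. con K \<theta> \<longrightarrow> ((u, v) \<in> \<theta> \<longleftrightarrow> (e, e') \<in> \<theta>))"
proof -
  note pK = state_plat[OF st] and K = state_lat[OF st] and sP = state_side[OF st] and sQ = state_side2[OF st]
  have S: "smod K" using pK by (simp add: plat_def)
  note i = cov_in[OF uv]
  obtain c m c' where c: "(c, m, c') \<in> set P" "c \<le> u" "\<not> c' \<le> u" using side_exit[OF sP i] by blast
  obtain e n e' where e: "(e, n, e') \<in> set Q" "e \<le> u" "\<not> e' \<le> u" using side_exit[OF sQ i] by blast
  note cc = side_cov[OF sP c(1)] and ee = side_cov[OF sQ e(1)]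
  note ci = cov_in[OF cc] and ei = cov_in[OF ee]
  let ?l = "jn K c' u" and ?r = "jn K e' u"
  have l: "cov K u ?l" using smod_cov_jn[OF K S cc i(1) c(2,3)] .
  have r: "cov K u ?r" using smod_cov_jn[OF K S ee i(1) e(2,3)] .
  have pc: "(c, c') \<in> \<theta> \<longleftrightarrow> (u, ?l) \<in> \<theta>" if "con K \<theta>" for \<theta> using persp_cov[OF K that cc i(1) c(2,3)] .
  have pe: "(e, e') \<in> \<theta> \<longleftrightarrow> (u, ?r) \<in> \<theta>" if "con K \<theta>" for \<theta> using persp_cov[OF K that ee i(1) e(2,3)] .
  consider "?l = v" | "?r = v" | "?l \<noteq> v" "?r \<noteq> v" by blast
  then show ?thesis
  proof cases
    case 1 then show ?thesis using pc c(1) by (intro exI[of _ c] exI[of _ c'] exI[of _ m]) auto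
  next
    case 2 then show ?thesis using pe e(1) by (intro exI[of _ e] exI[of _ e'] exI[of _ n]) auto
  next
    case 3
    \<comment> \<open>The end \<open>f'\<close> of the boundary edge is incomparable with
      \<open>v\<close>, hence on its outer side; the join with \<open>u\<close> stays there, not
      being above \<open>v\<close>.\<close>
    have side: "lam D (jn K f' u) v" if f: "(f, k, f') \<in> set R" "f \<le> u" "\<not> f' \<le> u" and sR: "side D K R"
       and ne: "jn K f' u \<noteq> v" for D R f k f'
    proof -
      note ff = side_cov[OF sR f(1)]
      note fi = cov_in[OF ff]
      have j: "cov K u (jn K f' u)" using smod_cov_jn[OF K S ff i(1) f(2,3)] .
      have nv: "\<not> v \<le> jn K f' u" using cov_between[OF j i(2) less_imp_le[OF i(3)]] i ne by auto
      have n1: "\<not> f' \<le> v"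
      proof
        assume "f' \<le> v"
        then have "jn K f' u \<le> v" using jn_least[OF K fi(2) i(1,2)] i(3) by (simp add: less_imp_le)
        then show False using cov_between[OF uv cov_in(2)[OF j] less_imp_le[OF cov_in(3)[OF j]]] cov_in(3)[OF j] ne by auto
      qed
      have n2: "\<not> v \<le> f'"
      proof
        assume "v \<le> f'"
        then show False using nv jn_ge1[OF K fi(2) i(1)] by (meson order_trans)
      qed
      have "lam D f' v"
        by (rule lam_cases[OF pK fi(2) i(2), where d = D])
          (use n1 n2 lbdD[OF side_verts(2)[OF sR f(1)] i(2)] in auto)
      then show ?thesis using lam_le_left[OF _ jn_ge1[OF K fi(2) i(1)] nv] by blast
    qed
    have lv: "lam d ?l v" using side[OF c sP 3(1)] .
    have vr: "lam d v ?r" using side[OF e sQ 3(2)] lam_mirror by blast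
    note li = cov_in[OF l] and ri = cov_in[OF r]
    let ?j = "jn K ?r ?l"
    have lr: "\<not> ?r \<le> ?l" using lam_not_le[OF lam_trans[OF lv vr]] by blast
    have lj: "cov K ?l ?j" using smod_cov_jn[OF K S r li(2) less_imp_le[OF li(3)] lr] .
    have "v \<le> ?j" using lam_between_le[OF lv vr] K li ri by simp
    then have "jn K v ?l \<le> ?j" using jn_least[OF K i(2) li(2)] K li ri by simp
    moreover have "jn K v ?l \<noteq> ?l" using lam_not_le(2)[OF lv] jn_ge1[OF K i(2) li(2)] by metis
    ultimately have vj: "jn K v ?l = ?j"
      using cov_between[OF lj, of "jn K v ?l"] K i li by auto
    have "(u, v) \<in> \<theta> \<longleftrightarrow> (e, e') \<in> \<theta>" if th: "con K \<theta>" for \<theta>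
    proof -
      have "(u, v) \<in> \<theta> \<longleftrightarrow> (?l, jn K v ?l) \<in> \<theta>"
        using persp_cov[OF K th uv li(2) less_imp_le[OF li(3)] lam_not_le(2)[OF lv]] .
      moreover have "(u, ?r) \<in> \<theta> \<longleftrightarrow> (?l, ?j) \<in> \<theta>"
        using persp_cov[OF K th r li(2) less_imp_le[OF li(3)] lr] .
      ultimately show ?thesis using pe[OF th] vj by simp
    qed
    then show ?thesis using e(1) by (intro exI[of _ e] exI[of _ e'] exI[of _ n]) auto
  qed
qed

text \<open>The edge at which the opposite boundary leaves the down-set of \<open>x\<close> joins
  with \<open>x\<close> to the only upper cover \<open>y\<close>. It is a lower edge: an upper edge
  starting strictly below \<open>x\<close> would end below \<open>x\<close>, and one starting at
  \<open>x\<close> contradicts \<open>compat\<close>.\<close>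

lemma upper_edge:
  assumes st: "state d K P Q" and e: "(x, False, y) \<in> set P"
  shows "\<exists>f f'. (f, True, f') \<in> set Q \<and> (\<forall>\<theta>. con K \<theta> \<longrightarrow> ((x, y) \<in> \<theta> \<longleftrightarrow> (f, f') \<in> \<theta>))"
proof -
  note pK = state_plat[OF st] and K = state_lat[OF st] and sP = state_side[OF st] and sQ = state_side2[OF st]
  have S: "smod K" using pK by (simp add: plat_def)
  note xy = side_cov[OF sP e]
  note i = cov_in[OF xy]
  obtain f n f' where f: "(f, n, f') \<in> set Q" "f \<le> x" "\<not> f' \<le> x" using side_exit[OF sQ i] by blast
  note ff = side_cov[OF sQ f(1)]
  have j: "cov K x (jn K f' x)" using smod_cov_jn[OF K S ff i(1) f(2,3)] .
  have "y \<le> jn K f' x" using side_upper[OF sP e] cov_in[OF j] by blast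
  then have y: "jn K f' x = y" using cov_between[OF j i(2) less_imp_le[OF i(3)]] i by auto
  have n: n
  proof (rule ccontr)
    assume "\<not> n"
    then have fF: "(f, False, f') \<in> set Q" using f(1) by simp
    then have "f \<noteq> x" using compatF[OF state_compat[OF st] e] by blast
    then have "f' \<le> x" using side_upper[OF sQ fF i(1)] f(2) by auto
    then show False using f(3) by blast
  qed
  have fT: "(f, True, f') \<in> set Q" using f(1) n by simp
  have "(f, f') \<in> \<theta> \<longleftrightarrow> (x, y) \<in> \<theta>" if "con K \<theta>" for \<theta> using persp_cov[OF K that ff i(1) f(2,3)] y by simp
  then show ?thesis using fT by blast
qed

lemma lower_edge:
  assumes st: "state d K P Q" and uv: "cov K u v"
  shows "\<exists>e e'. (e, True, e') \<in> set P \<union> set Q \<and> (\<forall>\<theta>. con K \<theta> \<longrightarrow> ((u, v) \<in> \<theta> \<longleftrightarrow> (e, e') \<in> \<theta>))"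
proof -
  obtain e e' m where e: "(e, m, e') \<in> set P \<union> set Q" "\<forall>\<theta>. con K \<theta> \<longrightarrow> ((u, v) \<in> \<theta> \<longleftrightarrow> (e, e') \<in> \<theta>)"
    using boundary_edge[OF st uv] by blast
  show ?thesis
  proof (cases m)
    case True then show ?thesis using e by (intro exI[of _ e] exI[of _ e']) simp
  next
    case False
    then consider "(e, False, e') \<in> set P" | "(e, False, e') \<in> set Q" using e(1) by auto
    then obtain f f' where "(f, True, f') \<in> set P \<union> set Q" "\<forall>\<theta>. con K \<theta> \<longrightarrow> ((e, e') \<in> \<theta> \<longleftrightarrow> (f, f') \<in> \<theta>)"
    proof cases
      case 1 then show ?thesis using that upper_edge[OF st 1] by blast
    next
      case 2 then show ?thesis using that upper_edge[OF state_sym[OF st] 2] by blast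
    qed
    then show ?thesis using e(2) by (intro exI[of _ f] exI[of _ f']) simp
  qed
qed

section \<open>Strips along the lower boundary\<close>

lemma plane_bottom:
  assumes K: "plat K" and o1: "o1 \<in> K" "\<And>t. t \<in> K \<Longrightarrow> o1 \<le> t"
  obtains b where "new_bottom K b o1" "plat (insert b K)" "\<And>d. lbd d (insert b K) = insert b (lbd d K)"
proof -
  define b where "b = (fst o1 - 1, snd o1 - 1)"
  have c: "co d b < co d t" if "t \<in> K" for d t
    using o1(2)[OF that] by (auto simp: co_def b_def less_eq_prod_def)
  have bo: "b < o1" using c[OF o1(1), of True] c[OF o1(1), of False]
    by (auto simp: order_less_le le_co[of _ _ True])
  have bK: "b \<notin> K" using c by blast
  have nb: "new_bottom K b o1" by (rule new_bottom.intro) (use K bK o1 bo in \<open>auto simp: plat_def\<close>)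
  interpret B: new_bottom K b o1 by (rule nb)
  have "fst b \<noteq> fst t \<and> snd b \<noteq> snd t" if "t \<in> K" for t
    using c[OF that, of True] c[OF that, of False] by (auto simp: co_def)
  then have "plat (insert b K)" using K B.lat' B.smod' bK by (auto simp: plat_def)
  moreover have "lbd d (insert b K) = insert b (lbd d K)" for d
  proof -
    have "\<not> lam d b t \<and> \<not> lam d t b" if "t \<in> K" for t
      using c[OF that, of d] c[OF that, of "\<not> d"] by (auto simp: lam_def)
    then show ?thesis using lam_irrefl unfolding lbd_def by blast
  qed
  ultimately show thesis using nb that by blast
qed

text \<open>Both labels are possible for the new edge, as \<open>o1\<close> is the only upper cover
  of \<open>b\<close> and \<open>b\<close> the only lower cover of \<open>o1\<close>. The
  assumptions \<open>TT\<close> and \<open>FF\<close> take care of the branching at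
  \<open>o1\<close>.\<close>

lemma side_bottom:
  assumes nb: "new_bottom K b o1" and s: "side d K P" and lb: "lbd d (insert b K) = insert b (lbd d K)"
    and TT: "\<And>c. l \<Longrightarrow> (o1, True, c) \<in> set P \<Longrightarrow> \<exists>t. t \<noteq> c \<and> cov K o1 t"
    and FF: "\<And>c. \<not> l \<Longrightarrow> (o1, False, c) \<notin> set P"
  shows "side d (insert b K) ((b, l, o1) # P)"
proof -
  interpret new_bottom K b o1 by (rule nb)
  obtain c t where ct: "c \<in> K" "t \<in> K" "\<forall>s\<in>K. c \<le> s \<and> s \<le> t" "walk P c t" using side_walk[OF s] by blast
  have co: "c = o1" using ct o1 o1_le by (meson order_antisym)
  have inK: "x \<in> K" "y \<in> K" "x < y" if "(x, m, y) \<in> set P" for x m y using cov_in[OF side_cov[OF s that]] by auto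
  have ob: "o1 \<in> verts P"
  proof (cases P)
    case Nil then show ?thesis using side_ne[OF s] by simp
  next
    case (Cons e es) then show ?thesis using ct(4) co by (cases e) auto
  qed
  show ?thesis
  proof (rule sideI)
    show "\<exists>b' t. b' \<in> insert b K \<and> t \<in> insert b K \<and> (\<forall>s\<in>insert b K. b' \<le> s \<and> s \<le> t) \<and> walk ((b, l, o1) # P) b' t"
      using ct co b_le by (intro exI[of _ b] exI[of _ t]) auto
    show "lbd d (insert b K) = verts ((b, l, o1) # P)" using lb side_lbd[OF s] ob by auto
    show "cov (insert b K) x y" if "(x, m, y) \<in> set ((b, l, o1) # P)" for x m y
    proof (cases "(x, m, y) = (b, l, o1)")
      case True then show ?thesis using cov_b by simp
    next
      case False
      then have "(x, m, y) \<in> set P" using that by auto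
      then show ?thesis using cov_old[OF side_cov[OF s]] by blast
    qed
    show "r \<le> x" if e: "(x, True, y) \<in> set ((b, l, o1) # P)" and r: "r \<in> insert b K" "r < y" for x y r
    proof (cases "(x, True, y) = (b, l, o1)")
      case True then show ?thesis using r o1_le[of r] by auto
    next
      case False
      then have e': "(x, True, y) \<in> set P" using e by auto
      show ?thesis using side_lower[OF s e'] r b_le[OF inK(1)[OF e']] by blast
    qed
    show "y \<le> r" if e: "(x, False, y) \<in> set ((b, l, o1) # P)" and r: "r \<in> insert b K" "x < r" for x y r
    proof (cases "(x, False, y) = (b, l, o1)")
      case True then show ?thesis using r o1_le[of r] by auto
    next
      case False
      then have e': "(x, False, y) \<in> set P" using e by auto
      have "r \<in> K" using r not_le_b[OF inK(1)[OF e']] less_imp_le[of x b] by blast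
      then show ?thesis using side_upper[OF s e' _ r(2)] by blast
    qed
    show "\<exists>t. t \<noteq> z \<and> cov (insert b K) y t"
      if e: "(x, True, y) \<in> set ((b, l, o1) # P)" "(y, True, z) \<in> set ((b, l, o1) # P)" for x y z
    proof -
      have yz: "(y, True, z) \<in> set P" using e inK[of x True y] b o1 by auto
      show ?thesis
      proof (cases "(x, True, y) = (b, l, o1)")
        case True then show ?thesis using TT[of z] yz cov_old by blast
      next
        case False
        then have "(x, True, y) \<in> set P" using e by auto
        then show ?thesis using side_TT[OF s _ yz] cov_old by blast
      qed
    qed
    show "\<exists>t. t \<noteq> x \<and> cov (insert b K) t y"
      if e: "(x, False, y) \<in> set ((b, l, o1) # P)" "(y, False, z) \<in> set ((b, l, o1) # P)" for x y z
    proof -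
      have yz: "(y, False, z) \<in> set P" using e inK[of x False y] b o1 by auto
      have "(x, False, y) \<noteq> (b, l, o1)" using FF[of z] yz by auto
      then have "(x, False, y) \<in> set P" using e by auto
      then show ?thesis using side_FF[OF s _ yz] cov_old by blast
    qed
  qed simp
qed

lemma side_first:
  assumes s: "side d K P" and P: "P = (a, l, c) # P'"
  shows "a \<in> K" "\<And>t. t \<in> K \<Longrightarrow> a \<le> t" "(a, m, c') \<in> set P \<Longrightarrow> m = l \<and> c' = c"
proof -
  obtain b t where bt: "b \<in> K" "t \<in> K" "\<forall>s\<in>K. b \<le> s \<and> s \<le> t" "walk P b t" using side_walk[OF s] by blast
  then show "a \<in> K" "\<And>t. t \<in> K \<Longrightarrow> a \<le> t" using P by auto
  have ac: "a < c" using side_cov[OF s, of a l c] P by (auto simp: cov_iff)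
  assume "(a, m, c') \<in> set P"
  moreover have "(a, m, c') \<notin> set P'" using side_split2[of d K "[]" a l c P' a m c'] s P ac by auto
  ultimately show "m = l \<and> c' = c" using P by auto
qed

text \<open>The edge to the new bottom is labelled upper on the side of \<open>P\<close> and lower
  on the side of \<open>Q\<close>. Moving it past all lower edges of \<open>P\<close> creates the
  strip and restores the ladder; the moved edge stays perspective to \<open>(b, o1)\<close>, and
  diamonds at the members of \<open>S\<close> tie them all to it.\<close>

lemma strip:
  assumes fr: "frame d K P Q" and S: "S \<noteq> {}" "S \<subseteq> set P" "\<forall>a l b. (a, l, b) \<in> S \<longrightarrow> l"
  shows "\<exists>K' P' b o1. frame d K' P' ((b, True, o1) # Q) \<and> up K K' \<and>
     cext K K' (\<lambda>\<theta>. \<forall>e\<in>S. \<forall>f\<in>S. (fst e, snd (snd e)) \<in> \<theta> \<longleftrightarrow> (fst f, snd (snd f)) \<in> \<theta>) \<and>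
     (\<forall>\<theta>. con K' \<theta> \<longrightarrow> (\<forall>e\<in>S. (b, o1) \<in> \<theta> \<longleftrightarrow> (fst e, snd (snd e)) \<in> \<theta>))"
proof -
  have st: "state d K P Q" using fr by (simp add: frame_def)
  note pK = state_plat[OF st] and K = state_lat[OF st] and sP = state_side[OF st] and sQ = state_side2[OF st]
  obtain as us where P: "P = as @ us" "as \<noteq> []" "us \<noteq> []" "\<forall>a l b. (a, l, b) \<in> set as \<longrightarrow> l" "\<forall>a l b. (a, l, b) \<in> set us \<longrightarrow> \<not> l"
    using fr by (auto simp: frame_def ladder_def)
  obtain bs vs where Q: "Q = bs @ vs" "bs \<noteq> []" "vs \<noteq> []" "\<forall>a l b. (a, l, b) \<in> set bs \<longrightarrow> l" "\<forall>a l b. (a, l, b) \<in> set vs \<longrightarrow> \<not> l"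
    using fr by (auto simp: frame_def ladder_def)
  obtain o1 l1 p P0 where "P = (o1, l1, p) # P0" "(o1, l1, p) \<in> set as" using P(1,2) by (cases as) auto
  then have o1: "P = (o1, True, p) # P0" using P(4) by metis
  obtain o2 l2 q Q0 where "Q = (o2, l2, q) # Q0" "(o2, l2, q) \<in> set bs" using Q(1,2) by (cases bs) auto
  then have o2: "Q = (o2, True, q) # Q0" using Q(4) by metis
  have oo: "o2 = o1" using side_first(1,2)[OF sP o1] side_first(1,2)[OF sQ o2] by (meson order_antisym)
  have pq: "p \<noteq> q" using compatT[OF state_compat[OF st], of o1 p o1] o1 o2 oo by auto
  obtain b where nb: "new_bottom K b o1" and pK1: "plat (insert b K)" and lb: "\<And>d. lbd d (insert b K) = insert b (lbd d K)"
    using plane_bottom[OF pK side_first(1,2)[OF sP o1]] by blast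
  interpret B: new_bottom K b o1 by (rule nb)
  let ?K = "insert b K"
  have s1: "side d ?K ((b, False, o1) # P)"
    by (rule side_bottom[OF nb sP lb]) (use side_first(3)[OF sP o1] in auto)
  have s2: "side (\<not> d) ?K ((b, True, o1) # Q)"
  proof (rule side_bottom[OF nb sQ lb])
    fix c assume "(o1, True, c) \<in> set Q"
    then have "c = q" using side_first(3)[OF sQ o2] oo by auto
    then show "\<exists>t. t \<noteq> c \<and> cov K o1 t" using side_cov[OF sP, of o1 True p] o1 pq by auto
  qed simp
  have cp: "compat ((b, False, o1) # P) ((b, True, o1) # Q)"
  proof -
    have "(b, m, y) \<notin> set P \<and> (b, m, y) \<notin> set Q" for m y
      using side_cov[OF sP, of b m y] side_cov[OF sQ, of b m y] B.b by (auto simp: cov_iff)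
    moreover have "(y, m, o1) \<notin> set P" for y m
      using side_cov[OF sP, of y m o1] B.o1_le[of y] by (auto simp: cov_iff)
    ultimately show ?thesis using state_compat[OF st] unfolding compat_def by auto
  qed
  have st1: "state d ?K ([] @ (b, False, o1) # as @ us) ((b, True, o1) # Q)"
    using pK1 s1 s2 cp P(1) by (simp add: state_def)
  obtain K' as' x' y' where M: "state d K' ([] @ as' @ (x', False, y') # us) ((b, True, o1) # Q)" "length as' = length as"
     "\<forall>a l b. (a, l, b) \<in> set as' \<longrightarrow> l \<and> b \<notin> ?K"
     "cext ?K K' (\<lambda>\<theta>. \<forall>a l c. (a, l, c) \<in> set as \<inter> S \<longrightarrow> ((b, o1) \<in> \<theta> \<longleftrightarrow> (a, c) \<in> \<theta>))"
     "\<forall>D. up D ?K \<and> b \<notin> D \<longrightarrow> up D K'"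
    using move_edge[OF st1 P(4), of S] by blast
  have asS: "S \<subseteq> set as"
  proof
    fix e assume e: "e \<in> S"
    obtain a l c where alc: "e = (a, l, c)" by (cases e)
    then have "(a, l, c) \<in> set as \<or> (a, l, c) \<in> set us" "l" using S(2) S(3)[rule_format, of a l c] e P(1) by auto
    then show "e \<in> set as" using P(5) alc by blast
  qed
  have SK: "fst e \<in> K" "snd (snd e) \<in> K" if "e \<in> S" for e
  proof -
    obtain a l c where e: "e = (a, l, c)" by (cases e)
    then have "(a, l, c) \<in> set P" using S(2) that by blast
    from cov_in[OF side_cov[OF sP this]] show "fst e \<in> K" "snd (snd e) \<in> K" using e by auto
  qed
  have "cext ?K K' (\<lambda>\<theta>. \<forall>e\<in>S. (b, o1) \<in> \<theta> \<longleftrightarrow> (fst e, snd (snd e)) \<in> \<theta>)"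
    using M(4)
  proof (rule cext_cong)
    fix \<theta>
    have A: "(b, o1) \<in> \<theta> \<longleftrightarrow> (fst e, snd (snd e)) \<in> \<theta>"
      if L: "\<forall>a l c. (a, l, c) \<in> set as \<inter> S \<longrightarrow> ((b, o1) \<in> \<theta> \<longleftrightarrow> (a, c) \<in> \<theta>)" and e: "e \<in> S" for e
    proof -
      obtain a l c where "e = (a, l, c)" by (cases e)
      then show ?thesis using L[rule_format, of a l c] e asS by auto
    qed
    have B: "(b, o1) \<in> \<theta> \<longleftrightarrow> (a, c) \<in> \<theta>"
      if "\<forall>e\<in>S. (b, o1) \<in> \<theta> \<longleftrightarrow> (fst e, snd (snd e)) \<in> \<theta>" "(a, l, c) \<in> set as \<inter> S" for a l c
      using bspec[OF that(1), of "(a, l, c)"] that(2) by simp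
    show "(\<forall>a l c. (a, l, c) \<in> set as \<inter> S \<longrightarrow> ((b, o1) \<in> \<theta> \<longleftrightarrow> (a, c) \<in> \<theta>)) \<longleftrightarrow>
      (\<forall>e\<in>S. (b, o1) \<in> \<theta> \<longleftrightarrow> (fst e, snd (snd e)) \<in> \<theta>)" (is "?L = ?R")
    proof
      assume L: ?L
      show ?R by (intro ballI) (rule A[OF L])
    next
      assume R: ?R
      show ?L by (intro allI impI) (rule B[OF R])
    qed
  qed
  note ce = this
  note s2' = cext_subl[OF ce]
  have KK: "?K \<subseteq> K'" using subl_sub[OF s2'] .
  have eqs: "(b, o1) \<in> \<theta> \<longleftrightarrow> (fst e, snd (snd e)) \<in> \<theta>" if th: "con K' \<theta>" and e: "e \<in> S" for \<theta> e
    using cext_C[OF ce th] e SK[OF e] B.o1 by blast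
  have "up K K'"
  proof -
    have "up K ?K" by (rule upI) (use B.not_le_b in auto)
    then show ?thesis using M(5) B.b by blast
  qed
  moreover have "frame d K' (as' @ (x', False, y') # us) ((b, True, o1) # Q)"
  proof -
    have "ladder (as' @ (x', False, y') # us)" unfolding ladder_def
      using M(2,3) P(2,5) by (intro exI[of _ as'] exI[of _ "(x', False, y') # us"]) auto
    moreover have "ladder ((b, True, o1) # Q)" unfolding ladder_def
      using Q by (intro exI[of _ "(b, True, o1) # bs"] exI[of _ vs]) auto
    ultimately show ?thesis using M(1) by (simp add: frame_def)
  qed
  moreover have "cext K K' (\<lambda>\<theta>. \<forall>e\<in>S. \<forall>f\<in>S. (fst e, snd (snd e)) \<in> \<theta> \<longleftrightarrow> (fst f, snd (snd f)) \<in> \<theta>)"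
  proof (rule cextI)
    \<comment> \<open>\<open>B.con_extend\<close> leaves it open whether \<open>(b, o1)\<close> is
      collapsed. Since \<open>S\<close> has a member, this choice is forced, so no new freedom
      remains.\<close>
    obtain e0 where e0: "e0 \<in> S" using S(1) by blast
    have I: "(\<theta> \<inter> ?K \<times> ?K) \<inter> K \<times> K = \<theta> \<inter> K \<times> K" for \<theta> by blast
    show "subl K K'" using subl_trans[OF B.subl' s2'] .
    show "\<forall>e\<in>S. \<forall>f\<in>S. (fst e, snd (snd e)) \<in> \<theta> \<inter> K \<times> K \<longleftrightarrow> (fst f, snd (snd f)) \<in> \<theta> \<inter> K \<times> K" if "con K' \<theta>" for \<theta>
      by (intro ballI) (simp add: SK eqs[OF that, symmetric])
    show "\<exists>\<theta>'. con K' \<theta>' \<and> \<theta>' \<inter> K \<times> K = \<theta>"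
      if th: "con K \<theta>" and C: "\<forall>e\<in>S. \<forall>f\<in>S. (fst e, snd (snd e)) \<in> \<theta> \<longleftrightarrow> (fst f, snd (snd f)) \<in> \<theta>" for \<theta>
    proof -
      obtain \<theta>1 where t1: "con ?K \<theta>1" "\<theta>1 \<inter> K \<times> K = \<theta>" "(b, o1) \<in> \<theta>1 \<longleftrightarrow> (fst e0, snd (snd e0)) \<in> \<theta>"
        using B.con_extend[OF th] by blast
      have "(b, o1) \<in> \<theta>1 \<longleftrightarrow> (fst e, snd (snd e)) \<in> \<theta>1" if "e \<in> S" for e
        using t1 C e0 that SK[OF that] by blast
      then obtain \<theta>' where "con K' \<theta>'" "\<theta>' \<inter> ?K \<times> ?K = \<theta>1" using cext_ex[OF ce t1(1)] by blast
      then show ?thesis using I[of \<theta>'] t1(2) by (intro exI[of _ \<theta>']) simp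
    qed
    fix \<theta> \<theta>' assume c: "con K' \<theta>" "con K' \<theta>'" and e: "\<theta> \<inter> K \<times> K = \<theta>' \<inter> K \<times> K"
    have "(b, o1) \<in> \<theta> \<longleftrightarrow> (b, o1) \<in> \<theta>'" using eqs[OF c(1) e0] eqs[OF c(2) e0] e SK[OF e0] by blast
    then have "\<theta> \<inter> ?K \<times> ?K = \<theta>' \<inter> ?K \<times> ?K"
      using B.con_inj[OF con_restrict[OF s2' c(1)] con_restrict[OF s2' c(2)]] I e B.o1 by simp
    then show "\<theta> = \<theta>'" using cext_inj[OF ce c] by blast
  qed
  ultimately show ?thesis using eqs by blast
qed

text \<open>A lower edge on the wrong side is transferred by a strip along that side, marked at this
  edge alone: the edge \<open>(b, o1)\<close> becomes a lower edge of \<open>P\<close> tied to it,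
  and the condition on congruences is void.\<close>

lemma to_left:
  assumes fr: "frame d K P Q" and uv: "cov K u v"
  shows "\<exists>K' P' Q' e e'. frame d K' P' Q' \<and> up K K' \<and> cext K K' (\<lambda>_. True) \<and> set P \<subseteq> set P' \<and>
    (e, True, e') \<in> set P' \<and> (\<forall>\<theta>. con K' \<theta> \<longrightarrow> ((u, v) \<in> \<theta> \<longleftrightarrow> (e, e') \<in> \<theta>))"
proof -
  have st: "state d K P Q" using fr by (simp add: frame_def)
  note i = cov_in[OF uv]
  obtain e e' where e: "(e, True, e') \<in> set P \<union> set Q" "\<forall>\<theta>. con K \<theta> \<longrightarrow> ((u, v) \<in> \<theta> \<longleftrightarrow> (e, e') \<in> \<theta>)"
    using lower_edge[OF st uv] by blast
  show ?thesis
  proof (cases "(e, True, e') \<in> set P")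
    case True
    then show ?thesis using fr e up_refl cext_refl[OF state_lat[OF st]] by blast
  next
    case False
    then have eQ: "(e, True, e') \<in> set Q" using e by blast
    have eK: "e \<in> K" "e' \<in> K" using cov_in[OF side_cov[OF state_side2[OF st] eQ]] by auto
    obtain K' Q' b o1 where S: "frame (\<not> d) K' Q' ((b, True, o1) # P)" "up K K'"
     "cext K K' (\<lambda>\<theta>. \<forall>g\<in>{(e, True, e')}. \<forall>h\<in>{(e, True, e')}. (fst g, snd (snd g)) \<in> \<theta> \<longleftrightarrow> (fst h, snd (snd h)) \<in> \<theta>)"
     "\<forall>\<theta>. con K' \<theta> \<longrightarrow> (\<forall>g\<in>{(e, True, e')}. (b, o1) \<in> \<theta> \<longleftrightarrow> (fst g, snd (snd g)) \<in> \<theta>)"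
      using strip[OF frame_sym[OF fr], of "{(e, True, e')}"] eQ by auto
    have ce: "cext K K' (\<lambda>_. True)" using S(3) by (rule cext_cong) simp
    have "(u, v) \<in> \<theta> \<longleftrightarrow> (b, o1) \<in> \<theta>" if th: "con K' \<theta>" for \<theta>
    proof -
      have "(u, v) \<in> \<theta> \<longleftrightarrow> (e, e') \<in> \<theta>" using e(2)[rule_format, OF con_restrict[OF cext_subl[OF ce] th]] i eK by simp
      then show ?thesis using S(4) th by simp
    qed
    moreover have "frame d K' ((b, True, o1) # P) Q'" using frame_sym[OF S(1)] by simp
    ultimately show ?thesis using S(2) ce
      by (intro exI[of _ K'] exI[of _ "(b, True, o1) # P"] exI[of _ Q'] exI[of _ b] exI[of _ o1]) auto
  qed
qed

text \<open>Once both prime intervals are represented by lower edges of the same side, a single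
  strip marked at these two edges identifies them.\<close>

lemma identify:
  assumes fr: "frame d K P Q" and uv: "cov K u v" and uv': "cov K u' v'"
  shows "\<exists>K' P' Q'. frame d K' P' Q' \<and> up K K' \<and> cext K K' (\<lambda>\<theta>. (u, v) \<in> \<theta> \<longleftrightarrow> (u', v') \<in> \<theta>)"
proof -
  note i = cov_in[OF uv] and i' = cov_in[OF uv']
  obtain K1 P1 Q1 e e' where 1: "frame d K1 P1 Q1" "up K K1" "cext K K1 (\<lambda>_. True)"
    "(e, True, e') \<in> set P1" "\<forall>\<theta>. con K1 \<theta> \<longrightarrow> ((u, v) \<in> \<theta> \<longleftrightarrow> (e, e') \<in> \<theta>)"
    using to_left[OF fr uv] by blast
  have eK: "e \<in> K1" "e' \<in> K1" using 1(1,4) cov_in side_cov[OF state_side] unfolding frame_def by blast+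
  obtain K2 P2 Q2 f f' where 2: "frame d K2 P2 Q2" "up K1 K2" "cext K1 K2 (\<lambda>_. True)" "set P1 \<subseteq> set P2"
    "(f, True, f') \<in> set P2" "\<forall>\<theta>. con K2 \<theta> \<longrightarrow> ((u', v') \<in> \<theta> \<longleftrightarrow> (f, f') \<in> \<theta>)"
    using to_left[OF 1(1) cov_up[OF 1(2) uv']] by blast
  have n1: "{(e, True, e'), (f, True, f')} \<noteq> {}" by blast
  have n2: "{(e, True, e'), (f, True, f')} \<subseteq> set P2" using 1(4) 2(4,5) by blast
  have n3: "\<forall>a l b. (a, l, b) \<in> {(e, True, e'), (f, True, f')} \<longrightarrow> l" by simp
  obtain K3 P3 b o1 where 3: "frame d K3 P3 ((b, True, o1) # Q2)" "up K2 K3"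
     "cext K2 K3 (\<lambda>\<theta>. \<forall>g\<in>{(e, True, e'), (f, True, f')}. \<forall>h\<in>{(e, True, e'), (f, True, f')}. (fst g, snd (snd g)) \<in> \<theta> \<longleftrightarrow> (fst h, snd (snd h)) \<in> \<theta>)"
    using strip[OF 2(1) n1 n2 n3] by (elim exE conjE) (rule that)
  have ce: "cext K K2 (\<lambda>_. True)" using cext_trans[OF 1(3) 2(3), of "\<lambda>_. True"] by simp
  have "cext K K3 (\<lambda>\<theta>. True \<and> ((u, v) \<in> \<theta> \<longleftrightarrow> (u', v') \<in> \<theta>))"
  proof (rule cext_trans[OF ce 3(3)])
    fix \<theta> assume th: "con K2 \<theta>"
    have "(u, v) \<in> \<theta> \<longleftrightarrow> (e, e') \<in> \<theta>"
      using 1(5)[rule_format, OF con_restrict[OF cext_subl[OF 2(3)] th]] i eK up_sub[OF 1(2)] by auto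
    moreover have "(u', v') \<in> \<theta> \<longleftrightarrow> (f, f') \<in> \<theta>" using 2(6) th by blast
    ultimately show "(\<forall>g\<in>{(e, True, e'), (f, True, f')}. \<forall>h\<in>{(e, True, e'), (f, True, f')}. (fst g, snd (snd g)) \<in> \<theta> \<longleftrightarrow> (fst h, snd (snd h)) \<in> \<theta>)
      \<longleftrightarrow> ((u, v) \<in> \<theta> \<inter> K \<times> K \<longleftrightarrow> (u', v') \<in> \<theta> \<inter> K \<times> K)" using i i' by auto
  qed
  then have "cext K K3 (\<lambda>\<theta>. (u, v) \<in> \<theta> \<longleftrightarrow> (u', v') \<in> \<theta>)" by simp
  then show ?thesis using 3(1) up_trans[OF up_trans[OF 1(2) 2(2)] 3(2)] by blast
qed

lemma identify_all:
  assumes "frame d K P Q" "finite E" "\<And>u v u' v'. ((u, v), (u', v')) \<in> E \<Longrightarrow> cov K u v \<and> cov K u' v'"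
  shows "\<exists>K' P' Q'. frame d K' P' Q' \<and> up K K' \<and> cext K K' (\<lambda>\<theta>. \<forall>(p, q)\<in>E. p \<in> \<theta> \<longleftrightarrow> q \<in> \<theta>)"
  using assms(2,3)
proof (induction E rule: finite_induct)
  case empty
  have "cext K K (\<lambda>\<theta>. \<forall>(p, q)\<in>{}. p \<in> \<theta> \<longleftrightarrow> q \<in> \<theta>)"
    by (rule cext_cong[OF cext_refl]) (use assms(1) state_lat in \<open>auto simp: frame_def\<close>)
  then show ?case using assms(1) up_refl by blast
next
  case (insert e E)
  obtain K1 P1 Q1 where 1: "frame d K1 P1 Q1" "up K K1" "cext K K1 (\<lambda>\<theta>. \<forall>(p, q)\<in>E. p \<in> \<theta> \<longleftrightarrow> q \<in> \<theta>)"
    using insert(3)[OF insert(4)[OF insertI2]] by blast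
  obtain u v u' v' where e: "e = ((u, v), (u', v'))" by (cases e, cases "fst e", cases "snd e") simp
  then have uv: "cov K u v" "cov K u' v'" using insert(4)[of u v u' v'] by auto
  obtain K2 P2 Q2 where 2: "frame d K2 P2 Q2" "up K1 K2" "cext K1 K2 (\<lambda>\<theta>. (u, v) \<in> \<theta> \<longleftrightarrow> (u', v') \<in> \<theta>)"
    using identify[OF 1(1) cov_up[OF 1(2) uv(1)] cov_up[OF 1(2) uv(2)]] by blast
  have "cext K K2 (\<lambda>\<theta>. (\<forall>(p, q)\<in>E. p \<in> \<theta> \<longleftrightarrow> q \<in> \<theta>) \<and> ((u, v) \<in> \<theta> \<longleftrightarrow> (u', v') \<in> \<theta>))"
    by (rule cext_trans[OF 1(3) 2(3)]) (use cov_in[OF uv(1)] cov_in[OF uv(2)] in simp)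
  then have "cext K K2 (\<lambda>\<theta>. \<forall>(p, q)\<in>insert e E. p \<in> \<theta> \<longleftrightarrow> q \<in> \<theta>)"
    by (rule cext_cong) (auto simp: e)
  then show ?case using 2(1) up_trans[OF 1(2) 2(2)] by blast
qed

section \<open>Planar diagrams\<close>

locale diagram = bounded_lattice L for L :: "('a, 'm) gorder_scheme" (structure) +
  fixes p :: "'a \<Rightarrow> real \<times> real"
  assumes fin: "finite (carrier L)" and pd: "planar_diagram L p" and nt: "\<bottom> \<noteq> \<top>"
begin

abbreviation h :: "'a \<Rightarrow> real" where "h a \<equiv> snd (p a)"
abbreviation X :: "'a \<Rightarrow> real" where "X a \<equiv> fst (p a)"

lemma covD: "covers L a b \<Longrightarrow> a \<in> carrier L" "covers L a b \<Longrightarrow> b \<in> carrier L"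
  "covers L a b \<Longrightarrow> a \<sqsubseteq> b" "covers L a b \<Longrightarrow> a \<noteq> b" "covers L a b \<Longrightarrow> h a < h b"
  using pd by (auto simp: covers_def lless_eq planar_diagram_def)

lemma h_less: "a \<in> carrier L \<Longrightarrow> b \<in> carrier L \<Longrightarrow> a \<sqsubseteq> b \<Longrightarrow> a \<noteq> b \<Longrightarrow> h a < h b"
  using pd by (auto simp: lless_eq planar_diagram_def)
lemma h_mono: "a \<in> carrier L \<Longrightarrow> b \<in> carrier L \<Longrightarrow> a \<sqsubseteq> b \<Longrightarrow> h a \<le> h b"
  using h_less[of a b] by fastforce
lemma p_inj: "a \<in> carrier L \<Longrightarrow> b \<in> carrier L \<Longrightarrow> p a = p b \<Longrightarrow> a = b"
  using pd by (auto simp: planar_diagram_def inj_on_def)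
lemma no_cross: "covers L a b \<Longrightarrow> covers L c d \<Longrightarrow> (a, b) \<noteq> (c, d) \<Longrightarrow>
   q \<in> closed_segment (p a) (p b) \<Longrightarrow> q \<in> closed_segment (p c) (p d) \<Longrightarrow> q \<in> p ` ({a, b} \<inter> {c, d})"
  using pd unfolding planar_diagram_def by blast

lemma cov_exists:
  assumes "a \<in> carrier L" "b \<in> carrier L" "a \<sqsubseteq> b" "a \<noteq> b"
  shows "\<exists>c. covers L a c \<and> c \<sqsubseteq> b"
  using assms(2-)
proof (induction "card {t \<in> carrier L. a \<sqsubseteq> t \<and> t \<sqsubseteq> b}" arbitrary: b rule: less_induct)
  case less
  show ?case
  proof (cases "covers L a b")
    case True then show ?thesis using less by auto
  next
    case False
    then obtain z where z: "z \<in> carrier L" "a \<sqsubseteq> z" "a \<noteq> z" "z \<sqsubseteq> b" "z \<noteq> b"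
      using less assms(1) by (auto simp: covers_def lless_eq)
    have "{t \<in> carrier L. a \<sqsubseteq> t \<and> t \<sqsubseteq> z} \<subset> {t \<in> carrier L. a \<sqsubseteq> t \<and> t \<sqsubseteq> b}"
    proof
      show "{t \<in> carrier L. a \<sqsubseteq> t \<and> t \<sqsubseteq> z} \<subseteq> {t \<in> carrier L. a \<sqsubseteq> t \<and> t \<sqsubseteq> b}"
        using le_trans[of _ z b] z less by auto
      have "\<not> b \<sqsubseteq> z" using z less by auto
      then show "{t \<in> carrier L. a \<sqsubseteq> t \<and> t \<sqsubseteq> z} \<noteq> {t \<in> carrier L. a \<sqsubseteq> t \<and> t \<sqsubseteq> b}" using less by auto
    qed
    then have "card {t \<in> carrier L. a \<sqsubseteq> t \<and> t \<sqsubseteq> z} < card {t \<in> carrier L. a \<sqsubseteq> t \<and> t \<sqsubseteq> b}"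
      using fin by (intro psubset_card_mono) auto
    from less(1)[OF this z(1,2,3)] obtain c where "covers L a c" "c \<sqsubseteq> z" by blast
    then show ?thesis using le_trans[of c z b] z less covD(2) by blast
  qed
qed

fun path :: "'a list \<Rightarrow> 'a \<Rightarrow> 'a \<Rightarrow> bool" where
  "path [] a b \<longleftrightarrow> False"
| "path [x] a b \<longleftrightarrow> x = a \<and> x = b \<and> x \<in> carrier L"
| "path (x # y # vs) a b \<longleftrightarrow> x = a \<and> covers L x y \<and> path (y # vs) y b"

lemma path_Cons: "path (x # vs) a b \<Longrightarrow> x = a" by (cases vs) auto

lemma path_carrier: "path vs a b \<Longrightarrow> set vs \<subseteq> carrier L"
  by (induction vs a b rule: path.induct) (auto dest: covD)

lemma path_ends: "path vs a b \<Longrightarrow> a \<in> set vs \<and> b \<in> set vs"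
  by (induction vs a b rule: path.induct) auto

lemma path_low: "path vs a b \<Longrightarrow> v \<in> set vs \<Longrightarrow> a \<sqsubseteq> v"
proof (induction vs a b rule: path.induct)
  case (3 x y vs a b)
  then have c: "x = a" "covers L x y" "path (y # vs) y b" by auto
  show ?case
  proof (cases "v = x")
    case True then show ?thesis using c covD by auto
  next
    case False
    then have "y \<sqsubseteq> v" using 3 c by auto
    then show ?thesis using le_trans[of x y v] covD[OF c(2)] c path_carrier[OF 3(2)] 3(3) by auto
  qed
qed auto

lemma path_exists: "a \<in> carrier L \<Longrightarrow> b \<in> carrier L \<Longrightarrow> a \<sqsubseteq> b \<Longrightarrow> \<exists>vs. path vs a b"
proof (induction "card {t \<in> carrier L. a \<sqsubseteq> t}" arbitrary: a rule: less_induct)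
  case less
  show ?case
  proof (cases "a = b")
    case True then show ?thesis using less by (intro exI[of _ "[a]"]) simp
  next
    case False
    then obtain c where c: "covers L a c" "c \<sqsubseteq> b" using cov_exists less by blast
    have "{t \<in> carrier L. c \<sqsubseteq> t} \<subset> {t \<in> carrier L. a \<sqsubseteq> t}"
    proof
      show "{t \<in> carrier L. c \<sqsubseteq> t} \<subseteq> {t \<in> carrier L. a \<sqsubseteq> t}"
        using le_trans[of a c] covD[OF c(1)] by auto
      have "\<not> c \<sqsubseteq> a" using covD[OF c(1)] by auto
      then show "{t \<in> carrier L. c \<sqsubseteq> t} \<noteq> {t \<in> carrier L. a \<sqsubseteq> t}" using less by auto
    qed
    then have "card {t \<in> carrier L. c \<sqsubseteq> t} < card {t \<in> carrier L. a \<sqsubseteq> t}"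
      using fin by (intro psubset_card_mono) auto
    from less(1)[OF this covD(2)[OF c(1)] less(3) c(2)] obtain vs where vs: "path vs c b" by blast
    then obtain vs' where "vs = c # vs'" by (cases vs) (auto dest: path_Cons)
    then have "path (a # vs) a b" using vs c by simp
    then show ?thesis by blast
  qed
qed

lemma path_append: "path (xs @ [m]) a m \<Longrightarrow> path (m # ys) m b \<Longrightarrow> path (xs @ m # ys) a b"
proof (induction xs arbitrary: a)
  case (Cons x xs)
  show ?case
  proof (cases xs)
    case Nil then show ?thesis using Cons by auto
  next
    case C2: (Cons y zs)
    then show ?thesis using Cons by auto
  qed
qed auto

lemma path_snoc: "path vs a b \<Longrightarrow> \<exists>xs. vs = xs @ [b]"
  by (induction vs a b rule: path.induct) auto

lemma path_split: "path (xs @ m # ys) a b \<Longrightarrow> path (xs @ [m]) a m \<and> path (m # ys) m b"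
proof (induction xs arbitrary: a)
  case Nil then show ?case using path_Cons[of m ys a b] path_carrier[of "m # ys" a b] by auto
next
  case (Cons x xs)
  show ?case
  proof (cases xs)
    case Nil then show ?thesis using Cons(2) covD by auto
  next
    case C2: (Cons y zs)
    then show ?thesis using Cons(1)[of y] Cons(2) by auto
  qed
qed

lemma path_compar:
  assumes P: "path vs a b" and v: "v \<in> set vs" "w \<in> set vs" and h: "h v \<le> h w" shows "v \<sqsubseteq> w"
proof -
  have car: "v \<in> carrier L" "w \<in> carrier L" using path_carrier[OF P] v by auto
  obtain xs ys where vs: "vs = xs @ v # ys" using v(1) split_list by metis
  show ?thesis
  proof (cases "w \<in> set (v # ys)")
    case True
    then show ?thesis using path_low[OF conjunct2[OF path_split[OF P[unfolded vs]]]] by blast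
  next
    case False
    then obtain xs1 xs2 where xs: "xs = xs1 @ w # xs2" using v(2) vs split_list[of w xs] by auto
    then have "path (xs1 @ w # (xs2 @ v # ys)) a b" using P vs by simp
    then have "w \<sqsubseteq> v" using path_low[OF conjunct2[OF path_split], of xs1 w "xs2 @ v # ys" a b v] by auto
    then show ?thesis using h_less[OF car(2,1)] h car by (cases "v = w") auto
  qed
qed

text \<open>The polygonal line through the vertices \<open>vs\<close> has abscissa \<open>px vs t\<close> at height \<open>t\<close>.\<close>

definition lin :: "'a \<Rightarrow> 'a \<Rightarrow> real \<Rightarrow> real" where
  "lin a b t = X a + (t - h a) / (h b - h a) * (X b - X a)"

fun px :: "'a list \<Rightarrow> real \<Rightarrow> real" where
  "px [] t = 0"
| "px [x] t = X x"
| "px (x # y # vs) t = (if t \<le> h y then lin x y t else px (y # vs) t)"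

lemma lin_left: "lin a b (h a) = X a" by (simp add: lin_def)
lemma lin_right: "covers L a b \<Longrightarrow> lin a b (h b) = X b" using covD(5)[of a b] by (simp add: lin_def)

lemma px_start: "path (a # vs) a b \<Longrightarrow> px (a # vs) (h a) = X a"
  by (cases vs) (auto simp: lin_left dest: covD(5))

lemma px_cont: "path vs a b \<Longrightarrow> continuous_on {h a..h b} (px vs)"
proof (induction vs a b rule: path.induct)
  case (3 x y vs a b)
  then have c: "x = a" "covers L x y" "path (y # vs) y b" by auto
  have hh: "h x \<le> h y" "h y \<le> h b"
    using covD[OF c(2)] h_mono path_low[OF c(3)] path_ends[OF c(3)] path_carrier[OF c(3)] by auto
  have "continuous_on ({h x..h y} \<union> {h y..h b}) (\<lambda>t. if t \<le> h y then lin x y t else px (y # vs) t)"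
  proof (rule continuous_on_If)
    show "continuous_on {h x..h y} (lin x y)" unfolding lin_def
      using covD(5)[OF c(2)] by (intro continuous_intros) auto
    show "continuous_on {h y..h b} (px (y # vs))" using 3 c by simp
  qed (use lin_right[OF c(2)] px_start[OF c(3)] in auto)
  moreover have "{h x..h y} \<union> {h y..h b} = {h a..h b}" using hh c by auto
  ultimately show ?case by simp
qed auto

definition consec :: "'a list \<Rightarrow> 'a \<Rightarrow> 'a \<Rightarrow> bool" where
  "consec vs c d \<longleftrightarrow> (\<exists>xs ys. vs = xs @ c # d # ys)"

lemma consec_cov: "path vs a b \<Longrightarrow> consec vs c d \<Longrightarrow> covers L c d"
proof -
  assume P: "path vs a b" and "consec vs c d"
  then obtain xs ys where "vs = xs @ c # d # ys" by (auto simp: consec_def)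
  then show ?thesis using path_split[of xs c "d # ys" a b] P by auto
qed

lemma px_late: "path (xs @ m # ys) a b \<Longrightarrow> h m \<le> t \<Longrightarrow> px (xs @ m # ys) t = px (m # ys) t"
proof (induction xs arbitrary: a)
  case (Cons x xs)
  show ?case
  proof (cases xs)
    case Nil
    then show ?thesis using Cons(2,3) px_start[of m ys b] lin_right[of x m] by auto
  next
    case C2: (Cons y zs)
    then have P: "path (xs @ m # ys) y b" "covers L x y" using Cons(2) by auto
    have "m \<in> set (xs @ m # ys)" by simp
    then have "h y \<le> h m"
      using h_mono[OF covD(2)[OF P(2)]] path_low[OF P(1)] path_carrier[OF P(1)] by blast
    then have "t \<le> h y \<Longrightarrow> t = h y" using Cons(3) by simp
    then have "px ((x # xs) @ m # ys) t = px (xs @ m # ys) t"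
      using C2 px_start[of y "zs @ m # ys" b] P lin_right[OF P(2)] by (cases "t \<le> h y") simp_all
    then show ?thesis using Cons(1)[OF P(1) Cons(3)] by simp
  qed
qed auto

lemma px_early: "path (xs @ m # ys) a b \<Longrightarrow> t \<le> h m \<Longrightarrow> xs \<noteq> [] \<Longrightarrow> px (xs @ m # ys) t = px (xs @ [m]) t"
proof (induction xs arbitrary: a)
  case (Cons x xs)
  show ?case
  proof (cases xs)
    case Nil then show ?thesis using Cons by auto
  next
    case C2: (Cons y zs)
    then have P: "path (xs @ m # ys) y b" using Cons(2) by auto
    show ?thesis using Cons(1)[OF P Cons(3)] C2 by auto
  qed
qed auto

lemma px_consec: assumes P: "path vs a b" and c: "consec vs c d" and t: "h c \<le> t" "t \<le> h d" shows "px vs t = lin c d t"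
proof -
  obtain xs ys where vs: "vs = xs @ c # d # ys" using c by (auto simp: consec_def)
  then show ?thesis using px_late[of xs c "d # ys" a b t] P t by simp
qed

lemma px_seg: "path vs a b \<Longrightarrow> a \<noteq> b \<Longrightarrow> h a \<le> t \<Longrightarrow> t \<le> h b \<Longrightarrow> \<exists>c d. consec vs c d \<and> h c \<le> t \<and> t \<le> h d"
proof (induction vs a b rule: path.induct)
  case (3 x y vs a b)
  then have c: "x = a" "covers L x y" "path (y # vs) y b" by auto
  show ?case
  proof (cases "t \<le> h y")
    case True
    moreover have "consec (x # y # vs) x y" unfolding consec_def by (intro exI[of _ "[]"] exI[of _ vs]) simp
    ultimately show ?thesis using 3(4) c by blast
  next
    case False
    then have "y \<noteq> b" using 3(5) by auto
    then obtain c' d' where "consec (y # vs) c' d'" "h c' \<le> t" "t \<le> h d'" using 3 c False by auto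
    moreover from this obtain xs ys where "y # vs = xs @ c' # d' # ys" by (auto simp: consec_def)
    then have "consec (x # y # vs) c' d'" unfolding consec_def by (intro exI[of _ "x # xs"] exI[of _ ys]) simp
    ultimately show ?thesis by blast
  qed
qed auto

lemma consec_set: "consec vs c d \<Longrightarrow> c \<in> set vs \<and> d \<in> set vs" by (auto simp: consec_def)

lemma lin_segment:
  assumes c: "covers L a b" and t: "h a \<le> t" "t \<le> h b" shows "(lin a b t, t) \<in> closed_segment (p a) (p b)"
proof -
  let ?r = "(t - h a) / (h b - h a)"
  have hh: "h a < h b" using covD(5)[OF c] .
  then obtain r where r: "r = ?r" "r * (h b - h a) = t - h a" by simp
  have "0 \<le> r" "r \<le> 1" using r(1) t hh by auto
  moreover have "(lin a b t, t) = (1 - r) *\<^sub>R p a + r *\<^sub>R p b"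
    using r(2) by (simp add: prod_eq_iff lin_def r(1)[symmetric]) (simp add: algebra_simps)
  ultimately show ?thesis unfolding closed_segment_def by blast
qed

lemma segment_lin:
  assumes c: "covers L a b" and q: "q \<in> closed_segment (p a) (p b)"
  shows "h a \<le> snd q" "snd q \<le> h b" "fst q = lin a b (snd q)"
proof -
  obtain r where r: "0 \<le> r" "r \<le> 1" "q = (1 - r) *\<^sub>R p a + r *\<^sub>R p b" using q unfolding closed_segment_def by blast
  have hh: "h a < h b" using covD(5)[OF c] .
  have s: "snd q = h a + r * (h b - h a)" unfolding r(3) by (simp add: algebra_simps)
  show "h a \<le> snd q" using s r hh by simp
  have "r * (h b - h a) \<le> 1 * (h b - h a)" using r hh by (intro mult_right_mono) auto
  then show "snd q \<le> h b" using s by simp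
  have "(snd q - h a) / (h b - h a) = r" using s hh by simp
  then have "lin a b (snd q) = X a + r * (X b - X a)" by (simp add: lin_def)
  moreover have "fst q = X a + r * (X b - X a)" unfolding r(3) by (simp add: algebra_simps)
  ultimately show "fst q = lin a b (snd q)" by simp
qed

definition full :: "'a list \<Rightarrow> bool" where "full vs \<longleftrightarrow> path vs \<bottom> \<top>"

lemma full_seg: "full vs \<Longrightarrow> x \<in> carrier L \<Longrightarrow> \<exists>c d. consec vs c d \<and> h c \<le> h x \<and> h x \<le> h d"
  using px_seg[of vs \<bottom> \<top> "h x"] nt h_mono[of \<bottom> x] h_mono[of x \<top>] by (auto simp: full_def)

lemma px_vertex: assumes "full vs" "v \<in> set vs" shows "px vs (h v) = X v"
proof -
  obtain xs ys where vs: "vs = xs @ v # ys" using assms(2) split_list by metis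
  then show ?thesis using px_late[of xs v ys \<bottom> \<top> "h v"] assms(1) px_start[of v ys \<top>] path_split[of xs v ys \<bottom> \<top>]
    by (auto simp: full_def)
qed

lemma full_compar: "full vs \<Longrightarrow> v \<in> set vs \<Longrightarrow> w \<in> set vs \<Longrightarrow> h v \<le> h w \<Longrightarrow> v \<sqsubseteq> w"
  unfolding full_def by (rule path_compar)
lemma full_carrier: "full vs \<Longrightarrow> v \<in> set vs \<Longrightarrow> v \<in> carrier L"
  using path_carrier unfolding full_def by blast

text \<open>Two maximal chains that change sides do so at a common vertex.\<close>

lemma crossing:
  assumes P: "full P" and Q: "full Q" and x: "x \<in> carrier L" and y: "y \<in> carrier L" and xy: "h x < h y"
    and 1: "px P (h x) < px Q (h x)" and 2: "px Q (h y) < px P (h y)"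
  shows "\<exists>w. w \<in> set P \<and> w \<in> set Q \<and> h x < h w \<and> h w < h y"
proof -
  have hb: "h \<bottom> \<le> h x" "h y \<le> h \<top>" using h_mono x y by auto
  have sub: "{h x..h y} \<subseteq> {h \<bottom>..h \<top>}" using hb by auto
  have cont: "continuous_on {h x..h y} (\<lambda>t. px P t - px Q t)"
    using continuous_on_subset[OF px_cont sub, of P] continuous_on_subset[OF px_cont sub, of Q] P Q
    unfolding full_def by (intro continuous_on_diff)
  obtain t where t: "h x \<le> t" "t \<le> h y" "px P t - px Q t = 0"
    using IVT'[where f = "\<lambda>t. px P t - px Q t" and a = "h x" and y = 0 and b = "h y"] 1 2 xy cont by auto
  have t': "h x < t" "t < h y" using t 1 2 by (auto simp: order_less_le)
  obtain a b where ab: "consec P a b" "h a \<le> t" "t \<le> h b" using px_seg[of P \<bottom> \<top> t] P nt t hb by (auto simp: full_def)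
  obtain c d where cd: "consec Q c d" "h c \<le> t" "t \<le> h d" using px_seg[of Q \<bottom> \<top> t] Q nt t hb by (auto simp: full_def)
  have PP: "path P \<bottom> \<top>" and QQ: "path Q \<bottom> \<top>" using P Q by (auto simp: full_def)
  have cab: "covers L a b" and ccd: "covers L c d" using consec_cov PP QQ ab cd by blast+
  have e: "lin a b t = lin c d t" using px_consec[OF PP ab] px_consec[OF QQ cd] t by simp
  \<comment> \<open>An edge common to both chains must start above \<open>h x\<close>, since
    otherwise the lines would agree at that height. Two different edges meet only in a common end,
    by planarity.\<close>
  show ?thesis
  proof (cases "(a, b) = (c, d)")
    case True
    have "h x < h a"
    proof (rule ccontr)
      assume "\<not> h x < h a"
      then have "px P (h x) = px Q (h x)"
        using px_consec[OF PP ab(1), of "h x"] px_consec[OF QQ cd(1), of "h x"] True t' ab by auto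
      then show False using 1 by simp
    qed
    then show ?thesis using True ab cd t' consec_set by (intro exI[of _ a]) auto
  next
    case False
    have "(lin a b t, t) \<in> p ` ({a, b} \<inter> {c, d})"
      using no_cross[OF cab ccd False lin_segment[OF cab ab(2,3)]] lin_segment[OF ccd cd(2,3)] e by simp
    then obtain w where w: "w \<in> {a, b} \<inter> {c, d}" "(lin a b t, t) = p w" by (elim imageE) simp
    have "h w = t" using arg_cong[OF w(2), of snd] by simp
    moreover have "w \<in> {a, b}" "w \<in> {c, d}" using w(1) by auto
    ultimately show ?thesis using consec_set[OF ab(1)] consec_set[OF cd(1)] t' by (intro exI[of _ w]) auto
  qed
qed

text \<open>As \<open>x\<close> is not the top, it is the lower end of some edge, and planarity
  forbids an edge not ending in \<open>x\<close> to run through its point.\<close>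

lemma px_off: assumes P: "full P" and x: "x \<in> carrier L" "x \<notin> set P" shows "px P (h x) \<noteq> X x"
proof
  assume e: "px P (h x) = X x"
  have PP: "path P \<bottom> \<top>" using P by (simp add: full_def)
  obtain a b where ab: "consec P a b" "h a \<le> h x" "h x \<le> h b" using full_seg[OF P x(1)] by blast
  have cab: "covers L a b" using consec_cov[OF PP ab(1)] .
  have "x \<noteq> \<top>" using x path_ends[OF PP] by auto
  then obtain c where c: "covers L x c" using cov_exists[of x \<top>] x by auto
  have "lin a b (h x) = X x" using px_consec[OF PP ab] e by simp
  then have "p x \<in> closed_segment (p a) (p b)" using lin_segment[OF cab ab(2,3)] by (metis prod.collapse)
  moreover have "(a, b) \<noteq> (x, c)" using consec_set[OF ab(1)] x by auto
  ultimately have "p x \<in> p ` ({a, b} \<inter> {x, c})" using no_cross[OF cab c] by simp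
  then obtain w where w: "w \<in> {a, b}" "p x = p w" by blast
  then have "x = w" using p_inj[OF x(1)] covD[OF cab] by auto
  then show False using w consec_set[OF ab(1)] x by auto
qed

section \<open>The left-right relation of incomparable elements\<close>

definition par :: "'a \<Rightarrow> 'a \<Rightarrow> bool" where
  "par x y \<longleftrightarrow> x \<in> carrier L \<and> y \<in> carrier L \<and> \<not> x \<sqsubseteq> y \<and> \<not> y \<sqsubseteq> x"
text \<open>The left-right relation of Kelly and Rival: a maximal chain through \<open>y\<close>
  passes to the right of \<open>x\<close> at the height of \<open>x\<close>. The choice of the chain
  is immaterial by \<open>lft_iff1\<close>.\<close>

definition lft :: "'a \<Rightarrow> 'a \<Rightarrow> bool" where
  "lft x y \<longleftrightarrow> par x y \<and> (\<exists>P. full P \<and> y \<in> set P \<and> X x < px P (h x))"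

lemma par_sym: "par x y \<Longrightarrow> par y x" by (auto simp: par_def)

lemma par_off: "par x y \<Longrightarrow> full P \<Longrightarrow> y \<in> set P \<Longrightarrow> x \<notin> set P"
  using full_compar[of P x y] full_compar[of P y x] by (cases "h x \<le> h y") (auto simp: par_def)

text \<open>If the two chains disagreed about the sides of \<open>x\<close> and \<open>y\<close>,
  they would cross between the two heights, by \<open>crossing\<close> in a common vertex. Such a
  vertex lies between \<open>x\<close> and \<open>y\<close> in the order and makes them
  comparable.\<close>

lemma side_switch:
  assumes xy: "par x y" and P: "full P" "y \<in> set P" and Q: "full Q" "x \<in> set Q"
  shows "X x < px P (h x) \<longleftrightarrow> px Q (h y) < X y"
proof -
  have car: "x \<in> carrier L" "y \<in> carrier L" using xy by (auto simp: par_def)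
  note vx = px_vertex[OF Q] and vy = px_vertex[OF P]
  have nx: "px P (h x) \<noteq> X x" using px_off[OF P(1) car(1) par_off[OF xy P]] .
  have ny: "px Q (h y) \<noteq> X y" using px_off[OF Q(1) car(2) par_off[OF par_sym[OF xy] Q]] .
  have no1: False if "w \<in> set P" "w \<in> set Q" "h x < h w" "h w < h y" for w
    using full_compar[OF Q(1) Q(2) that(2)] full_compar[OF P(1) that(1) P(2)]
      le_trans[of x w y] car full_carrier[OF P(1) that(1)] that xy by (auto simp: par_def)
  have no2: False if "w \<in> set P" "w \<in> set Q" "h y < h w" "h w < h x" for w
    using full_compar[OF P(1) P(2) that(1)] full_compar[OF Q(1) that(2) Q(2)]
      le_trans[of y w x] car full_carrier[OF P(1) that(1)] that xy by (auto simp: par_def)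
  consider "h x = h y" | "h x < h y" | "h y < h x" by linarith
  then show ?thesis
  proof cases
    case 1 then show ?thesis using vx vy by auto
  next
    case 2
    show ?thesis
      using crossing[OF P(1) Q(1) car 2] crossing[OF Q(1) P(1) car 2] no1 vx vy nx ny
      by (smt (verit, ccfv_threshold))
  next
    case 3
    show ?thesis
      using crossing[OF P(1) Q(1) car(2,1) 3] crossing[OF Q(1) P(1) car(2,1) 3] no2 vx vy nx ny
      by (smt (verit, ccfv_threshold))
  qed
qed

lemma full_through2:
  assumes "x \<in> carrier L" "y \<in> carrier L" "x \<sqsubseteq> y" shows "\<exists>P. full P \<and> x \<in> set P \<and> y \<in> set P"
proof -
  obtain as where a: "path as \<bottom> x" using path_exists[of \<bottom> x] assms by auto
  obtain bs where b: "path bs x y" using path_exists assms by blast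
  obtain cs where c: "path cs y \<top>" using path_exists[of y \<top>] assms by auto
  obtain as' where as: "as = as' @ [x]" using path_snoc[OF a] by blast
  obtain bs' where bs: "bs = bs' @ [y]" using path_snoc[OF b] by blast
  obtain cs' where cs: "cs = y # cs'" using c by (cases cs) (auto dest: path_Cons)
  have bc: "path (bs' @ y # cs') x \<top>" using path_append[of bs' y x cs' \<top>] b c bs cs by simp
  then obtain ds where ds: "bs' @ y # cs' = x # ds" by (cases "bs' @ y # cs'") (auto dest: path_Cons)
  then have "path (as' @ x # ds) \<bottom> \<top>" using path_append[of as' x \<bottom> ds \<top>] a bc as by simp
  moreover have "y \<in> set (as' @ x # ds)" using ds by (metis UnCI in_set_conv_decomp set_append)
  ultimately show ?thesis unfolding full_def by (intro exI[of _ "as' @ x # ds"]) auto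
qed

lemma full_through: "x \<in> carrier L \<Longrightarrow> \<exists>P. full P \<and> x \<in> set P"
  using full_through2[of x x] by auto

text \<open>All chains through \<open>y\<close> are compared with one chain through \<open>x\<close>
  by \<open>side_switch\<close>, so they agree.\<close>

lemma lft_iff1: assumes "par x y" "full P" "y \<in> set P" shows "lft x y \<longleftrightarrow> X x < px P (h x)"
proof
  assume "lft x y"
  then obtain R where R: "full R" "y \<in> set R" "X x < px R (h x)" unfolding lft_def by blast
  obtain Q where Q: "full Q" "x \<in> set Q" using full_through[of x] assms(1) by (auto simp: par_def)
  show "X x < px P (h x)" using side_switch[OF assms Q] side_switch[OF assms(1) R(1,2) Q] R(3) by simp
qed (use assms in \<open>auto simp: lft_def\<close>)

lemma lft_iff2: assumes "par x y" "full Q" "x \<in> set Q" shows "lft x y \<longleftrightarrow> px Q (h y) < X y"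
proof -
  obtain P where P: "full P" "y \<in> set P" using full_through[of y] assms(1) by (auto simp: par_def)
  show ?thesis using side_switch[OF assms(1) P assms(2,3)] lft_iff1[OF assms(1) P] by simp
qed

lemma lft_par: "lft x y \<Longrightarrow> par x y" by (simp add: lft_def)

lemma lft_asym: assumes "lft x y" shows "\<not> lft y x"
proof -
  note xy = lft_par[OF assms]
  obtain P where P: "full P" "y \<in> set P" using full_through[of y] xy by (auto simp: par_def)
  show ?thesis using lft_iff1[OF xy P] lft_iff2[OF par_sym[OF xy] P] assms by auto
qed

lemma lft_total: assumes xy: "par x y" shows "lft x y \<or> lft y x"
proof -
  obtain P where P: "full P" "y \<in> set P" using full_through[of y] xy by (auto simp: par_def)
  have "px P (h x) \<noteq> X x" using px_off[OF P(1) _ par_off[OF xy P]] xy by (simp add: par_def)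
  then show ?thesis using lft_iff1[OF xy P] lft_iff2[OF par_sym[OF xy] P] by auto
qed

text \<open>A single maximal chain through \<open>y\<close> and \<open>z\<close> tests both
  relations.\<close>

lemma lft_cong_right: assumes "lft x y" "par x z" "y \<sqsubseteq> z \<or> z \<sqsubseteq> y" shows "lft x z"
proof -
  obtain P where P: "full P" "y \<in> set P" "z \<in> set P"
    using full_through2[of y z] full_through2[of z y] assms lft_par[OF assms(1)] by (auto simp: par_def)
  show ?thesis using lft_iff1[OF lft_par[OF assms(1)] P(1,2)] lft_iff1[OF assms(2) P(1,3)] assms(1) by simp
qed

lemma lft_cong_left: assumes "lft x y" "par z y" "x \<sqsubseteq> z \<or> z \<sqsubseteq> x" shows "lft z y"
proof -
  obtain P where P: "full P" "x \<in> set P" "z \<in> set P"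
    using full_through2[of x z] full_through2[of z x] assms lft_par[OF assms(1)] by (auto simp: par_def)
  show ?thesis using lft_iff2[OF lft_par[OF assms(1)] P(1,2)] lft_iff2[OF assms(2) P(1,3)] assms(1) by simp
qed

text \<open>A chain through comparable \<open>x\<close> and \<open>z\<close> would pass
  \<open>y\<close> both on its left and on its right.\<close>

lemma lft_par_trans: assumes xy: "lft x y" and yz: "lft y z" shows "par x z"
proof (rule ccontr)
  have car: "x \<in> carrier L" "z \<in> carrier L" using lft_par xy yz by (auto simp: par_def)
  assume "\<not> par x z"
  then have "x \<sqsubseteq> z \<or> z \<sqsubseteq> x" using car by (auto simp: par_def)
  then obtain P where P: "full P" "x \<in> set P" "z \<in> set P"
    using full_through2[of x z] full_through2[of z x] car by auto
  show False using lft_iff2[OF lft_par[OF xy] P(1,2)] lft_iff1[OF lft_par[OF yz] P(1,3)] xy yz by auto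
qed

text \<open>Choose maximal chains \<open>E\<close> through \<open>x\<close> and \<open>C\<close> through \<open>y\<close> that coincide below \<open>x \<sqinter> y\<close> and
  above \<open>x \<squnion> y\<close>; if \<open>x\<close> is left of \<open>y\<close>, they cannot change sides, so no element lies to the
  right of \<open>C\<close> and to the left of \<open>E\<close>.\<close>

lemma lft_trans: assumes xy: "lft x y" and yz: "lft y z" shows "lft x z"
proof (rule ccontr)
  assume n: "\<not> lft x z"
  note pxy = lft_par[OF xy] and pyz = lft_par[OF yz] and pxz = lft_par_trans[OF xy yz]
  have zx: "lft z x" using lft_total[OF pxz] n by blast
  have car: "x \<in> carrier L" "y \<in> carrier L" "z \<in> carrier L" using pxy pyz by (auto simp: par_def)
  let ?m = "x \<sqinter> y" and ?j = "x \<squnion> y"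
  have mj: "?m \<in> carrier L" "?j \<in> carrier L" "?m \<sqsubseteq> x" "?m \<sqsubseteq> y" "x \<sqsubseteq> ?j" "y \<sqsubseteq> ?j"
    using car meet_left meet_right join_left join_right by auto
  obtain as where a: "path as \<bottom> ?m" using path_exists[of \<bottom> ?m] mj by auto
  obtain ts where t: "path ts ?j \<top>" using path_exists[of ?j \<top>] mj by auto
  obtain as' where as: "as = as' @ [?m]" using path_snoc[OF a] by blast
  obtain ts' where ts: "ts = ?j # ts'" using t by (cases ts) (auto dest: path_Cons)
  have mid: "\<exists>bs. path (as' @ ?m # bs @ ?j # ts') \<bottom> \<top> \<and> v \<in> set bs"
    if v: "v \<in> carrier L" "?m \<sqsubseteq> v" "v \<sqsubseteq> ?j" "v \<noteq> ?m" "v \<noteq> ?j" for v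
  proof -
    obtain bs where b: "path bs ?m v" using path_exists[of ?m v] v mj by auto
    obtain cs where c: "path cs v ?j" using path_exists[of v ?j] v mj by auto
    obtain bs0 where bs: "bs = bs0 @ [v]" using path_snoc[OF b] by blast
    then obtain bs' where bs': "bs0 = ?m # bs'" using b v(4) by (cases bs0) (auto dest: path_Cons)
    obtain cs0 where cs: "cs = cs0 @ [?j]" using path_snoc[OF c] by blast
    then obtain cs' where cs': "cs0 = v # cs'" using c v(5) by (cases cs0) (auto dest: path_Cons)
    have "path ((v # cs') @ ?j # ts') v \<top>" using path_append[of "v # cs'" ?j v ts' \<top>] c t cs cs' ts by simp
    then have "path ((?m # bs') @ v # cs' @ ?j # ts') ?m \<top>"
      using path_append[of "?m # bs'" v ?m "cs' @ ?j # ts'" \<top>] b bs bs' by simp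
    then have "path (as' @ ?m # (bs' @ v # cs' @ ?j # ts')) \<bottom> \<top>"
      using path_append[of as' ?m \<bottom> "bs' @ v # cs' @ ?j # ts'" \<top>] a as by simp
    then show ?thesis by (intro exI[of _ "bs' @ v # cs'"]) simp
  qed
  have ne: "x \<noteq> ?m" "x \<noteq> ?j" "y \<noteq> ?m" "y \<noteq> ?j" using mj pxy by (auto simp: par_def)
  obtain es where es: "path (as' @ ?m # es @ ?j # ts') \<bottom> \<top>" "x \<in> set es" using mid[of x] mj car ne by blast
  obtain cs where cs: "path (as' @ ?m # cs @ ?j # ts') \<bottom> \<top>" "y \<in> set cs" using mid[of y] mj car ne by blast
  let ?E = "as' @ ?m # es @ ?j # ts'" and ?C = "as' @ ?m # cs @ ?j # ts'"
  have E: "full ?E" "x \<in> set ?E" and C: "full ?C" "y \<in> set ?C" using es cs by (auto simp: full_def)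
  have late: "px ?E t = px ?C t" if "h ?j \<le> t" for t
    using px_late[of "as' @ ?m # es" ?j ts' \<bottom> \<top> t] px_late[of "as' @ ?m # cs" ?j ts' \<bottom> \<top> t] es(1) cs(1) that by simp
  have early: "px ?E t = px ?C t" if "t < h ?m" "h \<bottom> \<le> t" for t
  proof -
    \<comment> \<open>\<open>px_early\<close> asks for a proper initial segment. Without one the
      meet is the bottom, and no admissible height lies below it.\<close>
    have "as' \<noteq> []"
    proof
      assume "as' = []"
      then have "?m = \<bottom>" using a as path_Cons by auto
      then show False using that by auto
    qed
    then show ?thesis
      using px_early[of as' ?m "es @ ?j # ts'" \<bottom> \<top> t] px_early[of as' ?m "cs @ ?j # ts'" \<bottom> \<top> t] es(1) cs(1) that by simp
  qed
  have Ex: "px ?E (h x) < px ?C (h x)" using lft_iff1[OF pxy C] xy px_vertex[OF E] by simp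
  have Cz: "px ?C (h z) < px ?E (h z)"
    using lft_iff2[OF pyz C] yz lft_iff1[OF lft_par[OF zx] E] zx by auto
  consider "h x = h z" | "h x < h z" | "h z < h x" by linarith
  then show False
  proof cases
    case 1 then show False using Ex Cz by simp
  next
    case 2
    obtain w where w: "w \<in> set ?E" "w \<in> set ?C" "h x < h w" "h w < h z" using crossing[OF E(1) C(1) car(1,3) 2 Ex Cz] by blast
    have wc: "w \<in> carrier L" using full_carrier[OF E(1) w(1)] .
    have xw: "x \<sqsubseteq> w" using full_compar[OF E w(1)] w by auto
    \<comment> \<open>A common vertex above \<open>x\<close> is also above \<open>y\<close>, since
      it is comparable with \<open>y\<close> on the chain through \<open>y\<close> and cannot lie
      below it. So it lies above \<open>x \<squnion> y\<close>, from where on both chains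
      coincide.\<close>
    have "y \<sqsubseteq> w"
    proof (rule ccontr)
      assume "\<not> y \<sqsubseteq> w"
      then have "w \<sqsubseteq> y" using full_compar[OF C(1) C(2) w(2)] full_compar[OF C(1) w(2) C(2)] by linarith
      then show False using le_trans[OF xw _ car(1) wc car(2)] pxy by (auto simp: par_def)
    qed
    then have "h ?j \<le> h w" using h_mono join_le[OF xw _ car(1,2) wc] mj wc by auto
    then show False using late[of "h z"] w Cz by auto
  next
    case 3
    obtain w where w: "w \<in> set ?C" "w \<in> set ?E" "h z < h w" "h w < h x" using crossing[OF C(1) E(1) car(3,1) 3 Cz Ex] by blast
    have wc: "w \<in> carrier L" using full_carrier[OF E(1) w(2)] .
    have wx: "w \<sqsubseteq> x" using full_compar[OF E(1) w(2) E(2)] w by auto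
    have "w \<sqsubseteq> y"
    proof (rule ccontr)
      assume "\<not> w \<sqsubseteq> y"
      then have "y \<sqsubseteq> w" using full_compar[OF C(1) C(2) w(1)] full_compar[OF C(1) w(1) C(2)] by linarith
      then show False using le_trans[OF _ wx car(2) wc car(1)] pxy by (auto simp: par_def)
    qed
    then have "h w \<le> h ?m" using h_mono meet_le[OF wx _ car(1,2) wc] mj wc by auto
    then show False using early[of "h z"] w Cz h_mono[of \<bottom> z] car by auto
  qed
qed

lemma edge_full: assumes "covers L a b" shows "\<exists>P. full P \<and> consec P a b"
proof -
  note c = covD[OF assms]
  obtain as where a: "path as \<bottom> a" using path_exists[of \<bottom> a] c by auto
  obtain cs where b: "path cs b \<top>" using path_exists[of b \<top>] c by auto
  obtain as' where as: "as = as' @ [a]" using path_snoc[OF a] by blast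
  obtain cs' where cs: "cs = b # cs'" using b by (cases cs) (auto dest: path_Cons)
  have "path (a # b # cs') a \<top>" using assms b cs by simp
  then have "path (as' @ a # b # cs') \<bottom> \<top>" using path_append[of as' a \<bottom> "b # cs'" \<top>] a as by simp
  then show ?thesis unfolding full_def consec_def by blast
qed

text \<open>An edge through a point beside \<open>x\<close> cannot have \<open>x\<close> between its
  ends in the order, while their heights enclose that of \<open>x\<close>; so one of the ends is
  incomparable with \<open>x\<close>. A maximal chain containing the edge passes through the
  point.\<close>

lemma boundary_aux:
  assumes x: "x \<in> carrier L" and ab: "covers L a b" and q: "q \<in> closed_segment (p a) (p b)" "snd q = h x" "fst q \<noteq> X x"
  shows "\<exists>y P. par x y \<and> full P \<and> y \<in> set P \<and> px P (h x) = fst q"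
proof -
  note c = covD[OF ab] and s = segment_lin[OF ab q(1)]
  obtain P where P: "full P" "consec P a b" using edge_full[OF ab] by blast
  have PP: "path P \<bottom> \<top>" using P by (simp add: full_def)
  have px: "px P (h x) = fst q" using px_consec[OF PP P(2)] s q by simp
  have ne: "x \<notin> set P" using px_vertex[OF P(1)] px q by auto
  have "\<not> (a \<sqsubseteq> x \<and> x \<sqsubseteq> b)" using ab x ne consec_set[OF P(2)] by (auto simp: covers_def lless_eq)
  moreover have "\<not> x \<sqsubseteq> a" using h_less[OF x c(1)] s q ne consec_set[OF P(2)] by auto
  moreover have "\<not> b \<sqsubseteq> x" using h_less[OF c(2) x] s q ne consec_set[OF P(2)] by auto
  ultimately have "par x a \<or> par x b" using x c by (auto simp: par_def)
  then show ?thesis using P px consec_set[OF P(2)] by blast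
qed

lemma boundary_aux2:
  assumes x: "x \<in> carrier L" and P: "full P"
  shows "\<exists>a b q. covers L a b \<and> q \<in> closed_segment (p a) (p b) \<and> snd q = h x \<and> fst q = px P (h x)"
proof -
  have PP: "path P \<bottom> \<top>" using P by (simp add: full_def)
  obtain a b where ab: "consec P a b" "h a \<le> h x" "h x \<le> h b" using full_seg[OF P x] by blast
  have c: "covers L a b" using consec_cov[OF PP ab(1)] .
  show ?thesis using c lin_segment[OF c ab(2,3)] px_consec[OF PP ab]
    by (intro exI[of _ a] exI[of _ b] exI[of _ "(lin a b (h x), h x)"]) auto
qed

text \<open>Translates the geometric boundary into order-theoretic terms: a point of the drawing to
  the left of \<open>x\<close> lies on a maximal chain through some element that is left of
  \<open>x\<close>, and conversely.\<close>

lemma left_boundary_iff: "x \<in> left_boundary L p \<longleftrightarrow> x \<in> carrier L \<and> (\<forall>y. \<not> lft y x)"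
proof (intro iffI conjI allI notI)
  assume x: "x \<in> left_boundary L p"
  then show xc: "x \<in> carrier L" by (simp add: left_boundary_def)
  fix y assume y: "lft y x"
  obtain P where P: "full P" "y \<in> set P" using full_through[of y] lft_par[OF y] by (auto simp: par_def)
  have "px P (h x) < X x" using lft_iff2[OF lft_par[OF y] P] y by simp
  then show False using boundary_aux2[OF xc P(1)] x unfolding left_boundary_def by fastforce
next
  assume x: "x \<in> carrier L \<and> (\<forall>y. \<not> lft y x)"
  have "X x \<le> fst q" if q: "covers L a b" "q \<in> closed_segment (p a) (p b)" "snd q = h x" for a b q
  proof (rule ccontr)
    assume n: "\<not> X x \<le> fst q"
    then obtain y P where y: "par x y" "full P" "y \<in> set P" "px P (h x) = fst q"
      using boundary_aux[OF _ q] x by auto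
    then have "lft y x" using lft_iff2[OF par_sym[OF y(1)] y(2,3)] n by simp
    then show False using x by blast
  qed
  then show "x \<in> left_boundary L p" using x by (auto simp: left_boundary_def)
qed

lemma right_boundary_iff: "x \<in> right_boundary L p \<longleftrightarrow> x \<in> carrier L \<and> (\<forall>y. \<not> lft x y)"
proof (intro iffI conjI allI notI)
  assume x: "x \<in> right_boundary L p"
  then show xc: "x \<in> carrier L" by (simp add: right_boundary_def)
  fix y assume y: "lft x y"
  obtain P where P: "full P" "y \<in> set P" using full_through[of y] lft_par[OF y] by (auto simp: par_def)
  have "X x < px P (h x)" using lft_iff1[OF lft_par[OF y] P] y by simp
  then show False using boundary_aux2[OF xc P(1)] x unfolding right_boundary_def by fastforce
next
  assume x: "x \<in> carrier L \<and> (\<forall>y. \<not> lft x y)"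
  have "fst q \<le> X x" if q: "covers L a b" "q \<in> closed_segment (p a) (p b)" "snd q = h x" for a b q
  proof (rule ccontr)
    assume n: "\<not> fst q \<le> X x"
    then obtain y P where y: "par x y" "full P" "y \<in> set P" "px P (h x) = fst q"
      using boundary_aux[OF _ q] x by auto
    then have "lft x y" using lft_iff1[OF y(1,2,3)] n by simp
    then show False using x by blast
  qed
  then show "x \<in> right_boundary L p" using x by (auto simp: right_boundary_def)
qed

text \<open>The order is the intersection of the linear orders \<open>le1\<close> and \<open>le2\<close>, whence the ranks in these
  embed the lattice in the plane.\<close>

definition le1 :: "'a \<Rightarrow> 'a \<Rightarrow> bool" where "le1 x y \<longleftrightarrow> x \<sqsubseteq> y \<or> lft x y"
definition le2 :: "'a \<Rightarrow> 'a \<Rightarrow> bool" where "le2 x y \<longleftrightarrow> x \<sqsubseteq> y \<or> lft y x"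
definition rk :: "('a \<Rightarrow> 'a \<Rightarrow> bool) \<Rightarrow> 'a \<Rightarrow> real" where "rk r x = real (card {t \<in> carrier L. r t x})"
definition emb :: "'a \<Rightarrow> real \<times> real" where "emb x = (rk le1 x, rk le2 x)"

text \<open>In the mixed cases \<open>z \<sqsubseteq> x\<close> would make the left-right pair
  comparable. So either \<open>x \<sqsubseteq> z\<close>, or \<open>x\<close> and \<open>z\<close>
  are incomparable and \<open>lft_cong_left\<close> or \<open>lft_cong_right\<close>
  applies.\<close>

lemma le1_trans: assumes c: "x \<in> carrier L" "y \<in> carrier L" "z \<in> carrier L" and "le1 x y" "le1 y z" shows "le1 x z"
proof -
  consider "x \<sqsubseteq> y" "y \<sqsubseteq> z" | "x \<sqsubseteq> y" "lft y z" | "lft x y" "y \<sqsubseteq> z" | "lft x y" "lft y z"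
    using assms by (auto simp: le1_def)
  then show ?thesis
  proof cases
    case 1 then show ?thesis using le_trans c by (auto simp: le1_def)
  next
    case 2
    then show ?thesis using lft_cong_left[OF 2(2), of x] lft_par[OF 2(2)] c le_trans[of z x y]
      by (auto simp: le1_def par_def)
  next
    case 3
    then show ?thesis using lft_cong_right[OF 3(1), of z] lft_par[OF 3(1)] c le_trans[of y z x]
      by (auto simp: le1_def par_def)
  next
    case 4 then show ?thesis using lft_trans by (auto simp: le1_def)
  qed
qed

lemma le2_trans: assumes c: "x \<in> carrier L" "y \<in> carrier L" "z \<in> carrier L" and "le2 x y" "le2 y z" shows "le2 x z"
proof -
  consider "x \<sqsubseteq> y" "y \<sqsubseteq> z" | "x \<sqsubseteq> y" "lft z y" | "lft y x" "y \<sqsubseteq> z" | "lft y x" "lft z y"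
    using assms by (auto simp: le2_def)
  then show ?thesis
  proof cases
    case 1 then show ?thesis using le_trans c by (auto simp: le2_def)
  next
    case 2
    then show ?thesis using lft_cong_right[OF 2(2), of x] lft_par[OF 2(2)] c le_trans[of z x y]
      by (auto simp: le2_def par_def)
  next
    case 3
    then show ?thesis using lft_cong_left[OF 3(1), of z] lft_par[OF 3(1)] c le_trans[of y z x]
      by (auto simp: le2_def par_def)
  next
    case 4 then show ?thesis using lft_trans by (auto simp: le2_def)
  qed
qed

lemma rk_le:
  assumes tr: "\<And>x y z. x \<in> carrier L \<Longrightarrow> y \<in> carrier L \<Longrightarrow> z \<in> carrier L \<Longrightarrow> r x y \<Longrightarrow> r y z \<Longrightarrow> r x z"
    and rf: "\<And>x. x \<in> carrier L \<Longrightarrow> r x x" and tot: "\<And>x y. x \<in> carrier L \<Longrightarrow> y \<in> carrier L \<Longrightarrow> r x y \<or> r y x"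
    and xy: "x \<in> carrier L" "y \<in> carrier L"
  shows "rk r x \<le> rk r y \<longleftrightarrow> r x y"
proof
  assume "r x y"
  then have "{t \<in> carrier L. r t x} \<subseteq> {t \<in> carrier L. r t y}" using tr xy by blast
  then show "rk r x \<le> rk r y" using fin by (simp add: rk_def card_mono)
next
  assume le: "rk r x \<le> rk r y"
  show "r x y"
  proof (rule ccontr)
    assume n: "\<not> r x y"
    then have "{t \<in> carrier L. r t y} \<subseteq> {t \<in> carrier L. r t x}" using tot[OF xy] tr xy by blast
    moreover have "x \<in> {t \<in> carrier L. r t x}" "x \<notin> {t \<in> carrier L. r t y}" using n rf xy by auto
    ultimately have "card {t \<in> carrier L. r t y} < card {t \<in> carrier L. r t x}"
      using fin by (intro psubset_card_mono) auto
    then show False using le by (simp add: rk_def)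
  qed
qed

lemma le1_total: "x \<in> carrier L \<Longrightarrow> y \<in> carrier L \<Longrightarrow> le1 x y \<or> le1 y x"
  using lft_total[of x y] by (auto simp: le1_def par_def)
lemma le2_total: "x \<in> carrier L \<Longrightarrow> y \<in> carrier L \<Longrightarrow> le2 x y \<or> le2 y x"
  using lft_total[of x y] by (auto simp: le2_def par_def)

lemma rk1: "x \<in> carrier L \<Longrightarrow> y \<in> carrier L \<Longrightarrow> rk le1 x \<le> rk le1 y \<longleftrightarrow> le1 x y"
  by (rule rk_le) (use le1_trans le1_total in \<open>blast | simp add: le1_def\<close>)+
lemma rk2: "x \<in> carrier L \<Longrightarrow> y \<in> carrier L \<Longrightarrow> rk le2 x \<le> rk le2 y \<longleftrightarrow> le2 x y"
  by (rule rk_le) (use le2_trans le2_total in \<open>blast | simp add: le2_def\<close>)+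

lemma emb_le: assumes "x \<in> carrier L" "y \<in> carrier L" shows "emb x \<le> emb y \<longleftrightarrow> x \<sqsubseteq> y"
  using rk1[OF assms] rk2[OF assms] lft_asym[of x y]
  by (auto simp: emb_def less_eq_prod_def le1_def le2_def)

lemma emb_inj: assumes c: "x \<in> carrier L" "y \<in> carrier L" and e: "fst (emb x) = fst (emb y) \<or> snd (emb x) = snd (emb y)" shows "x = y"
proof -
  have "(le1 x y \<and> le1 y x) \<or> (le2 x y \<and> le2 y x)"
    using e rk1[OF c] rk1[OF c(2,1)] rk2[OF c] rk2[OF c(2,1)] by (auto simp: emb_def)
  then show ?thesis using lft_asym lft_par[of x y] lft_par[of y x] c by (auto simp: le1_def le2_def par_def)
qed

lemma emb_lft: assumes c: "x \<in> carrier L" "y \<in> carrier L"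
  shows "fst (emb x) < fst (emb y) \<and> snd (emb y) < snd (emb x) \<longleftrightarrow> lft x y"
proof
  assume l: "lft x y"
  have "\<not> le1 y x" "\<not> le2 x y" using lft_par[OF l] lft_asym[OF l] by (auto simp: le1_def le2_def par_def)
  then show "fst (emb x) < fst (emb y) \<and> snd (emb y) < snd (emb x)"
    using rk1[OF c(2,1)] rk2[OF c] by (simp add: emb_def)
next
  assume "fst (emb x) < fst (emb y) \<and> snd (emb y) < snd (emb x)"
  then have "\<not> le1 y x" "\<not> le2 x y" using rk1[OF c(2,1)] rk2[OF c] by (simp_all add: emb_def)
  then show "lft x y" using le1_total[OF c] by (auto simp: le1_def le2_def)
qed

end

section \<open>Rectangular lattices as sets of points\<close>

locale oiso = lattice L for L :: "('b, 'm) gorder_scheme" (structure) +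
  fixes f :: "'b \<Rightarrow> 'a::order" and K :: "'a set"
  assumes bij: "bij_betw f (carrier L) K"
    and f_le: "\<And>x y. x \<in> carrier L \<Longrightarrow> y \<in> carrier L \<Longrightarrow> f x \<le> f y \<longleftrightarrow> x \<sqsubseteq> y"
begin

lemma f_in: "x \<in> carrier L \<Longrightarrow> f x \<in> K" using bij by (auto simp: bij_betw_def)
lemma f_inj: "x \<in> carrier L \<Longrightarrow> y \<in> carrier L \<Longrightarrow> f x = f y \<longleftrightarrow> x = y"
  using bij by (auto simp: bij_betw_def inj_on_def)
lemma f_ex: "a \<in> K \<Longrightarrow> \<exists>x\<in>carrier L. a = f x" using bij by (auto simp: bij_betw_def)
lemma f_less: "x \<in> carrier L \<Longrightarrow> y \<in> carrier L \<Longrightarrow> f x < f y \<longleftrightarrow> x \<sqsubset> y"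
  by (simp add: order_less_le f_le f_inj lless_eq)

lemma isjn_f: "x \<in> carrier L \<Longrightarrow> y \<in> carrier L \<Longrightarrow> isjn K (f x) (f y) (f (x \<squnion> y))"
  using join_left[of x y] join_right[of x y] join_le[of x _ y] f_ex
  by (force simp: isjn_def f_in f_le)
lemma ismt_f: "x \<in> carrier L \<Longrightarrow> y \<in> carrier L \<Longrightarrow> ismt K (f x) (f y) (f (x \<sqinter> y))"
  using meet_left[of x y] meet_right[of x y] meet_le[of _ x y] f_ex
  by (force simp: ismt_def f_in f_le)

lemma latK: "lat K"
  by (rule latI) (use f_ex isjn_f ismt_f in blast)+

lemma f_jn: "x \<in> carrier L \<Longrightarrow> y \<in> carrier L \<Longrightarrow> f (x \<squnion> y) = jn K (f x) (f y)"
  using jn_eqI[OF latK _ _ isjn_f] f_in by simp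
lemma f_mt: "x \<in> carrier L \<Longrightarrow> y \<in> carrier L \<Longrightarrow> f (x \<sqinter> y) = mt K (f x) (f y)"
  using mt_eqI[OF latK _ _ ismt_f] f_in by simp

lemma f_cov: assumes "x \<in> carrier L" "y \<in> carrier L" shows "cov K (f x) (f y) \<longleftrightarrow> covers L x y"
proof -
  have "(\<exists>z\<in>K. f x < z \<and> z < f y) \<longleftrightarrow> (\<exists>z\<in>carrier L. x \<sqsubset> z \<and> z \<sqsubset> y)"
    using f_ex f_in f_less assms by metis
  then show ?thesis using assms f_in f_less by (simp add: cov_iff covers_def)
qed

lemma f_smod: "smod K \<longleftrightarrow> semimodular L"
proof
  assume S: "smod K"
  show "semimodular L" unfolding semimodular_def
  proof (intro ballI impI)
    fix a b c assume abc: "a \<in> carrier L" "b \<in> carrier L" "c \<in> carrier L" "covers L a b"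
    then have "jn K (f a) (f c) = jn K (f b) (f c) \<or> cov K (jn K (f a) (f c)) (jn K (f b) (f c))"
      using smodD[OF S, of "f a" "f b" "f c"] f_cov f_in by simp
    then show "a \<squnion> c = b \<squnion> c \<or> covers L (a \<squnion> c) (b \<squnion> c)"
      using abc by (simp add: f_jn[symmetric] f_cov f_inj)
  qed
next
  assume S: "semimodular L"
  show "smod K"
  proof (rule smodI)
    fix a b c assume ab: "cov K a b" and c: "c \<in> K"
    obtain x y z where x: "x \<in> carrier L" "a = f x" "y \<in> carrier L" "b = f y" "z \<in> carrier L" "c = f z"
      using f_ex[OF cov_in(1)[OF ab]] f_ex[OF cov_in(2)[OF ab]] f_ex[OF c] by blast
    then have "covers L x y" using ab f_cov by simp
    then have "x \<squnion> z = y \<squnion> z \<or> covers L (x \<squnion> z) (y \<squnion> z)" using S x by (simp add: semimodular_def)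
    then show "jn K a c = jn K b c \<or> cov K (jn K a c) (jn K b c)"
      using x by (auto simp: f_jn[symmetric] f_cov)
  qed
qed

lemma f_dirr: assumes x: "x \<in> carrier L" shows "doubly_irreducible (olat K) (f x) \<longleftrightarrow> doubly_irreducible L x"
proof -
  have up: "\<exists>y. a = f y \<and> covers L x y" if "cov K (f x) a" for a
    using f_ex[OF cov_in(2)[OF that]] that f_cov[OF x] by blast
  have dn: "\<exists>y. a = f y \<and> covers L y x" if "cov K a (f x)" for a
    using f_ex[OF cov_in(1)[OF that]] that f_cov[OF _ x] by blast
  have c: "covers L y z \<Longrightarrow> y \<in> carrier L \<and> z \<in> carrier L" for y z by (simp add: covers_def)
  have "(\<exists>!a. cov K (f x) a) \<longleftrightarrow> (\<exists>!y. covers L x y)"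
  proof
    assume "\<exists>!a. cov K (f x) a" then show "\<exists>!y. covers L x y" using up c f_cov[OF x] f_inj by metis
  next
    assume "\<exists>!y. covers L x y" then show "\<exists>!a. cov K (f x) a" using up c f_cov[OF x] by metis
  qed
  moreover have "(\<exists>!a. cov K a (f x)) \<longleftrightarrow> (\<exists>!y. covers L y x)"
  proof
    assume "\<exists>!a. cov K a (f x)" then show "\<exists>!y. covers L y x" using dn c f_cov[OF _ x] f_inj by metis
  next
    assume "\<exists>!y. covers L y x" then show "\<exists>!a. cov K a (f x)" using dn c f_cov[OF _ x] by metis
  qed
  ultimately show ?thesis using x f_in by (simp add: doubly_irreducible_def)
qed

lemma con_pull: assumes "con K \<theta>" shows "lattice_congruence L (restrict_con L f \<theta>)"
proof -
  have "equiv (carrier L) (restrict_con L f \<theta>)"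
    unfolding equiv_def refl_on_def sym_def trans_def restrict_con_def
    using con_refl[OF assms] con_sym[OF assms] con_trans[OF assms] f_in by blast
  moreover have "(x \<squnion> u, y \<squnion> v) \<in> restrict_con L f \<theta> \<and> (x \<sqinter> u, y \<sqinter> v) \<in> restrict_con L f \<theta>"
    if "(x, y) \<in> restrict_con L f \<theta>" "(u, v) \<in> restrict_con L f \<theta>" for x y u v
    using that con_jn[OF assms] con_mt[OF assms] by (simp add: restrict_con_def f_jn f_mt)
  ultimately show ?thesis unfolding lattice_congruence_def by blast
qed

text \<open>Inverse to restriction along \<open>f\<close>, by \<open>pull_push\<close> and
  \<open>push_pull\<close>.\<close>

definition push :: "('b \<times> 'b) set \<Rightarrow> ('a \<times> 'a) set" where "push \<alpha> = {(f x, f y) |x y. (x, y) \<in> \<alpha>}"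

lemma push_iff: "lattice_congruence L \<alpha> \<Longrightarrow> x \<in> carrier L \<Longrightarrow> y \<in> carrier L \<Longrightarrow> (f x, f y) \<in> push \<alpha> \<longleftrightarrow> (x, y) \<in> \<alpha>"
proof -
  assume a: "lattice_congruence L \<alpha>" and xy: "x \<in> carrier L" "y \<in> carrier L"
  have "\<alpha> \<subseteq> carrier L \<times> carrier L" using a by (auto simp: lattice_congruence_def equiv_def)
  then show ?thesis using xy unfolding push_def by (auto simp: f_inj)
qed

lemma con_push: assumes a: "lattice_congruence L \<alpha>" shows "con K (push \<alpha>)"
proof -
  have eq: "equiv (carrier L) \<alpha>" using a by (simp add: lattice_congruence_def)
  have sub: "\<alpha> \<subseteq> carrier L \<times> carrier L" and rf: "\<And>x. x \<in> carrier L \<Longrightarrow> (x, x) \<in> \<alpha>"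
    and sy: "\<And>x y. (x, y) \<in> \<alpha> \<Longrightarrow> (y, x) \<in> \<alpha>" and tr: "\<And>x y z. (x, y) \<in> \<alpha> \<Longrightarrow> (y, z) \<in> \<alpha> \<Longrightarrow> (x, z) \<in> \<alpha>"
    using eq unfolding equiv_def refl_on_def sym_def trans_def by blast+
  have ops: "(x \<squnion> u, y \<squnion> v) \<in> \<alpha>" "(x \<sqinter> u, y \<sqinter> v) \<in> \<alpha>" if "(x, y) \<in> \<alpha>" "(u, v) \<in> \<alpha>" for x y u v
    using a that unfolding lattice_congruence_def by blast+
  show ?thesis
  proof (rule conI)
    show "push \<alpha> \<subseteq> K \<times> K" using sub f_in unfolding push_def by blast
    show "(c, c) \<in> push \<alpha>" if "c \<in> K" for c using f_ex[OF that] rf unfolding push_def by blast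
    show "(d, c) \<in> push \<alpha>" if "(c, d) \<in> push \<alpha>" for c d using that sy unfolding push_def by blast
    show "(c, e) \<in> push \<alpha>" if cd: "(c, d) \<in> push \<alpha>" "(d, e) \<in> push \<alpha>" for c d e
    proof -
      obtain x y where 1: "c = f x" "d = f y" "(x, y) \<in> \<alpha>" using cd(1) unfolding push_def by blast
      obtain y' z where 2: "d = f y'" "e = f z" "(y', z) \<in> \<alpha>" using cd(2) unfolding push_def by blast
      have "y = y'" using 1 2 sub f_inj[of y y'] by auto
      then show ?thesis using 1 2 tr[of x y z] unfolding push_def by blast
    qed
    fix c d e assume cd: "(c, d) \<in> push \<alpha>" and e: "e \<in> K"
    obtain x y where 1: "c = f x" "d = f y" "(x, y) \<in> \<alpha>" using cd unfolding push_def by blast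
    obtain z where z: "z \<in> carrier L" "e = f z" using f_ex[OF e] by blast
    have xy: "x \<in> carrier L" "y \<in> carrier L" using 1 sub by auto
    show "(jn K c e, jn K d e) \<in> push \<alpha>" using ops(1)[OF 1(3) rf[OF z(1)]] xy z 1
      unfolding push_def by (auto simp: f_jn[symmetric])
    show "(mt K c e, mt K d e) \<in> push \<alpha>" using ops(2)[OF 1(3) rf[OF z(1)]] xy z 1
      unfolding push_def by (auto simp: f_mt[symmetric])
  qed
qed

lemma pull_push: assumes a: "lattice_congruence L \<alpha>" shows "restrict_con L f (push \<alpha>) = \<alpha>"
proof -
  have "\<alpha> \<subseteq> carrier L \<times> carrier L" using a by (auto simp: lattice_congruence_def equiv_def)
  then show ?thesis using push_iff[OF a] unfolding restrict_con_def by auto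
qed

lemma push_pull: assumes th: "con K \<theta>" shows "push (restrict_con L f \<theta>) = \<theta>"
proof
  show "push (restrict_con L f \<theta>) \<subseteq> \<theta>" unfolding push_def restrict_con_def by auto
  show "\<theta> \<subseteq> push (restrict_con L f \<theta>)"
  proof
    fix e assume e: "e \<in> \<theta>"
    obtain c d where cd: "e = (c, d)" by (cases e)
    then obtain x y where "x \<in> carrier L" "c = f x" "y \<in> carrier L" "d = f y"
      using con_in[OF th] e f_ex by metis
    then show "e \<in> push (restrict_con L f \<theta>)" using e cd unfolding push_def restrict_con_def by blast
  qed
qed

end

section \<open>Boundary chains of a rectangular lattice\<close>

abbreviation dirr :: "'a::order set \<Rightarrow> 'a \<Rightarrow> bool" where "dirr K \<equiv> doubly_irreducible (olat K)"

text \<open>Among the upper covers of \<open>c\<close> take the one with least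
  \<open>d\<close>-coordinate. An element beside it would lie above \<open>c\<close>, hence above
  another cover with smaller coordinate.\<close>

lemma lbd_next:
  assumes K: "plat K" and c: "c \<in> lbd d K" and t: "t \<in> K" "c < t"
  shows "\<exists>c'\<in>lbd d K. cov K c c'"
proof -
  have fin: "finite K" using K by (simp add: plat_def)
  let ?S = "{s. cov K c s}"
  have "?S \<subseteq> K" by (auto simp: cov_iff)
  then have "finite ?S" using fin finite_subset by blast
  moreover have "?S \<noteq> {}" using finite_cov_above[OF fin lbd_in[OF c] t] by blast
  ultimately obtain s where s: "cov K c s" "\<And>r. cov K c r \<Longrightarrow> co d s \<le> co d r"
    using arg_min_if_finite[of ?S "co d"] by (metis (mono_tags, lifting) linorder_not_le mem_Collect_eq)
  note si = cov_in[OF s(1)]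
  have "\<not> lam d y s" if y: "y \<in> K" for y
  proof
    assume l: "lam d y s"
    have cy: "c \<le> y" using lam_ge_right[OF l less_imp_le[OF si(3)]] lbdD[OF c y] by blast
    have "c \<noteq> y" using lam_not_le(1)[OF l] si(3) by (auto simp: less_imp_le)
    then obtain r where r: "cov K c r" "r \<le> y" using finite_cov_above[OF fin si(1) y] cy by (auto simp: order_less_le)
    then have "co d s \<le> co d y" using s(2)[OF r(1)] r(2) le_co[of r y d] by linarith
    then show False using l by (simp add: lam_def)
  qed
  then have "s \<in> lbd d K" using si(2) unfolding lbd_def by blast
  then show ?thesis using s(1) by blast
qed

lemma lbd_exit:
  assumes K: "plat K" and b: "b \<in> K" "\<And>s. s \<in> K \<Longrightarrow> b \<le> s" and x: "x \<in> K" and t: "t \<in> K" "x < t"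
  shows "\<exists>c\<in>lbd d K. \<exists>c'\<in>lbd d K. cov K c c' \<and> c \<le> x \<and> \<not> c' \<le> x \<and> (\<forall>y\<in>lbd d K. y \<le> x \<longrightarrow> y \<le> c)"
proof -
  let ?S = "{c \<in> lbd d K. c \<le> x}"
  have bl: "b \<in> lbd d K" using b lam_not_le(2) unfolding lbd_def by blast
  have "finite ?S" using K by (auto simp: plat_def lbd_def)
  moreover have "?S \<noteq> {}" using bl b(2)[OF x] by blast
  ultimately obtain c where c: "c \<in> ?S" "\<And>y. y \<in> ?S \<Longrightarrow> c \<le> y \<Longrightarrow> c = y" using finite_has_maximal[of ?S] by blast
  have ct: "c < t" using c(1) t(2) by auto
  obtain c' where c': "c' \<in> lbd d K" "cov K c c'" using lbd_next[OF K _ t(1) ct] c(1) by blast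
  have "\<not> c' \<le> x" using c(2)[of c'] c' cov_in(3)[OF c'(2)] by (auto simp: less_imp_le)
  moreover have "y \<le> c" if "y \<in> lbd d K" "y \<le> x" for y
    using lbd_chain[OF K that(1), of c] c(1) c(2)[of y] that by (metis (mono_tags, lifting) mem_Collect_eq)
  ultimately show ?thesis using c c' by blast
qed

lemma walk_start: assumes "walk es a b" "es \<noteq> []" shows "a \<in> verts es"
proof -
  obtain e fs where es: "es = e # fs" using assms(2) by (cases es) auto
  obtain x l y where e: "e = (x, l, y)" by (cases e)
  show ?thesis using assms(1) unfolding es e by simp
qed

text \<open>Isolates what the analysis of one side requires, so that left and right are two
  instances.\<close>

locale corner_pair =
  fixes d :: bool and K :: "(real \<times> real) set" and b t lc rc :: "real \<times> real"
  assumes pK: "plat K" and b: "b \<in> K" "\<And>s. s \<in> K \<Longrightarrow> b \<le> s" and t: "t \<in> K" "\<And>s. s \<in> K \<Longrightarrow> s \<le> t"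
    and lc: "lc \<in> lbd d K" and rc: "rc \<in> lbd (\<not> d) K" and ne: "lc \<noteq> b" "lc \<noteq> t"
    and uniq: "\<And>x. x \<in> lbd d K \<Longrightarrow> dirr K x \<Longrightarrow> x \<noteq> b \<Longrightarrow> x \<noteq> t \<Longrightarrow> x = lc"
    and jt: "jn K lc rc = t" and mb: "mt K lc rc = b"
begin

lemma K: "lat K" and S: "smod K" and fin: "finite K" using pK by (auto simp: plat_def)
lemma lcK: "lc \<in> K" and rcK: "rc \<in> K" using lc rc lbd_in by blast+
lemma less_t: "x \<in> K \<Longrightarrow> x \<noteq> t \<Longrightarrow> x < t" using t(2)[of x] by (auto simp: order_less_le)

lemma not_rc_le: "\<not> rc \<le> lc" using jn_absorb2[OF K lcK rcK] jt ne by auto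
lemma not_lc_le: "\<not> lc \<le> rc" using mt_absorb[OF K lcK rcK] mb ne by auto

text \<open>On the chain of the right boundary \<open>y\<close> is comparable with \<open>rc\<close>
  and not above it, so it is below both corners, whose meet is \<open>b\<close>.\<close>

lemma right_le_lc: assumes "y \<in> lbd (\<not> d) K" "y \<le> lc" shows "y = b"
proof -
  have y: "y \<in> K" using assms lbd_in by blast
  have "\<not> rc \<le> y" using not_rc_le assms(2) order_trans by blast
  then have "y \<le> rc" using lbd_chain[OF pK assms(1) rc] by blast
  then have "y \<le> b" using le_mt_iff[OF K lcK rcK y] assms(2) mb by simp
  then show ?thesis using b(2)[OF y] by simp
qed

lemma right_ge_lc: assumes "y \<in> lbd (\<not> d) K" "lc \<le> y" shows "y = t"
proof -
  have y: "y \<in> K" using assms lbd_in by blast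
  have "\<not> y \<le> rc" using not_lc_le assms(2) order_trans by blast
  then have "rc \<le> y" using lbd_chain[OF pK assms(1) rc] by blast
  then have "t \<le> y" using jn_le_iff[OF K lcK rcK y] assms(2) jt by simp
  then show ?thesis using t(2)[OF y] by simp
qed

lemma two_covers: "cov K a x \<Longrightarrow> cov K a y \<Longrightarrow> x \<noteq> y \<Longrightarrow> \<not> x \<le> y"
  using cov_between[of K a y x] by (auto simp: cov_iff less_imp_le)
lemma two_covers2: "cov K x a \<Longrightarrow> cov K y a \<Longrightarrow> x \<noteq> y \<Longrightarrow> \<not> x \<le> y"
  using cov_between[of K x a y] by (auto simp: cov_iff less_imp_le)

lemma left_lam: assumes "x \<in> lbd d K" "y \<in> K" "\<not> x \<le> y" "\<not> y \<le> x" shows "lam d x y"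
  by (rule lam_cases[OF pK lbd_in[OF assms(1)] assms(2), where d = d]) (use assms lbdD[OF assms(1,2)] in auto)
lemma right_lam: assumes "y \<in> lbd (\<not> d) K" "x \<in> K" "\<not> x \<le> y" "\<not> y \<le> x" shows "lam d x y"
  by (rule lam_cases[OF pK assms(2) lbd_in[OF assms(1)], where d = d])
    (use assms lbdD[OF assms(1,2)] lam_mirror in auto)

text \<open>Suppose \<open>x \<le> lc\<close> is off the boundary. Where the boundary leaves the
  down-set of \<open>x\<close>, at \<open>c0\<close>, there are three upper covers:
  \<open>c1\<close> on the boundary, \<open>w\<close> below \<open>x\<close>, and \<open>?g\<close>
  obtained from the right boundary, not below \<open>lc\<close>. As \<open>w\<close> lies between
  \<open>c1\<close> and \<open>?g\<close>, semimodularity gives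
  \<open>jn K w c1 = jn K ?g c1\<close>. The left side is below \<open>lc\<close>, so
  \<open>?g\<close> is as well, a contradiction.\<close>

lemma lower_left: assumes x: "x \<in> K" "x \<le> lc" shows "x \<in> lbd d K"
proof (rule ccontr)
  assume n: "x \<notin> lbd d K"
  have xlc: "x < lc" using n x lc by (auto simp: order_less_le)
  obtain c0 c1 where c: "c0 \<in> lbd d K" "c1 \<in> lbd d K" "cov K c0 c1" "c0 \<le> x" "\<not> c1 \<le> x"
    using lbd_exit[OF pK b x(1) lcK xlc] by blast
  note ci = cov_in[OF c(3)]
  have "c0 < x" using c n by (auto simp: order_less_le)
  then obtain w where w: "cov K c0 w" "w \<le> x" using finite_cov_above[OF fin ci(1) x(1)] by blast
  note wi = cov_in[OF w(1)]
  have wlc: "w \<le> lc" using w x order_trans by blast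
  have c1w: "c1 \<noteq> w" using w c by blast
  have c1lc: "c1 \<le> lc"
  proof (rule ccontr)
    assume "\<not> c1 \<le> lc"
    then have "lc \<le> c1" using lbd_chain[OF pK c(2) lc] by blast
    then have "lc = c0 \<or> lc = c1" using cov_between[OF c(3) lcK] c(4) x(2) by (meson order_trans)
    then show False using \<open>\<not> c1 \<le> lc\<close> \<open>c0 < x\<close> x(2) by auto
  qed
  have "c0 < t" using less_t[OF ci(1)] ci t(2)[OF ci(2)] by (metis leD)
  then obtain e e' where e: "e \<in> lbd (\<not> d) K" "e' \<in> lbd (\<not> d) K" "cov K e e'" "e \<le> c0" "\<not> e' \<le> c0"
    using lbd_exit[OF pK b ci(1) t(1), of "\<not> d"] by blast
  note ei = cov_in[OF e(3)]
  have eb: "e = b" using right_le_lc[OF e(1)] e(4) c(4) x(2) by (meson order_trans)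
  have e'lc: "\<not> e' \<le> lc" using right_le_lc[OF e(2)] eb ei by auto
  let ?g = "jn K e' c0"
  have g: "cov K c0 ?g" using smod_cov_jn[OF K S e(3) ci(1) e(4,5)] .
  note gi = cov_in[OF g]
  have e'g: "e' \<le> ?g" using jn_ge1[OF K ei(2) ci(1)] .
  have glc: "\<not> ?g \<le> lc" using e'g e'lc order_trans by blast
  have l1: "lam d c1 w" using left_lam[OF c(2) wi(2)] two_covers[OF c(3) w(1)] two_covers[OF w(1) c(3)] c1w by blast
  have "\<not> w \<le> e'"
  proof
    assume "w \<le> e'"
    then have "w = b \<or> w = e'" using cov_between[OF e(3) wi(2)] eb b(2)[OF wi(2)] by blast
    then show False using wi(3) b(2)[OF ci(1)] wlc e'lc by auto
  qed
  moreover have "\<not> e' \<le> w" using wlc e'lc order_trans by blast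
  ultimately have "lam d w e'" using right_lam[OF e(2) wi(2)] by blast
  moreover have "\<not> w \<le> ?g" using two_covers[OF w(1) g] glc wlc by auto
  ultimately have l2: "lam d w ?g" using lam_le_right e'g by blast
  let ?j = "jn K ?g c1"
  have gc1: "\<not> ?g \<le> c1" using glc c1lc order_trans by blast
  have cj: "cov K c1 ?j" using smod_cov_jn[OF K S g ci(2) less_imp_le[OF ci(3)] gc1] .
  have "w \<le> ?j" using lam_between_le[OF l1 l2] K gi ci by simp
  then have "jn K w c1 \<le> ?j" using jn_least[OF K wi(2) ci(2)] K gi ci by simp
  moreover have "jn K w c1 \<noteq> c1" using jn_ge1[OF K wi(2) ci(2)] two_covers[OF w(1) c(3)] c1w by metis
  ultimately have "jn K w c1 = ?j" using cov_between[OF cj, of "jn K w c1"] K wi ci by auto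
  then have "?j \<le> lc" using jn_least[OF K wi(2) ci(2) lcK wlc c1lc] by simp
  then show False using glc jn_ge1[OF K gi(2) ci(2)] order_trans by blast
qed

text \<open>Take \<open>c\<close> maximal with two upper covers. Then \<open>c\<close> turns out to
  be the only lower cover of the next boundary element \<open>c2\<close>, which is not doubly
  irreducible and so has two upper covers itself, contrary to maximality.\<close>

lemma upper_unique: assumes "c \<in> lbd d K" "lc \<le> c" "cov K c s" "cov K c s'" shows "s = s'"
proof (rule ccontr)
  assume ss: "s \<noteq> s'"
  let ?S = "{c \<in> lbd d K. lc \<le> c \<and> (\<exists>s s'. cov K c s \<and> cov K c s' \<and> s \<noteq> s')}"
  have "finite ?S" using fin by (auto simp: lbd_def)
  moreover have "?S \<noteq> {}" using assms ss by blast
  ultimately obtain c where cS: "c \<in> ?S" and mx: "\<And>y. y \<in> ?S \<Longrightarrow> c \<le> y \<Longrightarrow> c = y"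
    using finite_has_maximal[of ?S] by blast
  then have c: "c \<in> lbd d K" "lc \<le> c" by auto
  have cK: "c \<in> K" using lbd_in[OF c(1)] .
  obtain s s' where s: "cov K c s" "cov K c s'" "s \<noteq> s'" using cS by blast
  have ct: "c < t" using less_t[OF cK] s t(2) cov_in by (metis leD)
  obtain c2 where c2: "c2 \<in> lbd d K" "cov K c c2" using lbd_next[OF pK c(1) t(1) ct] by blast
  obtain w where w: "cov K c w" "w \<noteq> c2" using s by metis
  note c2i = cov_in[OF c2(2)] and wi = cov_in[OF w(1)]
  obtain e e' where e: "e \<in> lbd (\<not> d) K" "e' \<in> lbd (\<not> d) K" "cov K e e'" "e \<le> c" "\<not> e' \<le> c"
    using lbd_exit[OF pK b cK t(1) ct, of "\<not> d"] by blast
  note ei = cov_in[OF e(3)]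
  let ?g = "jn K e' c"
  have g: "cov K c ?g" using smod_cov_jn[OF K S e(3) cK e(4,5)] .
  note gi = cov_in[OF g]
  have e'g: "e' \<le> ?g" using jn_ge1[OF K ei(2) cK] .
  \<comment> \<open>Otherwise \<open>c2\<close> would be on the outer side of \<open>w\<close> and
    \<open>w\<close> on the outer side of \<open>e'\<close>, although \<open>e'\<close> lies below
    \<open>?g\<close>.\<close>
  have A: "?g \<noteq> c2"
  proof
    assume gc: "?g = c2"
    have l: "lam d c2 w" using left_lam[OF c2(1) wi(2)] two_covers[OF c2(2) w(1)] two_covers[OF w(1) c2(2)] w(2) by blast
    have "\<not> e' \<le> w"
    proof
      assume "e' \<le> w"
      then have "?g \<le> w" using jn_least[OF K ei(2) cK wi(2)] wi(3) by (simp add: less_imp_le)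
      then show False using two_covers[OF c2(2) w(1)] w(2) gc by simp
    qed
    moreover have "\<not> w \<le> e'"
    proof
      assume we: "w \<le> e'"
      then have "lc \<le> e'" using c(2) wi(3) by (meson less_imp_le order_trans)
      then have "e' = t" using right_ge_lc[OF e(2)] by blast
      then have "w \<le> c2" using e'g gc t(2)[OF wi(2)] order_trans by blast
      then show False using two_covers[OF w(1) c2(2)] w(2) by simp
    qed
    ultimately have "lam d w e'" using right_lam[OF e(2) wi(2)] by blast
    then have "lam d c2 e'" using lam_trans[OF l] by blast
    then show False using lam_not_le(2) e'g gc by simp
  qed
  have e'c2: "\<not> e' \<le> c2"
  proof
    assume "e' \<le> c2"
    then have "?g \<le> c2" using jn_least[OF K ei(2) cK c2i(2)] c2i(3) by (simp add: less_imp_le)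
    then show False using two_covers[OF g c2(2)] A by simp
  qed
  \<comment> \<open>A second lower cover \<open>v\<close> of \<open>c2\<close> would lie
    horizontally between \<open>c\<close> and \<open>e'\<close>, hence below their join
    \<open>?g\<close>. Then \<open>c2\<close>, being the join of \<open>c\<close> and
    \<open>v\<close>, would lie below \<open>?g\<close>, a different cover of
    \<open>c\<close>.\<close>
  have low: "v = c" if v: "cov K v c2" for v
  proof (rule ccontr)
    assume vc: "v \<noteq> c"
    note vi = cov_in[OF v]
    have inc: "\<not> v \<le> c" "\<not> c \<le> v" using two_covers2[OF v c2(2)] two_covers2[OF c2(2) v] vc by auto
    have l: "lam d c v" using left_lam[OF c(1) vi(1)] inc by blast
    have "\<not> e' \<le> v" using e'c2 vi(3) by (meson less_imp_le order_trans)
    moreover have "\<not> v \<le> e'"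
    proof
      assume ve: "v \<le> e'"
      have j: "jn K v e \<in> K" "e \<le> jn K v e" "jn K v e \<le> e'"
        using K vi ei ve by (auto simp: jn_least less_imp_le)
      consider "jn K v e = e" | "jn K v e = e'" using cov_between[OF e(3) j] by blast
      then show False
      proof cases
        case 1 then show False using jn_ge1[OF K vi(1) ei(1)] e(4) inc order_trans by metis
      next
        case 2
        have "e \<le> c2" using e(4) c2i(3) by (meson less_imp_le order_trans)
        then have "e' \<le> c2" using 2 jn_least[OF K vi(1) ei(1) vi(2)] vi(3) by (simp add: less_imp_le)
        then show False using e'c2 by simp
      qed
    qed
    ultimately have l2: "lam d v e'" using right_lam[OF e(2) vi(1)] by blast
    have vg: "v \<le> ?g"
    proof (rule ccontr)
      assume "\<not> v \<le> ?g"
      then have "lam d v ?g" using lam_le_right[OF l2 e'g] by blast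
      then show False using lam_between_le[OF l, of ?g ?g] gi(3) \<open>\<not> v \<le> ?g\<close> by (simp add: less_imp_le)
    qed
    have "jn K c v \<le> c2" using jn_least[OF K cK vi(1) vi(2)] c2i(3) vi(3) by (simp add: less_imp_le)
    moreover have "jn K c v \<noteq> c" using jn_ge2[OF K cK vi(1)] inc by metis
    ultimately have "jn K c v = c2" using cov_between[OF c2(2), of "jn K c v"] K cK vi by auto
    then have "c2 \<le> ?g" using jn_least[OF K cK vi(1) gi(2)] gi(3) vg by (simp add: less_imp_le)
    then show False using two_covers[OF c2(2) g] A by simp
  qed
  have c2t: "c2 \<noteq> t" using e'c2 t(2)[OF ei(2)] by auto
  have c2b: "c2 \<noteq> b" using c2i(3) b(2)[OF cK] by auto
  have c2lc: "c2 \<noteq> lc" using c2i(3) c(2) by auto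
  obtain c3 where c3: "cov K c2 c3" using lbd_next[OF pK c2(1) t(1) less_t[OF c2i(2) c2t]] by blast
  have "\<not> dirr K c2" using uniq[OF c2(1)] c2t c2b c2lc by blast
  moreover have "\<exists>!v. cov K v c2" using low c2(2) by blast
  ultimately have "\<not> (\<exists>!y. cov K c2 y)" using c2i(2) unfolding doubly_irreducible_def by simp
  then obtain c3' where "cov K c2 c3'" "c3' \<noteq> c3" using c3 by blast
  moreover have "lc \<le> c2" using c(2) less_imp_le[OF c2i(3)] by (rule order_trans)
  ultimately have "c2 \<in> ?S" using c2(1) c3 by blast
  then show False using mx[of c2] c2i(3) by (simp add: less_imp_le)
qed

text \<open>The last boundary element below \<open>x\<close> would have two upper covers, one on the
  boundary and one below \<open>x\<close>.\<close>

lemma upper_left: assumes x: "x \<in> K" "lc \<le> x" shows "x \<in> lbd d K"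
proof (rule ccontr)
  assume n: "x \<notin> lbd d K"
  have "t \<in> lbd d K" using t lam_not_le(1) unfolding lbd_def by blast
  then have xt: "x < t" using less_t[OF x(1)] n by blast
  obtain c c' where c: "c \<in> lbd d K" "c' \<in> lbd d K" "cov K c c'" "c \<le> x" "\<not> c' \<le> x" "\<forall>y\<in>lbd d K. y \<le> x \<longrightarrow> y \<le> c"
    using lbd_exit[OF pK b x(1) t(1) xt] by blast
  have "c < x" using c n by (auto simp: order_less_le)
  then obtain w where w: "cov K c w" "w \<le> x" using finite_cov_above[OF fin lbd_in[OF c(1)] x(1)] by blast
  have "lc \<le> c" using c(6) lc x(2) by blast
  then show False using upper_unique[OF c(1) _ w(1) c(3)] w c by blast
qed

lemma lbd_walk:
  assumes "a \<in> lbd d K" "z \<in> lbd d K" "a \<le> z"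
  shows "\<exists>es. walk es a z \<and> (\<forall>x m y. (x, m, y) \<in> set es \<longrightarrow> m = l \<and> cov K x y \<and> a \<le> x \<and> y \<le> z \<and> x \<in> lbd d K \<and> y \<in> lbd d K) \<and>
    (\<forall>v\<in>lbd d K. a \<le> v \<and> v \<le> z \<longrightarrow> v = a \<or> v \<in> verts es)"
  using assms
proof (induction "card {v \<in> K. a \<le> v}" arbitrary: a rule: less_induct)
  case less
  show ?case
  proof (cases "a = z")
    case True then show ?thesis by (intro exI[of _ "[]"]) (auto intro: order_antisym)
  next
    case False
    then have az: "a < z" using less(4) by (simp add: order_less_le)
    obtain c where c: "c \<in> lbd d K" "cov K a c" using lbd_next[OF pK less(2) lbd_in[OF less(3)] az] by blast
    note ci = cov_in[OF c(2)]
    have "\<not> z < c" using cov_between[OF c(2) lbd_in[OF less(3)]] az by (auto simp: order_less_le)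
    then have cz: "c \<le> z" using lbd_chain[OF pK c(1) less(3)] by (auto simp: order_less_le)
    have "{v \<in> K. c \<le> v} \<subset> {v \<in> K. a \<le> v}"
    proof
      show "{v \<in> K. c \<le> v} \<subseteq> {v \<in> K. a \<le> v}" using less_imp_le[OF ci(3)] order_trans by blast
      show "{v \<in> K. c \<le> v} \<noteq> {v \<in> K. a \<le> v}" using ci by force
    qed
    then have "card {v \<in> K. c \<le> v} < card {v \<in> K. a \<le> v}" using fin by (intro psubset_card_mono) auto
    from less(1)[OF this c(1) less(3) cz] obtain es where
      es: "walk es c z" "\<forall>x m y. (x, m, y) \<in> set es \<longrightarrow> m = l \<and> cov K x y \<and> c \<le> x \<and> y \<le> z \<and> x \<in> lbd d K \<and> y \<in> lbd d K"
      "\<forall>v\<in>lbd d K. c \<le> v \<and> v \<le> z \<longrightarrow> v = c \<or> v \<in> verts es" by blast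
    have "walk ((a, l, c) # es) a z" using es(1) by simp
    moreover have "m = l \<and> cov K x y \<and> a \<le> x \<and> y \<le> z \<and> x \<in> lbd d K \<and> y \<in> lbd d K"
      if xy: "(x, m, y) \<in> set ((a, l, c) # es)" for x m y
    proof (cases "(x, m, y) = (a, l, c)")
      case True then show ?thesis using c cz less(2) by auto
    next
      case False
      then have "(x, m, y) \<in> set es" using xy by auto
      then show ?thesis using es(2)[rule_format, of x m y] less_imp_le[OF ci(3)] order_trans by blast
    qed
    moreover have "v = a \<or> v \<in> verts ((a, l, c) # es)" if v: "v \<in> lbd d K" "a \<le> v" "v \<le> z" for v
    proof (cases "c \<le> v")
      case True then show ?thesis using es(3) v by auto
    next
      case False
      then have "v \<le> c" using lbd_chain[OF pK v(1) c(1)] by blast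
      then show ?thesis using cov_between[OF c(2) lbd_in[OF v(1)] v(2)] False by auto
    qed
    ultimately show ?thesis by (intro exI[of _ "(a, l, c) # es"] conjI allI impI ballI) blast+
  qed
qed

text \<open>By \<open>lower_left\<close> the elements below \<open>lc\<close> form a chain, which
  justifies the labels \<open>True\<close> up to \<open>lc\<close>; \<open>upper_left\<close> does
  the same for \<open>False\<close> from there on. Every inner vertex other than \<open>lc\<close>
  has a unique cover in one direction and is not doubly irreducible, which yields the required
  branch in the other.\<close>

lemma side_exists:
  "\<exists>P. side d K P \<and> ladder P \<and> (\<forall>x y. (x, True, y) \<in> set P \<longrightarrow> y \<le> lc) \<and> (\<forall>x y. (x, False, y) \<in> set P \<longrightarrow> lc \<le> x)"
proof -
  have bl: "b \<in> lbd d K" using lower_left[OF b(1) b(2)[OF lcK]] .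
  have tl: "t \<in> lbd d K" using upper_left[OF t(1) t(2)[OF lcK]] .
  obtain as where as: "walk as b lc"
    "\<And>x m y. (x, m, y) \<in> set as \<Longrightarrow> m = True \<and> cov K x y \<and> b \<le> x \<and> y \<le> lc \<and> x \<in> lbd d K \<and> y \<in> lbd d K"
    "\<And>v. v \<in> lbd d K \<Longrightarrow> b \<le> v \<and> v \<le> lc \<Longrightarrow> v = b \<or> v \<in> verts as"
    using lbd_walk[OF bl lc b(2)[OF lcK], of True] by blast
  obtain us where us: "walk us lc t"
    "\<And>x m y. (x, m, y) \<in> set us \<Longrightarrow> m = False \<and> cov K x y \<and> lc \<le> x \<and> y \<le> t \<and> x \<in> lbd d K \<and> y \<in> lbd d K"
    "\<And>v. v \<in> lbd d K \<Longrightarrow> lc \<le> v \<and> v \<le> t \<Longrightarrow> v = lc \<or> v \<in> verts us"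
    using lbd_walk[OF lc tl t(2)[OF lcK], of False] by blast
  let ?P = "as @ us"
  have ne1: "as \<noteq> []" using as(1) ne by auto
  have ne2: "us \<noteq> []" using us(1) ne by auto
  have T: "cov K x y \<and> y \<le> lc \<and> x \<in> lbd d K \<and> y \<in> lbd d K" if "(x, True, y) \<in> set ?P" for x y
    using that as(2)[of x True y] us(2)[of x True y] by auto
  have F: "cov K x y \<and> lc \<le> x \<and> x \<in> lbd d K \<and> y \<in> lbd d K" if "(x, False, y) \<in> set ?P" for x y
    using that as(2)[of x False y] us(2)[of x False y] by auto
  have cv: "cov K x y \<and> x \<in> lbd d K \<and> y \<in> lbd d K" if "(x, m, y) \<in> set ?P" for x m y
    using that T F by (cases m) auto
  have 4: "s \<le> x" if e: "(x, True, y) \<in> set ?P" and s: "s \<in> K" "s < y" for x y s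
  proof -
    have c: "cov K x y" "y \<le> lc" "x \<in> lbd d K" using T[OF e] by auto
    have "s \<in> lbd d K" using lower_left[OF s(1)] s(2) c(2) by (meson less_imp_le order_trans)
    then have "s \<le> x \<or> x \<le> s" using lbd_chain[OF pK _ c(3)] by blast
    then show ?thesis using cov_between[OF c(1) s(1)] s(2) by (auto simp: order_less_le)
  qed
  have 5: "y \<le> s" if e: "(x, False, y) \<in> set ?P" and s: "s \<in> K" "x < s" for x y s
  proof -
    have c: "cov K x y" "lc \<le> x" "y \<in> lbd d K" using F[OF e] by auto
    have "s \<in> lbd d K" using upper_left[OF s(1)] s(2) c(2) by (meson less_imp_le order_trans)
    then have "s \<le> y \<or> y \<le> s" using lbd_chain[OF pK _ c(3)] by blast
    then show ?thesis using cov_between[OF c(1) s(1)] s(2) by (auto simp: order_less_le)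
  qed
  have 6: "\<exists>s. s \<noteq> z \<and> cov K y s" if e: "(x, True, y) \<in> set ?P" "(y, True, z) \<in> set ?P" for x y z
  proof (rule ccontr)
    assume n: "\<not> ?thesis"
    note xy = T[OF e(1)] and yz = T[OF e(2)]
    note i = cov_in[OF conjunct1[OF xy]] and j = cov_in[OF conjunct1[OF yz]]
    have "s = x" if s: "cov K s y" for s
      using 4[OF e(1) cov_in(1)[OF s] cov_in(3)[OF s]] cov_between[OF s i(1)] i(3) by (auto simp: less_imp_le)
    then have "\<exists>!s. cov K s y" using xy by blast
    moreover have "\<exists>!s. cov K y s" by (rule ex1I[of _ z]) (use n yz in metis)+
    ultimately have "dirr K y" using i(2) unfolding doubly_irreducible_def by simp
    moreover have "y \<noteq> b" "y \<noteq> t" "y \<noteq> lc" using i j b(2)[OF i(1)] t(2)[OF j(2)] yz by auto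
    ultimately show False using uniq xy by blast
  qed
  have 7: "\<exists>s. s \<noteq> x \<and> cov K s y" if e: "(x, False, y) \<in> set ?P" "(y, False, z) \<in> set ?P" for x y z
  proof (rule ccontr)
    assume n: "\<not> ?thesis"
    note xy = F[OF e(1)] and yz = F[OF e(2)]
    note i = cov_in[OF conjunct1[OF xy]] and j = cov_in[OF conjunct1[OF yz]]
    have "s = z" if s: "cov K y s" for s
      using 5[OF e(2) cov_in(2)[OF s] cov_in(3)[OF s]] cov_between[OF s j(2)] j(3) by (auto simp: less_imp_le)
    then have "\<exists>!s. cov K y s" using yz by blast
    moreover have "\<exists>!s. cov K s y" by (rule ex1I[of _ x]) (use n xy in metis)+
    ultimately have "dirr K y" using i(2) unfolding doubly_irreducible_def by simp
    moreover have "y \<noteq> b" "y \<noteq> t" "y \<noteq> lc" using i j b(2)[OF i(1)] t(2)[OF j(2)] xy by auto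
    ultimately show False using uniq xy by blast
  qed
  have "side d K ?P"
  proof (rule sideI)
    show "?P \<noteq> []" using ne1 by simp
    show "\<exists>b t. b \<in> K \<and> t \<in> K \<and> (\<forall>s\<in>K. b \<le> s \<and> s \<le> t) \<and> walk ?P b t"
    proof -
      have "walk ?P b t" unfolding walk_append using as(1) us(1) by blast
      then show ?thesis using b t by blast
    qed
    show "lbd d K = verts ?P"
    proof
      have "b \<in> verts as" using walk_start[OF as(1) ne1] .
      moreover have "lc \<in> verts us" using walk_start[OF us(1) ne2] .
      ultimately show "lbd d K \<subseteq> verts ?P"
        using as(3) us(3) b(2) t(2) lbd_chain[OF pK lc] lbd_in by (metis Un_iff subsetI verts_append)
      show "verts ?P \<subseteq> lbd d K" using cv unfolding verts_def by blast
    qed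
    show "cov K x y" if "(x, m, y) \<in> set ?P" for x m y using cv[OF that] by blast
  qed (fact 4 5 6 7)+
  moreover have "ladder ?P" unfolding ladder_def
    using ne1 ne2 as(2) us(2) by (intro exI[of _ as] exI[of _ us] conjI allI impI) blast+
  ultimately show ?thesis using T F by blast
qed

end

theorem rectangular_frame:
  fixes F :: "'a gorder"
  assumes R: "rectangular_lattice F"
  shows "\<exists>i K P Q. oiso F i K \<and> frame True K P Q \<and> i \<bottom>\<^bsub>F\<^esub> = c"
proof -
  obtain p lc rc where bl: "bounded_lattice F" and fin: "finite (carrier F)" and S: "semimodular F" and pd: "planar_diagram F p"
    and L: "{x \<in> left_boundary F p. doubly_irreducible F x \<and> x \<noteq> \<bottom>\<^bsub>F\<^esub> \<and> x \<noteq> \<top>\<^bsub>F\<^esub>} = {lc}"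
    and Rr: "{x \<in> right_boundary F p. doubly_irreducible F x \<and> x \<noteq> \<bottom>\<^bsub>F\<^esub> \<and> x \<noteq> \<top>\<^bsub>F\<^esub>} = {rc}"
    and jt: "lc \<squnion>\<^bsub>F\<^esub> rc = \<top>\<^bsub>F\<^esub>" and mb: "lc \<sqinter>\<^bsub>F\<^esub> rc = \<bottom>\<^bsub>F\<^esub>"
    using R unfolding rectangular_lattice_def by blast
  interpret B: bounded_lattice F by (rule bl)
  have l: "lc \<in> left_boundary F p" "lc \<noteq> \<bottom>\<^bsub>F\<^esub>" "lc \<noteq> \<top>\<^bsub>F\<^esub>" using L by auto
  have r: "rc \<in> right_boundary F p" "rc \<noteq> \<bottom>\<^bsub>F\<^esub>" "rc \<noteq> \<top>\<^bsub>F\<^esub>" using Rr by auto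
  have lcc: "lc \<in> carrier F" "rc \<in> carrier F" using l r by (auto simp: left_boundary_def right_boundary_def)
  have nt: "\<bottom>\<^bsub>F\<^esub> \<noteq> \<top>\<^bsub>F\<^esub>"
  proof
    assume e: "\<bottom>\<^bsub>F\<^esub> = \<top>\<^bsub>F\<^esub>"
    have "lc = \<bottom>\<^bsub>F\<^esub>" by (rule B.bottom_eq[OF lcc(1)]) (metis B.bottom_lower B.le_trans B.top_closed B.top_higher e lcc(1))
    then show False using l by simp
  qed
  interpret D: diagram F p by unfold_locales (use fin pd nt in auto)
  \<comment> \<open>The ranks are translated so that the bottom falls on the prescribed point
    \<open>c\<close>; this later makes the top of one lattice the bottom of the other.\<close>
  define em where "em = (\<lambda>x. D.emb x + (c - D.emb \<bottom>\<^bsub>F\<^esub>))"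
  have em_le: "em x \<le> em y \<longleftrightarrow> x \<sqsubseteq>\<^bsub>F\<^esub> y" if "x \<in> carrier F" "y \<in> carrier F" for x y
    using D.emb_le[OF that] by (simp add: em_def less_eq_prod_def)
  have em_inj: "x = y" if "x \<in> carrier F" "y \<in> carrier F" "fst (em x) = fst (em y) \<or> snd (em x) = snd (em y)" for x y
    using D.emb_inj[OF that(1,2)] that(3) by (simp add: em_def)
  have em_lft: "fst (em x) < fst (em y) \<and> snd (em y) < snd (em x) \<longleftrightarrow> D.lft x y" if "x \<in> carrier F" "y \<in> carrier F" for x y
    using D.emb_lft[OF that] by (simp add: em_def)
  let ?K = "em ` carrier F"
  have inj: "inj_on em (carrier F)" using em_inj by (intro inj_onI) auto
  interpret I: oiso F em ?K
    by unfold_locales (use inj em_le in \<open>auto simp: bij_betw_def\<close>)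
  have pK: "plat ?K" unfolding plat_def
  proof (intro conjI)
    show "lat ?K" by (rule I.latK)
    show "smod ?K" using I.f_smod S by simp
    show "finite ?K" using fin by simp
    show "?K \<noteq> {}" using lcc by auto
    have "a = a'" if a: "a \<in> ?K" "a' \<in> ?K" "fst a = fst a' \<or> snd a = snd a'" for a a'
    proof -
      obtain x x' where x: "x \<in> carrier F" "a = em x" "x' \<in> carrier F" "a' = em x'" using a by blast
      then show ?thesis using em_inj[OF x(1,3)] a(3) by simp
    qed
    then show "inj_on fst ?K" "inj_on snd ?K" unfolding inj_on_def by blast+
  qed
  have lam1: "lam True (em x) (em y) \<longleftrightarrow> D.lft x y" if "x \<in> carrier F" "y \<in> carrier F" for x y
    using em_lft[OF that] by (simp add: lam_def co_def)
  have lam2: "lam False (em x) (em y) \<longleftrightarrow> D.lft y x" if "x \<in> carrier F" "y \<in> carrier F" for x y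
    using lam1[OF that(2,1)] lam_mirror[of True] by simp
  have lb1: "em x \<in> lbd True ?K \<longleftrightarrow> x \<in> left_boundary F p" if x: "x \<in> carrier F" for x
  proof -
    have "\<not> D.lft y x" if "y \<notin> carrier F" for y using that D.lft_par[of y x] by (auto simp: D.par_def)
    then show ?thesis unfolding D.left_boundary_iff lbd_def using x lam1 by blast
  qed
  have lb2: "em x \<in> lbd False ?K \<longleftrightarrow> x \<in> right_boundary F p" if x: "x \<in> carrier F" for x
  proof -
    have "\<not> D.lft x y" if "y \<notin> carrier F" for y using that D.lft_par[of x y] by (auto simp: D.par_def)
    then show ?thesis unfolding D.right_boundary_iff lbd_def using x lam2 by blast
  qed
  let ?b = "em \<bottom>\<^bsub>F\<^esub>" and ?t = "em \<top>\<^bsub>F\<^esub>" and ?l = "em lc" and ?r = "em rc"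
  have bt: "?b \<in> ?K" "?t \<in> ?K" and ble: "\<And>s. s \<in> ?K \<Longrightarrow> ?b \<le> s" and tge: "\<And>s. s \<in> ?K \<Longrightarrow> s \<le> ?t"
    using em_le by auto
  have e: "?l \<noteq> ?b" "?l \<noteq> ?t" "?r \<noteq> ?b" "?r \<noteq> ?t" using l r lcc I.f_inj by auto
  have u1: "a = ?l" if a: "a \<in> lbd True ?K" "dirr ?K a" "a \<noteq> ?b" "a \<noteq> ?t" for a
  proof -
    obtain x where x: "x \<in> carrier F" "a = em x" using lbd_in[OF a(1)] by blast
    then have "x \<in> {lc}" using a lb1 I.f_dirr unfolding L[symmetric] by auto
    then show ?thesis using x by simp
  qed
  have u2: "a = ?r" if a: "a \<in> lbd False ?K" "dirr ?K a" "a \<noteq> ?b" "a \<noteq> ?t" for a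
  proof -
    obtain x where x: "x \<in> carrier F" "a = em x" using lbd_in[OF a(1)] by blast
    then have "x \<in> {rc}" using a lb2 I.f_dirr unfolding Rr[symmetric] by auto
    then show ?thesis using x by simp
  qed
  have j: "jn ?K ?l ?r = ?t" "mt ?K ?l ?r = ?b" using I.f_jn[OF lcc] I.f_mt[OF lcc] jt mb by auto
  have ll: "?l \<in> lbd True ?K" "?r \<in> lbd False ?K" using lb1 lb2 l r lcc by auto
  interpret C1: corner_pair True ?K ?b ?t ?l ?r
    by (rule corner_pair.intro) (use pK bt ble tge ll e u1 j in simp_all)
  interpret C2: corner_pair False ?K ?b ?t ?r ?l
    by (rule corner_pair.intro) (use pK bt ble tge ll e u2 j in \<open>simp_all add: jn_comm[of ?K ?r ?l] mt_comm[of ?K ?r ?l]\<close>)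
  obtain P where P: "side True ?K P" "ladder P" "\<forall>x y. (x, True, y) \<in> set P \<longrightarrow> y \<le> ?l" "\<forall>x y. (x, False, y) \<in> set P \<longrightarrow> ?l \<le> x"
    using C1.side_exists by blast
  obtain Q where Q: "side False ?K Q" "ladder Q" "\<forall>x y. (x, True, y) \<in> set Q \<longrightarrow> y \<le> ?r" "\<forall>x y. (x, False, y) \<in> set Q \<longrightarrow> ?r \<le> x"
    using C2.side_exists by blast
  \<comment> \<open>A common start of upper edges would be above both corners, hence the top, which
    no edge leaves; a common end of lower edges would be the bottom.\<close>
  have "compat P Q"
  proof -
    have "(x, False, y') \<notin> set Q" if xy: "(x, False, y) \<in> set P" for x y y'
    proof
      assume q: "(x, False, y') \<in> set Q"
      note i = cov_in[OF side_cov[OF P(1) xy]]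
      have "?t \<le> x" using jn_least[OF C1.K C1.lcK C1.rcK i(1)] P(4) Q(4) xy q j by metis
      then show False using i(3) tge[OF i(2)] by (meson leD order_less_le_trans order_trans)
    qed
    moreover have "(x', True, y) \<notin> set Q" if xy: "(x, True, y) \<in> set P" for x x' y
    proof
      assume q: "(x', True, y) \<in> set Q"
      note i = cov_in[OF side_cov[OF P(1) xy]]
      have "y \<le> ?b" using mt_greatest[OF C1.K C1.lcK C1.rcK i(2)] P(3) Q(3) xy q j by metis
      then show False using i(3) ble[OF i(1)] by (meson leD order_less_le_trans order_trans)
    qed
    ultimately show ?thesis unfolding compat_def by blast
  qed
  then have "frame True ?K P Q" using pK P Q by (simp add: frame_def state_def)
  moreover have "em \<bottom>\<^bsub>F\<^esub> = c" by (simp add: em_def)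
  ultimately show ?thesis using I.oiso_axioms by blast
qed

section \<open>From frames back to rectangular lattices\<close>

lemma walk_inner:
  "walk es a b \<Longrightarrow> v \<in> verts es \<Longrightarrow> (v = a \<or> (\<exists>x l. (x, l, v) \<in> set es)) \<and> (v = b \<or> (\<exists>l y. (v, l, y) \<in> set es))"
proof (induction es a b rule: walk.induct)
  case (2 x l y es a b)
  then have w: "x = a" "walk es y b" by auto
  have m: "(x, l, y) \<in> set ((x, l, y) # es)" and sub: "\<And>e. e \<in> set es \<Longrightarrow> e \<in> set ((x, l, y) # es)"
    by simp_all
  show ?case
  proof (cases "v \<in> verts es")
    case True
    then show ?thesis using 2(1)[OF w(2)] m sub by blast
  next
    case False
    then have v: "v = x \<or> v = y" using 2(3) by auto
    have "y = b" if "es = []" using w(2) that by simp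
    moreover have "y \<in> verts es" if "es \<noteq> []" using walk_start[OF w(2) that] .
    ultimately have "v = y \<Longrightarrow> v = b" using False by blast
    then show ?thesis using v w(1) m by blast
  qed
qed (simp add: verts_def)

text \<open>Whatever lies strictly below the end of an edge lies below its start; descending along
  the walk, one meets \<open>s\<close> as the end of an edge or arrives at \<open>a\<close>.\<close>

lemma walk_low:
  "walk es a b \<Longrightarrow> (\<And>x l y s. (x, l, y) \<in> set es \<Longrightarrow> s \<in> K \<Longrightarrow> s < y \<Longrightarrow> s \<le> x) \<Longrightarrow> s \<in> K \<Longrightarrow> s \<le> b \<Longrightarrow>
    s \<le> a \<or> (\<exists>x l. (x, l, s) \<in> set es)"
proof (induction es arbitrary: b rule: rev_induct)
  case (snoc e es)
  obtain x l y where e: "e = (x, l, y)" by (cases e)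
  have w: "walk es a x" "y = b" using snoc(2) e by (auto simp: walk_append)
  show ?case
  proof (cases "s = b")
    case True
    then have "(x, l, s) \<in> set (es @ [e])" using e w by simp
    then show ?thesis by blast
  next
    case False
    then have "s \<le> x" using snoc(3)[of x l y s] e w snoc(4,5) by (auto simp: order_less_le)
    moreover have "t \<le> x'" if "(x', l', y') \<in> set es" "t \<in> K" "t < y'" for x' l' y' t
      using snoc(3)[of x' l' y' t] that by simp
    ultimately have "s \<le> a \<or> (\<exists>x l. (x, l, s) \<in> set es)" using snoc(1)[OF w(1) _ snoc(4)] by blast
    then show ?thesis unfolding set_append by blast
  qed
qed simp

lemma walk_high:
  "walk es a b \<Longrightarrow> (\<And>x l y s. (x, l, y) \<in> set es \<Longrightarrow> s \<in> K \<Longrightarrow> x < s \<Longrightarrow> y \<le> s) \<Longrightarrow> s \<in> K \<Longrightarrow> a \<le> s \<Longrightarrow>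
    b \<le> s \<or> (\<exists>l y. (s, l, y) \<in> set es)"
proof (induction es arbitrary: a)
  case (Cons e es)
  obtain x l y where e: "e = (x, l, y)" by (cases e)
  have w: "x = a" "walk es y b" using Cons(2) e by auto
  show ?case
  proof (cases "s = a")
    case True
    then have "(s, l, y) \<in> set (e # es)" using e w by simp
    then show ?thesis by blast
  next
    case False
    then have "y \<le> s" using Cons(3)[of x l y s] e w Cons(4,5) by (auto simp: order_less_le)
    moreover have "y' \<le> t" if "(x', l', y') \<in> set es" "t \<in> K" "x' < t" for x' l' y' t
      using Cons(3)[of x' l' y' t] that by simp
    ultimately have "b \<le> s \<or> (\<exists>l y. (s, l, y) \<in> set es)" using Cons(1)[OF w(2) _ Cons(4)] by blast
    then show ?thesis unfolding list.set by blast
  qed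
qed simp

text \<open>The corner is the vertex where the labels change from lower to upper; both its covers
  are unique. At any other inner vertex two edges with equal labels meet, and the branch that
  \<open>side\<close> guarantees there excludes double irreducibility.\<close>

lemma side_corner:
  assumes s: "side d K P" and lad: "ladder P" and bK: "b \<in> K" and tK: "t \<in> K" and bnd: "\<forall>s\<in>K. b \<le> s \<and> s \<le> t"
  shows "\<exists>lc. lc \<in> lbd d K \<and> dirr K lc \<and> lc \<noteq> b \<and> lc \<noteq> t \<and> (\<forall>a\<in>lbd d K. dirr K a \<and> a \<noteq> b \<and> a \<noteq> t \<longrightarrow> a = lc) \<and>
    (\<forall>x\<in>K. x \<le> lc \<longrightarrow> x = b \<or> (\<exists>y. (y, True, x) \<in> set P)) \<and> (\<forall>x\<in>K. lc \<le> x \<longrightarrow> x = t \<or> (\<exists>y. (x, False, y) \<in> set P))"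
proof -
  have b: "b \<in> K" "\<And>s. s \<in> K \<Longrightarrow> b \<le> s" and t: "t \<in> K" "\<And>s. s \<in> K \<Longrightarrow> s \<le> t"
    using bK tK bnd by auto
  obtain as us where P: "P = as @ us" "as \<noteq> []" "us \<noteq> []" "\<forall>a l b. (a, l, b) \<in> set as \<longrightarrow> l" "\<forall>a l b. (a, l, b) \<in> set us \<longrightarrow> \<not> l"
    using lad by (auto simp: ladder_def)
  obtain b' t' where bt: "b' \<in> K" "t' \<in> K" "\<forall>s\<in>K. b' \<le> s \<and> s \<le> t'" "walk P b' t'" using side_walk[OF s] by blast
  have "b' = b" "t' = t" using bt b t by (meson order_antisym)+
  then have "walk P b t" using bt(4) by simp
  then obtain lc where w: "walk as b lc" "walk us lc t" unfolding P(1) walk_append by blast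
  have inc: "x < y" if "(x, l, y) \<in> set P" for x l y using side_cov[OF s that] by (simp add: cov_iff)
  have incA: "x < y" if "(x, l, y) \<in> set as" for x l y using inc[of x l y] that P(1) by simp
  have incU: "x < y" if "(x, l, y) \<in> set us" for x l y using inc[of x l y] that P(1) by simp
  have low1: "y \<le> lc" if "(x, l, y) \<in> set as" for x l y
  proof -
    have "b \<le> lc \<and> (\<forall>x l y. (x, l, y) \<in> set as \<longrightarrow> b \<le> x \<and> y \<le> lc)"
      by (rule walk_bounds[OF w(1)], rule incA, assumption)
    then show ?thesis using that by blast
  qed
  have high1: "lc \<le> x" if "(x, l, y) \<in> set us" for x l y
  proof -
    have "lc \<le> t \<and> (\<forall>x l y. (x, l, y) \<in> set us \<longrightarrow> lc \<le> x \<and> y \<le> t)"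
      by (rule walk_bounds[OF w(2)], rule incU, assumption)
    then show ?thesis using that by blast
  qed
  have low2: "(x, True, y) \<in> set P" if xy: "(x, l, y) \<in> set as" for x l y
  proof -
    have "l = True" using P(4) xy by blast
    then show ?thesis using xy P(1) by simp
  qed
  have high2: "(x, False, y) \<in> set P" if xy: "(x, l, y) \<in> set us" for x l y
  proof -
    have "l = False" using P(5) xy by blast
    then show ?thesis using xy P(1) by simp
  qed
  obtain as0 e where "as = as0 @ [e]" using P(2) rev_exhaust by blast
  moreover obtain a1 l1 c1 where "e = (a1, l1, c1)" by (cases e)
  ultimately have e1: "(a1, l1, lc) \<in> set as" using w(1) by (auto simp: walk_append)
  have eT: "(a1, True, lc) \<in> set P" using low2[OF e1] .
  obtain f us0 where "us = f # us0" using P(3) by (cases us) auto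
  moreover obtain a2 l2 c2 where "f = (a2, l2, c2)" by (cases f)
  ultimately have e2: "(lc, l2, c2) \<in> set us" using w(2) by auto
  have eF: "(lc, False, c2) \<in> set P" using high2[OF e2] .
  note i1 = cov_in[OF side_cov[OF s eT]] and i2 = cov_in[OF side_cov[OF s eF]]
  have lb: "lc \<in> lbd d K" using side_verts(2)[OF s eT] .
  have "v = a1" if v: "cov K v lc" for v
    using side_lower[OF s eT cov_in(1)[OF v] cov_in(3)[OF v]] cov_between[OF v i1(1)] i1(3) by (auto simp: less_imp_le)
  then have u1: "\<exists>!v. cov K v lc" using side_cov[OF s eT] by blast
  have "v = c2" if v: "cov K lc v" for v
    using side_upper[OF s eF cov_in(2)[OF v] cov_in(3)[OF v]] cov_between[OF v i2(2)] i2(3) by (auto simp: less_imp_le)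
  then have u2: "\<exists>!v. cov K lc v" using side_cov[OF s eF] by blast
  have d: "dirr K lc" using u1 u2 i1(2) by (simp add: doubly_irreducible_def)
  have ne: "lc \<noteq> b" "lc \<noteq> t" using i1(3) b(2)[OF i1(1)] i2(3) t(2)[OF i2(2)] by auto
  have un: "a = lc" if a: "a \<in> lbd d K" "dirr K a" "a \<noteq> b" "a \<noteq> t" for a
  proof -
    have "a \<in> verts P" using a(1) side_lbd[OF s] by simp
    then obtain x m n z where xz: "(x, m, a) \<in> set P" "(a, n, z) \<in> set P"
      using walk_inner[OF \<open>walk P b t\<close>] a by blast
    have nTT: "\<not> (m \<and> n)"
    proof
      assume "m \<and> n"
      then obtain r where "r \<noteq> z" "cov K a r" using side_TT[OF s, of x a z] xz by auto
      then show False using a(2) side_cov[OF s xz(2)] unfolding doubly_irreducible_def by blast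
    qed
    have nFF: "\<not> (\<not> m \<and> \<not> n)"
    proof
      assume "\<not> m \<and> \<not> n"
      then obtain r where "r \<noteq> x" "cov K r a" using side_FF[OF s, of x a z] xz by auto
      then show False using a(2) side_cov[OF s xz(1)] unfolding doubly_irreducible_def by blast
    qed
    have nm: "m \<Longrightarrow> (x, m, a) \<in> set as" "\<not> m \<Longrightarrow> (x, m, a) \<in> set us" "n \<Longrightarrow> (a, n, z) \<in> set as" "\<not> n \<Longrightarrow> (a, n, z) \<in> set us"
    proof -
      have "(x, m, a) \<in> set as \<or> (x, m, a) \<in> set us" "(a, n, z) \<in> set as \<or> (a, n, z) \<in> set us"
        using xz unfolding P(1) by simp_all
      then show "m \<Longrightarrow> (x, m, a) \<in> set as" "\<not> m \<Longrightarrow> (x, m, a) \<in> set us" "n \<Longrightarrow> (a, n, z) \<in> set as" "\<not> n \<Longrightarrow> (a, n, z) \<in> set us"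
        using P(4,5) by blast+
    qed
    show "a = lc"
    proof (cases m)
      case True
      then show ?thesis using nTT low1[OF nm(1)] high1[OF nm(4)] by auto
    next
      case False
      then have "lc \<le> x" "z \<le> lc" using nFF low1[OF nm(3)] high1[OF nm(2)] by auto
      then show ?thesis using inc[OF xz(1)] inc[OF xz(2)] by (meson leD order_less_le_trans order_le_less_trans order_less_trans)
    qed
  qed
  have lo: "x = b \<or> (\<exists>y. (y, True, x) \<in> set P)" if x: "x \<in> K" "x \<le> lc" for x
  proof -
    have A: "r \<le> p" if "(p, l, q) \<in> set as" "r \<in> K" "r < q" for p l q r
      using side_lower[OF s low2[OF that(1)] that(2,3)] .
    have "x \<le> b \<or> (\<exists>y l. (y, l, x) \<in> set as)"
      by (rule walk_low[OF w(1) _ x], rule A, assumption+)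
    then show ?thesis using b(2)[OF x(1)] low2 by (metis order_antisym)
  qed
  have hi: "x = t \<or> (\<exists>y. (x, False, y) \<in> set P)" if x: "x \<in> K" "lc \<le> x" for x
  proof -
    have A: "q \<le> r" if "(p, l, q) \<in> set us" "r \<in> K" "p < r" for p l q r
      using side_upper[OF s high2[OF that(1)] that(2,3)] .
    have "t \<le> x \<or> (\<exists>l y. (x, l, y) \<in> set us)"
      by (rule walk_high[OF w(2) _ x], rule A, assumption+)
    then show ?thesis using t(2)[OF x(1)] high2 by (metis order_antisym)
  qed
  show ?thesis using lb d ne un lo hi by (intro exI[of _ lc] conjI ballI impI) blast+
qed

lemma segment_le: assumes "a \<le> b" "r \<in> closed_segment a b" shows "a \<le> r \<and> r \<le> (b :: real \<times> real)"
proof -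
  obtain s where s: "0 \<le> s" "s \<le> 1" "r = (1 - s) *\<^sub>R a + s *\<^sub>R b" using assms(2) unfolding closed_segment_def by blast
  have "x \<le> (1 - s) * x + s * y \<and> (1 - s) * x + s * y \<le> y" if "x \<le> y" for x y :: real
  proof -
    have "0 \<le> s * (y - x)" "0 \<le> (1 - s) * (y - x)" using s that by simp_all
    then show ?thesis by (simp add: algebra_simps)
  qed
  then show ?thesis using assms(1) unfolding s(3) less_eq_prod_def by simp
qed

text \<open>Both segments are collinear, and in \<open>r = a + s (b - a) = a + t (c - a)\<close> the
  smaller parameter belongs to the farther end.\<close>

lemma segments_common_end:
  fixes a b c r :: "real \<times> real"
  assumes "a \<le> b" "a \<le> c" "r \<in> closed_segment a b" "r \<in> closed_segment a c" "r \<noteq> a" shows "b \<le> c \<or> c \<le> b"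
proof -
  obtain s where s: "0 \<le> s" "r = (1 - s) *\<^sub>R a + s *\<^sub>R b" using assms(3) unfolding closed_segment_def by blast
  obtain t where t: "0 \<le> t" "r = (1 - t) *\<^sub>R a + t *\<^sub>R c" using assms(4) unfolding closed_segment_def by blast
  have e1: "s * (fst b - fst a) = t * (fst c - fst a)" "s * (snd b - snd a) = t * (snd c - snd a)"
    using s(2) t(2) by (auto simp: prod_eq_iff algebra_simps)
  have "s \<noteq> 0" "t \<noteq> 0" using assms(5) s t by auto
  then have st: "s > 0" "t > 0" using s t by auto
  have main: "y' \<le> y" if "s * (y - x) = t * (y' - x)" "x \<le> y" "s \<le> t" "t > 0" for x y y' s t :: real
  proof -
    have "t * (y' - x) \<le> t * (y - x)" using that mult_right_mono[OF that(3), of "y - x"] by simp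
    then show ?thesis using that(4) by simp
  qed
  show ?thesis
  proof (cases "s \<le> t")
    case True
    then show ?thesis using main[OF e1(1)] main[OF e1(2)] assms(1) st by (simp add: less_eq_prod_def)
  next
    case False
    then show ?thesis using main[OF e1(1)[symmetric]] main[OF e1(2)[symmetric]] assms(2) st by (simp add: less_eq_prod_def)
  qed
qed

lemma segments_common_top:
  fixes a b c r :: "real \<times> real"
  assumes "b \<le> a" "c \<le> a" "r \<in> closed_segment b a" "r \<in> closed_segment c a" "r \<noteq> a" shows "b \<le> c \<or> c \<le> b"
proof -
  have n: "- x \<in> closed_segment (- z) (- y)" if x: "x \<in> closed_segment y z" for x y z :: "real \<times> real"
  proof -
    obtain s where s: "0 \<le> s" "s \<le> 1" "x = (1 - s) *\<^sub>R y + s *\<^sub>R z" using x unfolding closed_segment_def by blast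
    have "- x = (1 - (1 - s)) *\<^sub>R (- z) + (1 - s) *\<^sub>R (- y)" unfolding s(3) by simp
    moreover have "0 \<le> 1 - s" "1 - s \<le> 1" using s by simp_all
    ultimately show ?thesis unfolding closed_segment_def by blast
  qed
  have m: "- y \<le> - x \<longleftrightarrow> x \<le> y" for x y :: "real \<times> real" by (simp add: less_eq_prod_def)
  have "- b \<le> - c \<or> - c \<le> - b"
    by (rule segments_common_end[of "- a" "- b" "- c" "- r"]) (use assms(5) in \<open>simp_all only: m assms(1,2) n[OF assms(3)] n[OF assms(4)] neg_equal_iff_equal not_False_eq_True\<close>)
  then have "c \<le> b \<or> b \<le> c" by (simp only: m)
  then show ?thesis by (rule disj_commute[THEN iffD1])
qed

text \<open>The meet of the upper ends \<open>b\<close> and \<open>d\<close> is above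
  \<open>a\<close> and \<open>c\<close>, because \<open>a \<le> r \<le> d\<close> and
  \<open>c \<le> r \<le> b\<close>. It is therefore an end of both edges, so the edges share an
  end.\<close>

lemma segment_cross:
  fixes a b c d r :: "real \<times> real"
  assumes K: "lat K" and ab: "cov K a b" and cd: "cov K c d" and ne: "(a, b) \<noteq> (c, d)"
    and r: "r \<in> closed_segment a b" "r \<in> closed_segment c d"
  shows "r \<in> {a, b} \<inter> {c, d}"
proof -
  note i = cov_in[OF ab] and j = cov_in[OF cd]
  have ar: "a \<le> r" "r \<le> b" and cr: "c \<le> r" "r \<le> d"
    using segment_le[OF less_imp_le[OF i(3)] r(1)] segment_le[OF less_imp_le[OF j(3)] r(2)] by blast+
  let ?m = "mt K b d"
  have m: "?m \<in> K" "a \<le> ?m" "?m \<le> b" "c \<le> ?m" "?m \<le> d"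
    using mt_in[OF K i(2) j(2)] mt_le1[OF K i(2) j(2)] mt_le2[OF K i(2) j(2)]
      mt_greatest[OF K i(2) j(2) i(1) less_imp_le[OF i(3)] order_trans[OF ar(1) cr(2)]]
      mt_greatest[OF K i(2) j(2) j(1) order_trans[OF cr(1) ar(2)] less_imp_le[OF j(3)]] by blast+
  have "?m = a \<or> ?m = b" "?m = c \<or> ?m = d" using cov_between[OF ab m(1,2,3)] cov_between[OF cd m(1,4,5)] .
  then consider "a = c" | "b = d" | "a = d" | "b = c" by metis
  then show ?thesis
  proof cases
    case 1
    show ?thesis
    proof (cases "r = a")
      case False
      have "b \<le> d \<or> d \<le> b" using segments_common_end[of a b d r] r 1 False less_imp_le[OF i(3)] less_imp_le[OF j(3)] by simp
      then have "b = d" using cov_between[OF ab j(2)] cov_between[OF cd i(2)] 1 i j by (auto simp: less_imp_le)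
      then show ?thesis using 1 ne by simp
    qed (use 1 in simp)
  next
    case 2
    show ?thesis
    proof (cases "r = b")
      case False
      have "a \<le> c \<or> c \<le> a" using segments_common_top[of a b c r] r 2 False less_imp_le[OF i(3)] less_imp_le[OF j(3)] by simp
      then have "a = c" using cov_between[OF ab j(1)] cov_between[OF cd i(1)] 2 i j by (auto simp: less_imp_le)
      then show ?thesis using 2 ne by simp
    qed (use 2 in simp)
  next
    case 3 then have "r = a" using ar cr by auto then show ?thesis using 3 by simp
  next
    case 4 then have "r = b" using ar cr by auto then show ?thesis using 4 by simp
  qed
qed

definition rot :: "real \<times> real \<Rightarrow> real \<times> real" where "rot q = (fst q - snd q, fst q + snd q)"

lemma rot_linear: "linear rot" by (auto simp: linear_iff rot_def algebra_simps)
lemma rot_inj: "rot a = rot b \<longleftrightarrow> a = b" by (auto simp: rot_def prod_eq_iff)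
lemma rot_segment: "closed_segment (rot a) (rot b) = rot ` closed_segment a b"
  by (rule closed_segment_linear_image[OF rot_linear])

text \<open>The diagram of a set of points of the plane under the componentwise order is obtained by
  rotating the plane by 45 degrees (up to scaling).\<close>

theorem frame_rectangular:
  fixes g :: "'b \<Rightarrow> real \<times> real"
  assumes iso: "oiso L g K" and fr: "frame True K P Q"
  shows "rectangular_lattice L"
proof -
  interpret I: oiso L g K by (rule iso)
  have st: "state True K P Q" and lad: "ladder P" "ladder Q" using fr by (auto simp: frame_def)
  note pK = state_plat[OF st] and K = state_lat[OF st] and sP = state_side[OF st]
  have sQ: "side False K Q" using state_side2[OF st] by simp
  have finK: "finite K" using pK by (simp add: plat_def)
  have fin: "finite (carrier L)" using finK I.bij bij_betw_finite by blast
  obtain b0 t0 where bt0: "b0 \<in> K" "t0 \<in> K" "\<forall>s\<in>K. b0 \<le> s \<and> s \<le> t0" using side_walk[OF sP] by blast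
  obtain b where b: "b \<in> carrier L" "b0 = g b" using I.f_ex[OF bt0(1)] by blast
  obtain t where t: "t \<in> carrier L" "t0 = g t" using I.f_ex[OF bt0(2)] by blast
  have bl: "b \<sqsubseteq>\<^bsub>L\<^esub> x" and tl: "x \<sqsubseteq>\<^bsub>L\<^esub> t" if "x \<in> carrier L" for x
    using bt0(3) b t I.f_le[of b x] I.f_le[of x t] I.f_in[OF that] that by auto
  have "weak_partial_order_bottom_axioms L"
    unfolding weak_partial_order_bottom_axioms_def least_def using b bl by blast
  moreover have "weak_partial_order_top_axioms L"
    unfolding weak_partial_order_top_axioms_def greatest_def using t tl by blast
  ultimately have BL: "bounded_lattice L"
    by (intro bounded_lattice.intro weak_partial_order_bottom.intro weak_partial_order_top.intro)
      (rule I.lattice_axioms I.weak_partial_order_axioms | assumption)+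
  interpret B: bounded_lattice L by (rule BL)
  have bb: "\<bottom>\<^bsub>L\<^esub> = b" "\<top>\<^bsub>L\<^esub> = t" using B.bottom_eq[OF b(1) bl] B.top_eq[OF t(1) tl] by auto
  have B0: "b0 \<le> s" and T0: "s \<le> t0" if "s \<in> K" for s using bt0(3) that by auto
  obtain lc where lc: "lc \<in> lbd True K" "dirr K lc" "lc \<noteq> b0" "lc \<noteq> t0"
    "\<forall>a\<in>lbd True K. dirr K a \<and> a \<noteq> b0 \<and> a \<noteq> t0 \<longrightarrow> a = lc"
    "\<forall>x\<in>K. x \<le> lc \<longrightarrow> x = b0 \<or> (\<exists>y. (y, True, x) \<in> set P)" "\<forall>x\<in>K. lc \<le> x \<longrightarrow> x = t0 \<or> (\<exists>y. (x, False, y) \<in> set P)"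
    using side_corner[OF sP lad(1) bt0(1,2,3)] by (elim exE conjE) (rule that)
  obtain rc where rc: "rc \<in> lbd False K" "dirr K rc" "rc \<noteq> b0" "rc \<noteq> t0"
    "\<forall>a\<in>lbd False K. dirr K a \<and> a \<noteq> b0 \<and> a \<noteq> t0 \<longrightarrow> a = rc"
    "\<forall>x\<in>K. x \<le> rc \<longrightarrow> x = b0 \<or> (\<exists>y. (y, True, x) \<in> set Q)" "\<forall>x\<in>K. rc \<le> x \<longrightarrow> x = t0 \<or> (\<exists>y. (x, False, y) \<in> set Q)"
    using side_corner[OF sQ lad(2) bt0(1,2,3)] by (elim exE conjE) (rule that)
  note cp = state_compat[OF st]
  have li: "lc \<in> K" "rc \<in> K" using lbd_in[OF lc(1)] lbd_in[OF rc(1)] by auto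
  have mK: "mt K lc rc \<in> K" "mt K lc rc \<le> lc" "mt K lc rc \<le> rc"
    and jK: "jn K lc rc \<in> K" "lc \<le> jn K lc rc" "rc \<le> jn K lc rc" using K li by simp_all
  \<comment> \<open>Any other meet would end a lower edge on each side, against
    \<open>compat\<close>; the join is treated dually.\<close>
  have mb: "mt K lc rc = b0"
  proof (rule ccontr)
    assume n: "mt K lc rc \<noteq> b0"
    obtain y where "(y, True, mt K lc rc) \<in> set P" using bspec[OF lc(6) mK(1)] mK(2) n by auto
    moreover obtain y' where "(y', True, mt K lc rc) \<in> set Q" using bspec[OF rc(6) mK(1)] mK(3) n by auto
    ultimately show False using compatT[OF cp] by blast
  qed
  have jt: "jn K lc rc = t0"
  proof (rule ccontr)
    assume n: "jn K lc rc \<noteq> t0"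
    obtain y where "(jn K lc rc, False, y) \<in> set P" using bspec[OF lc(7) jK(1)] jK(2) n by auto
    moreover obtain y' where "(jn K lc rc, False, y') \<in> set Q" using bspec[OF rc(7) jK(1)] jK(3) n by auto
    ultimately show False using compatF[OF cp] by blast
  qed
  let ?p = "\<lambda>x. rot (g x)"
  have pd: "planar_diagram L ?p" unfolding planar_diagram_def
  proof (intro conjI ballI allI impI)
    show "inj_on ?p (carrier L)" by (rule inj_onI) (simp add: rot_inj I.f_inj)
    fix x y assume xy: "x \<in> carrier L" "y \<in> carrier L" "x \<sqsubset>\<^bsub>L\<^esub> y"
    then have "g x < g y" using I.f_less by blast
    then have "fst (g x) \<le> fst (g y)" "snd (g x) \<le> snd (g y)" "g x \<noteq> g y" by (auto simp: order_less_le less_eq_prod_def)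
    then show "snd (?p x) < snd (?p y)" by (auto simp: rot_def prod_eq_iff)
  next
    fix a c b d assume h: "covers L a b \<and> covers L c d \<and> (a, b) \<noteq> (c, d)"
    then have car: "a \<in> carrier L" "b \<in> carrier L" "c \<in> carrier L" "d \<in> carrier L" by (auto simp: covers_def)
    show "closed_segment (?p a) (?p b) \<inter> closed_segment (?p c) (?p d) \<subseteq> ?p ` ({a, b} \<inter> {c, d})"
    proof
      fix q assume "q \<in> closed_segment (?p a) (?p b) \<inter> closed_segment (?p c) (?p d)"
      then obtain r where r: "r \<in> closed_segment (g a) (g b)" "r \<in> closed_segment (g c) (g d)" "q = rot r"
        unfolding rot_segment by (auto simp: rot_inj)
      have "r \<in> {g a, g b} \<inter> {g c, g d}"
        by (rule segment_cross[OF K _ _ _ r(1,2)]) (use h car I.f_cov I.f_inj in auto)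
      then show "q \<in> ?p ` ({a, b} \<inter> {c, d})" using r(3) I.f_inj car by auto
    qed
  qed
  have nt: "\<bottom>\<^bsub>L\<^esub> \<noteq> \<top>\<^bsub>L\<^esub>"
  proof
    assume "\<bottom>\<^bsub>L\<^esub> = \<top>\<^bsub>L\<^esub>"
    then have "b0 = t0" using bb b t by simp
    then have "lc = b0" using bt0(3) li(1) by (meson order_antisym)
    then show False using lc(3) by simp
  qed
  interpret D: diagram L ?p by unfold_locales (use fin pd nt in auto)
  \<comment> \<open>At the height of \<open>x\<close> the chain \<open>R\<close> through
    \<open>y\<close> runs inside an edge \<open>[c, e]\<close> that is entirely above or entirely
    below \<open>y\<close>. So its point \<open>r\<close> is comparable with \<open>g y\<close>, and
    on the level of \<open>g x\<close> this forces it to the left.\<close>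
  have lam_lft: "D.lft y x" if par: "D.par y x" and l: "lam True (g y) (g x)" for x y
  proof -
    have car: "y \<in> carrier L" "x \<in> carrier L" using par by (auto simp: D.par_def)
    obtain R where R: "D.full R" "y \<in> set R" using D.full_through[OF car(1)] by blast
    obtain c e where ce: "D.consec R c e" "D.h c \<le> D.h x" "D.h x \<le> D.h e" using D.full_seg[OF R(1) car(2)] by blast
    have Rp: "D.path R \<bottom>\<^bsub>L\<^esub> \<top>\<^bsub>L\<^esub>" using R by (simp add: D.full_def)
    have cv: "covers L c e" using D.consec_cov[OF Rp ce(1)] .
    note cc = D.covD[OF cv]
    have cR: "c \<in> set R" "e \<in> set R" using D.consec_set[OF ce(1)] by auto
    have "(D.px R (D.h x), D.h x) \<in> closed_segment (?p c) (?p e)"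
      using D.lin_segment[OF cv ce(2,3)] D.px_consec[OF Rp ce] by simp
    then obtain r where r: "r \<in> closed_segment (g c) (g e)" "(D.px R (D.h x), D.h x) = rot r"
      unfolding rot_segment by blast
    have rr: "g c \<le> r" "r \<le> g e" using segment_le[OF _ r(1)] cc I.f_le by auto
    have "y \<sqsubseteq>\<^bsub>L\<^esub> c \<or> e \<sqsubseteq>\<^bsub>L\<^esub> y"
    proof (cases "D.h y \<le> D.h c")
      case True then show ?thesis using D.full_compar[OF R cR(1)] by blast
    next
      case False
      then have cy: "c \<sqsubseteq>\<^bsub>L\<^esub> y" "c \<noteq> y" using D.full_compar[OF R(1) cR(1) R(2)] by auto
      show ?thesis
      proof (cases "D.h e \<le> D.h y")
        case True then show ?thesis using D.full_compar[OF R(1) cR(2) R(2)] by blast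
      next
        case False
        then have "y \<sqsubseteq>\<^bsub>L\<^esub> e" "y \<noteq> e" using D.full_compar[OF R(1) R(2) cR(2)] by auto
        then show ?thesis using cv cy car by (auto simp: covers_def I.lless_eq)
      qed
    qed
    then have "g y \<le> g c \<or> g e \<le> g y" using I.f_le cc car by blast
    moreover have "fst (g y) < fst (g x)" "snd (g x) < snd (g y)" using l by (auto simp: lam_def co_def)
    moreover have "fst r + snd r = fst (g x) + snd (g x)" "D.px R (D.h x) = fst r - snd r"
      using r(2) by (auto simp: rot_def)
    ultimately have "D.px R (D.h x) < fst (?p x)" using rr by (auto simp: rot_def less_eq_prod_def)
    then show ?thesis using D.lft_iff2[OF par R] by simp
  qed
  have lft_lam: "D.lft y x \<longleftrightarrow> lam True (g y) (g x)" if car: "y \<in> carrier L" "x \<in> carrier L" for x y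
  proof
    assume l: "lam True (g y) (g x)"
    then have "D.par y x" using lam_not_le[OF l] I.f_le car by (auto simp: D.par_def)
    then show "D.lft y x" using lam_lft l by blast
  next
    assume l: "D.lft y x"
    note par = D.lft_par[OF l]
    show "lam True (g y) (g x)"
    proof (rule lam_cases[OF pK I.f_in[OF car(1)] I.f_in[OF car(2)], where d = True])
      assume "lam True (g x) (g y)"
      then have "D.lft x y" using lam_lft D.par_sym[OF par] by blast
      then show ?thesis using D.lft_asym[OF l] by blast
    qed (use par I.f_le car in \<open>auto simp: D.par_def\<close>)
  qed
  have out: "\<not> D.lft y x \<and> \<not> D.lft x y" if "y \<notin> carrier L" for x y
    using that D.lft_par[of y x] D.lft_par[of x y] by (auto simp: D.par_def)
  have L1: "x \<in> left_boundary L ?p \<longleftrightarrow> g x \<in> lbd True K" if x: "x \<in> carrier L" for x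
  proof -
    have "(\<forall>y. \<not> D.lft y x) \<longleftrightarrow> (\<forall>a\<in>K. \<not> lam True a (g x))"
    proof (intro iffI ballI allI)
      fix a assume h: "\<forall>y. \<not> D.lft y x" and a: "a \<in> K"
      obtain y where "y \<in> carrier L" "a = g y" using I.f_ex[OF a] by blast
      then show "\<not> lam True a (g x)" using h lft_lam[OF _ x] by simp
    next
      fix y assume h: "\<forall>a\<in>K. \<not> lam True a (g x)"
      show "\<not> D.lft y x"
      proof (cases "y \<in> carrier L")
        case True then show ?thesis using lft_lam[OF True x] h I.f_in[OF True] by simp
      next
        case False then show ?thesis using out by simp
      qed
    qed
    then show ?thesis using x I.f_in[OF x] by (simp add: D.left_boundary_iff lbd_def)
  qed
  have L2: "x \<in> right_boundary L ?p \<longleftrightarrow> g x \<in> lbd False K" if x: "x \<in> carrier L" for x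
  proof -
    have m: "lam False a (g x) \<longleftrightarrow> lam True (g x) a" for a using lam_mirror[of True a "g x"] by simp
    have "(\<forall>y. \<not> D.lft x y) \<longleftrightarrow> (\<forall>a\<in>K. \<not> lam False a (g x))"
    proof (intro iffI ballI allI)
      fix a assume h: "\<forall>y. \<not> D.lft x y" and a: "a \<in> K"
      obtain y where "y \<in> carrier L" "a = g y" using I.f_ex[OF a] by blast
      then show "\<not> lam False a (g x)" using h lft_lam[OF x] m by simp
    next
      fix y assume h: "\<forall>a\<in>K. \<not> lam False a (g x)"
      show "\<not> D.lft x y"
      proof (cases "y \<in> carrier L")
        case True then show ?thesis using lft_lam[OF x True] h I.f_in[OF True] m by simp
      next
        case False then show ?thesis using out by simp
      qed
    qed
    then show ?thesis using x I.f_in[OF x] by (simp add: D.right_boundary_iff lbd_def)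
  qed
  obtain l0 where l0: "l0 \<in> carrier L" "lc = g l0" using I.f_ex[OF li(1)] by blast
  obtain r0 where r0: "r0 \<in> carrier L" "rc = g r0" using I.f_ex[OF li(2)] by blast
  have E1: "{x \<in> left_boundary L ?p. doubly_irreducible L x \<and> x \<noteq> \<bottom>\<^bsub>L\<^esub> \<and> x \<noteq> \<top>\<^bsub>L\<^esub>} = {l0}"
  proof (intro equalityI subsetI)
    fix x assume x: "x \<in> {x \<in> left_boundary L ?p. doubly_irreducible L x \<and> x \<noteq> \<bottom>\<^bsub>L\<^esub> \<and> x \<noteq> \<top>\<^bsub>L\<^esub>}"
    then have xc: "x \<in> carrier L" by (simp add: left_boundary_def)
    have "g x = lc" using lc(5) x xc L1 I.f_dirr I.f_inj b t bb by auto
    then show "x \<in> {l0}" using l0 xc I.f_inj by auto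
  next
    fix x assume "x \<in> {l0}"
    then show "x \<in> {x \<in> left_boundary L ?p. doubly_irreducible L x \<and> x \<noteq> \<bottom>\<^bsub>L\<^esub> \<and> x \<noteq> \<top>\<^bsub>L\<^esub>}"
      using l0 lc(1-4) L1 I.f_dirr b t bb by auto
  qed
  have E2: "{x \<in> right_boundary L ?p. doubly_irreducible L x \<and> x \<noteq> \<bottom>\<^bsub>L\<^esub> \<and> x \<noteq> \<top>\<^bsub>L\<^esub>} = {r0}"
  proof (intro equalityI subsetI)
    fix x assume x: "x \<in> {x \<in> right_boundary L ?p. doubly_irreducible L x \<and> x \<noteq> \<bottom>\<^bsub>L\<^esub> \<and> x \<noteq> \<top>\<^bsub>L\<^esub>}"
    then have xc: "x \<in> carrier L" by (simp add: right_boundary_def)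
    have "g x = rc" using rc(5) x xc L2 I.f_dirr I.f_inj b t bb by auto
    then show "x \<in> {r0}" using r0 xc I.f_inj by auto
  next
    fix x assume "x \<in> {r0}"
    then show "x \<in> {x \<in> right_boundary L ?p. doubly_irreducible L x \<and> x \<noteq> \<bottom>\<^bsub>L\<^esub> \<and> x \<noteq> \<top>\<^bsub>L\<^esub>}"
      using r0 rc(1-4) L2 I.f_dirr b t bb by auto
  qed
  have j: "l0 \<squnion>\<^bsub>L\<^esub> r0 = \<top>\<^bsub>L\<^esub>" "l0 \<sqinter>\<^bsub>L\<^esub> r0 = \<bottom>\<^bsub>L\<^esub>"
    using I.f_jn[OF l0(1) r0(1)] I.f_mt[OF l0(1) r0(1)] jt mb l0 r0 b t bb I.f_inj by auto
  have S: "semimodular L" using I.f_smod pK by (simp add: plat_def)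
  show ?thesis unfolding rectangular_lattice_def using BL fin S pd E1 E2 j by blast
qed

section \<open>The glued sum and its corners\<close>

lemma side_last:
  assumes s: "side d K P" and P: "P = P' @ [(a, l, c)]"
  shows "(a', m, c) \<in> set P \<Longrightarrow> m = l"
proof -
  have ac: "a < c" using side_cov[OF s, of a l c] P by (auto simp: cov_iff)
  assume "(a', m, c) \<in> set P"
  moreover have "(a', m, c) \<notin> set P'" using side_split[of d K P' a l c "[]" a' m c] s P ac by auto
  ultimately show "m = l" using P by auto
qed

lemma cov_dn: assumes "dn K K'" "cov K a b" shows "cov K' a b"
proof -
  have "t \<in> K" if "t \<in> K'" "t < b" for t
    using dnD[OF assms(1) cov_in(2)[OF assms(2)] that(1) less_imp_le[OF that(2)]] .
  then show ?thesis using assms(2) dn_sub[OF assms(1)] unfolding cov_iff by blast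
qed

lemma ladder_first: "ladder P \<Longrightarrow> \<exists>a c P'. P = (a, True, c) # P'"
proof -
  assume "ladder P"
  then obtain as us where P: "P = as @ us" "as \<noteq> []" "\<forall>a l b. (a, l, b) \<in> set as \<longrightarrow> l" by (auto simp: ladder_def)
  then obtain e as' where as: "as = e # as'" by (cases as) auto
  obtain a l c where e: "e = (a, l, c)" by (cases e)
  have "(a, l, c) \<in> set as" using as e by simp
  then have "l = True" using P(3) by blast
  then show ?thesis using P as e by auto
qed

lemma ladder_last: "ladder P \<Longrightarrow> \<exists>a c P'. P = P' @ [(a, False, c)]"
proof -
  assume "ladder P"
  then obtain as us where P: "P = as @ us" "us \<noteq> []" "\<forall>a l b. (a, l, b) \<in> set us \<longrightarrow> \<not> l" by (auto simp: ladder_def)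
  then obtain e us' where us: "us = us' @ [e]" by (cases us rule: rev_cases) auto
  obtain a l c where e: "e = (a, l, c)" by (cases e)
  have "(a, l, c) \<in> set us" using us e by simp
  then have "l = False" using P(3) by blast
  then show ?thesis using P us e by auto
qed

text \<open>At the seam \<open>e\<close> an upper edge is followed by a lower edge, so no two equal
  labels meet there and no branch has to be supplied.\<close>

lemma side_glue:
  assumes gs: "glued_sum F G e" and sF: "side d F P" and sG: "side d G Q" and lF: "ladder P" and lG: "ladder Q"
    and lb: "lbd d (F \<union> G) = lbd d F \<union> lbd d G"
  shows "side d (F \<union> G) (P @ Q)"
proof -
  interpret glued_sum F G e by (rule gs)
  obtain b t where bt: "b \<in> F" "t \<in> F" "\<forall>s\<in>F. b \<le> s \<and> s \<le> t" "walk P b t" using side_walk[OF sF] by blast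
  obtain b' t' where bt': "b' \<in> G" "t' \<in> G" "\<forall>s\<in>G. b' \<le> s \<and> s \<le> t'" "walk Q b' t'" using side_walk[OF sG] by blast
  have te: "t = e" "b' = e" using bt bt' eF eG Fe[OF bt(2)] Ge[OF bt'(1)] by (auto intro: order_antisym)
  have iF: "x \<in> F" "y \<in> F" "x < y" if "(x, l, y) \<in> set P" for x l y using cov_in[OF side_cov[OF sF that]] by auto
  have iG: "x \<in> G" "y \<in> G" "x < y" if "(x, l, y) \<in> set Q" for x l y using cov_in[OF side_cov[OF sG that]] by auto
  obtain c1 c2 P' where P: "P = P' @ [(c1, False, c2)]" using ladder_last[OF lF] by blast
  have c2: "c2 = e" using bt(4) te unfolding P by (auto simp: walk_append)
  have noT: "(x, True, e) \<notin> set P" for x using side_last[OF sF P, of x True] c2 by blast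
  obtain a1 a2 Q' where Q: "Q = (a1, True, a2) # Q'" using ladder_first[OF lG] by blast
  have a1: "a1 = e" using bt'(4) te unfolding Q by simp
  have noF: "(e, False, x) \<notin> set Q" for x using side_first(3)[OF sG Q, of False x] a1 by auto
  have mix: "False" if "(x, l, y) \<in> set Q" "(y, m, z) \<in> set P" for x l y m z
  proof -
    have "y = e" using both iG[OF that(1)] iF[OF that(2)] by blast
    then show False using iF(3)[OF that(2)] Fe[OF iF(2)[OF that(2)]] by auto
  qed
  have mem: "(x, l, y) \<in> set P \<or> (x, l, y) \<in> set Q" if "(x, l, y) \<in> set (P @ Q)" for x l y using that by simp
  show ?thesis
  proof (rule sideI)
    show "P @ Q \<noteq> []" using P by simp
    have "walk (P @ Q) b t'" unfolding walk_append using bt(4) bt'(4) te by blast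
    moreover have "b \<le> s \<and> s \<le> t'" if "s \<in> F \<union> G" for s
      using that bt(1,3) bt'(2,3) FG_le[of b s] FG_le[of s t'] by auto
    ultimately show "\<exists>b t. b \<in> F \<union> G \<and> t \<in> F \<union> G \<and> (\<forall>s\<in>F \<union> G. b \<le> s \<and> s \<le> t) \<and> walk (P @ Q) b t"
      using bt(1) bt'(2) by blast
    show "lbd d (F \<union> G) = verts (P @ Q)" using lb side_lbd[OF sF] side_lbd[OF sG] by simp
    show "cov (F \<union> G) x y" if "(x, l, y) \<in> set (P @ Q)" for x l y
      using mem[OF that] cov_F[OF side_cov[OF sF]] cov_G[OF side_cov[OF sG]] by blast
    show "s \<le> x" if e1: "(x, True, y) \<in> set (P @ Q)" and s: "s \<in> F \<union> G" "s < y" for x y s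
    proof (cases "(x, True, y) \<in> set P")
      case True
      have "s \<in> F" using s Ge[of s] Fe[OF iF(2)[OF True]] by (metis Un_iff leD order_trans)
      then show ?thesis using side_lower[OF sF True _ s(2)] by blast
    next
      case False
      then have q: "(x, True, y) \<in> set Q" using mem[OF e1] by blast
      show ?thesis
      proof (cases "s \<in> G")
        case True then show ?thesis using side_lower[OF sG q _ s(2)] by blast
      next
        case False then show ?thesis using s(1) FG_le[OF _ iG(1)[OF q]] by blast
      qed
    qed
    show "y \<le> s" if e1: "(x, False, y) \<in> set (P @ Q)" and s: "s \<in> F \<union> G" "x < s" for x y s
    proof (cases "(x, False, y) \<in> set Q")
      case True
      have "s \<in> G" using s Fe[of s] Ge[OF iG(1)[OF True]] by (metis Un_iff leD order_trans)
      then show ?thesis using side_upper[OF sG True _ s(2)] by blast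
    next
      case False
      then have q: "(x, False, y) \<in> set P" using mem[OF e1] by blast
      show ?thesis
      proof (cases "s \<in> F")
        case True then show ?thesis using side_upper[OF sF q _ s(2)] by blast
      next
        case False then show ?thesis using s(1) FG_le[OF iF(2)[OF q]] by blast
      qed
    qed
    show "\<exists>s. s \<noteq> z \<and> cov (F \<union> G) y s" if e1: "(x, True, y) \<in> set (P @ Q)" "(y, True, z) \<in> set (P @ Q)" for x y z
    proof -
      have "\<not> ((x, True, y) \<in> set P \<and> (y, True, z) \<in> set Q)"
      proof
        assume h: "(x, True, y) \<in> set P \<and> (y, True, z) \<in> set Q"
        then have "y = e" using both iF(2) iG(1) by blast
        then show False using h noT by blast
      qed
      then consider "(x, True, y) \<in> set P" "(y, True, z) \<in> set P" | "(x, True, y) \<in> set Q" "(y, True, z) \<in> set Q"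
        using mem[OF e1(1)] mem[OF e1(2)] mix by blast
      then show ?thesis
      proof cases
        case 1 then show ?thesis using side_TT[OF sF 1] cov_F by blast
      next
        case 2 then show ?thesis using side_TT[OF sG 2] cov_G by blast
      qed
    qed
    show "\<exists>s. s \<noteq> x \<and> cov (F \<union> G) s y" if e1: "(x, False, y) \<in> set (P @ Q)" "(y, False, z) \<in> set (P @ Q)" for x y z
    proof -
      have "\<not> ((x, False, y) \<in> set P \<and> (y, False, z) \<in> set Q)"
      proof
        assume h: "(x, False, y) \<in> set P \<and> (y, False, z) \<in> set Q"
        then have "y = e" using both iF(2) iG(1) by blast
        then show False using h noF by blast
      qed
      then consider "(x, False, y) \<in> set P" "(y, False, z) \<in> set P" | "(x, False, y) \<in> set Q" "(y, False, z) \<in> set Q"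
        using mem[OF e1(1)] mem[OF e1(2)] mix by blast
      then show ?thesis
      proof cases
        case 1 then show ?thesis using side_FF[OF sF 1] cov_F by blast
      next
        case 2 then show ?thesis using side_FF[OF sG 2] cov_G by blast
      qed
    qed
  qed
qed

text \<open>The labels of \<open>P1 @ P2\<close> read lower, upper, lower, upper, and exchanging the
  two middle blocks produces a ladder. The assumptions \<open>U\<close> and \<open>D\<close> keep
  \<open>G\<close> an up-set and \<open>F\<close> a down-set while this happens.\<close>

lemma fill_frame:
  assumes st: "state d K (P1 @ P2) Q" and l: "ladder P1" "ladder P2"
    and U: "\<forall>x y. (x, False, y) \<in> set P1 \<longrightarrow> x \<notin> G" and D: "\<forall>x y. (x, True, y) \<in> set P2 \<longrightarrow> y \<notin> F"
    and up: "up G K" and dn: "dn F K"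
  shows "\<exists>K' P. state d K' P Q \<and> ladder P \<and> cext K K' (\<lambda>_. True) \<and> up G K' \<and> dn F K'"
proof -
  obtain as us where 1: "P1 = as @ us" "as \<noteq> []" "us \<noteq> []" "\<forall>a l b. (a, l, b) \<in> set as \<longrightarrow> l" "\<forall>a l b. (a, l, b) \<in> set us \<longrightarrow> \<not> l"
    using l(1) by (auto simp: ladder_def)
  obtain bs vs where 2: "P2 = bs @ vs" "bs \<noteq> []" "vs \<noteq> []" "\<forall>a l b. (a, l, b) \<in> set bs \<longrightarrow> l" "\<forall>a l b. (a, l, b) \<in> set vs \<longrightarrow> \<not> l"
    using l(2) by (auto simp: ladder_def)
  have st': "state d K (as @ us @ bs @ vs) Q" using st 1 2 by simp
  obtain K' bs' us' where M: "state d K' (as @ bs' @ us' @ vs) Q" "\<forall>a l b. (a, l, b) \<in> set us' \<longrightarrow> \<not> l"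
     "\<forall>a l b. (a, l, b) \<in> set bs' \<longrightarrow> l" "cext K K' (\<lambda>_. True)"
     "\<forall>D. up D K \<and> (\<forall>a l b. (a, l, b) \<in> set us \<longrightarrow> a \<notin> D) \<longrightarrow> up D K'"
     "\<forall>D. dn D K \<and> (\<forall>a l b. (a, l, b) \<in> set bs \<longrightarrow> b \<notin> D) \<longrightarrow> dn D K'"
    using fill_side[OF st' 1(5) 2(4)] by (elim exE conjE) (rule that)
  have "a \<notin> G" if h: "(a, l, b) \<in> set us" for a l b
  proof -
    have "l = False" using 1(5) h by blast
    then have "(a, False, b) \<in> set P1" using 1(1) h by simp
    then show ?thesis using U by blast
  qed
  then have u: "up G K'" using M(5) up by blast
  have "b \<notin> F" if h: "(a, l, b) \<in> set bs" for a l b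
  proof -
    have "l = True" using 2(4) h by blast
    then have "(a, True, b) \<in> set P2" using 2(1) h by simp
    then show ?thesis using D by blast
  qed
  then have dd: "dn F K'" using M(6) dn by blast
  have "ladder (as @ bs' @ us' @ vs)" unfolding ladder_def
  proof (intro exI conjI)
    show "as @ bs' @ us' @ vs = (as @ bs') @ (us' @ vs)" by simp
    show "as @ bs' \<noteq> []" "us' @ vs \<noteq> []" using 1 2 by auto
    show "\<forall>a l b. (a, l, b) \<in> set (as @ bs') \<longrightarrow> l" using 1(4) M(3) unfolding set_append by blast
    show "\<forall>a l b. (a, l, b) \<in> set (us' @ vs) \<longrightarrow> \<not> l" using 2(5) M(2) unfolding set_append by blast
  qed
  then show ?thesis using M(1,4) u dd by blast
qed

lemma glue_frames:
  assumes fF: "frame True F PF QF" and fG: "frame True G PG QG" and e: "e \<in> F" "e \<in> G"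
    and Fe: "\<And>s. s \<in> F \<Longrightarrow> s \<le> e" and Ge: "\<And>t. t \<in> G \<Longrightarrow> e \<le> t"
  shows "\<exists>K P Q. frame True K P Q \<and> glued_sum F G e \<and> cext (F \<union> G) K (\<lambda>_. True) \<and> up G K \<and> dn F K"
proof -
  have stF: "state True F PF QF" and lF: "ladder PF" "ladder QF" using fF by (auto simp: frame_def)
  have stG: "state True G PG QG" and lG: "ladder PG" "ladder QG" using fG by (auto simp: frame_def)
  note pF = state_plat[OF stF] and pG = state_plat[OF stG]
  have gs: "glued_sum F G e" by (rule glued_sum.intro) (fact state_lat[OF stF] state_lat[OF stG] e Fe Ge)+
  interpret S: glued_sum F G e by (rule gs)
  let ?K = "F \<union> G"
  \<comment> \<open>A coordinate shared by a point of \<open>F\<close> and a point of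
    \<open>G\<close> can only be that of \<open>e\<close>.\<close>
  have inj: "s = t" if "s \<in> F" "t \<in> G" "co d s = co d t" for s t d
  proof -
    have "co d s \<le> co d e" "co d e \<le> co d t" using Fe[OF that(1)] Ge[OF that(2)] le_co by blast+
    then have "co d s = co d e" "co d t = co d e" using that(3) by auto
    then show ?thesis using co_inj[OF pF that(1) e(1)] co_inj[OF pG that(2) e(2)] by blast
  qed
  have inj2: "s = t" if "s \<in> ?K" "t \<in> ?K" "co d s = co d t" for s t d
    using that inj[of s t d] inj[of t s d] co_inj[OF pF, of s t d] co_inj[OF pG, of s t d] by auto
  have pK: "plat ?K" unfolding plat_def
  proof (intro conjI)
    show "lat ?K" by (rule S.lat')
    show "smod ?K" by (rule S.smod') (use pF pG in \<open>simp_all add: plat_def\<close>)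
    show "finite ?K" "?K \<noteq> {}" using pF pG by (auto simp: plat_def)
    show "inj_on fst ?K" using inj2[where d = True] by (intro inj_onI) (simp add: co_def)
    show "inj_on snd ?K" using inj2[where d = False] by (intro inj_onI) (simp add: co_def)
  qed
  have lb: "lbd d ?K = lbd d F \<union> lbd d G" for d
  proof -
    have n: "\<not> lam d s t" "\<not> lam d t s" if "s \<in> F" "t \<in> G" for s t
      using lam_not_le S.FG_le[OF that] by blast+
    have eF: "s \<in> lbd d G \<Longrightarrow> s \<in> F \<Longrightarrow> s \<in> lbd d F" and eG: "s \<in> lbd d F \<Longrightarrow> s \<in> G \<Longrightarrow> s \<in> lbd d G" for s
      using n unfolding lbd_def by blast+
    show ?thesis using n unfolding lbd_def by blast
  qed
  have s1: "side True ?K (PF @ PG)"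
    by (rule side_glue[OF gs state_side[OF stF] state_side[OF stG] lF(1) lG(1) lb])
  have s2: "side (\<not> True) ?K (QF @ QG)"
    by (rule side_glue[OF gs state_side2[OF stF] state_side2[OF stG] lF(2) lG(2) lb])
  have srcF: "x \<notin> G" if "(x, m, y) \<in> set PF \<union> set QF" for x m y
  proof
    assume x: "x \<in> G"
    have c: "cov F x y" using that side_cov[OF state_side[OF stF]] side_cov[OF state_side2[OF stF]] by blast
    note i = cov_in[OF c]
    have "x = e" using S.both[OF i(1) x] .
    then show False using i(3) Fe[OF i(2)] by auto
  qed
  have tgtG: "y \<notin> F" if "(x, m, y) \<in> set PG \<union> set QG" for x m y
  proof
    assume y: "y \<in> F"
    have c: "cov G x y" using that side_cov[OF state_side[OF stG]] side_cov[OF state_side2[OF stG]] by blast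
    note i = cov_in[OF c]
    have "y = e" using S.both[OF y i(2)] .
    then show False using i(3) Ge[OF i(1)] by auto
  qed
  have inF: "x \<in> F" "y \<in> F" if "(x, m, y) \<in> set PF \<union> set QF" for x m y
    using that cov_in[OF side_cov[OF state_side[OF stF]]] cov_in[OF side_cov[OF state_side2[OF stF]]] by blast+
  have inG: "x \<in> G" "y \<in> G" if "(x, m, y) \<in> set PG \<union> set QG" for x m y
    using that cov_in[OF side_cov[OF state_side[OF stG]]] cov_in[OF side_cov[OF state_side2[OF stG]]] by blast+
  have cp: "compat (PF @ PG) (QF @ QG)"
  proof -
    have "(x, False, y') \<notin> set (QF @ QG)" if h: "(x, False, y) \<in> set (PF @ PG)" for x y y'
    proof
      assume q: "(x, False, y') \<in> set (QF @ QG)"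
      consider "(x, False, y) \<in> set PF" "(x, False, y') \<in> set QF" | "(x, False, y) \<in> set PG" "(x, False, y') \<in> set QG"
        | "(x, False, y) \<in> set PF" "(x, False, y') \<in> set QG" | "(x, False, y) \<in> set PG" "(x, False, y') \<in> set QF"
        using h q by auto
      then show False
      proof cases
        case 1 then show False using compatF[OF state_compat[OF stF]] by blast
      next
        case 2 then show False using compatF[OF state_compat[OF stG]] by blast
      next
        case 3 then show False using srcF inG by blast
      next
        case 4 then show False using srcF inG by blast
      qed
    qed
    moreover have "(x', True, y) \<notin> set (QF @ QG)" if h: "(x, True, y) \<in> set (PF @ PG)" for x x' y
    proof
      assume q: "(x', True, y) \<in> set (QF @ QG)"
      consider "(x, True, y) \<in> set PF" "(x', True, y) \<in> set QF" | "(x, True, y) \<in> set PG" "(x', True, y) \<in> set QG"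
        | "(x, True, y) \<in> set PF" "(x', True, y) \<in> set QG" | "(x, True, y) \<in> set PG" "(x', True, y) \<in> set QF"
        using h q by auto
      then show False
      proof cases
        case 1 then show False using compatT[OF state_compat[OF stF]] by blast
      next
        case 2 then show False using compatT[OF state_compat[OF stG]] by blast
      next
        case 3 then show False using tgtG inF by blast
      next
        case 4 then show False using tgtG inF by blast
      qed
    qed
    ultimately show ?thesis unfolding compat_def by blast
  qed
  have st: "state True ?K (PF @ PG) (QF @ QG)" using pK s1 s2 cp by (simp add: state_def)
  have up: "up G ?K"
  proof (rule upI)
    fix s t assume "s \<in> G" "t \<in> ?K" "s \<le> t"
    then show "t \<in> G" using S.GF_le[of s t] e by auto
  qed simp
  have dn: "dn F ?K"
  proof (rule dnI)
    fix s t assume "s \<in> F" "t \<in> ?K" "t \<le> s"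
    then show "t \<in> F" using S.GF_le[of t s] e by auto
  qed simp
  \<comment> \<open>The two sides are filled in one after the other; each step leaves the edges of
    the other side untouched.\<close>
  obtain K1 P where 1: "state True K1 P (QF @ QG)" "ladder P" "cext ?K K1 (\<lambda>_. True)" "up G K1" "dn F K1"
    using fill_frame[OF st lF(1) lG(1) _ _ up dn] srcF tgtG by blast
  obtain K2 Q where 2: "state (\<not> True) K2 Q P" "ladder Q" "cext K1 K2 (\<lambda>_. True)" "up G K2" "dn F K2"
    using fill_frame[OF state_sym[OF 1(1)] lF(2) lG(2) _ _ 1(4,5)] srcF tgtG by blast
  have "frame True K2 P Q" using state_sym[OF 2(1)] 1(2) 2(2) by (simp add: frame_def)
  moreover have "cext ?K K2 (\<lambda>_. True)" using cext_trans[OF 1(3) 2(3), of "\<lambda>_. True"] by simp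
  ultimately show ?thesis using gs 2(4,5) by blast
qed

section \<open>Joins of congruences\<close>

lemma trancl_map:
  assumes "(a, b) \<in> r\<^sup>+" "\<And>s t. (s, t) \<in> r \<Longrightarrow> (h s, h t) \<in> r'" shows "(h a, h b) \<in> r'\<^sup>+"
  using assms(1)
proof (induction rule: trancl_induct)
  case (base y) then show ?case using assms(2) by blast
next
  case (step y z) then show ?case using assms(2) by (meson trancl.trancl_into_trancl)
qed

text \<open>This is the join of the two congruences: joining or meeting with \<open>c\<close>
  carries a chain of steps to a chain of steps.\<close>

lemma con_trancl:
  assumes a: "con K \<alpha>" and b: "con K \<beta>" shows "con K ((\<alpha> \<union> \<beta>)\<^sup>+)"
proof (rule conI)
  show "(\<alpha> \<union> \<beta>)\<^sup>+ \<subseteq> K \<times> K" by (rule trancl_subset_Sigma) (use con_sub[OF a] con_sub[OF b] in blast)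
  show "(s, s) \<in> (\<alpha> \<union> \<beta>)\<^sup>+" if "s \<in> K" for s using con_refl[OF a that] by blast
  have "sym (\<alpha> \<union> \<beta>)" by (rule symI) (use con_sym[OF a] con_sym[OF b] in blast)
  then show "(t, s) \<in> (\<alpha> \<union> \<beta>)\<^sup>+" if "(s, t) \<in> (\<alpha> \<union> \<beta>)\<^sup>+" for s t using sym_trancl that by (meson symD)
  show "(s, u) \<in> (\<alpha> \<union> \<beta>)\<^sup>+" if "(s, t) \<in> (\<alpha> \<union> \<beta>)\<^sup>+" "(t, u) \<in> (\<alpha> \<union> \<beta>)\<^sup>+" for s t u using that by (rule trancl_trans)
  fix s t c assume st: "(s, t) \<in> (\<alpha> \<union> \<beta>)\<^sup>+" and c: "c \<in> K"
  show "(jn K s c, jn K t c) \<in> (\<alpha> \<union> \<beta>)\<^sup>+"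
    by (rule trancl_map[OF st]) (use con_jn1[OF a _ c] con_jn1[OF b _ c] in blast)
  show "(mt K s c, mt K t c) \<in> (\<alpha> \<union> \<beta>)\<^sup>+"
    by (rule trancl_map[OF st]) (use con_mt1[OF a _ c] con_mt1[OF b _ c] in blast)
qed

text \<open>The clamping map \<open>z \<mapsto> (z \<squnion> x) \<sqinter> y\<close> sends every chain of \<open>\<alpha>\<close>- and \<open>\<beta>\<close>-steps from \<open>x\<close> to \<open>y\<close> into
  \<open>[x, y]\<close>; hence prime intervals are join-prime with respect to the congruences collapsing them.\<close>

lemma cov_trancl:
  assumes K: "lat K" and a: "con K \<alpha>" and b: "con K \<beta>" and xy: "cov K x y" and t: "(x, y) \<in> (\<alpha> \<union> \<beta>)\<^sup>+"
  shows "(x, y) \<in> \<alpha> \<or> (x, y) \<in> \<beta>"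
proof (rule ccontr)
  assume n: "\<not> ?thesis"
  note i = cov_in[OF xy]
  define c where "c z = mt K (jn K z x) y" for z
  have cin: "c z = x \<or> c z = y" if "z \<in> K" for z
  proof -
    have "x \<le> c z" unfolding c_def using K i that by (simp add: le_mt_iff less_imp_le)
    moreover have "c z \<le> y" "c z \<in> K" unfolding c_def using K i that by simp_all
    ultimately show ?thesis using cov_between[OF xy] by blast
  qed
  have cx: "c x = x" unfolding c_def using jn_absorb[OF K i(1) i(1)] mt_absorb[OF K i(1,2)] i(3) by (simp add: less_imp_le)
  have cy: "c y = y" unfolding c_def using jn_absorb2[OF K i(2) i(1)] mt_absorb[OF K i(2) i(2)] i(3) by (simp add: less_imp_le)
  have step: "c z' = x" if z: "(z, z') \<in> \<alpha> \<union> \<beta>" "c z = x" for z z'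
  proof (rule ccontr)
    assume h: "c z' \<noteq> x"
    have "z' \<in> K" using z(1) con_in[OF a] con_in[OF b] by blast
    then have "c z' = y" using cin h by blast
    moreover have "(c z, c z') \<in> \<alpha> \<or> (c z, c z') \<in> \<beta>"
      unfolding c_def using z(1) con_mt1[OF a con_jn1[OF a _ i(1)] i(2)] con_mt1[OF b con_jn1[OF b _ i(1)] i(2)] by blast
    ultimately show False using n z(2) by simp
  qed
  have "c y = x" using t
  proof (induction rule: trancl_induct)
    case (base z) then show ?case using step cx by blast
  next
    case (step z z') then show ?case using \<open>\<And>z z'. (z, z') \<in> \<alpha> \<union> \<beta> \<Longrightarrow> c z = x \<Longrightarrow> c z' = x\<close> by blast
  qed
  then show False using cy i(3) by simp
qed

lemma Con_simps [simp]: "carrier (Con L) = {\<theta>. lattice_congruence L \<theta>}" "le (Con L) = (\<subseteq>)" "eq (Con L) = (=)"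
  by (auto simp: Con_def)

text \<open>\<open>\<bottom>\<close> is given by choice among least elements, so its value is found
  by their uniqueness.\<close>

lemma Con_bottom:
  assumes lC: "lattice (Con L)" and z: "lattice_congruence L z" and le: "\<And>\<theta>. lattice_congruence L \<theta> \<Longrightarrow> z \<subseteq> \<theta>"
  shows "\<bottom>\<^bsub>Con L\<^esub> = z"
  unfolding bottom_def
proof (rule some_equality)
  show "least (Con L) z (carrier (Con L))" using z le by (simp add: least_def)
  show "x = z" if "least (Con L) x (carrier (Con L))" for x using that z le by (auto simp: least_def)
qed

lemma Con_top:
  assumes lC: "lattice (Con L)" and z: "lattice_congruence L z" and le: "\<And>\<theta>. lattice_congruence L \<theta> \<Longrightarrow> \<theta> \<subseteq> z"
  shows "\<top>\<^bsub>Con L\<^esub> = z"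
  unfolding top_def
proof (rule some_equality)
  show "greatest (Con L) z (carrier (Con L))" using z le by (simp add: greatest_def)
  show "x = z" if "greatest (Con L) x (carrier (Con L))" for x using that z le by (auto simp: greatest_def)
qed

lemma con_Id: "lat K \<Longrightarrow> con K (Id_on K)"
  by (rule conI) auto
lemma con_all: "lat K \<Longrightarrow> con K (K \<times> K)"
  by (rule conI) auto
lemma con_inter: assumes "con K \<alpha>" "con K \<beta>" shows "con K (\<alpha> \<inter> \<beta>)"
proof (rule conI)
  show "\<alpha> \<inter> \<beta> \<subseteq> K \<times> K" using con_sub[OF assms(1)] by blast
  show "(s, s) \<in> \<alpha> \<inter> \<beta>" if "s \<in> K" for s using con_refl[OF assms(1) that] con_refl[OF assms(2) that] by (rule IntI)
  show "(t, s) \<in> \<alpha> \<inter> \<beta>" if "(s, t) \<in> \<alpha> \<inter> \<beta>" for s t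
    using con_sym[OF assms(1)] con_sym[OF assms(2)] that by (meson IntE IntI)
  show "(s, r) \<in> \<alpha> \<inter> \<beta>" if "(s, t) \<in> \<alpha> \<inter> \<beta>" "(t, r) \<in> \<alpha> \<inter> \<beta>" for s t r
    using con_trans[OF assms(1), of s t r] con_trans[OF assms(2), of s t r] that by (meson IntE IntI)
  fix s t d assume st: "(s, t) \<in> \<alpha> \<inter> \<beta>" and d: "d \<in> K"
  show "(jn K s d, jn K t d) \<in> \<alpha> \<inter> \<beta>"
    using con_jn1[OF assms(1) _ d] con_jn1[OF assms(2) _ d] st by (meson IntE IntI)
  show "(mt K s d, mt K t d) \<in> \<alpha> \<inter> \<beta>"
    using con_mt1[OF assms(1) _ d] con_mt1[OF assms(2) _ d] st by (meson IntE IntI)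
qed

context oiso
begin

lemma push_mono: "\<alpha> \<subseteq> \<beta> \<Longrightarrow> push \<alpha> \<subseteq> push \<beta>" unfolding push_def by blast
lemma pull_mono: "\<alpha> \<subseteq> \<beta> \<Longrightarrow> restrict_con L f \<alpha> \<subseteq> restrict_con L f \<beta>" unfolding restrict_con_def by blast

lemma push_le: "lattice_congruence L \<alpha> \<Longrightarrow> lattice_congruence L \<beta> \<Longrightarrow> push \<alpha> \<subseteq> push \<beta> \<Longrightarrow> \<alpha> \<subseteq> \<beta>"
  using pull_mono[of "push \<alpha>" "push \<beta>"] by (simp add: pull_push)

lemma Con_bot: assumes "lattice (Con L)" shows "lattice_congruence L \<bottom>\<^bsub>Con L\<^esub>" "push \<bottom>\<^bsub>Con L\<^esub> = Id_on K"
proof -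
  have c: "con K (Id_on K)" using con_Id[OF latK] .
  have e: "\<bottom>\<^bsub>Con L\<^esub> = restrict_con L f (Id_on K)"
  proof (rule Con_bottom[OF assms con_pull[OF c]])
    fix \<theta> assume t: "lattice_congruence L \<theta>"
    have "Id_on K \<subseteq> push \<theta>" using con_refl[OF con_push[OF t]] by blast
    from pull_mono[OF this] show "restrict_con L f (Id_on K) \<subseteq> \<theta>" by (simp add: pull_push[OF t])
  qed
  show "lattice_congruence L \<bottom>\<^bsub>Con L\<^esub>" "push \<bottom>\<^bsub>Con L\<^esub> = Id_on K" unfolding e using con_pull[OF c] push_pull[OF c] by auto
qed

lemma Con_tp: assumes "lattice (Con L)" shows "lattice_congruence L \<top>\<^bsub>Con L\<^esub>" "push \<top>\<^bsub>Con L\<^esub> = K \<times> K"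
proof -
  have c: "con K (K \<times> K)" using con_all[OF latK] .
  have e: "\<top>\<^bsub>Con L\<^esub> = restrict_con L f (K \<times> K)"
  proof (rule Con_top[OF assms con_pull[OF c]])
    fix \<theta> assume t: "lattice_congruence L \<theta>"
    have "push \<theta> \<subseteq> K \<times> K" by (rule con_sub[OF con_push[OF t]])
    from pull_mono[OF this] show "\<theta> \<subseteq> restrict_con L f (K \<times> K)" by (simp add: pull_push[OF t])
  qed
  show "lattice_congruence L \<top>\<^bsub>Con L\<^esub>" "push \<top>\<^bsub>Con L\<^esub> = K \<times> K" unfolding e using con_pull[OF c] push_pull[OF c] by auto
qed

lemma Con_join:
  assumes "lattice (Con L)" and a: "lattice_congruence L \<alpha>" and b: "lattice_congruence L \<beta>"
  shows "lattice_congruence L (\<alpha> \<squnion>\<^bsub>Con L\<^esub> \<beta>)" "\<alpha> \<subseteq> \<alpha> \<squnion>\<^bsub>Con L\<^esub> \<beta>" "\<beta> \<subseteq> \<alpha> \<squnion>\<^bsub>Con L\<^esub> \<beta>"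
    "push (\<alpha> \<squnion>\<^bsub>Con L\<^esub> \<beta>) \<subseteq> (push \<alpha> \<union> push \<beta>)\<^sup>+"
proof -
  interpret C: lattice "Con L" by (rule assms(1))
  show c: "lattice_congruence L (\<alpha> \<squnion>\<^bsub>Con L\<^esub> \<beta>)" using C.join_closed[of \<alpha> \<beta>] a b by simp
  show "\<alpha> \<subseteq> \<alpha> \<squnion>\<^bsub>Con L\<^esub> \<beta>" "\<beta> \<subseteq> \<alpha> \<squnion>\<^bsub>Con L\<^esub> \<beta>" using C.join_left[of \<alpha> \<beta>] C.join_right[of \<alpha> \<beta>] a b by simp_all
  have t: "con K ((push \<alpha> \<union> push \<beta>)\<^sup>+)" by (rule con_trancl[OF con_push[OF a] con_push[OF b]])
  have "push \<alpha> \<subseteq> (push \<alpha> \<union> push \<beta>)\<^sup>+" "push \<beta> \<subseteq> (push \<alpha> \<union> push \<beta>)\<^sup>+" by auto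
  then have "\<alpha> \<subseteq> restrict_con L f ((push \<alpha> \<union> push \<beta>)\<^sup>+)" "\<beta> \<subseteq> restrict_con L f ((push \<alpha> \<union> push \<beta>)\<^sup>+)"
    using pull_mono[of "push \<alpha>"] pull_mono[of "push \<beta>"] pull_push[OF a] pull_push[OF b] by auto
  then have "\<alpha> \<squnion>\<^bsub>Con L\<^esub> \<beta> \<subseteq> restrict_con L f ((push \<alpha> \<union> push \<beta>)\<^sup>+)"
    using C.join_le[of \<alpha> "restrict_con L f ((push \<alpha> \<union> push \<beta>)\<^sup>+)" \<beta>] a b con_pull[OF t] by simp
  from push_mono[OF this] show "push (\<alpha> \<squnion>\<^bsub>Con L\<^esub> \<beta>) \<subseteq> (push \<alpha> \<union> push \<beta>)\<^sup>+" by (simp add: push_pull[OF t])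
qed

lemma Con_meet:
  assumes "lattice (Con L)" and a: "lattice_congruence L \<alpha>" and b: "lattice_congruence L \<beta>"
  shows "lattice_congruence L (\<alpha> \<sqinter>\<^bsub>Con L\<^esub> \<beta>)" "\<alpha> \<sqinter>\<^bsub>Con L\<^esub> \<beta> \<subseteq> \<alpha>" "\<alpha> \<sqinter>\<^bsub>Con L\<^esub> \<beta> \<subseteq> \<beta>"
    "push (\<alpha> \<sqinter>\<^bsub>Con L\<^esub> \<beta>) = push \<alpha> \<inter> push \<beta>"
proof -
  interpret C: lattice "Con L" by (rule assms(1))
  show c: "lattice_congruence L (\<alpha> \<sqinter>\<^bsub>Con L\<^esub> \<beta>)" using C.meet_closed[of \<alpha> \<beta>] a b by simp
  show l: "\<alpha> \<sqinter>\<^bsub>Con L\<^esub> \<beta> \<subseteq> \<alpha>" "\<alpha> \<sqinter>\<^bsub>Con L\<^esub> \<beta> \<subseteq> \<beta>" using C.meet_left[of \<alpha> \<beta>] C.meet_right[of \<alpha> \<beta>] a b by simp_all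
  have t: "con K (push \<alpha> \<inter> push \<beta>)" by (rule con_inter[OF con_push[OF a] con_push[OF b]])
  have "restrict_con L f (push \<alpha> \<inter> push \<beta>) \<subseteq> \<alpha>" "restrict_con L f (push \<alpha> \<inter> push \<beta>) \<subseteq> \<beta>"
    using pull_mono[of "push \<alpha> \<inter> push \<beta>" "push \<alpha>"] pull_mono[of "push \<alpha> \<inter> push \<beta>" "push \<beta>"] pull_push[OF a] pull_push[OF b] by auto
  then have "restrict_con L f (push \<alpha> \<inter> push \<beta>) \<subseteq> \<alpha> \<sqinter>\<^bsub>Con L\<^esub> \<beta>"
    using C.meet_le[of "restrict_con L f (push \<alpha> \<inter> push \<beta>)" \<alpha> \<beta>] a b con_pull[OF t] by simp
  from push_mono[OF this] have "push \<alpha> \<inter> push \<beta> \<subseteq> push (\<alpha> \<sqinter>\<^bsub>Con L\<^esub> \<beta>)" by (simp add: push_pull[OF t])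
  then show "push (\<alpha> \<sqinter>\<^bsub>Con L\<^esub> \<beta>) = push \<alpha> \<inter> push \<beta>" using push_mono[OF l(1)] push_mono[OF l(2)] by blast
qed

end

text \<open>A prime interval of \<open>G\<close> determines the prime filter of all \<open>\<alpha>\<close> for which \<open>\<phi> \<alpha>\<close> collapses it; its
  least element is generated by a prime interval of \<open>F\<close>.\<close>

lemma prime_source:
  assumes iF: "oiso F i KF" and iG: "oiso G j KG" and fin: "finite KF"
    and \<phi>: "bounded_lattice_hom (Con F) (Con G) \<phi>" and uv: "cov KG u v"
  shows "\<exists>u' v'. cov KF u' v' \<and> (\<forall>\<alpha>. lattice_congruence F \<alpha> \<longrightarrow>
    ((u', v') \<in> oiso.push i \<alpha> \<longleftrightarrow> (u, v) \<in> oiso.push j (\<phi> \<alpha>)))"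
proof -
  interpret F: oiso F i KF by (rule iF)
  interpret G: oiso G j KG by (rule iG)
  have cF: "lattice (Con F)" and cG: "lattice (Con G)" using \<phi> by (auto simp: bounded_lattice_hom_def join_pres_def)
  have ph: "lattice_congruence G (\<phi> \<alpha>)" if "lattice_congruence F \<alpha>" for \<alpha>
    using \<phi> that by (auto simp: bounded_lattice_hom_def Pi_iff)
  have pj: "\<phi> (\<alpha> \<squnion>\<^bsub>Con F\<^esub> \<beta>) = \<phi> \<alpha> \<squnion>\<^bsub>Con G\<^esub> \<phi> \<beta>" and pm: "\<phi> (\<alpha> \<sqinter>\<^bsub>Con F\<^esub> \<beta>) = \<phi> \<alpha> \<sqinter>\<^bsub>Con G\<^esub> \<phi> \<beta>"
    if "lattice_congruence F \<alpha>" "lattice_congruence F \<beta>" for \<alpha> \<beta>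
    using \<phi> that by (auto simp: bounded_lattice_hom_def join_pres_def meet_pres_def)
  have pb: "\<phi> \<bottom>\<^bsub>Con F\<^esub> = \<bottom>\<^bsub>Con G\<^esub>" "\<phi> \<top>\<^bsub>Con F\<^esub> = \<top>\<^bsub>Con G\<^esub>" using \<phi> by (auto simp: bounded_lattice_hom_def)
  note i = cov_in[OF uv]
  define q where "q \<alpha> \<longleftrightarrow> (u, v) \<in> G.push (\<phi> \<alpha>)" for \<alpha>
  have qj: "q (\<alpha> \<squnion>\<^bsub>Con F\<^esub> \<beta>) \<Longrightarrow> q \<alpha> \<or> q \<beta>" if ab: "lattice_congruence F \<alpha>" "lattice_congruence F \<beta>" for \<alpha> \<beta>
    using G.Con_join(4)[OF cG ph[OF ab(1)] ph[OF ab(2)]] pj[OF ab]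
      cov_trancl[OF G.latK G.con_push[OF ph[OF ab(1)]] G.con_push[OF ph[OF ab(2)]] uv]
    unfolding q_def by auto
  have qm: "q (\<alpha> \<sqinter>\<^bsub>Con F\<^esub> \<beta>) \<longleftrightarrow> q \<alpha> \<and> q \<beta>" if ab: "lattice_congruence F \<alpha>" "lattice_congruence F \<beta>" for \<alpha> \<beta>
    using G.Con_meet(4)[OF cG ph[OF ab(1)] ph[OF ab(2)]] pm[OF ab] unfolding q_def by auto
  have qmono: "q \<beta>" if ab: "lattice_congruence F \<alpha>" "lattice_congruence F \<beta>" "\<alpha> \<subseteq> \<beta>" "q \<alpha>" for \<alpha> \<beta>
  proof -
    have "F.push (\<alpha> \<sqinter>\<^bsub>Con F\<^esub> \<beta>) = F.push \<alpha>" using F.Con_meet(4)[OF cF ab(1,2)] F.push_mono[OF ab(3)] by blast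
    then have "\<alpha> \<sqinter>\<^bsub>Con F\<^esub> \<beta> = \<alpha>" using F.pull_push[OF F.Con_meet(1)[OF cF ab(1,2)]] F.pull_push[OF ab(1)] by metis
    then show ?thesis using qm[OF ab(1,2)] ab(4) by simp
  qed
  have qbot: "\<not> q \<bottom>\<^bsub>Con F\<^esub>" unfolding q_def pb G.Con_bot(2)[OF cG] using i(3) by auto
  have qtop: "q \<top>\<^bsub>Con F\<^esub>" unfolding q_def pb G.Con_tp(2)[OF cG] using i by auto
  let ?S = "{\<alpha>. lattice_congruence F \<alpha> \<and> q \<alpha>}"
  have "finite (carrier F)" using fin F.bij bij_betw_finite by blast
  then have "finite (Pow (carrier F \<times> carrier F))" by simp
  moreover have "?S \<subseteq> Pow (carrier F \<times> carrier F)" by (auto simp: lattice_congruence_def equiv_def)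
  ultimately have "finite ?S" by (rule rev_finite_subset)
  moreover have "?S \<noteq> {}" using qtop F.Con_tp(1)[OF cF] by blast
  ultimately obtain a0 where a0: "a0 \<in> ?S" "\<And>\<alpha>. \<alpha> \<in> ?S \<Longrightarrow> \<alpha> \<subseteq> a0 \<Longrightarrow> a0 = \<alpha>" using finite_has_minimal[of ?S] by blast
  then have a0c: "lattice_congruence F a0" "q a0" by auto
  have least: "a0 \<subseteq> \<alpha>" if h: "lattice_congruence F \<alpha>" "q \<alpha>" for \<alpha>
  proof -
    have "a0 \<sqinter>\<^bsub>Con F\<^esub> \<alpha> \<in> ?S" using F.Con_meet(1)[OF cF a0c(1) h(1)] qm[OF a0c(1) h(1)] h a0c by simp
    then have "a0 = a0 \<sqinter>\<^bsub>Con F\<^esub> \<alpha>" using a0(2) F.Con_meet(2)[OF cF a0c(1) h(1)] by blast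
    then show ?thesis using F.Con_meet(3)[OF cF a0c(1) h(1)] by simp
  qed
  \<comment> \<open>Otherwise each prime interval collapsed by \<open>a0\<close> is collapsed by a
    congruence outside the filter. The join of these finitely many congruences is still outside, the
    filter being prime, yet it contains \<open>a0\<close>.\<close>
  have "\<exists>p. cov KF (fst p) (snd p) \<and> p \<in> F.push a0 \<and> (\<forall>\<alpha>. lattice_congruence F \<alpha> \<and> p \<in> F.push \<alpha> \<longrightarrow> q \<alpha>)"
  proof (rule ccontr)
    assume n: "\<not> ?thesis"
    let ?P = "{p. cov KF (fst p) (snd p) \<and> p \<in> F.push a0}"
    have "?P \<subseteq> KF \<times> KF" by (auto simp: cov_iff)
    then have "finite ?P" using fin finite_subset by blast
    moreover have "\<exists>\<beta>. lattice_congruence F \<beta> \<and> \<not> q \<beta> \<and> R \<subseteq> F.push \<beta>" if "finite R" "R \<subseteq> ?P" for R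
      using that
    proof (induction R rule: finite_induct)
      case empty
      show ?case using F.Con_bot(1)[OF cF] qbot by blast
    next
      case (insert p R)
      obtain \<beta> where be: "lattice_congruence F \<beta>" "\<not> q \<beta>" "R \<subseteq> F.push \<beta>" using insert(3,4) by blast
      obtain \<alpha> where al: "lattice_congruence F \<alpha>" "p \<in> F.push \<alpha>" "\<not> q \<alpha>" using n insert(4) by blast
      note J = F.Con_join[OF cF al(1) be(1)]
      have "\<not> q (\<alpha> \<squnion>\<^bsub>Con F\<^esub> \<beta>)" using qj[OF al(1) be(1)] al(3) be(2) by blast
      moreover have "insert p R \<subseteq> F.push (\<alpha> \<squnion>\<^bsub>Con F\<^esub> \<beta>)"
        using F.push_mono[OF J(2)] F.push_mono[OF J(3)] al(2) be(3) by blast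
      ultimately show ?case using J(1) by blast
    qed
    ultimately obtain \<beta> where be: "lattice_congruence F \<beta>" "\<not> q \<beta>" "?P \<subseteq> F.push \<beta>" by blast
    have "(s, t) \<in> F.push \<beta>" if "cov KF s t" "(s, t) \<in> F.push a0" for s t
    proof -
      have "(s, t) \<in> ?P" using that by simp
      then show ?thesis using be(3) by blast
    qed
    then have "F.push a0 \<subseteq> F.push \<beta>" by (rule con_covers_le[OF F.latK fin F.con_push[OF a0c(1)] F.con_push[OF be(1)]])
    then have "a0 \<subseteq> \<beta>" by (rule F.push_le[OF a0c(1) be(1)])
    then show False using qmono[OF a0c(1) be(1)] a0c(2) be(2) by blast
  qed
  then obtain p where p: "cov KF (fst p) (snd p)" "p \<in> F.push a0" "\<And>\<alpha>. lattice_congruence F \<alpha> \<Longrightarrow> p \<in> F.push \<alpha> \<Longrightarrow> q \<alpha>"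
    by blast
  have "p \<in> F.push \<alpha> \<longleftrightarrow> q \<alpha>" if h: "lattice_congruence F \<alpha>" for \<alpha>
    using p(3)[OF h] F.push_mono[OF least[OF h]] p(2) by blast
  then show ?thesis using p(1) unfolding q_def by (intro exI[of _ "fst p"] exI[of _ "snd p"]) simp
qed

section \<open>Transport to a lattice on the natural numbers\<close>

lemma nat_copy:
  assumes K: "lat K" and fin: "finite K"
  shows "\<exists>(L :: nat gorder) (n :: 'a::order \<Rightarrow> nat) h. oiso L h K \<and>
    (\<forall>a\<in>K. n a \<in> carrier L \<and> h (n a) = a) \<and> (\<forall>x\<in>carrier L. n (h x) = x)"
proof -
  obtain n :: "'a \<Rightarrow> nat" where n: "inj_on n K" using finite_imp_inj_to_nat_seg[OF fin] by blast
  define h where "h = inv_into K n"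
  have hn: "h (n a) = a" if "a \<in> K" for a using n that by (simp add: h_def)
  have hK: "h x \<in> K" "n (h x) = x" if "x \<in> n ` K" for x
    using that by (auto simp: h_def inv_into_into f_inv_into_f)
  define L :: "nat gorder" where "L = \<lparr>carrier = n ` K, eq = (=), le = (\<lambda>x y. h x \<le> h y)\<rparr>"
  have Ls: "carrier L = n ` K" "le L = (\<lambda>x y. h x \<le> h y)" "eq L = (=)" by (simp_all add: L_def)
  interpret po: partial_order L
  proof unfold_locales
    fix x y assume "x \<sqsubseteq>\<^bsub>L\<^esub> y" "y \<sqsubseteq>\<^bsub>L\<^esub> x" "x \<in> carrier L" "y \<in> carrier L"
    then have "h x \<le> h y" "h y \<le> h x" and xy: "x \<in> n ` K" "y \<in> n ` K" unfolding Ls by simp_all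
    then have "h x = h y" by (intro order_antisym)
    then have "n (h x) = n (h y)" by (rule arg_cong)
    then show "x .=\<^bsub>L\<^esub> y" unfolding Ls hK(2)[OF xy(1)] hK(2)[OF xy(2)] .
  next
    fix x y z assume "x \<sqsubseteq>\<^bsub>L\<^esub> y" "y \<sqsubseteq>\<^bsub>L\<^esub> z"
    then show "x \<sqsubseteq>\<^bsub>L\<^esub> z" unfolding Ls by (rule order_trans)
  qed (simp_all add: Ls)
  have "lattice L"
  proof unfold_locales
    fix x y assume "x \<in> carrier L" "y \<in> carrier L"
    then have xy: "x \<in> n ` K" "y \<in> n ` K" by (simp_all add: Ls)
    note hh = hK(1)[OF xy(1)] hK(1)[OF xy(2)]
    let ?j = "jn K (h x) (h y)" and ?m = "mt K (h x) (h y)"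
    have j: "h (n ?j) = ?j" "n ?j \<in> n ` K" and m: "h (n ?m) = ?m" "n ?m \<in> n ` K" using K hh hn by simp_all
    have xyL: "{x, y} \<subseteq> carrier L" using xy by (simp add: Ls)
    have "least L (n ?j) (Upper L {x, y})"
    proof (rule least_UpperI[OF _ _ xyL])
      show "z \<sqsubseteq>\<^bsub>L\<^esub> n ?j" if "z \<in> {x, y}" for z using that jn_ge1[OF K hh] jn_ge2[OF K hh] unfolding Ls j by blast
      show "n ?j \<sqsubseteq>\<^bsub>L\<^esub> u" if u: "u \<in> Upper L {x, y}" for u
      proof -
        have "x \<sqsubseteq>\<^bsub>L\<^esub> u \<and> u \<in> carrier L" "y \<sqsubseteq>\<^bsub>L\<^esub> u" using Upper_memD[OF u _ xyL, of x] Upper_memD[OF u _ xyL, of y] by simp_all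
        then show ?thesis using jn_least[OF K hh, of "h u"] hK(1)[of u] by (simp add: Ls j)
      qed
    qed (simp add: Ls j(2))
    then show "\<exists>s. least L s (Upper L {x, y})" by blast
    have "greatest L (n ?m) (Lower L {x, y})"
    proof (rule greatest_LowerI[OF _ _ xyL])
      show "n ?m \<sqsubseteq>\<^bsub>L\<^esub> z" if "z \<in> {x, y}" for z using that mt_le1[OF K hh] mt_le2[OF K hh] unfolding Ls m by blast
      show "u \<sqsubseteq>\<^bsub>L\<^esub> n ?m" if u: "u \<in> Lower L {x, y}" for u
      proof -
        have "u \<sqsubseteq>\<^bsub>L\<^esub> x \<and> u \<in> carrier L" "u \<sqsubseteq>\<^bsub>L\<^esub> y" using Lower_memD[OF u _ xyL, of x] Lower_memD[OF u _ xyL, of y] by simp_all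
        then show ?thesis using mt_greatest[OF K hh, of "h u"] hK(1)[of u] by (simp add: Ls m)
      qed
    qed (simp add: Ls m(2))
    then show "\<exists>s. greatest L s (Lower L {x, y})" by blast
  qed
  moreover have "bij_betw h (carrier L) K"
    unfolding Ls bij_betw_def
  proof
    show "inj_on h (n ` K)" by (rule inj_on_inverseI[of _ n]) (rule hK(2))
    show "h ` n ` K = K" using hn by (simp add: image_image)
  qed
  ultimately have "oiso L h K"
    by (intro oiso.intro oiso_axioms.intro) (simp_all add: Ls)
  moreover have "n a \<in> carrier L" if "a \<in> K" for a using that by (simp add: Ls)
  moreover have "n (h x) = x" if "x \<in> carrier L" for x using hK(2)[of x] that by (simp add: Ls)
  ultimately show ?thesis using hn by blast
qed

text \<open>Through \<open>i\<close> the lattice \<open>X\<close> becomes a sublattice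
  \<open>K0\<close> of \<open>K\<close>, and \<open>h\<close> identifies \<open>L\<close> with
  \<open>K\<close>, with inverse \<open>n\<close>. So \<open>n \<circ> i\<close> is the embedding of
  \<open>X\<close> into \<open>L\<close>; both \<open>F\<close> and \<open>G\<close> are
  instances.\<close>

locale copy = I: oiso X i K0 + L: oiso L h K
  for X :: "('b, 'm) gorder_scheme" and i :: "'b \<Rightarrow> 'a::order" and K0 :: "'a set" and L :: "('c, 'n) gorder_scheme" and h :: "'c \<Rightarrow> 'a" and K :: "'a set" +
  fixes n :: "'a \<Rightarrow> 'c"
  assumes s: "subl K0 K" and nL: "\<And>a. a \<in> K \<Longrightarrow> n a \<in> carrier L" and hn: "\<And>a. a \<in> K \<Longrightarrow> h (n a) = a"
    and nh: "\<And>x. x \<in> carrier L \<Longrightarrow> n (h x) = x"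
begin

lemma iK: "x \<in> carrier X \<Longrightarrow> i x \<in> K" using I.f_in subl_sub[OF s] by blast
lemma h_ni: "x \<in> carrier X \<Longrightarrow> h (n (i x)) = i x" using hn iK by simp
lemma ni_in: "x \<in> carrier X \<Longrightarrow> n (i x) \<in> carrier L" using nL iK by simp

lemma ni_jn: assumes "x \<in> carrier X" "y \<in> carrier X"
  shows "n (i (x \<squnion>\<^bsub>X\<^esub> y)) = n (i x) \<squnion>\<^bsub>L\<^esub> n (i y)" "n (i (x \<sqinter>\<^bsub>X\<^esub> y)) = n (i x) \<sqinter>\<^bsub>L\<^esub> n (i y)"
proof -
  have c: "n (i x) \<squnion>\<^bsub>L\<^esub> n (i y) \<in> carrier L" "n (i x) \<sqinter>\<^bsub>L\<^esub> n (i y) \<in> carrier L" using ni_in assms by auto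
  have "h (n (i x) \<squnion>\<^bsub>L\<^esub> n (i y)) = i (x \<squnion>\<^bsub>X\<^esub> y)"
    using L.f_jn[OF ni_in ni_in] assms I.f_jn I.f_in by (simp add: h_ni subl_jn[OF s])
  then show "n (i (x \<squnion>\<^bsub>X\<^esub> y)) = n (i x) \<squnion>\<^bsub>L\<^esub> n (i y)" using nh[OF c(1)] by simp
  have "h (n (i x) \<sqinter>\<^bsub>L\<^esub> n (i y)) = i (x \<sqinter>\<^bsub>X\<^esub> y)"
    using L.f_mt[OF ni_in ni_in] assms I.f_mt I.f_in by (simp add: h_ni subl_mt[OF s])
  then show "n (i (x \<sqinter>\<^bsub>X\<^esub> y)) = n (i x) \<sqinter>\<^bsub>L\<^esub> n (i y)" using nh[OF c(2)] by simp
qed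

lemma embedding: "lattice_embedding X L (n \<circ> i)"
proof -
  have "inj_on (n \<circ> i) (carrier X)"
  proof (rule inj_onI)
    fix x y assume xy: "x \<in> carrier X" "y \<in> carrier X" "(n \<circ> i) x = (n \<circ> i) y"
    then have "h (n (i x)) = h (n (i y))" by simp
    then show "x = y" using xy h_ni I.f_inj by simp
  qed
  then show ?thesis using ni_in ni_jn I.lattice_axioms L.lattice_axioms
    by (auto simp: lattice_embedding_def join_pres_def meet_pres_def)
qed

lemma subl_image: "K0 \<noteq> {} \<Longrightarrow> sublattice ((n \<circ> i) ` carrier X) L"
  unfolding sublattice_def
proof (intro conjI ballI)
  assume "K0 \<noteq> {}"
  then show "(n \<circ> i) ` carrier X \<noteq> {}" using I.f_ex by auto
  show "(n \<circ> i) ` carrier X \<subseteq> carrier L" using ni_in by auto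
  fix a b assume "a \<in> (n \<circ> i) ` carrier X" "b \<in> (n \<circ> i) ` carrier X"
  then obtain x y where xy: "x \<in> carrier X" "y \<in> carrier X" "a = n (i x)" "b = n (i y)" by auto
  have "x \<squnion>\<^bsub>X\<^esub> y \<in> carrier X" "x \<sqinter>\<^bsub>X\<^esub> y \<in> carrier X" using xy by auto
  then show "a \<squnion>\<^bsub>L\<^esub> b \<in> (n \<circ> i) ` carrier X" "a \<sqinter>\<^bsub>L\<^esub> b \<in> (n \<circ> i) ` carrier X"
    using ni_jn[OF xy(1,2)] xy(3,4) by (metis comp_apply image_eqI)+
qed

lemma image_iff: "z \<in> carrier L \<Longrightarrow> z \<in> (n \<circ> i) ` carrier X \<longleftrightarrow> h z \<in> K0"
proof
  assume z: "z \<in> carrier L"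
  show "h z \<in> K0" if "z \<in> (n \<circ> i) ` carrier X" using that h_ni I.f_in by auto
  assume "h z \<in> K0"
  then obtain x where "x \<in> carrier X" "h z = i x" using I.f_ex by blast
  then show "z \<in> (n \<circ> i) ` carrier X" using nh[OF z] by force
qed

lemma convex_image:
  assumes "K0 \<noteq> {}" "\<And>a b c. a \<in> K0 \<Longrightarrow> b \<in> K0 \<Longrightarrow> c \<in> K \<Longrightarrow> a \<le> c \<Longrightarrow> c \<le> b \<Longrightarrow> c \<in> K0"
  shows "convex_sublattice ((n \<circ> i) ` carrier X) L"
  unfolding convex_sublattice_def
proof (intro conjI ballI impI)
  let ?I = "(n \<circ> i) ` carrier X"
  show sb: "sublattice ?I L" by (rule subl_image[OF assms(1)])
  fix a b z assume ab: "a \<in> ?I" "b \<in> ?I" and z: "z \<in> carrier L" and le: "a \<sqsubseteq>\<^bsub>L\<^esub> z \<and> z \<sqsubseteq>\<^bsub>L\<^esub> b"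
  have car: "a \<in> carrier L" "b \<in> carrier L" using ab sb by (auto simp: sublattice_def)
  have "h a \<in> K0" "h b \<in> K0" "h a \<le> h z" "h z \<le> h b"
    using ab image_iff[OF car(1)] image_iff[OF car(2)] le L.f_le[OF car(1) z] L.f_le[OF z car(2)] by blast+
  then have "h z \<in> K0" by (rule assms(2)[OF _ _ L.f_in[OF z]])
  then show "z \<in> ?I" using image_iff[OF z] by blast
qed

lemma filter_image:
  assumes "K0 \<noteq> {}" "up K0 K" shows "lattice_filter ((n \<circ> i) ` carrier X) L"
  unfolding lattice_filter_def
proof (intro conjI ballI impI)
  let ?I = "(n \<circ> i) ` carrier X"
  show sb: "sublattice ?I L" by (rule subl_image[OF assms(1)])
  fix a z assume a: "a \<in> ?I" and z: "z \<in> carrier L" and le: "a \<sqsubseteq>\<^bsub>L\<^esub> z"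
  have car: "a \<in> carrier L" using a sb by (auto simp: sublattice_def)
  have "h a \<in> K0" "h a \<le> h z" using a image_iff[OF car] le L.f_le[OF car z] by blast+
  then have "h z \<in> K0" by (intro upD[OF assms(2) _ L.f_in[OF z]])
  then show "z \<in> ?I" using image_iff[OF z] by blast
qed

lemma restrict_image:
  assumes "lattice_congruence L \<alpha>"
  shows "restrict_con X (n \<circ> i) \<alpha> = restrict_con X i (L.push \<alpha> \<inter> K0 \<times> K0)"
proof -
  have "(n (i x), n (i y)) \<in> \<alpha> \<longleftrightarrow> (i x, i y) \<in> L.push \<alpha>" if "x \<in> carrier X" "y \<in> carrier X" for x y
    using L.push_iff[OF assms ni_in[OF that(1)] ni_in[OF that(2)]] that by (simp add: h_ni)
  then show ?thesis using I.f_in unfolding restrict_con_def by auto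
qed

lemma push_restrict:
  assumes "lattice_congruence L \<alpha>"
  shows "I.push (restrict_con X (n \<circ> i) \<alpha>) = L.push \<alpha> \<inter> K0 \<times> K0" "lattice_congruence X (restrict_con X (n \<circ> i) \<alpha>)"
proof -
  have c: "con K0 (L.push \<alpha> \<inter> K0 \<times> K0)" using con_restrict[OF s L.con_push[OF assms]] .
  show "I.push (restrict_con X (n \<circ> i) \<alpha>) = L.push \<alpha> \<inter> K0 \<times> K0" "lattice_congruence X (restrict_con X (n \<circ> i) \<alpha>)"
    unfolding restrict_image[OF assms] using I.push_pull[OF c] I.con_pull[OF c] by auto
qed

end

theorem theorem3:
  fixes F :: "'a gorder" and G :: "'b gorder"
    and \<phi> :: "('a \<times> 'a) set \<Rightarrow> ('b \<times> 'b) set"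
  assumes "rectangular_lattice F" and "rectangular_lattice G"
    and "bounded_lattice_hom (Con F) (Con G) \<phi>"
  shows "\<exists>(L :: nat gorder) f g.
           rectangular_lattice L \<and>
           lattice_embedding F L f \<and> convex_sublattice (f ` carrier F) L \<and>
           lattice_embedding G L g \<and> convex_sublattice (g ` carrier G) L \<and>
           lattice_filter (g ` carrier G) L \<and>
           congruence_preserving_extension F L f \<and>
           (\<forall>\<alpha>\<in>carrier (Con L). \<phi> (restrict_con F f \<alpha>) = restrict_con G g \<alpha>)"
proof -
  \<comment> \<open>The position of \<open>F\<close> in the plane is arbitrary, whence
    \<open>undefined\<close>; that of \<open>G\<close> is then determined by the top
    \<open>e\<close> of \<open>KF\<close>.\<close>
  obtain i KF PF QF where iF: "oiso F i KF" and fF: "frame True KF PF QF" using rectangular_frame[OF assms(1), of undefined] by blast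
  interpret F: oiso F i KF by (rule iF)
  have stF: "state True KF PF QF" using fF by (simp add: frame_def)
  obtain b e where be: "b \<in> KF" "e \<in> KF" "\<forall>s\<in>KF. b \<le> s \<and> s \<le> e" using side_walk[OF state_side[OF stF]] by blast
  obtain j KG PG QG where iG: "oiso G j KG" and fG: "frame True KG PG QG" and jb: "j \<bottom>\<^bsub>G\<^esub> = e"
    using rectangular_frame[OF assms(2), of e] by blast
  interpret G: oiso G j KG by (rule iG)
  interpret BG: bounded_lattice G using assms(2) by (simp add: rectangular_lattice_def)
  have stG: "state True KG PG QG" using fG by (simp add: frame_def)
  have eG: "e \<in> KG" using G.f_in[OF BG.bottom_closed] jb by simp
  have Ge: "e \<le> t" if "t \<in> KG" for t using G.f_ex[OF that] G.f_le[OF BG.bottom_closed] BG.bottom_lower jb by blast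
  have finF: "finite KF" and finG: "finite KG" using state_plat[OF stF] state_plat[OF stG] by (auto simp: plat_def)
  obtain K P Q where K: "frame True K P Q" "glued_sum KF KG e" "cext (KF \<union> KG) K (\<lambda>_. True)" "up KG K" "dn KF K"
    using glue_frames[OF fF fG be(2) eG _ Ge] be(3) by blast
  interpret S: glued_sum KF KG e by (rule K(2))
  \<comment> \<open>The partner in \<open>F\<close> of a prime interval of \<open>G\<close>: it
    generates the least congruence whose image under \<phi> collapses that interval. Its existence
    is \<open>prime_source\<close>.\<close>
  define src where "src u v = (SOME p. cov KF (fst p) (snd p) \<and> (\<forall>\<alpha>. lattice_congruence F \<alpha> \<longrightarrow>
    (p \<in> F.push \<alpha> \<longleftrightarrow> (u, v) \<in> G.push (\<phi> \<alpha>))))" for u v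
  have src: "cov KF (fst (src u v)) (snd (src u v))"
    "\<And>\<alpha>. lattice_congruence F \<alpha> \<Longrightarrow> src u v \<in> F.push \<alpha> \<longleftrightarrow> (u, v) \<in> G.push (\<phi> \<alpha>)" if uv: "cov KG u v" for u v
  proof -
    obtain u' v' where u: "cov KF u' v'" "\<forall>\<alpha>. lattice_congruence F \<alpha> \<longrightarrow> ((u', v') \<in> F.push \<alpha> \<longleftrightarrow> (u, v) \<in> G.push (\<phi> \<alpha>))"
      using prime_source[OF iF iG finF assms(3) uv] by blast
    have "\<exists>p. cov KF (fst p) (snd p) \<and> (\<forall>\<alpha>. lattice_congruence F \<alpha> \<longrightarrow> (p \<in> F.push \<alpha> \<longleftrightarrow> (u, v) \<in> G.push (\<phi> \<alpha>)))"
      by (rule exI[of _ "(u', v')"]) (use u in simp)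
    from someI_ex[OF this, folded src_def]
    show "cov KF (fst (src u v)) (snd (src u v))"
      "\<And>\<alpha>. lattice_congruence F \<alpha> \<Longrightarrow> src u v \<in> F.push \<alpha> \<longleftrightarrow> (u, v) \<in> G.push (\<phi> \<alpha>)" by blast+
  qed
  define E where "E = {(src u v, (u, v)) |u v. cov KG u v}"
  have "E \<subseteq> (\<lambda>(u, v). (src u v, (u, v))) ` (KG \<times> KG)" unfolding E_def by (auto simp: cov_iff)
  then have finE: "finite E" using finG by (meson finite_SigmaI finite_imageI finite_subset)
  have Ecov: "cov K u v \<and> cov K u' v'" if "((u, v), (u', v')) \<in> E" for u v u' v'
  proof -
    have h: "cov KG u' v'" "src u' v' = (u, v)" using that by (auto simp: E_def)
    then show ?thesis using cov_up[OF K(4) h(1)] cov_dn[OF K(5) src(1)[OF h(1)]] by simp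
  qed
  obtain K3 P3 Q3 where K3: "frame True K3 P3 Q3" "up K K3" "cext K K3 (\<lambda>\<theta>. \<forall>(p, q)\<in>E. p \<in> \<theta> \<longleftrightarrow> q \<in> \<theta>)"
    using identify_all[OF K(1) finE Ecov] by blast
  let ?K0 = "KF \<union> KG"
  have K0K: "?K0 \<subseteq> K" using subl_sub[OF cext_subl[OF K(3)]] .
  have pE: "p \<in> KF \<times> KF \<and> q \<in> KG \<times> KG" if pq: "(p, q) \<in> E" for p q
  proof -
    obtain u v where h: "cov KG u v" "p = src u v" "q = (u, v)" using pq unfolding E_def by blast
    then show ?thesis using cov_in[OF src(1)[OF h(1)]] cov_in[OF h(1)] by (auto simp: mem_Times_iff)
  qed
  \<comment> \<open>Both steps together: the congruences of \<open>K3\<close> correspond to the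
    pairs of congruences of \<open>F\<close> and \<open>G\<close> that treat partners in
    \<open>E\<close> alike.\<close>
  have ce: "cext ?K0 K3 (\<lambda>\<theta>. True \<and> (\<forall>(p, q)\<in>E. p \<in> \<theta> \<longleftrightarrow> q \<in> \<theta>))"
  proof (rule cext_trans[OF K(3) K3(3)])
    fix \<theta> :: "((real \<times> real) \<times> (real \<times> real)) set"
    have "(fst x \<in> \<theta> \<longleftrightarrow> snd x \<in> \<theta>) \<longleftrightarrow> (fst x \<in> \<theta> \<inter> ?K0 \<times> ?K0 \<longleftrightarrow> snd x \<in> \<theta> \<inter> ?K0 \<times> ?K0)" if "x \<in> E" for x
    proof -
      have "fst x \<in> ?K0 \<times> ?K0" "snd x \<in> ?K0 \<times> ?K0"
        using pE[of "fst x" "snd x"] that by (auto simp: mem_Times_iff)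
      then show ?thesis by simp
    qed
    then show "(\<forall>(p, q)\<in>E. p \<in> \<theta> \<longleftrightarrow> q \<in> \<theta>) \<longleftrightarrow>
      (\<forall>(p, q)\<in>E. p \<in> \<theta> \<inter> ?K0 \<times> ?K0 \<longleftrightarrow> q \<in> \<theta> \<inter> ?K0 \<times> ?K0)"
      unfolding case_prod_beta by (intro ball_cong refl)
  qed
  have st3: "state True K3 P3 Q3" using K3(1) by (simp add: frame_def)
  have lat3: "lat K3" and fin3: "finite K3" using state_plat[OF st3] by (auto simp: plat_def)
  obtain L :: "nat gorder" and n :: "real \<times> real \<Rightarrow> nat" and h :: "nat \<Rightarrow> real \<times> real" where
    L0: "oiso L h K3" "(\<forall>a\<in>K3. n a \<in> carrier L \<and> h (n a) = a) \<and> (\<forall>x\<in>carrier L. n (h x) = x)"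
    using nat_copy[OF lat3 fin3] by blast
  then have L: "oiso L h K3" "\<And>a. a \<in> K3 \<Longrightarrow> n a \<in> carrier L" "\<And>a. a \<in> K3 \<Longrightarrow> h (n a) = a"
    "\<And>x. x \<in> carrier L \<Longrightarrow> n (h x) = x" by simp_all
  interpret L: oiso L h K3 by (rule L(1))
  have s3: "subl ?K0 K3" using cext_subl[OF ce] .
  interpret CF: copy F i KF L h K3 n
    by (intro copy.intro copy_axioms.intro F.oiso_axioms L(1) subl_trans[OF S.sublF s3] L(2,3,4))
  interpret CG: copy G j KG L h K3 n
    by (intro copy.intro copy_axioms.intro G.oiso_axioms L(1) subl_trans[OF S.sublG s3] L(2,3,4))
  have upG: "up KG K3" using up_trans[OF K(4) K3(2)] .
  have ne: "KF \<noteq> {}" "KG \<noteq> {}" using be(1) eG by auto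
  \<comment> \<open>What lies above an element of \<open>KF\<close> is in the up-set
    \<open>K\<close> of \<open>K3\<close>, and inside \<open>K\<close> the set \<open>KF\<close> is
    a down-set.\<close>
  have cF: "convex_sublattice ((n \<circ> i) ` carrier F) L"
  proof (rule CF.convex_image[OF ne(1)])
    fix a b c assume h: "a \<in> KF" "b \<in> KF" "c \<in> K3" "a \<le> c" "c \<le> b"
    have "a \<in> K" using h(1) K0K by blast
    then have "c \<in> K" using upD[OF K3(2) _ h(3,4)] by blast
    then show "c \<in> KF" using dnD[OF K(5) h(2) _ h(5)] by blast
  qed
  have cG: "convex_sublattice ((n \<circ> j) ` carrier G) L"
    by (rule CG.convex_image[OF ne(2)]) (rule upD[OF upG])
  have gF: "lattice_filter ((n \<circ> j) ` carrier G) L" by (rule CG.filter_image[OF ne(2) upG])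
  have ph: "lattice_congruence G (\<phi> \<alpha>)" if "lattice_congruence F \<alpha>" for \<alpha>
    using assms(3) that by (auto simp: bounded_lattice_hom_def Pi_iff)
  have ii: "\<phi> (restrict_con F (n \<circ> i) \<alpha>) = restrict_con G (n \<circ> j) \<alpha>" if al: "lattice_congruence L \<alpha>" for \<alpha>
  proof -
    let ?a = "restrict_con F (n \<circ> i) \<alpha>" and ?g = "restrict_con G (n \<circ> j) \<alpha>" and ?t = "L.push \<alpha>"
    note pa = CF.push_restrict[OF al] and pg = CG.push_restrict[OF al]
    have ct: "con K3 ?t" using L.con_push[OF al] .
    have C: "\<forall>(p, q)\<in>E. p \<in> ?t \<inter> ?K0 \<times> ?K0 \<longleftrightarrow> q \<in> ?t \<inter> ?K0 \<times> ?K0" using cext_C[OF ce ct] by (rule conjunct2)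
    \<comment> \<open>A prime interval of \<open>G\<close> is collapsed on either side exactly if
      its partner in \<open>F\<close> is. Both congruences are determined by such intervals.\<close>
    have eq: "(u, v) \<in> G.push (\<phi> ?a) \<longleftrightarrow> (u, v) \<in> G.push ?g" if uv: "cov KG u v" for u v
    proof -
      have e: "(src u v, (u, v)) \<in> E" using uv unfolding E_def by blast
      note p = pE[OF e, THEN conjunct1] pE[OF e, THEN conjunct2]
      have "src u v \<in> ?t \<inter> ?K0 \<times> ?K0 \<longleftrightarrow> (u, v) \<in> ?t \<inter> ?K0 \<times> ?K0" using bspec[OF C e] unfolding prod.case .
      moreover have "src u v \<in> ?K0 \<times> ?K0" "(u, v) \<in> ?K0 \<times> ?K0" using p by (simp_all add: mem_Times_iff)
      ultimately have "src u v \<in> ?t \<longleftrightarrow> (u, v) \<in> ?t" by (simp only: Int_iff simp_thms)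
      then show ?thesis using src(2)[OF uv pa(2)] p unfolding pa(1) pg(1) by (simp only: Int_iff simp_thms)
    qed
    have c1: "con KG (G.push (\<phi> ?a))" "con KG (G.push ?g)" using G.con_push ph pa(2) pg(2) by blast+
    have "G.push (\<phi> ?a) = G.push ?g"
    proof (rule equalityI)
      show "G.push (\<phi> ?a) \<subseteq> G.push ?g"
        by (rule con_covers_le[OF G.latK finG c1]) (rule iffD1[OF eq])
      show "G.push ?g \<subseteq> G.push (\<phi> ?a)"
        by (rule con_covers_le[OF G.latK finG c1(2,1)]) (rule iffD2[OF eq])
    qed
    then show ?thesis by (rule box_equals[OF arg_cong[where f = "restrict_con G j"] G.pull_push[OF ph[OF pa(2)]] G.pull_push[OF pg(2)]])
  qed
  have cpe: "congruence_preserving_extension F L (n \<circ> i)"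
    unfolding congruence_preserving_extension_def
  proof (intro conjI ballI)
    show "lattice_embedding F L (n \<circ> i)" by (rule CF.embedding)
    fix \<theta> assume "\<theta> \<in> carrier (Con F)"
    then have th: "lattice_congruence F \<theta>" by simp
    \<comment> \<open>The candidate is the pair of \<theta> and its image under \<phi>; the choice
      of \<open>src\<close> is just what makes it respect \<open>E\<close>.\<close>
    obtain t0 where t0: "con ?K0 t0" "t0 \<inter> KF \<times> KF = F.push \<theta>" "t0 \<inter> KG \<times> KG = G.push (\<phi> \<theta>)"
      using S.con_extend[OF F.con_push[OF th] G.con_push[OF ph[OF th]]] by blast
    have "p \<in> t0 \<longleftrightarrow> q \<in> t0" if pq: "(p, q) \<in> E" for p q
    proof -
      obtain u v where h: "cov KG u v" "p = src u v" "q = (u, v)" using pq unfolding E_def by blast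
      have "p \<in> t0 \<longleftrightarrow> p \<in> F.push \<theta>" "q \<in> t0 \<longleftrightarrow> q \<in> G.push (\<phi> \<theta>)"
        using pE[OF pq] unfolding t0(2)[symmetric] t0(3)[symmetric] by blast+
      then show ?thesis using src(2)[OF h(1) th] h by simp
    qed
    then have "True \<and> (\<forall>(p, q)\<in>E. p \<in> t0 \<longleftrightarrow> q \<in> t0)" by fast
    from cext_ex[OF ce t0(1) this] obtain t3 where t3: "con K3 t3" "t3 \<inter> ?K0 \<times> ?K0 = t0" by (elim exE conjE) (rule that)
    let ?\<alpha> = "restrict_con L h t3"
    have al: "lattice_congruence L ?\<alpha>" using L.con_pull[OF t3(1)] .
    have "L.push ?\<alpha> \<inter> KF \<times> KF = F.push \<theta>" unfolding L.push_pull[OF t3(1)] using t3(2) t0(2) by blast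
    then have r: "restrict_con F (n \<circ> i) ?\<alpha> = \<theta>" unfolding CF.restrict_image[OF al] using F.pull_push[OF th] by simp
    show "\<exists>!\<alpha>. \<alpha> \<in> carrier (Con L) \<and> restrict_con F (n \<circ> i) \<alpha> = \<theta>"
    proof (rule ex1I[of _ ?\<alpha>])
      show "?\<alpha> \<in> carrier (Con L) \<and> restrict_con F (n \<circ> i) ?\<alpha> = \<theta>" using al r by simp
      fix \<beta> assume "\<beta> \<in> carrier (Con L) \<and> restrict_con F (n \<circ> i) \<beta> = \<theta>"
      then have be: "lattice_congruence L \<beta>" "restrict_con F (n \<circ> i) \<beta> = \<theta>" by auto
      \<comment> \<open>By \<open>ii\<close> the trace on \<open>F\<close> determines the trace on
        \<open>G\<close>, and the two traces determine the congruence.\<close>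
      have g: "restrict_con G (n \<circ> j) \<beta> = restrict_con G (n \<circ> j) ?\<alpha>" using ii[OF be(1)] ii[OF al] be(2) r by simp
      have I: "(x \<inter> ?K0 \<times> ?K0) \<inter> KF \<times> KF = x \<inter> KF \<times> KF" "(x \<inter> ?K0 \<times> ?K0) \<inter> KG \<times> KG = x \<inter> KG \<times> KG" for x by blast+
      have "L.push \<beta> \<inter> KF \<times> KF = L.push ?\<alpha> \<inter> KF \<times> KF"
        using CF.push_restrict(1)[OF be(1)] CF.push_restrict(1)[OF al] be(2) r by simp
      moreover have "L.push \<beta> \<inter> KG \<times> KG = L.push ?\<alpha> \<inter> KG \<times> KG"
        using CG.push_restrict(1)[OF be(1)] CG.push_restrict(1)[OF al] g by simp
      ultimately have "L.push \<beta> \<inter> ?K0 \<times> ?K0 = L.push ?\<alpha> \<inter> ?K0 \<times> ?K0"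
        by (intro S.con_inj[OF con_restrict[OF s3 L.con_push[OF be(1)]] con_restrict[OF s3 L.con_push[OF al]]])
          (unfold I)
      then have "L.push \<beta> = L.push ?\<alpha>" by (rule cext_inj[OF ce L.con_push[OF be(1)] L.con_push[OF al]])
      then show "\<beta> = ?\<alpha>" by (rule box_equals[OF arg_cong[where f = "restrict_con L h"] L.pull_push[OF be(1)] L.pull_push[OF al]])
    qed
  qed
  have "rectangular_lattice L" by (rule frame_rectangular[OF L(1) K3(1)])
  moreover have "\<forall>\<alpha>\<in>carrier (Con L). \<phi> (restrict_con F (n \<circ> i) \<alpha>) = restrict_con G (n \<circ> j) \<alpha>" using ii by simp
  ultimately show ?thesis using CF.embedding CG.embedding cF cG gF cpe
    by (intro exI[of _ L] exI[of _ "n \<circ> i"] exI[of _ "n \<circ> j"] conjI)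
qed

end
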